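(* Consider the stochastic regression model $y_t=\alpha_0+\alpha'x_t+\varepsilon_t$ and the Robinson–Hidalgo weighted least squares estimators $\hat\alpha_n$, $\hat\alpha_{0n}$ described in the context. Assume: (1) One of the following holds: (i) $H<1/2$ and $\sigma>0$; (ii) $H=1/2$, $\sigma>0$ and $\sum_{j=0}^\infty|a_j|<\infty$; (iii) $1/2<H<1$. (2) The distribution function $G_0$ of $e_t$ is three times differentiable with bounded, continuous and integrable derivatives, and $\int x^4\,dG_0(x)<\infty$. (3) $\sum_{j=0}^\infty\tilde\phi_j<\infty$ and $\bigl(\sum_{j=0}^n|\gamma_j|+n\tilde\gamma_n\bigr)\bigl[\bigl(\sum_{j=0}^n\tilde\phi_j^{1/2}\bigr)^2+n\Phi_n\bigr]=O(n)$ as $n\to\infty$, where $\tilde\gamma_a=\max_{j\ge a}|\gamma_j|$, $\tilde\phi_a=\max_{j\ge a}|\phi_j|$ and $\Phi_a=\sum_{|j|>a}|\phi_j|$. (4) $\{x_t\}$ is fourth-order stationary, $\Gamma_u=E[(x_1-Ex_1)(x_{1+|u|}-Ex_1)']\to0$ and $\max_{|v|,|w|<\infty}|\kappa_{abcd}(0,u,v,w)|\to0$ as $|u|\to\infty$, for $1\le a,b,c,d\le q$. (5) $\Sigma_\psi$ is finite, and $\Sigma_\phi$ and $\Sigma_\psi$ are nonsingular, where $\Sigma_\chi=\frac1{2\pi}\int_{-\pi}^{\pi}\chi(\lambda)\,d\mathcal H(\lambda)$ and $\mathcal H(\lambda)$ is the Hermitian matrix such that $\Gamma_j=\int_{-\pi}^{\pi}e^{ij\lambda}\,d\mathcal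 H(\lambda)$. Let $\beta=(\alpha_0,\alpha')'$, $\hat\beta_n=(\hat\alpha_{0n},\hat\alpha_n')'$, $X_t=(1,x_t')'$. Then $$\sup_{x\in\mathbb R}\bigl|\hat K_n(x)-K_n(x)-R_nF'(x)\bigr|=o_p(1),$$ where $R_n=\sigma_n^{-1}(\hat\beta_n-\beta)'\sum_{t=1}^nX_t=O_p(1)$.
   Context: Noise: $\varepsilon_t=\sum_{i=0}^\infty a_ie_{t-i}$, where $\{e_t\}$ is i.i.d. with mean zero, $\sigma_e^2=Ee_t^2<\infty$ and distribution function $G_0$; $a_0=1$, $a_k=k^{H-3/2}L_0(k)$ for $k\ge1$ with $L_0$ slowly varying and $H<1$; $\sum_{i=1}^\infty a_i^2<\infty$. $F$ is the distribution function of $\varepsilon_t$; $\sigma_n^2=\operatorname{var}(\sum_{t=1}^n\varepsilon_t)$; when $\sum_j|a_j|<\infty$, $\sigma^2=\lim_n\sigma_n^2/n$ exists and is finite. Model: $y_t=\alpha_0+\alpha'x_t+\varepsilon_t$, with $\{x_t\}$ a $q$-dimensional time series independent of $\{\varepsilon_t\}$ and $(\alpha_0,\alpha')'$ an unknown parameter vector of dimension $p=q+1$. Estimators: let $f$ be the spectral density of $\varepsilon_t$, and $\phi(\lambda)$ a real-valued, even, integrable, $2\pi$-periodic function such that $\psi(\lambda)=\phi^2(\lambda)f(\lambda)$ is continuous; $\phi_j=(2\pi)^{-2}\int_{-\pi}^{\pi}\phi(\lambda)\cos(j\lambda)\,d\lambda$. With $\bar x=\frac1n\sum_{t=1}^nx_t$,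 $\bar y=\frac1n\sum_{t=1}^ny_t$, $$\hat\alpha_n=\Bigl[\sum_{t=1}^n\sum_{s=1}^n(x_t-\bar x)(x_s-\bar x)'\phi_{t-s}\Bigr]^{-1}\Bigl[\sum_{t=1}^n\sum_{s=1}^n(x_t-\bar x)(y_s-\bar y)\phi_{t-s}\Bigr],\qquad \hat\alpha_{0n}=\bar y-\hat\alpha_n'\bar x.$$ $\gamma_j=E(\varepsilon_t\varepsilon_{t+j})$; $\kappa_{abcd}(s,u,v,w)$ is the fourth cumulant of $x_{as},x_{bu},x_{cv},x_{dw}$, where $x_{as}$ is the $a$th element of $x_s$. Residuals and empirical processes: $\hat\varepsilon_t=y_t-\hat\alpha_{0n}-\hat\alpha_n'x_t$, $$K_n(x)=\frac1{\sigma_n}\sum_{t=1}^n[I(\varepsilon_t\le x)-F(x)],\qquad \hat K_n(x)=\frac1{\sigma_n}\sum_{t=1}^n[I(\hat\varepsilon_t\le x)-F(x)].$$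
   Formalization: Σ_φ is formed with the continuous version of φ, which exists by (3), rather than with φ itself; they agree if φ is continuous or H has a density. Otherwise φ can be altered on a Lebesgue-null set carrying H, and the claim can fail. *)

theory Defs
  imports "HOL-Probability.Probability" "HOL-Library.Landau_Symbols"
begin

text \<open>Slow variation at infinity in the sense of Bingham, Goldie and Teugels: only the values on
  some half-line matter, and there the function is positive and Borel measurable.\<close>

definition slowly_varying :: "(real \<Rightarrow> real) \<Rightarrow> bool" where
  "slowly_varying L \<longleftrightarrow>
     (\<exists>X. (\<forall>x\<ge>X. 0 < L x) \<and> set_borel_measurable borel {X..} L) \<and>
     (\<forall>c>0. ((\<lambda>x. L (c * x) / L x) \<longlongrightarrow> 1) at_top)"

text \<open>For centred i.i.d. innovations with finite variance and square summable coefficients the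
  series converges almost surely.\<close>

definition linear_process :: "(nat \<Rightarrow> real) \<Rightarrow> (int \<Rightarrow> 'w \<Rightarrow> real) \<Rightarrow> int \<Rightarrow> 'w \<Rightarrow> real" where
  "linear_process a e t \<omega> = (\<Sum>i. a i * e (t - int i) \<omega>)"

definition partial_sum_sd :: "'w measure \<Rightarrow> (int \<Rightarrow> 'w \<Rightarrow> real) \<Rightarrow> nat \<Rightarrow> real" where
  "partial_sum_sd M \<epsilon> n = sqrt (prob_space.variance M (\<lambda>\<omega>. \<Sum>t=1..int n. \<epsilon> t \<omega>))"

text \<open>Only used when the coefficients of the linear process are absolutely summable, in which case
  the limit exists.\<close>

definition long_run_sd :: "'w measure \<Rightarrow> (int \<Rightarrow> 'w \<Rightarrow> real) \<Rightarrow> real" where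
  "long_run_sd M \<epsilon> = sqrt (lim (\<lambda>n. (partial_sum_sd M \<epsilon> n)\<^sup>2 / real n))"

text \<open>\<open>indep_var\<close> of the library needs both variables to have the same value type.\<close>

definition indep_processes ::
    "'w measure \<Rightarrow> (int \<Rightarrow> 'w \<Rightarrow> 'a::topological_space) \<Rightarrow> (int \<Rightarrow> 'w \<Rightarrow> 'b::topological_space) \<Rightarrow> bool" where
  "indep_processes M x z \<longleftrightarrow>
     (\<lambda>\<omega> t. x t \<omega>) \<in> measurable M (PiM UNIV (\<lambda>_. borel)) \<and>
     (\<lambda>\<omega> t. z t \<omega>) \<in> measurable M (PiM UNIV (\<lambda>_. borel)) \<and>
     prob_space.indep_set M
       {(\<lambda>\<omega> t. x t \<omega>) -` A \<inter> space M |A. A \<in> sets (PiM UNIV (\<lambda>_. borel))}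
       {(\<lambda>\<omega> t. z t \<omega>) -` B \<inter> space M |B. B \<in> sets (PiM UNIV (\<lambda>_. borel))}"

text \<open>The processes below are stationary, so the covariances may be taken at a fixed time.\<close>

definition noise_autocov :: "'w measure \<Rightarrow> (int \<Rightarrow> 'w \<Rightarrow> real) \<Rightarrow> int \<Rightarrow> real" where
  "noise_autocov M \<epsilon> j = (\<integral>\<omega>. \<epsilon> 0 \<omega> * \<epsilon> j \<omega> \<partial>M)"

definition autocov_matrix ::
    "'w measure \<Rightarrow> (int \<Rightarrow> 'w \<Rightarrow> real ^ 'q) \<Rightarrow> int \<Rightarrow> real ^ 'q ^ 'q" where
  "autocov_matrix M x u =
     (\<chi> a b. \<integral>\<omega>. (x 1 \<omega> $ a - (\<integral>\<omega>. x 1 \<omega> $ a \<partial>M)) *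
                 (x (1 + u) \<omega> $ b - (\<integral>\<omega>. x 1 \<omega> $ b \<partial>M)) \<partial>M)"

text \<open>A list of pairs \<open>(a, t)\<close> stands for the product of the variables \<open>x t $ a\<close>, so this says that
  all mixed moments of order at most four exist and are invariant under time shifts.\<close>

definition fourth_order_stationary :: "'w measure \<Rightarrow> (int \<Rightarrow> 'w \<Rightarrow> real ^ 'q) \<Rightarrow> bool" where
  "fourth_order_stationary M x \<longleftrightarrow>
     (\<forall>t. x t \<in> borel_measurable M) \<and>
     (\<forall>ps. length ps \<le> 4 \<longrightarrow>
        integrable M (\<lambda>\<omega>. \<Prod>(a, t)\<leftarrow>ps. x t \<omega> $ a) \<and>
        (\<forall>h. (\<integral>\<omega>. (\<Prod>(a, t)\<leftarrow>ps. x (t + h) \<omega> $ a) \<partial>M) = (\<integral>\<omega>. (\<Prod>(a, t)\<leftarrow>ps. x t \<omega> $ a) \<partial>M)))"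

text \<open>Joint cumulant of the family \<open>X i\<close>, \<open>i \<in> I\<close>, as in Brillinger's book on time series: a sum over
  all set partitions of the index set.\<close>

definition joint_cumulant :: "'w measure \<Rightarrow> 'i set \<Rightarrow> ('i \<Rightarrow> 'w \<Rightarrow> real) \<Rightarrow> real" where
  "joint_cumulant M I X =
     (\<Sum>P | partition_on I P.
        (-1) ^ (card P - 1) * fact (card P - 1) * (\<Prod>B\<in>P. \<integral>\<omega>. (\<Prod>i\<in>B. X i \<omega>) \<partial>M))"

definition fourth_cumulant ::
    "'w measure \<Rightarrow> (int \<Rightarrow> 'w \<Rightarrow> real ^ 'q) \<Rightarrow> 'q \<Rightarrow> 'q \<Rightarrow> 'q \<Rightarrow> 'q \<Rightarrow>
     int \<Rightarrow> int \<Rightarrow> int \<Rightarrow> int \<Rightarrow> real" where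
  "fourth_cumulant M x a b c d s u v w =
     joint_cumulant M {0..<4::nat} (\<lambda>i \<omega>. [x s \<omega> $ a, x u \<omega> $ b, x v \<omega> $ c, x w \<omega> $ d] ! i)"

text \<open>A spectral density is only determined up to null sets; any nonnegative version may be taken.\<close>

definition spectral_density :: "(int \<Rightarrow> real) \<Rightarrow> (real \<Rightarrow> real) \<Rightarrow> bool" where
  "spectral_density \<gamma> f \<longleftrightarrow>
     (\<forall>l. 0 \<le> f l \<and> f (l + 2 * pi) = f l) \<and> set_integrable lborel {-pi..pi} f \<and>
     (\<forall>j. complex_of_real (\<gamma> j) = (LINT l:{-pi..pi}|lborel. cis (of_int j * l) * complex_of_real (f l)))"

text \<open>The estimator depends on the weight function only through its Fourier coefficients, that is up
  to null sets. An integral of a weight function with respect to a spectral distribution that may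
  have a singular part needs a definite version, and this is the continuous one.\<close>

definition continuous_version :: "(real \<Rightarrow> real) \<Rightarrow> (real \<Rightarrow> real) \<Rightarrow> bool" where
  "continuous_version h g \<longleftrightarrow> continuous_on UNIV h \<and> (AE l in lborel. h l = g l)"

definition weight_coeff :: "(real \<Rightarrow> real) \<Rightarrow> int \<Rightarrow> real" where
  "weight_coeff \<phi> j = 1 / (2 * pi)\<^sup>2 * (LINT l:{-pi..pi}|lborel. \<phi> l * cos (of_int j * l))"

text \<open>Covariances and Fourier coefficients are bounded, so the suprema are genuine; they are maxima
  when the sequence tends to zero.\<close>

definition tail_max :: "(int \<Rightarrow> real) \<Rightarrow> nat \<Rightarrow> real" where
  "tail_max c n = (SUP j\<in>{int n..}. \<bar>c j\<bar>)"

definition tail_sum :: "(int \<Rightarrow> real) \<Rightarrow> nat \<Rightarrow> real" where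
  "tail_sum c n = (\<Sum>\<^sub>\<infinity>j\<in>{j. int n < \<bar>j\<bar>}. \<bar>c j\<bar>)"

definition quad_form :: "complex ^ 'q ^ 'q \<Rightarrow> complex ^ 'q \<Rightarrow> complex" where
  "quad_form A z = (\<Sum>a\<in>UNIV. \<Sum>b\<in>UNIV. cnj (z $ a) * A $ a $ b * z $ b)"

text \<open>A Hermitian matrix function with nonnegative definite increments, normalised to be continuous
  from the right.\<close>

definition spectral_distribution :: "(real \<Rightarrow> complex ^ 'q ^ 'q) \<Rightarrow> bool" where
  "spectral_distribution \<H> \<longleftrightarrow>
     (\<forall>l a b. \<H> l $ a $ b = cnj (\<H> l $ b $ a)) \<and>
     (\<forall>z l m. l \<le> m \<longrightarrow> 0 \<le> Re (quad_form (\<H> m - \<H> l) z)) \<and>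
     (\<forall>l. continuous (at_right l) \<H>)"

text \<open>The matrix \<open>S\<close> is the Lebesgue-Stieltjes integral of \<open>g\<close> over \<open>(-\<pi>, \<pi>]\<close> with respect to the
  matrix function \<open>\<H>\<close>. For each \<open>z\<close> the function \<open>z\<^sup>* \<H> z\<close> is real and nondecreasing, and a
  complex matrix is determined by its quadratic form, so that by polarisation this is the entrywise
  integral. Existence (all entries finite) is part of the assertion.\<close>

definition has_matrix_integral ::
    "(real \<Rightarrow> complex) \<Rightarrow> (real \<Rightarrow> complex ^ 'q ^ 'q) \<Rightarrow> complex ^ 'q ^ 'q \<Rightarrow> bool" where
  "has_matrix_integral g \<H> S \<longleftrightarrow>
     (\<forall>z. let \<mu> = interval_measure (\<lambda>l. Re (quad_form (\<H> l) z)) in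
        set_integrable \<mu> {-pi<..pi} g \<and> quad_form S z = (LINT l:{-pi<..pi}|\<mu>. g l))"

definition sample_mean :: "nat \<Rightarrow> (int \<Rightarrow> 'v::real_vector) \<Rightarrow> 'v" where
  "sample_mean n z = (1 / real n) *\<^sub>R (\<Sum>t=1..int n. z t)"

definition outer_prod :: "real ^ 'q \<Rightarrow> real ^ 'q \<Rightarrow> real ^ 'q ^ 'q" where
  "outer_prod u v = (\<chi> a b. u $ a * v $ b)"

text \<open>The weighted least squares estimators for weights \<open>c\<close> and observed samples \<open>x\<close>, \<open>y\<close>.
  If the matrix is singular, \<open>matrix_inv\<close> is an unspecified constant.\<close>

definition wls_slope :: "(int \<Rightarrow> real) \<Rightarrow> nat \<Rightarrow> (int \<Rightarrow> real ^ 'q) \<Rightarrow> (int \<Rightarrow> real) \<Rightarrow> real ^ 'q" where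
  "wls_slope c n x y =
     matrix_inv (\<Sum>t=1..int n. \<Sum>s=1..int n.
        c (t - s) *\<^sub>R outer_prod (x t - sample_mean n x) (x s - sample_mean n x)) *v
     (\<Sum>t=1..int n. \<Sum>s=1..int n.
        (c (t - s) * (y s - sample_mean n y)) *\<^sub>R (x t - sample_mean n x))"

definition wls_intercept :: "(int \<Rightarrow> real) \<Rightarrow> nat \<Rightarrow> (int \<Rightarrow> real ^ 'q) \<Rightarrow> (int \<Rightarrow> real) \<Rightarrow> real" where
  "wls_intercept c n x y = sample_mean n y - wls_slope c n x y \<bullet> sample_mean n x"

definition wls_residual ::
    "(int \<Rightarrow> real) \<Rightarrow> nat \<Rightarrow> (int \<Rightarrow> real ^ 'q) \<Rightarrow> (int \<Rightarrow> real) \<Rightarrow> int \<Rightarrow> real" where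
  "wls_residual c n x y t = y t - wls_intercept c n x y - wls_slope c n x y \<bullet> x t"

definition empirical_process ::
    "real \<Rightarrow> (real \<Rightarrow> real) \<Rightarrow> nat \<Rightarrow> (int \<Rightarrow> real) \<Rightarrow> real \<Rightarrow> real" where
  "empirical_process s F n z u = 1 / s * (\<Sum>t=1..int n. of_bool (z t \<le> u) - F u)"

text \<open>Stochastic order symbols. Measurability is included because \<open>measure\<close> vanishes on
  non-measurable sets.\<close>

definition op_one :: "'w measure \<Rightarrow> (nat \<Rightarrow> 'w \<Rightarrow> real) \<Rightarrow> bool" where
  "op_one M Z \<longleftrightarrow> (\<forall>n. Z n \<in> borel_measurable M) \<and>
     (\<forall>\<delta>>0. (\<lambda>n. measure M {\<omega> \<in> space M. \<delta> < \<bar>Z n \<omega>\<bar>}) \<longlonglongrightarrow> 0)"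

definition Op_one :: "'w measure \<Rightarrow> (nat \<Rightarrow> 'w \<Rightarrow> real) \<Rightarrow> bool" where
  "Op_one M Z \<longleftrightarrow> (\<forall>n. Z n \<in> borel_measurable M) \<and>
     (\<forall>\<delta>>0. \<exists>C. \<forall>n. measure M {\<omega> \<in> space M. C < \<bar>Z n \<omega>\<bar>} \<le> \<delta>)"

end

theory Submission
  imports Defs "HOL-Real_Asymp.Real_Asymp"
begin

text \<open>Because of the intercept, \<open>R\<^sub>n\<close> equals \<open>\<sigma>\<^sub>n\<^sup>-\<^sup>1 \<Sum> \<epsilon>\<^sub>t\<close> exactly, and the residuals are \<open>\<epsilon>\<^sub>t - \<delta>\<^sub>t\<close> with
  \<open>\<delta>\<^sub>t\<close> the mean of the noise plus the product of the slope error with the centred regressor. Both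
  coefficients are \<open>O\<^sub>p(\<sigma>\<^sub>n / n)\<close>: absolute summability of the weights bounds the Toeplitz form of the
  noise by \<open>n \<Sum> \<bar>\<gamma>\<^sub>j\<bar>\<close>, which is of the order of \<open>\<sigma>\<^sub>n\<^sup>2\<close> under short and under long memory, while the
  weighted moment matrix of the regressors, divided by \<open>n\<close>, converges in \<open>L\<^sup>1\<close> to \<open>\<Sum> c\<^sub>j \<Gamma>\<^sub>j\<close>, the
  integral of \<open>\<phi>\<close> with respect to the spectral distribution.

  By independence the regressors may be frozen. Then \<open>\<delta>\<^sub>t\<close> is linear in finitely many
  coefficients of size \<open>O(\<sigma>\<^sub>n / n)\<close>. For fixed coefficients the indicator increments, centred by
  their conditional expectations given the past innovations, are martingale differences with an
  exponential inequality strong enough for a grid of polynomial size; the conditional expectations are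
  smooth, and a law of large numbers for \<open>G\<^sub>0'\<close> at the past of the noise replaces them by \<open>\<delta>\<^sub>t F'\<close>.\<close>

section \<open>Slowly varying functions\<close>

text \<open>The obstacle is that the shifts depend on the whole noise sample: they are not
  predictable, so no martingale argument applies to them directly. Once the regressors are frozen,
  the only random part of the shifts is a coefficient vector in a cube of fixed dimension, the
  number of regressors plus one, with side of order \<open>s n / n\<close>. The expansion is
  therefore proved for all points of that cube at once. Orders of magnitude: the absolute shifts sum
  to O(\<open>s n\<close>), which bounds the conditional variance of the martingale. With
  exponential parameter \<open>1 / sqrt (s n)\<close>, a deviation \<open>\<tau> * s n\<close> has
  probability of order exp(-c sqrt(\<open>s n\<close>)). Since \<open>(s n)\<^sup>2\<close> grows at
  least linearly, this is at most exp(-c' n^(1/4)). The quadratic Taylor remainder is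
  O(\<open>(s n)\<^sup>2 / n\<close>), hence o(\<open>s n\<close>) because \<open>s n / n\<close>
  tends to 0. The lower bound on \<open>(s n)\<^sup>2\<close> and its comparison with the
  autocovariances are where the memory regimes differ: under long memory both rest on the eventual
  positivity and the divergent sum of the coefficients.\<close>

lemma uniform_convergence_translates:
  fixes h :: "real \<Rightarrow> real"
  assumes meas[measurable]: "h \<in> borel_measurable borel"
    and lim: "\<And>u. ((\<lambda>x. h (x + u) - h x) \<longlongrightarrow> 0) at_top"
    and "0 < d"
  shows "\<exists>X. \<forall>x\<ge>X. \<forall>u\<in>{0..1}. \<bar>h (x + u) - h x\<bar> < d"
proof (rule ccontr)
  assume "\<not> ?thesis"
  then have neg: "\<exists>x\<ge>X. \<exists>u\<in>{0..1}. d \<le> \<bar>h (x + u) - h x\<bar>" for X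
    by (simp add: not_less)
  define P where "P n p \<longleftrightarrow> real n \<le> fst p \<and> snd p \<in> {0..1} \<and> d \<le> \<bar>h (fst p + snd p) - h (fst p)\<bar>"
    for n :: nat and p
  have "\<exists>p. P n p" for n
  proof -
    obtain x u where "real n \<le> x" "u \<in> {0..1}" "d \<le> \<bar>h (x + u) - h x\<bar>"
      using neg[of "real n"] by (elim exE conjE bexE)
    then show ?thesis by (intro exI[of _ "(x, u)"]) (simp add: P_def)
  qed
  then obtain p where p: "\<And>n. P n (p n)" by metis
  define x u where "x n = fst (p n)" and "u n = snd (p n)" for n
  have xu: "\<And>n::nat. real n \<le> x n" "\<And>n. u n \<in> {0..1}"
    "\<And>n. d \<le> \<bar>h (x n + u n) - h (x n)\<bar>" using p by (auto simp: P_def x_def u_def)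
  \<comment> \<open>An Egorov argument: pointwise convergence along \<open>y\<close> makes these
    sets increase to all of \<open>{0..2}\<close>, so their measures tend to 2.\<close>
  have big: "\<exists>N. \<forall>n\<ge>N. measure lborel {v \<in> {0..2}. \<forall>m\<ge>n. \<bar>h (y m + v) - h (y m)\<bar> < d / 2} > 3 / 2"
    if y: "\<And>n::nat. real n \<le> y n" for y
  proof -
    let ?U = "\<lambda>n. {v \<in> {0..2::real}. \<forall>m\<ge>n. \<bar>h (y m + v) - h (y m)\<bar> < d / 2}"
    have ms: "range ?U \<subseteq> sets lborel"
    proof -
      have "\<And>n. ?U n \<in> sets borel" by measurable
      then show ?thesis by auto
    qed
    have ytop: "filterlim y at_top sequentially"
      by (rule filterlim_at_top_mono[OF filterlim_real_sequentially]) (use y in auto)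
    have un: "(\<Union>n. ?U n) = {0..2}"
    proof safe
      fix v :: real assume v: "v \<in> {0..2}"
      have "(\<lambda>n. h (y n + v) - h (y n)) \<longlonglongrightarrow> 0"
        using filterlim_compose[OF lim ytop] by simp
      then have "eventually (\<lambda>n. \<bar>h (y n + v) - h (y n)\<bar> < d / 2) sequentially"
        using \<open>0 < d\<close> by (auto dest!: tendstoD[where e="d/2"] simp: dist_real_def)
      then show "v \<in> (\<Union>n. ?U n)" using v by (auto simp: eventually_sequentially)
    qed
    have "(\<lambda>n. measure lborel (?U n)) \<longlonglongrightarrow> measure lborel (\<Union>n. ?U n)"
    proof (rule Lim_measure_incseq)
      show "incseq ?U" by (auto simp: incseq_def)
      show "emeasure lborel (\<Union>n. ?U n) \<noteq> \<infinity>" unfolding un by simp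
    qed (use ms in auto)
    then have "(\<lambda>n. measure lborel (?U n)) \<longlonglongrightarrow> 2" unfolding un by simp
    then have "eventually (\<lambda>n. 3 / 2 < measure lborel (?U n)) sequentially"
      by (rule order_tendstoD) simp
    then show ?thesis by (auto simp: eventually_sequentially)
  qed
  obtain n1 where n1: "\<forall>n\<ge>n1. measure lborel {v \<in> {0..2}. \<forall>m\<ge>n. \<bar>h (x m + v) - h (x m)\<bar> < d / 2} > 3 / 2"
    using big[of x] xu(1) by auto
  have "\<And>n. real n \<le> x n + u n" using xu(1,2) by (metis add_increasing2 atLeastAtMost_iff)
  from big[of "\<lambda>n. x n + u n", OF this] obtain n2 where n2: "\<forall>n\<ge>n2. measure lborel
    {v \<in> {0..2}. \<forall>m\<ge>n. \<bar>h (x m + u m + v) - h (x m + u m)\<bar> < d / 2} > 3 / 2" by auto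
  define n where "n = max n1 n2"
  define U where "U = {v \<in> {0..2}. \<forall>m\<ge>n. \<bar>h (x m + v) - h (x m)\<bar> < d / 2}"
  define V where "V = {v \<in> {0..2}. \<forall>m\<ge>n. \<bar>h (x m + u m + v) - h (x m + u m)\<bar> < d / 2}"
  \<comment> \<open>\<open>W\<close> is \<open>V\<close> translated by \<open>u n\<close>. Both
    \<open>U\<close> and \<open>W\<close> lie in \<open>{0..3}\<close> and have measure above 3/2,
    so they meet; a common point \<open>w\<close> makes \<open>h (x n + w)\<close> close to
    \<open>h (x n)\<close> and to \<open>h (x n + u n)\<close>, against the choice of the
    sequence.\<close>
  define W where "W = (+) (- u n) -` V"
  have U: "U \<in> sets borel" and V: "V \<in> sets borel"
    unfolding U_def V_def by measurable
  have W: "W \<in> sets borel"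
    using measurable_sets[OF _ V, of "(+) (- u n)" borel] unfolding W_def by simp
  have mW: "measure lborel W = measure lborel V"
  proof -
    have "emeasure lborel V = emeasure (distr lborel borel ((+) (- u n))) V"
      by (simp add: lborel_distr_plus)
    also have "\<dots> = emeasure lborel W"
      unfolding W_def by (subst emeasure_distr) (use V in auto)
    finally show ?thesis by (simp add: measure_def)
  qed
  have mU: "measure lborel U > 3 / 2" and mV: "measure lborel V > 3 / 2"
    using n1[rule_format, of n] n2[rule_format, of n] unfolding U_def V_def by (simp_all add: n_def)
  have U3: "U \<subseteq> {0..3}" by (auto simp: U_def)
  have W3: "W \<subseteq> {0..3}" using xu(2)[of n] by (auto simp: W_def V_def)
  have fin: "{0..3::real} \<in> fmeasurable lborel" by (rule fmeasurableI) simp_all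
  have fU: "U \<in> fmeasurable lborel" and fW: "W \<in> fmeasurable lborel"
    using fmeasurableI2[OF fin] U W U3 W3 by auto
  have "U \<inter> W \<noteq> {}"
  proof
    assume "U \<inter> W = {}"
    then have "measure lborel (U \<union> W) = measure lborel U + measure lborel W"
      using fU fW by (intro measure_Union) (auto simp: fmeasurable_def less_top)
    moreover have "measure lborel (U \<union> W) \<le> measure lborel {0..3::real}"
      using U3 W3 fin U W by (intro measure_mono_fmeasurable) auto
    ultimately show False using mU mV mW by simp
  qed
  then obtain w where w: "w \<in> U" "w - u n \<in> V" by (auto simp: W_def)
  have "\<bar>h (x n + w) - h (x n)\<bar> < d / 2" using w by (auto simp: U_def)
  moreover have "\<bar>h (x n + u n + (w - u n)) - h (x n + u n)\<bar> < d / 2" using w unfolding V_def by blast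
  then have "\<bar>h (x n + w) - h (x n + u n)\<bar> < d / 2" by simp
  ultimately show False using xu(3)[of n] by linarith
qed

text \<open>The uniform convergence theorem for slowly varying functions on the window from 1 to e.
  In logarithmic coordinates scaling becomes translation, and the window becomes the unit
  interval.\<close>

lemma slowly_varying_uniform:
  assumes L: "slowly_varying L" and "0 < d"
  shows "\<exists>X. 1 \<le> X \<and> (\<forall>x\<ge>X. 0 < L x \<and> (\<forall>c\<in>{1..exp 1}. \<bar>ln (L (c * x)) - ln (L x)\<bar> < d))"
proof -
  from L obtain X0 where X0: "\<forall>x\<ge>X0. 0 < L x" "set_borel_measurable borel {X0..} L"
    and lim: "\<And>c. 0 < c \<Longrightarrow> ((\<lambda>x. L (c * x) / L x) \<longlongrightarrow> 1) at_top"
    unfolding slowly_varying_def by blast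
  \<comment> \<open>Below \<open>X0\<close> the function may fail to be positive or measurable; the
    value 1 there gives a positive Borel function on the whole line with the same behaviour at
    infinity.\<close>
  define L1 where "L1 x = (if X0 \<le> x then L x else 1)" for x
  have "L1 = (\<lambda>x. if X0 \<le> x then indicator {X0..} x *\<^sub>R L x else 1)" by (auto simp: L1_def)
  also have "\<dots> \<in> borel_measurable borel"
    using X0(2) unfolding set_borel_measurable_def by measurable
  finally have mL1: "L1 \<in> borel_measurable borel" .
  have pL1: "0 < L1 x" for x using X0(1) by (auto simp: L1_def)
  define h where "h y = ln (L1 (exp y))" for y
  have mh: "h \<in> borel_measurable borel" unfolding h_def using mL1 by measurable
  have limh: "((\<lambda>x. h (x + u) - h x) \<longlongrightarrow> 0) at_top" for u
  proof -
    have "((\<lambda>y. L (exp u * exp y) / L (exp y)) \<longlongrightarrow> 1) at_top"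
      using filterlim_compose[OF lim[of "exp u"] exp_at_top] by simp
    then have "((\<lambda>y. ln (L (exp u * exp y) / L (exp y))) \<longlongrightarrow> ln 1) at_top"
      by (rule tendsto_ln) simp
    moreover have "eventually (\<lambda>y. ln (L (exp u * exp y) / L (exp y)) = h (y + u) - h y) at_top"
    proof -
      have "filterlim (\<lambda>y. y + u) at_top at_top"
        using filterlim_tendsto_add_at_top[OF tendsto_const filterlim_ident, of u] by (simp add: add.commute)
      then have "filterlim (\<lambda>y. exp (y + u)) at_top at_top" by (rule filterlim_compose[OF exp_at_top])
      then have "eventually (\<lambda>y. X0 \<le> exp y) at_top" "eventually (\<lambda>y. X0 \<le> exp (y + u)) at_top"
        using exp_at_top unfolding filterlim_at_top by blast+
      then show ?thesis
      proof eventually_elim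
        case (elim y)
        then have "0 < L (exp y)" "0 < L (exp y * exp u)" using X0(1) by (auto simp: exp_add)
        then show ?case using elim by (simp add: h_def L1_def ln_div exp_add mult.commute)
      qed
    qed
    ultimately show ?thesis by (simp add: tendsto_cong)
  qed
  from uniform_convergence_translates[OF mh limh \<open>0 < d\<close>] obtain Y
    where Y: "\<And>y u. y \<ge> Y \<Longrightarrow> u \<in> {0..1} \<Longrightarrow> \<bar>h (y + u) - h y\<bar> < d" by blast
  define X where "X = max 1 (max X0 (exp Y))"
  have "0 < L x \<and> (\<forall>c\<in>{1..exp 1}. \<bar>ln (L (c * x)) - ln (L x)\<bar> < d)" if x: "x \<ge> X" for x
  proof (intro conjI ballI)
    show "0 < L x" using X0(1) x by (auto simp: X_def)
    fix c :: real assume c: "c \<in> {1..exp 1}"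
    have x1: "1 \<le> x" "X0 \<le> x" "exp Y \<le> x" using x by (auto simp: X_def)
    then have "x \<le> c * x" using c by (simp add: mult_le_cancel_right1)
    then have "X0 \<le> c * x" using x1 by linarith
    moreover have "Y \<le> ln x" using x1 by (simp add: ln_ge_iff)
    moreover have "ln c \<in> {0..1}" using c ln_mono[of c "exp 1"] by simp
    ultimately have "\<bar>h (ln x + ln c) - h (ln x)\<bar> < d" using Y by blast
    then show "\<bar>ln (L (c * x)) - ln (L x)\<bar> < d"
      using x1 c \<open>X0 \<le> c * x\<close> by (simp add: h_def L1_def exp_add mult.commute)
  qed
  then show ?thesis by (intro exI[of _ X]) (auto simp: X_def)
qed

text \<open>The factor (n+1)/n changes with n, so the pointwise definition is not enough; it stays
  in the window since it is at most 2, which is below e.\<close>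

lemma slowly_varying_Suc_ratio:
  assumes "slowly_varying L"
  shows "(\<lambda>n. L (real (Suc n)) / L (real n)) \<longlonglongrightarrow> 1"
proof -
  have "(\<lambda>n. ln (L (real (Suc n)) / L (real n))) \<longlonglongrightarrow> 0"
  proof (rule LIMSEQ_I)
    fix d :: real assume "0 < d"
    from slowly_varying_uniform[OF assms this] obtain X where X: "1 \<le> X"
      "\<And>x. x \<ge> X \<Longrightarrow> 0 < L x" "\<And>x c. x \<ge> X \<Longrightarrow> c \<in> {1..exp 1} \<Longrightarrow> \<bar>ln (L (c * x)) - ln (L x)\<bar> < d"
      by blast
    have "norm (ln (L (real (Suc n)) / L (real n)) - 0) < d" if n: "n \<ge> nat \<lceil>X\<rceil>" for n
    proof -
      have nX: "real n \<ge> X" "real (Suc n) \<ge> X" using n by linarith+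
      have n1: "1 \<le> real n" using nX X by linarith
      have "real (Suc n) / real n \<le> 2" using n1 by (simp add: field_simps)
      also have "(2::real) \<le> exp 1" using exp_ge_add_one_self[of 1] by simp
      finally have "real (Suc n) / real n \<in> {1..exp 1}" using n1 by (simp add: field_simps)
      from X(3)[OF nX(1) this] show ?thesis
        using n1 X(2)[OF nX(1)] X(2)[OF nX(2)] by (simp add: ln_div)
    qed
    then show "\<exists>no. \<forall>n\<ge>no. norm (ln (L (real (Suc n)) / L (real n)) - 0) < d" by blast
  qed
  then have "(\<lambda>n. exp (ln (L (real (Suc n)) / L (real n)))) \<longlonglongrightarrow> exp 0"
    by (rule tendsto_exp)
  moreover have "eventually (\<lambda>n. exp (ln (L (real (Suc n)) / L (real n))) = L (real (Suc n)) / L (real n)) sequentially"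
  proof -
    obtain X where X: "\<And>x. x \<ge> X \<Longrightarrow> 0 < L x" using slowly_varying_uniform[OF assms zero_less_one] by blast
    have "exp (ln (L (real (Suc n)) / L (real n))) = L (real (Suc n)) / L (real n)" if "n \<ge> nat \<lceil>X\<rceil>" for n
    proof -
      have "real n \<ge> X" "real (Suc n) \<ge> X" using that by linarith+
      then show ?thesis using X by simp
    qed
    then show ?thesis unfolding eventually_sequentially by blast
  qed
  ultimately show ?thesis unfolding exp_zero by (rule Lim_transform_eventually)
qed

text \<open>A weak form of Potter's bounds: going from \<open>X\<close> to \<open>x\<close> takes
  about \<open>ln x\<close> multiplications by at most e, and each of them changes
  \<open>ln (L x)\<close> by less than \<open>d\<close>.\<close>

lemma slowly_varying_potter:
  assumes "slowly_varying L" and "0 < d"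
  shows "\<exists>C>0. eventually (\<lambda>x. C * x powr (- d) \<le> L x \<and> L x \<le> x powr d / C) at_top"
proof -
  from slowly_varying_uniform[OF assms] obtain X where X: "1 \<le> X"
    "\<And>x. x \<ge> X \<Longrightarrow> 0 < L x" "\<And>x c. x \<ge> X \<Longrightarrow> c \<in> {1..exp 1} \<Longrightarrow> \<bar>ln (L (c * x)) - ln (L x)\<bar> < d"
    by blast
  \<comment> \<open>Here \<open>y\<close> is the logarithm of the ratio to \<open>X\<close>. The
    extra 1 in \<open>y + 1\<close> pays for the last, incomplete unit step.\<close>
  have step: "\<bar>ln (L (exp y * X)) - ln (L X)\<bar> \<le> d * (y + 1)" if "0 \<le> y" "y \<le> real k" for y k
    using that
  proof (induction k arbitrary: y)
    case 0
    then show ?case using \<open>0 < d\<close> by simp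
  next
    case (Suc k)
    show ?case
    proof (cases "y \<le> 1")
      case True
      then have "\<bar>ln (L (exp y * X)) - ln (L X)\<bar> < d" using X(3)[of X "exp y"] Suc.prems by simp
      also have "d \<le> d * (y + 1)" using Suc.prems \<open>0 < d\<close> by simp
      finally show ?thesis by simp
    next
      case False
      have "\<bar>ln (L (exp (y - 1) * X)) - ln (L X)\<bar> \<le> d * (y - 1 + 1)"
        using Suc.IH[of "y - 1"] Suc.prems False by simp
      moreover have "X \<le> exp (y - 1) * X" using X(1) False by (simp add: mult_le_cancel_right1)
      then have "\<bar>ln (L (exp 1 * (exp (y - 1) * X))) - ln (L (exp (y - 1) * X))\<bar> < d"
        using X(3)[of "exp (y - 1) * X" "exp 1"] by simp
      moreover have "exp 1 * (exp (y - 1) * X) = exp y * X"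
        by (simp add: mult_exp_exp flip: mult.assoc)
      ultimately show ?thesis by (auto simp: distrib_left)
    qed
  qed
  \<comment> \<open>The constant collects what the chain leaves over: the starting value
    \<open>ln (L X)\<close> and the extra \<open>d\<close>.\<close>
  define c where "c = \<bar>ln (L X)\<bar> + d"
  have "exp (- c) * x powr (- d) \<le> L x \<and> L x \<le> x powr d / exp (- c)" if x: "x \<ge> X" for x
  proof -
    define y where "y = ln (x / X)"
    have y: "0 \<le> y" "exp y * X = x" using x X(1) by (auto simp: y_def)
    have "y \<le> ln x" using x X(1) by (simp add: y_def ln_div)
    obtain k :: nat where "y \<le> real k" using real_arch_simple by blast
    from step[OF y(1) this] have "\<bar>ln (L x) - ln (L X)\<bar> \<le> d * (y + 1)" by (simp add: y)
    also have "\<dots> \<le> d * (ln x + 1)" using \<open>y \<le> ln x\<close> \<open>0 < d\<close> by simp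
    finally have *: "\<bar>ln (L x)\<bar> \<le> c + d * ln x" by (simp add: c_def algebra_simps)
    have Lx: "0 < L x" and x0: "0 < x" using X x by auto
    have "L x = exp (ln (L x))" using Lx by simp
    also have "\<dots> \<le> exp (c + d * ln x)" using * by simp
    also have "\<dots> = x powr d / exp (- c)" using x0 by (simp add: exp_add powr_def exp_minus field_simps)
    finally have "L x \<le> x powr d / exp (- c)" .
    moreover have "exp (- c) * x powr (- d) = exp (- (c + d * ln x))"
      using x0 by (simp add: exp_add powr_def flip: exp_add)
    moreover have "\<dots> \<le> exp (ln (L x))" using * by simp
    ultimately show ?thesis using Lx by simp
  qed
  then show ?thesis by (intro exI[of _ "exp (- c)"]) (auto simp: eventually_at_top_linorder)
qed

section \<open>Toeplitz sums\<close>

lemma toeplitz_row_le: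
  fixes f :: "int \<Rightarrow> real"
  assumes "t \<in> {1..int n}"
  shows "(\<Sum>s=1..int n. \<bar>f (t - s)\<bar>) \<le> (\<Sum>j=-int n..int n. \<bar>f j\<bar>)"
proof -
  have "(\<Sum>s=1..int n. \<bar>f (t - s)\<bar>) = (\<Sum>j\<in>(\<lambda>s. t - s) ` {1..int n}. \<bar>f j\<bar>)"
    by (subst sum.reindex) (auto simp: inj_on_def)
  also have "\<dots> \<le> (\<Sum>j=-int n..int n. \<bar>f j\<bar>)"
    by (rule sum_mono2) (use assms in auto)
  finally show ?thesis .
qed

lemma toeplitz_col_le:
  fixes f :: "int \<Rightarrow> real"
  assumes "s \<in> {1..int n}"
  shows "(\<Sum>t=1..int n. \<bar>f (t - s)\<bar>) \<le> (\<Sum>j=-int n..int n. \<bar>f j\<bar>)"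
proof -
  have "(\<Sum>t=1..int n. \<bar>f (t - s)\<bar>) = (\<Sum>j\<in>(\<lambda>t. t - s) ` {1..int n}. \<bar>f j\<bar>)"
    by (subst sum.reindex) (auto simp: inj_on_def)
  also have "\<dots> \<le> (\<Sum>j=-int n..int n. \<bar>f j\<bar>)"
    by (rule sum_mono2) (use assms in auto)
  finally show ?thesis .
qed

lemma weighted_AM_GM:
  fixes u v k :: real
  assumes "0 < k"
  shows "\<bar>u * v\<bar> \<le> (k * u\<^sup>2 + v\<^sup>2 / k) / 2"
proof -
  have "0 \<le> (k * \<bar>u\<bar> - \<bar>v\<bar>)\<^sup>2 / k" using assms by simp
  also have "\<dots> = k * u\<^sup>2 - 2 * \<bar>u * v\<bar> + v\<^sup>2 / k"
    using assms by (simp add: power2_eq_square field_simps abs_mult)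
  finally show ?thesis by simp
qed

text \<open>Schur's test: the weighted arithmetic-geometric mean separates \<open>u\<close> from
  \<open>v\<close>, and each part then meets only row or column sums of the kernel. The parameter
  \<open>k\<close> stays free for balancing the two parts.\<close>

lemma toeplitz_form_le:
  fixes f u v :: "int \<Rightarrow> real"
  assumes "0 < k"
  shows "\<bar>\<Sum>t=1..int n. \<Sum>s=1..int n. f (t - s) * u t * v s\<bar>
    \<le> (\<Sum>j=-int n..int n. \<bar>f j\<bar>) * (k * (\<Sum>t=1..int n. (u t)\<^sup>2) + (\<Sum>s=1..int n. (v s)\<^sup>2) / k) / 2"
proof -
  let ?A = "\<Sum>j=-int n..int n. \<bar>f j\<bar>"
  have "\<bar>\<Sum>t=1..int n. \<Sum>s=1..int n. f (t - s) * u t * v s\<bar>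
      \<le> (\<Sum>t=1..int n. \<Sum>s=1..int n. \<bar>f (t - s) * u t * v s\<bar>)"
    by (rule order.trans[OF sum_abs]) (intro sum_mono sum_abs)
  also have "\<dots> \<le> (\<Sum>t=1..int n. \<Sum>s=1..int n. \<bar>f (t - s)\<bar> * ((k * (u t)\<^sup>2 + (v s)\<^sup>2 / k) / 2))"
  proof (intro sum_mono)
    fix t s
    show "\<bar>f (t - s) * u t * v s\<bar> \<le> \<bar>f (t - s)\<bar> * ((k * (u t)\<^sup>2 + (v s)\<^sup>2 / k) / 2)"
      using mult_left_mono[OF weighted_AM_GM[OF assms, of "u t" "v s"], of "\<bar>f (t - s)\<bar>"]
      by (simp add: abs_mult mult.assoc)
  qed
  also have "\<dots> = (\<Sum>t=1..int n. \<Sum>s=1..int n. \<bar>f (t - s)\<bar> * (k * (u t)\<^sup>2 / 2)) +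
      (\<Sum>t=1..int n. \<Sum>s=1..int n. \<bar>f (t - s)\<bar> * ((v s)\<^sup>2 / k / 2))"
    by (simp add: sum.distrib add_divide_distrib distrib_left)
  also have "(\<Sum>t=1..int n. \<Sum>s=1..int n. \<bar>f (t - s)\<bar> * ((v s)\<^sup>2 / k / 2)) =
      (\<Sum>s=1..int n. \<Sum>t=1..int n. \<bar>f (t - s)\<bar> * ((v s)\<^sup>2 / k / 2))"
    by (rule sum.swap)
  also have "\<dots> = (\<Sum>s=1..int n. (\<Sum>t=1..int n. \<bar>f (t - s)\<bar>) * ((v s)\<^sup>2 / k / 2))"
    by (subst sum_distrib_right) (rule refl)
  also have "\<dots> \<le> (\<Sum>s=1..int n. ?A * ((v s)\<^sup>2 / k / 2))"
    using assms by (intro sum_mono mult_right_mono toeplitz_col_le) auto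
  also have "(\<Sum>t=1..int n. \<Sum>s=1..int n. \<bar>f (t - s)\<bar> * (k * (u t)\<^sup>2 / 2)) =
      (\<Sum>t=1..int n. (\<Sum>s=1..int n. \<bar>f (t - s)\<bar>) * (k * (u t)\<^sup>2 / 2))"
    by (subst sum_distrib_right) (rule refl)
  also have "\<dots> \<le> (\<Sum>t=1..int n. ?A * (k * (u t)\<^sup>2 / 2))"
    using assms by (intro sum_mono mult_right_mono toeplitz_row_le) auto
  finally show ?thesis
    by (simp add: sum_distrib_left[symmetric] sum_divide_distrib[symmetric] add_divide_distrib distrib_left)
qed

lemma toeplitz_quad_le:
  fixes f u :: "int \<Rightarrow> real"
  shows "\<bar>\<Sum>t=1..int n. \<Sum>s=1..int n. f (t - s) * u t * u s\<bar>
    \<le> (\<Sum>j=-int n..int n. \<bar>f j\<bar>) * (\<Sum>t=1..int n. (u t)\<^sup>2)"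
  using toeplitz_form_le[where k=1 and u=u and v=u and f=f and n=n] by simp

text \<open>Duality: the left side is the Toeplitz form of \<open>z\<close> paired with its own
  convolution \<open>v\<close>. With parameter \<open>A\<close> in \<open>toeplitz_form_le\<close>
  the square sum of \<open>v\<close> reappears with factor one half and is absorbed.\<close>

lemma toeplitz_conv_sq_le:
  fixes f z :: "int \<Rightarrow> real"
  assumes A: "(\<Sum>j=-int n..int n. \<bar>f j\<bar>) \<le> A" and "0 < A"
  shows "(\<Sum>s=1..int n. (\<Sum>t=1..int n. f (t - s) * z t)\<^sup>2) \<le> A\<^sup>2 * (\<Sum>t=1..int n. (z t)\<^sup>2)"
proof -
  define v where "v s = (\<Sum>t=1..int n. f (t - s) * z t)" for s
  let ?V = "\<Sum>s=1..int n. (v s)\<^sup>2" and ?Z = "\<Sum>t=1..int n. (z t)\<^sup>2"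
  have "?V = (\<Sum>s=1..int n. \<Sum>t=1..int n. f (t - s) * z t * v s)"
    by (simp add: v_def power2_eq_square sum_distrib_right)
  also have "\<dots> = (\<Sum>t=1..int n. \<Sum>s=1..int n. f (t - s) * z t * v s)" by (rule sum.swap)
  also have "\<dots> \<le> (\<Sum>j=-int n..int n. \<bar>f j\<bar>) * (A * ?Z + ?V / A) / 2"
    using toeplitz_form_le[OF \<open>0 < A\<close>, where u=z and v=v and f=f and n=n] by linarith
  also have "\<dots> \<le> A * (A * ?Z + ?V / A) / 2"
    using A \<open>0 < A\<close> by (intro divide_right_mono mult_right_mono) (auto intro!: add_nonneg_nonneg mult_nonneg_nonneg divide_nonneg_nonneg sum_nonneg)
  also have "\<dots> = A\<^sup>2 * ?Z / 2 + ?V / 2" using \<open>0 < A\<close> by (simp add: field_simps power2_eq_square)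
  finally show ?thesis by (simp add: v_def)
qed

lemma cesaro_abs_null:
  fixes f :: "int \<Rightarrow> real"
  assumes "\<And>k. 0 < k \<Longrightarrow> \<exists>J. \<forall>j. \<bar>j\<bar> \<ge> J \<longrightarrow> \<bar>f j\<bar> < k"
  shows "(\<lambda>n. (\<Sum>j=-int n..int n. \<bar>f j\<bar>) / real n) \<longlonglongrightarrow> 0"
proof (rule LIMSEQ_I)
  fix r :: real assume "0 < r"
  obtain J0 where J0: "\<forall>j. \<bar>j\<bar> \<ge> J0 \<longrightarrow> \<bar>f j\<bar> < r / 6" using assms[of "r/6"] \<open>0 < r\<close> by auto
  define J where "J = nat \<bar>J0\<bar>"
  define C where "C = (\<Sum>j=-int J..int J. \<bar>f j\<bar>)"
  have bound: "(\<Sum>j=-int n..int n. \<bar>f j\<bar>) \<le> C + (2 * real n + 1) * (r / 6)" for n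
  proof -
    have "(\<Sum>j=-int n..int n. \<bar>f j\<bar>) \<le> (\<Sum>j=-int n..int n. (if j \<in> {-int J..int J} then \<bar>f j\<bar> else 0) + r / 6)"
      using J0 \<open>0 < r\<close> by (intro sum_mono) (auto simp: J_def less_imp_le)
    also have "\<dots> = (\<Sum>j=-int n..int n. (if j \<in> {-int J..int J} then \<bar>f j\<bar> else 0)) + (2 * real n + 1) * (r / 6)"
      by (simp add: sum.distrib algebra_simps)
    also have "(\<Sum>j=-int n..int n. (if j \<in> {-int J..int J} then \<bar>f j\<bar> else 0)) =
        (\<Sum>j\<in>{-int n..int n} \<inter> {-int J..int J}. \<bar>f j\<bar>)" by (subst sum.inter_restrict) auto
    also have "\<dots> \<le> C" unfolding C_def by (rule sum_mono2) auto
    finally show ?thesis by simp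
  qed
  obtain N :: nat where N: "6 * (C + 1) / r < real N" using reals_Archimedean2 by blast
  have C0: "0 \<le> C" by (simp add: C_def sum_nonneg)
  have "norm ((\<Sum>j=-int n..int n. \<bar>f j\<bar>) / real n - 0) < r" if n: "n \<ge> max 1 N" for n
  proof -
    have n1: "1 \<le> real n" and "6 * (C + 1) / r < real n" using n N by auto
    then have "6 * C \<le> r * real n" using \<open>0 < r\<close> by (simp add: divide_less_eq algebra_simps)
    moreover have "r \<le> r * real n" using n1 \<open>0 < r\<close> by simp
    ultimately have "C + (2 * real n + 1) * (r / 6) < r * real n"
    proof -
      have "0 < r * real n" using n1 \<open>0 < r\<close> by simp
      moreover have "(2 * real n + 1) * (r / 6) = r * real n / 3 + r / 6" by (simp add: field_simps)
      ultimately show ?thesis using \<open>6 * C \<le> r * real n\<close> \<open>r \<le> r * real n\<close> by linarith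
    qed
    then have "(\<Sum>j=-int n..int n. \<bar>f j\<bar>) < r * real n" using bound[of n] by linarith
    then show ?thesis using n1 by (simp add: sum_nonneg divide_less_eq)
  qed
  then show "\<exists>no. \<forall>n\<ge>no. norm ((\<Sum>j=-int n..int n. \<bar>f j\<bar>) / real n - 0) < r" by blast
qed

lemma sym_sum_tail:
  fixes c :: "int \<Rightarrow> real"
  assumes bound: "\<And>n. (\<Sum>j=-int n..int n. \<bar>c j\<bar>) \<le> A" and "0 < k"
  shows "\<exists>m. \<forall>n\<ge>m. (\<Sum>j\<in>{-int n..int n} - {-int m..int m}. \<bar>c j\<bar>) < k"
proof -
  let ?S = "\<lambda>n. \<Sum>j=-int n..int n. \<bar>c j\<bar>"
  have "incseq ?S" by (auto simp: incseq_def intro!: sum_mono2)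
  then have "convergent ?S" using bound by (intro Bseq_mono_convergent BseqI'[of _ A])
    (auto simp: sum_nonneg incseq_def)
  then have "Cauchy ?S" by (simp add: Cauchy_convergent_iff)
  then obtain m where m: "\<And>n. n \<ge> m \<Longrightarrow> norm (?S n - ?S m) < k"
    using \<open>0 < k\<close> unfolding Cauchy_iff by blast
  have "(\<Sum>j\<in>{-int n..int n} - {-int m..int m}. \<bar>c j\<bar>) < k" if "n \<ge> m" for n
    using m[OF that] that by (subst sum_diff) auto
  then show ?thesis by blast
qed

text \<open>The restriction \<open>s \<le> n\<close> in the inner sum only affects boundedly many terms for each lag.\<close>

lemma (in prob_space) toeplitz_L1:
  fixes c :: "int \<Rightarrow> real" and Y :: "int \<Rightarrow> int \<Rightarrow> 'a \<Rightarrow> real" and G :: "int \<Rightarrow> real"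
  assumes c: "\<And>n. (\<Sum>j=-int n..int n. \<bar>c j\<bar>) \<le> A"
    and int: "\<And>t s. integrable M (Y t s)" and C: "\<And>t s. (\<integral>\<omega>. \<bar>Y t s \<omega>\<bar> \<partial>M) \<le> C"
    and lim: "\<And>j. (\<lambda>n. \<integral>\<omega>. \<bar>(\<Sum>t=1..int n. Y t (t - j) \<omega>) / real n - G j\<bar> \<partial>M) \<longlonglongrightarrow> 0"
    and S: "(\<lambda>m. \<Sum>j=-int m..int m. c j * G j) \<longlonglongrightarrow> S"
  shows "(\<lambda>n. \<integral>\<omega>. \<bar>(\<Sum>t=1..int n. \<Sum>s=1..int n. c (t - s) * Y t s \<omega>) / real n - S\<bar> \<partial>M) \<longlonglongrightarrow> 0"
proof (rule LIMSEQ_I)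
  fix r :: real assume r: "0 < r"
  have C0: "0 \<le> C" using C[of 0 0] by (meson Bochner_Integration.integral_nonneg abs_ge_zero order_trans)
  \<comment> \<open>First moments are at most \<open>C\<close>, so lags beyond \<open>m1\<close>
    will contribute less than r/8; adding 1 keeps the denominator positive.\<close>
  obtain m1 where m1: "\<forall>n\<ge>m1. (\<Sum>j\<in>{-int n..int n} - {-int m1..int m1}. \<bar>c j\<bar>) < r / (8 * (C + 1))"
    using sym_sum_tail[OF c, of "r / (8 * (C + 1))"] r C0 by auto
  obtain m2 where m2: "\<forall>m\<ge>m2. norm ((\<Sum>j=-int m..int m. c j * G j) - S) < r / 4"
    using LIMSEQ_D[OF S, of "r/4"] r by auto
  define m where "m = max m1 m2"
  let ?I = "{-int m..int m}"
  have tail: "(\<Sum>j\<in>{-int n..int n} - ?I. \<bar>c j\<bar>) \<le> r / (8 * (C + 1))" for n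
  proof -
    have "(\<Sum>j\<in>{-int n..int n} - ?I. \<bar>c j\<bar>) \<le> (\<Sum>j\<in>{-int (max n m1)..int (max n m1)} - {-int m1..int m1}. \<bar>c j\<bar>)"
      by (rule sum_mono2) (auto simp: m_def)
    also have "\<dots> < r / (8 * (C + 1))" using m1 by (simp del: max.cobounded2 add: max.cobounded2)
    finally show ?thesis by simp
  qed
  define Am where "Am = (\<Sum>j\<in>?I. \<bar>c j\<bar>)"
  have Am0: "0 \<le> Am" by (simp add: Am_def sum_nonneg)
  define Z where "Z n j \<omega> = (\<Sum>t=1..int n. Y t (t - j) \<omega>) / real n - G j" for n j \<omega>
  have intZ: "integrable M (Z n j)" for n j unfolding Z_def using int by auto
  \<comment> \<open>\<open>E1\<close> holds the pairs with a lag outside the window.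
    \<open>E2\<close> holds the terms missing because \<open>t - j\<close> leaves the sample; adding
    and subtracting them completes, for each lag in the window, the average that \<open>lim\<close>
    controls.\<close>
  define E1 where "E1 n = {(t, s). t \<in> {1..int n} \<and> s \<in> {1..int n} \<and> t - s \<notin> ?I}" for n
  define E2 where "E2 n = {(t, j). t \<in> {1..int n} \<and> j \<in> ?I \<and> t - j \<notin> {1..int n}}" for n
  have fE1: "finite (E1 n)" for n by (rule finite_subset[of _ "{1..int n} \<times> {1..int n}"]) (auto simp: E1_def)
  have fE2: "finite (E2 n)" for n by (rule finite_subset[of _ "{1..int n} \<times> ?I"]) (auto simp: E2_def)
  have decomp: "(\<Sum>t=1..int n. \<Sum>s=1..int n. c (t - s) * Y t s \<omega>) =
      (\<Sum>(t, s)\<in>E1 n. c (t - s) * Y t s \<omega>) - (\<Sum>(t, j)\<in>E2 n. c j * Y t (t - j) \<omega>)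
       + (\<Sum>j\<in>?I. c j * (\<Sum>t=1..int n. Y t (t - j) \<omega>))" for n \<omega>
  proof -
    let ?B = "{1..int n} \<times> {1..int n}"
    have "(\<Sum>t=1..int n. \<Sum>s=1..int n. c (t - s) * Y t s \<omega>) = (\<Sum>(t, s)\<in>?B. c (t - s) * Y t s \<omega>)"
      by (simp add: sum.cartesian_product)
    also have "\<dots> = (\<Sum>(t, s)\<in>E1 n. c (t - s) * Y t s \<omega>) + (\<Sum>(t, s)\<in>?B - E1 n. c (t - s) * Y t s \<omega>)"
      by (subst add.commute, rule sum.subset_diff) (auto simp: E1_def)
    also have "(\<Sum>(t, s)\<in>?B - E1 n. c (t - s) * Y t s \<omega>) = (\<Sum>(t, j)\<in>{1..int n} \<times> ?I - E2 n. c j * Y t (t - j) \<omega>)"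
      by (rule sum.reindex_bij_witness[of _ "\<lambda>(t, j). (t, t - j)" "\<lambda>(t, s). (t, t - s)"])
        (auto simp: E1_def E2_def)
    also have "\<dots> = (\<Sum>(t, j)\<in>{1..int n} \<times> ?I. c j * Y t (t - j) \<omega>) - (\<Sum>(t, j)\<in>E2 n. c j * Y t (t - j) \<omega>)"
      by (rule sum_diff) (auto simp: E2_def)
    also have "(\<Sum>(t, j)\<in>{1..int n} \<times> ?I. c j * Y t (t - j) \<omega>) = (\<Sum>t=1..int n. \<Sum>j\<in>?I. c j * Y t (t - j) \<omega>)"
      by (simp add: sum.cartesian_product)
    also have "\<dots> = (\<Sum>j\<in>?I. c j * (\<Sum>t=1..int n. Y t (t - j) \<omega>))"
      by (subst sum.swap) (simp add: sum_distrib_left)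
    finally show ?thesis by simp
  qed
  have sE1: "(\<Sum>(t, s)\<in>E1 n. \<bar>c (t - s)\<bar>) \<le> real n * (r / (8 * (C + 1)))" for n
  proof -
    have "(\<Sum>(t, s)\<in>E1 n. \<bar>c (t - s)\<bar>) = (\<Sum>t=1..int n. \<Sum>s\<in>{s\<in>{1..int n}. t - s \<notin> ?I}. \<bar>c (t - s)\<bar>)"
      by (subst sum.Sigma) (auto simp: E1_def Sigma_def intro!: sum.cong intro: finite_subset[of _ "{1..int n}"])
    also have "\<dots> \<le> (\<Sum>t=1..int n. r / (8 * (C + 1)))"
    proof (rule sum_mono)
      fix t assume t: "t \<in> {1..int n}"
      have "(\<Sum>s\<in>{s\<in>{1..int n}. t - s \<notin> ?I}. \<bar>c (t - s)\<bar>) =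
          (\<Sum>j\<in>(\<lambda>s. t - s) ` {s\<in>{1..int n}. t - s \<notin> ?I}. \<bar>c j\<bar>)"
        by (subst sum.reindex) (auto simp: inj_on_def)
      also have "\<dots> \<le> (\<Sum>j\<in>{-int n..int n} - ?I. \<bar>c j\<bar>)"
        by (rule sum_mono2) (use t in auto)
      also note tail
      finally show "(\<Sum>s\<in>{s\<in>{1..int n}. t - s \<notin> ?I}. \<bar>c (t - s)\<bar>) \<le> r / (8 * (C + 1))" .
    qed
    finally show ?thesis by simp
  qed
  \<comment> \<open>A lag of size at most \<open>m\<close> leaves the sample only near its two ends,
    for at most \<open>2 * m\<close> times \<open>t\<close>. This is bounded in \<open>n\<close> and
    disappears after division by \<open>n\<close>.\<close>
  have sE2: "(\<Sum>(t, j)\<in>E2 n. \<bar>c j\<bar>) \<le> 2 * real m * Am" for n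
  proof -
    have "(\<Sum>(t, j)\<in>E2 n. \<bar>c j\<bar>) = (\<Sum>(j, t)\<in>{(j, t). j \<in> ?I \<and> t \<in> {t\<in>{1..int n}. t - j \<notin> {1..int n}}}. \<bar>c j\<bar>)"
      by (rule sum.reindex_bij_witness[of _ "\<lambda>(t, j). (j, t)" "\<lambda>(t, j). (j, t)"]) (auto simp: E2_def)
    also have "\<dots> = (\<Sum>j\<in>?I. \<Sum>t\<in>{t\<in>{1..int n}. t - j \<notin> {1..int n}}. \<bar>c j\<bar>)"
      by (subst sum.Sigma) (auto simp: Sigma_def intro!: sum.cong intro: finite_subset[of _ "{1..int n}"])
    also have "\<dots> \<le> (\<Sum>j\<in>?I. 2 * real m * \<bar>c j\<bar>)"
    proof (rule sum_mono)
      fix j assume j: "j \<in> ?I"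
      have "{t\<in>{1..int n}. t - j \<notin> {1..int n}} \<subseteq> {1..int m} \<union> {int n - int m + 1..int n}" using j by auto
      then have "card {t\<in>{1..int n}. t - j \<notin> {1..int n}} \<le> card ({1..int m} \<union> {int n - int m + 1..int n})"
        by (intro card_mono) auto
      also have "\<dots> \<le> m + m" by (rule order.trans[OF card_Un_le]) simp
      finally have "real (card {t\<in>{1..int n}. t - j \<notin> {1..int n}}) \<le> 2 * real m" by linarith
      then show "(\<Sum>t\<in>{t\<in>{1..int n}. t - j \<notin> {1..int n}}. \<bar>c j\<bar>) \<le> 2 * real m * \<bar>c j\<bar>"
        by (simp add: mult_right_mono)
    qed
    also have "\<dots> = 2 * real m * Am" by (simp add: Am_def sum_distrib_left)
    finally show ?thesis .
  qed
  have main: "(\<integral>\<omega>. \<bar>(\<Sum>t=1..int n. \<Sum>s=1..int n. c (t - s) * Y t s \<omega>) / real n - S\<bar> \<partial>M) \<le>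
      r / 8 + 2 * real m * Am * C / real n + (\<Sum>j\<in>?I. \<bar>c j\<bar> * (\<integral>\<omega>. \<bar>Z n j \<omega>\<bar> \<partial>M)) + r / 4"
    if n: "0 < n" for n
  proof -
    let ?b = "\<lambda>\<omega>. (\<Sum>(t, s)\<in>E1 n. \<bar>c (t - s)\<bar> * \<bar>Y t s \<omega>\<bar>) / real n
       + (\<Sum>(t, j)\<in>E2 n. \<bar>c j\<bar> * \<bar>Y t (t - j) \<omega>\<bar>) / real n + (\<Sum>j\<in>?I. \<bar>c j\<bar> * \<bar>Z n j \<omega>\<bar>) + r / 4"
    have "(\<integral>\<omega>. \<bar>(\<Sum>t=1..int n. \<Sum>s=1..int n. c (t - s) * Y t s \<omega>) / real n - S\<bar> \<partial>M) \<le> (\<integral>\<omega>. ?b \<omega> \<partial>M)"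
    proof (rule integral_mono)
      show "integrable M (\<lambda>\<omega>. \<bar>(\<Sum>t=1..int n. \<Sum>s=1..int n. c (t - s) * Y t s \<omega>) / real n - S\<bar>)"
        using int by auto
      show "integrable M ?b" using int intZ
        by (auto intro!: Bochner_Integration.integrable_add Bochner_Integration.integrable_sum
            integrable_divide_zero simp: case_prod_beta)
      fix \<omega>
      have "(\<Sum>t=1..int n. \<Sum>s=1..int n. c (t - s) * Y t s \<omega>) / real n - S =
         (\<Sum>(t, s)\<in>E1 n. c (t - s) * Y t s \<omega>) / real n - (\<Sum>(t, j)\<in>E2 n. c j * Y t (t - j) \<omega>) / real n
         + (\<Sum>j\<in>?I. c j * Z n j \<omega>) + ((\<Sum>j\<in>?I. c j * G j) - S)"
      proof -
        have "(\<Sum>j\<in>?I. c j * (\<Sum>t=1..int n. Y t (t - j) \<omega>)) / real n =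
            (\<Sum>j\<in>?I. c j * ((\<Sum>t=1..int n. Y t (t - j) \<omega>) / real n))"
          by (subst sum_divide_distrib) simp
        then show ?thesis
          unfolding decomp Z_def add_divide_distrib diff_divide_distrib right_diff_distrib sum_subtractf by simp
      qed
      moreover have "\<bar>(\<Sum>j\<in>?I. c j * G j) - S\<bar> \<le> r / 4" using m2[rule_format, of m] by (simp add: m_def)
      moreover have "\<bar>\<Sum>(t, s)\<in>E1 n. c (t - s) * Y t s \<omega>\<bar> \<le> (\<Sum>(t, s)\<in>E1 n. \<bar>c (t - s)\<bar> * \<bar>Y t s \<omega>\<bar>)"
        by (rule order.trans[OF sum_abs]) (auto simp: abs_mult case_prod_beta)
      moreover have "\<bar>\<Sum>(t, j)\<in>E2 n. c j * Y t (t - j) \<omega>\<bar> \<le> (\<Sum>(t, j)\<in>E2 n. \<bar>c j\<bar> * \<bar>Y t (t - j) \<omega>\<bar>)"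
        by (rule order.trans[OF sum_abs]) (auto simp: abs_mult case_prod_beta)
      moreover have "\<bar>\<Sum>j\<in>?I. c j * Z n j \<omega>\<bar> \<le> (\<Sum>j\<in>?I. \<bar>c j\<bar> * \<bar>Z n j \<omega>\<bar>)"
        by (rule order.trans[OF sum_abs]) (auto simp: abs_mult)
      ultimately have le: "\<bar>(\<Sum>t=1..int n. \<Sum>s=1..int n. c (t - s) * Y t s \<omega>) / real n - S\<bar> \<le>
        \<bar>(\<Sum>(t, s)\<in>E1 n. c (t - s) * Y t s \<omega>) / real n\<bar> + \<bar>(\<Sum>(t, j)\<in>E2 n. c j * Y t (t - j) \<omega>) / real n\<bar>
         + (\<Sum>j\<in>?I. \<bar>c j\<bar> * \<bar>Z n j \<omega>\<bar>) + r / 4" by linarith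
      have "\<bar>(\<Sum>(t, s)\<in>E1 n. c (t - s) * Y t s \<omega>) / real n\<bar> \<le> (\<Sum>(t, s)\<in>E1 n. \<bar>c (t - s)\<bar> * \<bar>Y t s \<omega>\<bar>) / real n"
        using \<open>\<bar>\<Sum>(t, s)\<in>E1 n. c (t - s) * Y t s \<omega>\<bar> \<le> _\<close> by (simp add: divide_right_mono)
      moreover have "\<bar>(\<Sum>(t, j)\<in>E2 n. c j * Y t (t - j) \<omega>) / real n\<bar> \<le> (\<Sum>(t, j)\<in>E2 n. \<bar>c j\<bar> * \<bar>Y t (t - j) \<omega>\<bar>) / real n"
        using \<open>\<bar>\<Sum>(t, j)\<in>E2 n. c j * Y t (t - j) \<omega>\<bar> \<le> _\<close> by (simp add: divide_right_mono)
      ultimately show "\<bar>(\<Sum>t=1..int n. \<Sum>s=1..int n. c (t - s) * Y t s \<omega>) / real n - S\<bar> \<le> ?b \<omega>"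
        using le by linarith
    qed
    also have "(\<integral>\<omega>. ?b \<omega> \<partial>M) = (\<Sum>(t, s)\<in>E1 n. \<bar>c (t - s)\<bar> * (\<integral>\<omega>. \<bar>Y t s \<omega>\<bar> \<partial>M)) / real n
       + (\<Sum>(t, j)\<in>E2 n. \<bar>c j\<bar> * (\<integral>\<omega>. \<bar>Y t (t - j) \<omega>\<bar> \<partial>M)) / real n
       + (\<Sum>j\<in>?I. \<bar>c j\<bar> * (\<integral>\<omega>. \<bar>Z n j \<omega>\<bar> \<partial>M)) + r / 4"
      using int intZ by (simp add: case_prod_beta prob_space)
    also have "(\<Sum>(t, s)\<in>E1 n. \<bar>c (t - s)\<bar> * (\<integral>\<omega>. \<bar>Y t s \<omega>\<bar> \<partial>M)) \<le> (\<Sum>(t, s)\<in>E1 n. \<bar>c (t - s)\<bar> * C)"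
      using C by (intro sum_mono) (auto intro!: mult_left_mono)
    also have "\<dots> = (\<Sum>(t, s)\<in>E1 n. \<bar>c (t - s)\<bar>) * C" by (simp add: sum_distrib_right case_prod_beta)
    also have "\<dots> \<le> real n * (r / (8 * (C + 1))) * C" using C0 sE1 by (intro mult_right_mono)
    also have "\<dots> \<le> real n * (r / 8)"
      using C0 r by (simp add: field_simps)
    also have "(\<Sum>(t, j)\<in>E2 n. \<bar>c j\<bar> * (\<integral>\<omega>. \<bar>Y t (t - j) \<omega>\<bar> \<partial>M)) \<le> (\<Sum>(t, j)\<in>E2 n. \<bar>c j\<bar> * C)"
      using C by (intro sum_mono) (auto intro!: mult_left_mono)
    also have "\<dots> = (\<Sum>(t, j)\<in>E2 n. \<bar>c j\<bar>) * C" by (simp add: sum_distrib_right case_prod_beta)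
    also have "\<dots> \<le> 2 * real m * Am * C" using C0 sE2 by (intro mult_right_mono)
    finally show ?thesis using n by (simp add: divide_right_mono)
  qed
  have "(\<lambda>n. r / 8 + 2 * real m * Am * C / real n + (\<Sum>j\<in>?I. \<bar>c j\<bar> * (\<integral>\<omega>. \<bar>Z n j \<omega>\<bar> \<partial>M)) + r / 4)
      \<longlonglongrightarrow> r / 8 + 0 + (\<Sum>j\<in>?I. \<bar>c j\<bar> * 0) + r / 4"
    unfolding Z_def by (intro tendsto_intros lim lim_const_over_n)
  then have "eventually (\<lambda>n. r / 8 + 2 * real m * Am * C / real n + (\<Sum>j\<in>?I. \<bar>c j\<bar> * (\<integral>\<omega>. \<bar>Z n j \<omega>\<bar> \<partial>M)) + r / 4 < r) sequentially"
    by (rule order_tendstoD) (use r in simp)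
  then obtain N where N: "\<And>n. n \<ge> N \<Longrightarrow> r / 8 + 2 * real m * Am * C / real n + (\<Sum>j\<in>?I. \<bar>c j\<bar> * (\<integral>\<omega>. \<bar>Z n j \<omega>\<bar> \<partial>M)) + r / 4 < r"
    by (auto simp: eventually_sequentially)
  have "norm ((\<integral>\<omega>. \<bar>(\<Sum>t=1..int n. \<Sum>s=1..int n. c (t - s) * Y t s \<omega>) / real n - S\<bar> \<partial>M) - 0) < r"
    if "n \<ge> max 1 N" for n
  proof -
    have "0 \<le> (\<integral>\<omega>. \<bar>(\<Sum>t=1..int n. \<Sum>s=1..int n. c (t - s) * Y t s \<omega>) / real n - S\<bar> \<partial>M)"
      by (rule Bochner_Integration.integral_nonneg) simp
    moreover have "0 < n" "n \<ge> N" using that by auto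
    ultimately show ?thesis using order.strict_trans1[OF main N] unfolding real_norm_def by simp
  qed
  then show "\<exists>no. \<forall>n\<ge>no. norm ((\<integral>\<omega>. \<bar>(\<Sum>t=1..int n. \<Sum>s=1..int n. c (t - s) * Y t s \<omega>) / real n - S\<bar> \<partial>M) - 0) < r"
    by blast
qed

section \<open>Almost sure convergence of independent series\<close>

lemma le_sqrt_mult_sqrt:
  fixes a b z :: real
  assumes le: "\<And>k. 0 < k \<Longrightarrow> z \<le> (k * a + b / k) / 2" and a: "0 \<le> a" and b: "0 \<le> b"
  shows "z \<le> sqrt a * sqrt b"
proof (cases "a = 0 \<or> b = 0")
  case True
  have "z \<le> 0"
  proof (rule ccontr)
    assume "\<not> z \<le> 0"
    then have z: "0 < z" by simp
    show False
    proof (cases "a = 0")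
      case True
      \<comment> \<open>With \<open>a = 0\<close> any \<open>k\<close> above \<open>b / z\<close>
        contradicts the hypothesis; this is the infimum over \<open>k\<close>, which need not be
        attained when a factor vanishes.\<close>
      define k where "k = b / z + 1"
      have k: "0 < k" "z * k = b + z" using z b by (auto simp: k_def add_nonneg_pos field_simps)
      have "z \<le> b / k / 2" using le[OF k(1)] True by simp
      then have "2 * (z * k) \<le> b" using k(1) by (simp add: field_simps)
      then show False using k(2) z b by simp
    next
      case False
      then have a': "0 < a" "b = 0" using \<open>a = 0 \<or> b = 0\<close> a by auto
      have "z \<le> (z / a * a) / 2" using le[of "z / a"] a' z by simp
      then show False using z a' by simp
    qed
  qed
  then show ?thesis using True by auto
next
  case False
  then have ab: "0 < sqrt a" "0 < sqrt b" using a b by auto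
  \<comment> \<open>The minimiser of the right side over \<open>k\<close>; both summands then equal
    the geometric mean.\<close>
  have "z \<le> (sqrt b / sqrt a * a + b / (sqrt b / sqrt a)) / 2" using le[of "sqrt b / sqrt a"] ab by simp
  also have "sqrt b / sqrt a * a = sqrt a * sqrt b"
    using ab a real_sqrt_mult_self[of a] by (simp add: field_simps)
  also have "b / (sqrt b / sqrt a) = sqrt a * sqrt b"
    using ab b real_sqrt_mult_self[of b] by (simp add: field_simps)
  finally show ?thesis by simp
qed

lemma integrable_mult_square_integrable:
  fixes X Y :: "'a \<Rightarrow> real"
  assumes [measurable]: "X \<in> borel_measurable M" "Y \<in> borel_measurable M"
    and X: "integrable M (\<lambda>\<omega>. (X \<omega>)\<^sup>2)" and Y: "integrable M (\<lambda>\<omega>. (Y \<omega>)\<^sup>2)"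
  shows "integrable M (\<lambda>\<omega>. X \<omega> * Y \<omega>)"
proof (rule Bochner_Integration.integrable_bound)
  show "integrable M (\<lambda>\<omega>. (X \<omega>)\<^sup>2 + (Y \<omega>)\<^sup>2)" using X Y by simp
  show "AE \<omega> in M. norm (X \<omega> * Y \<omega>) \<le> norm ((X \<omega>)\<^sup>2 + (Y \<omega>)\<^sup>2)"
  proof (rule AE_I2)
    fix \<omega>
    have "0 \<le> (\<bar>X \<omega>\<bar> - \<bar>Y \<omega>\<bar>)\<^sup>2" by simp
    then have "2 * \<bar>X \<omega> * Y \<omega>\<bar> \<le> (X \<omega>)\<^sup>2 + (Y \<omega>)\<^sup>2" by (simp add: power2_diff abs_mult)
    then show "norm (X \<omega> * Y \<omega>) \<le> norm ((X \<omega>)\<^sup>2 + (Y \<omega>)\<^sup>2)" by simp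
  qed
qed simp

lemma integral_Cauchy_Schwarz:
  fixes X Y :: "'a \<Rightarrow> real"
  assumes [measurable]: "X \<in> borel_measurable M" "Y \<in> borel_measurable M"
    and X: "integrable M (\<lambda>\<omega>. (X \<omega>)\<^sup>2)" and Y: "integrable M (\<lambda>\<omega>. (Y \<omega>)\<^sup>2)"
  shows "(\<integral>\<omega>. \<bar>X \<omega> * Y \<omega>\<bar> \<partial>M) \<le> sqrt (\<integral>\<omega>. (X \<omega>)\<^sup>2 \<partial>M) * sqrt (\<integral>\<omega>. (Y \<omega>)\<^sup>2 \<partial>M)"
proof (rule le_sqrt_mult_sqrt)
  fix k :: real assume k: "0 < k"
  have "(\<integral>\<omega>. \<bar>X \<omega> * Y \<omega>\<bar> \<partial>M) \<le> (\<integral>\<omega>. (k * (X \<omega>)\<^sup>2 + (Y \<omega>)\<^sup>2 / k) / 2 \<partial>M)"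
  proof (rule integral_mono)
    fix \<omega>
    have "0 \<le> (k * \<bar>X \<omega>\<bar> - \<bar>Y \<omega>\<bar>)\<^sup>2 / k" using k by simp
    also have "\<dots> = k * (X \<omega>)\<^sup>2 - 2 * \<bar>X \<omega> * Y \<omega>\<bar> + (Y \<omega>)\<^sup>2 / k"
      using k by (simp add: power2_eq_square field_simps abs_mult)
    finally show "\<bar>X \<omega> * Y \<omega>\<bar> \<le> (k * (X \<omega>)\<^sup>2 + (Y \<omega>)\<^sup>2 / k) / 2" by simp
  qed (use integrable_mult_square_integrable[OF assms] X Y in auto)
  also have "\<dots> = (k * (\<integral>\<omega>. (X \<omega>)\<^sup>2 \<partial>M) + (\<integral>\<omega>. (Y \<omega>)\<^sup>2 \<partial>M) / k) / 2"
    using X Y by simp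
  finally show "(\<integral>\<omega>. \<bar>X \<omega> * Y \<omega>\<bar> \<partial>M) \<le> (k * (\<integral>\<omega>. (X \<omega>)\<^sup>2 \<partial>M) + (\<integral>\<omega>. (Y \<omega>)\<^sup>2 \<partial>M) / k) / 2" .
qed simp_all

lemma abs_integral_mult_le:
  fixes X Y :: "'a \<Rightarrow> real"
  assumes "X \<in> borel_measurable M" "Y \<in> borel_measurable M"
    and "integrable M (\<lambda>\<omega>. (X \<omega>)\<^sup>2)" and "integrable M (\<lambda>\<omega>. (Y \<omega>)\<^sup>2)"
    and "(\<integral>\<omega>. (X \<omega>)\<^sup>2 \<partial>M) \<le> a" and "(\<integral>\<omega>. (Y \<omega>)\<^sup>2 \<partial>M) \<le> b"
  shows "\<bar>\<integral>\<omega>. X \<omega> * Y \<omega> \<partial>M\<bar> \<le> sqrt a * sqrt b"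
proof -
  have "\<bar>\<integral>\<omega>. X \<omega> * Y \<omega> \<partial>M\<bar> \<le> (\<integral>\<omega>. \<bar>X \<omega> * Y \<omega>\<bar> \<partial>M)" by simp
  also note integral_Cauchy_Schwarz[OF assms(1-4)]
  also have "sqrt (\<integral>\<omega>. (X \<omega>)\<^sup>2 \<partial>M) * sqrt (\<integral>\<omega>. (Y \<omega>)\<^sup>2 \<partial>M) \<le> sqrt a * sqrt b"
  proof (rule mult_mono)
    have "0 \<le> (\<integral>\<omega>. (X \<omega>)\<^sup>2 \<partial>M)" by (rule Bochner_Integration.integral_nonneg) simp
    with assms(5) have "0 \<le> a" by linarith
    then show "0 \<le> sqrt a" by simp
  qed (use assms(5,6) in auto)
  finally show ?thesis .
qed

section \<open>Maximal inequality and almost sure convergence\<close>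

context prob_space
begin

lemma abs_expectation_le_sqrt:
  fixes X :: "'a \<Rightarrow> real"
  assumes "X \<in> borel_measurable M" "integrable M (\<lambda>\<omega>. (X \<omega>)\<^sup>2)" "expectation (\<lambda>\<omega>. (X \<omega>)\<^sup>2) \<le> a"
  shows "expectation (\<lambda>\<omega>. \<bar>X \<omega>\<bar>) \<le> sqrt a"
proof -
  have "expectation (\<lambda>\<omega>. \<bar>X \<omega> * 1\<bar>) \<le> sqrt (expectation (\<lambda>\<omega>. (X \<omega>)\<^sup>2)) * sqrt (expectation (\<lambda>\<omega>. 1\<^sup>2))"
    by (rule integral_Cauchy_Schwarz) (use assms in auto)
  then show ?thesis using assms(3) by (simp add: prob_space) (meson order_trans real_sqrt_le_iff)
qed

text \<open>Injectivity keeps the singletons \<open>{f j}\<close> disjoint, so independence of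
  disjoint groups of variables applies.\<close>

lemma indep_vars_reindex_inj:
  fixes X :: "'i \<Rightarrow> 'a \<Rightarrow> real" and f :: "'j \<Rightarrow> 'i"
  assumes "indep_vars (\<lambda>_. borel) X UNIV" and "inj f"
  shows "indep_vars (\<lambda>_. borel) (\<lambda>j. X (f j)) UNIV"
proof -
  have "indep_vars (\<lambda>j. PiM {f j} (\<lambda>_. borel)) (\<lambda>j \<omega>. restrict (\<lambda>i. X i \<omega>) {f j}) UNIV"
    by (rule indep_vars_restrict[OF assms(1)]) (use assms(2) in \<open>auto simp: disjoint_family_on_def inj_def\<close>)
  from indep_vars_compose2[OF this, of "\<lambda>j p. p (f j)" "\<lambda>_. borel"] show ?thesis by simp
qed

lemma kolmogorov_maximal_inequality:
  fixes X :: "nat \<Rightarrow> 'a \<Rightarrow> real"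
  assumes indep: "indep_vars (\<lambda>_. borel) X UNIV"
    and sq: "\<And>i. integrable M (\<lambda>\<omega>. (X i \<omega>)\<^sup>2)" and mean: "\<And>i. expectation (X i) = 0"
    and l: "0 < l"
  shows "l\<^sup>2 * prob {\<omega> \<in> space M. \<exists>k\<le>n. l \<le> \<bar>\<Sum>i<k. X i \<omega>\<bar>} \<le> expectation (\<lambda>\<omega>. (\<Sum>i<n. X i \<omega>)\<^sup>2)"
proof -
  have X[measurable]: "X i \<in> borel_measurable M" for i using indep by (auto simp: indep_vars_def)
  have intX: "integrable M (X i)" for i by (rule square_integrable_imp_integrable) (use sq in auto)
  define S where "S k \<omega> = (\<Sum>i<k. X i \<omega>)" for k \<omega>
  have S[measurable]: "S k \<in> borel_measurable M" for k unfolding S_def by measurable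
  have XX: "integrable M (\<lambda>\<omega>. X i \<omega> * X j \<omega>)" for i j
    by (rule integrable_mult_square_integrable) (use sq in auto)
  have SS: "integrable M (\<lambda>\<omega>. S k \<omega> * S m \<omega>)" for k m
    unfolding S_def sum_product using XX by auto
  have SSi: "integrable M (\<lambda>\<omega>. S k \<omega> * S m \<omega> * indicator A \<omega>)" if "A \<in> events" for k m A
    by (rule integrable_real_mult_indicator[OF that SS])
  \<comment> \<open>The event that the partial sums reach level \<open>l\<close> for the first time
    at \<open>k\<close>; these events split the event of the maximum.\<close>
  define A where "A k = {\<omega> \<in> space M. l \<le> \<bar>S k \<omega>\<bar> \<and> (\<forall>j<k. \<bar>S j \<omega>\<bar> < l)}" for k
  have A[measurable]: "A k \<in> events" for k unfolding A_def by measurable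
  have eq: "{\<omega> \<in> space M. \<exists>k\<le>n. l \<le> \<bar>\<Sum>i<k. X i \<omega>\<bar>} = (\<Union>k\<in>{..n}. A k)"
  proof (intro equalityI subsetI)
    fix \<omega> assume "\<omega> \<in> {\<omega> \<in> space M. \<exists>k\<le>n. l \<le> \<bar>\<Sum>i<k. X i \<omega>\<bar>}"
    then obtain k where k: "\<omega> \<in> space M" "k \<le> n" "l \<le> \<bar>S k \<omega>\<bar>" by (auto simp: S_def)
    define k' where "k' = (LEAST k. l \<le> \<bar>S k \<omega>\<bar>)"
    have "l \<le> \<bar>S k' \<omega>\<bar>" unfolding k'_def by (rule LeastI[of _ k]) (use k in simp)
    moreover have "k' \<le> k" unfolding k'_def by (rule Least_le) (use k in simp)
    moreover have "\<bar>S j \<omega>\<bar> < l" if "j < k'" for j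
      using not_less_Least[of j "\<lambda>k. l \<le> \<bar>S k \<omega>\<bar>"] that by (simp add: k'_def)
    ultimately show "\<omega> \<in> (\<Union>k\<in>{..n}. A k)" using k by (auto simp: A_def intro!: bexI[of _ k'])
  qed (auto simp: A_def S_def)
  have disj: "disjoint_family_on A {..n}"
    unfolding disjoint_family_on_def
  proof (intro ballI impI)
    fix j k :: nat assume "j \<noteq> k"
    then consider "j < k" | "k < j" by linarith
    then show "A j \<inter> A k = {}" by cases (fastforce simp: A_def)+
  qed
  have step: "l\<^sup>2 * prob (A k) \<le> expectation (\<lambda>\<omega>. S n \<omega> * S n \<omega> * indicator (A k) \<omega>)" if k: "k \<le> n" for k
  proof -
    let ?P = "PiM {..<k} (\<lambda>_. borel :: real measure)" and ?Q = "PiM {k..<n} (\<lambda>_. borel :: real measure)"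
    \<comment> \<open>The same event read off from the first \<open>k\<close> coordinates, so that
      independence of the later block can be used: the sum up to \<open>k\<close>, restricted to
      \<open>A k\<close>, is uncorrelated with the increment from \<open>k\<close> to
      \<open>n\<close>.\<close>
    define B where "B = {p \<in> space ?P. l \<le> \<bar>\<Sum>i<k. p i\<bar> \<and> (\<forall>j<k. \<bar>\<Sum>i<j. p i\<bar> < l)}"
    have Bm[measurable]: "B \<in> sets ?P" unfolding B_def by measurable
    have ind: "indep_var borel ((\<lambda>p. (\<Sum>i<k. p i) * indicator B p) \<circ> (\<lambda>\<omega>. restrict (\<lambda>i. X i \<omega>) {..<k}))
         borel ((\<lambda>q. \<Sum>i=k..<n. q i) \<circ> (\<lambda>\<omega>. restrict (\<lambda>i. X i \<omega>) {k..<n}))"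
      by (rule indep_var_compose[OF indep_var_restrict[OF indep]]) (auto, measurable)
    let ?U = "\<lambda>\<omega>. (\<Sum>i<k. X i \<omega>) * indicator B (restrict (\<lambda>i. X i \<omega>) {..<k})"
    let ?V = "\<lambda>\<omega>. \<Sum>i=k..<n. X i \<omega>"
    have ind: "indep_var borel ?U borel ?V" using ind by (simp add: comp_def)
    have intV: "integrable M ?V" using intX by auto
    have U_eq: "?U \<omega> = S k \<omega> * indicator (A k) \<omega>" if "\<omega> \<in> space M" for \<omega>
    proof -
      have "(\<Sum>i<j. restrict (\<lambda>i. X i \<omega>) {..<k} i) = S j \<omega>" if "j \<le> k" for j
        unfolding S_def by (rule sum.cong) (use that in auto)
      then show ?thesis using that by (auto simp: indicator_def A_def B_def space_PiM S_def)
    qed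
    have "integrable M (S k)" unfolding S_def using intX by auto
    then have "integrable M (\<lambda>\<omega>. S k \<omega> * indicator (A k) \<omega>)"
      by (rule integrable_real_mult_indicator[OF A])
    then have intU: "integrable M ?U" by (rule Bochner_Integration.integrable_cong[THEN iffD1, rotated -1]) (use U_eq in auto)
    have UV: "expectation (\<lambda>\<omega>. ?U \<omega> * ?V \<omega>) = 0"
    proof -
      have "expectation ?V = 0" using intX mean by simp
      then show ?thesis using indep_var_lebesgue_integral[OF ind intU intV] by simp
    qed
    have UV_eq: "?U \<omega> * ?V \<omega> = S k \<omega> * S n \<omega> * indicator (A k) \<omega> - S k \<omega> * S k \<omega> * indicator (A k) \<omega>"
      if "\<omega> \<in> space M" for \<omega>
    proof -
      have "S n \<omega> = S k \<omega> + ?V \<omega>" unfolding S_def using k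
        by (metis atLeast0LessThan sum.atLeastLessThan_concat zero_le)
      then show ?thesis using U_eq[OF that] by (simp add: algebra_simps)
    qed
    have "l\<^sup>2 * prob (A k) = expectation (\<lambda>\<omega>. l\<^sup>2 * indicator (A k) \<omega>)" by simp
    also have "\<dots> \<le> expectation (\<lambda>\<omega>. S k \<omega> * S k \<omega> * indicator (A k) \<omega>)"
    proof (rule integral_mono)
      fix \<omega>
      have "l\<^sup>2 \<le> S k \<omega> * S k \<omega>" if "\<omega> \<in> A k"
        using that power_mono[of l "\<bar>S k \<omega>\<bar>" 2] l by (simp add: A_def power2_eq_square)
      then show "l\<^sup>2 * indicator (A k) \<omega> \<le> S k \<omega> * S k \<omega> * indicator (A k) \<omega>"
        by (simp add: indicator_def)
      show "integrable M (\<lambda>\<omega>. l\<^sup>2 * indicator (A k) \<omega>)"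
        by (intro integrable_mult_right integrable_real_indicator A) (simp add: emeasure_eq_measure)
    qed (rule SSi[OF A])
    \<comment> \<open>Adding twice this vanishing expectation turns the integrand into 2 S_k S_n -
      S_k^2, which is at most S_n^2.\<close>
    also have "\<dots> = expectation (\<lambda>\<omega>. S k \<omega> * S k \<omega> * indicator (A k) \<omega>) + 2 * expectation (\<lambda>\<omega>. ?U \<omega> * ?V \<omega>)"
      unfolding UV by simp
    also have "expectation (\<lambda>\<omega>. ?U \<omega> * ?V \<omega>) = expectation (\<lambda>\<omega>. S k \<omega> * S n \<omega> * indicator (A k) \<omega> - S k \<omega> * S k \<omega> * indicator (A k) \<omega>)"
      by (rule Bochner_Integration.integral_cong) (use UV_eq in auto)
    also have "expectation (\<lambda>\<omega>. S k \<omega> * S k \<omega> * indicator (A k) \<omega>) + 2 * \<dots> =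
       expectation (\<lambda>\<omega>. 2 * (S k \<omega> * S n \<omega> * indicator (A k) \<omega>) - S k \<omega> * S k \<omega> * indicator (A k) \<omega>)"
      using SSi[OF A] by (simp add: algebra_simps)
    also have "\<dots> \<le> expectation (\<lambda>\<omega>. S n \<omega> * S n \<omega> * indicator (A k) \<omega>)"
    proof (rule integral_mono)
      fix \<omega>
      have "0 \<le> (S n \<omega> - S k \<omega>)\<^sup>2" by simp
      then have "2 * (S k \<omega> * S n \<omega>) - S k \<omega> * S k \<omega> \<le> S n \<omega> * S n \<omega>"
        by (simp add: power2_eq_square algebra_simps)
      then show "2 * (S k \<omega> * S n \<omega> * indicator (A k) \<omega>) - S k \<omega> * S k \<omega> * indicator (A k) \<omega> \<le> S n \<omega> * S n \<omega> * indicator (A k) \<omega>"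
        by (simp add: indicator_def)
    qed (use SSi[OF A] in auto)
    finally show ?thesis .
  qed
  have "l\<^sup>2 * prob (\<Union>k\<in>{..n}. A k) = (\<Sum>k\<le>n. l\<^sup>2 * prob (A k))"
    by (subst finite_measure_finite_Union[OF _ _ disj]) (auto simp: sum_distrib_left)
  also have "\<dots> \<le> (\<Sum>k\<le>n. expectation (\<lambda>\<omega>. S n \<omega> * S n \<omega> * indicator (A k) \<omega>))"
    by (rule sum_mono) (use step in auto)
  also have "\<dots> = expectation (\<lambda>\<omega>. \<Sum>k\<le>n. S n \<omega> * S n \<omega> * indicator (A k) \<omega>)"
    by (rule Bochner_Integration.integral_sum[symmetric]) (rule SSi[OF A])
  also have "\<dots> \<le> expectation (\<lambda>\<omega>. S n \<omega> * S n \<omega>)"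
  proof (rule integral_mono)
    fix \<omega>
    have "(\<Sum>k\<le>n. indicator (A k) \<omega> :: real) = indicator (\<Union>k\<in>{..n}. A k) \<omega>"
      by (rule indicator_UN_disjoint[OF _ disj, symmetric]) simp
    then have "(\<Sum>k\<le>n. indicator (A k) \<omega> :: real) \<le> 1" by (simp add: indicator_def)
    then show "(\<Sum>k\<le>n. S n \<omega> * S n \<omega> * indicator (A k) \<omega>) \<le> S n \<omega> * S n \<omega>"
      unfolding sum_distrib_left[symmetric] by (rule mult_left_le) simp
    show "integrable M (\<lambda>\<omega>. \<Sum>k\<le>n. S n \<omega> * S n \<omega> * indicator (A k) \<omega>)"
      by (rule Bochner_Integration.integrable_sum) (rule SSi[OF A])
  qed (rule SS)
  finally show ?thesis unfolding eq by (simp add: S_def power2_eq_square)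
qed

text \<open>Kolmogorov's theorem. The maximal inequality bounds the chance of an oscillation of size
  \<open>l\<close> after time \<open>m\<close> by a tail of the convergent series of
  \<open>v\<close>, so such oscillations cannot occur for every \<open>m\<close>.\<close>

lemma indep_L2_AE_summable:
  fixes X :: "nat \<Rightarrow> 'a \<Rightarrow> real"
  assumes indep: "indep_vars (\<lambda>_. borel) X UNIV"
    and sq: "\<And>i. integrable M (\<lambda>\<omega>. (X i \<omega>)\<^sup>2)" and mean: "\<And>i. expectation (X i) = 0"
    and v: "\<And>k n. expectation (\<lambda>\<omega>. (\<Sum>i<n. X (k + i) \<omega>)\<^sup>2) \<le> (\<Sum>i<n. v (k + i))" "\<And>i. 0 \<le> v i" "summable v"
  shows "AE \<omega> in M. summable (\<lambda>i. X i \<omega>)"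
proof -
  have X[measurable]: "X i \<in> borel_measurable M" for i using indep by (auto simp: indep_vars_def)
  define D where "D l m = {\<omega> \<in> space M. \<exists>k. l \<le> \<bar>\<Sum>i<k. X (m + i) \<omega>\<bar>}" for l :: real and m
  have D[measurable]: "D l m \<in> events" for l m unfolding D_def by measurable
  have Dle: "l\<^sup>2 * prob (D l m) \<le> (\<Sum>i. v (i + m))" if l: "0 < l" for l m
  proof -
    let ?E = "\<lambda>n. {\<omega> \<in> space M. \<exists>k\<le>n. l \<le> \<bar>\<Sum>i<k. X (m + i) \<omega>\<bar>}"
    have ind: "indep_vars (\<lambda>_. borel) (\<lambda>i. X (m + i)) UNIV"
      by (rule indep_vars_reindex_inj[OF indep]) simp
    have le: "l\<^sup>2 * prob (?E n) \<le> (\<Sum>i. v (i + m))" for n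
    proof -
      have "l\<^sup>2 * prob (?E n) \<le> expectation (\<lambda>\<omega>. (\<Sum>i<n. X (m + i) \<omega>)\<^sup>2)"
        by (rule kolmogorov_maximal_inequality[OF ind _ _ l]) (use sq mean in auto)
      also have "\<dots> \<le> (\<Sum>i<n. v (m + i))" by (rule v)
      also have "\<dots> \<le> (\<Sum>i. v (m + i))"
        by (rule sum_le_suminf) (use v summable_ignore_initial_segment[of v m] in \<open>auto simp: add.commute\<close>)
      finally show ?thesis by (simp add: add.commute)
    qed
    have "(\<lambda>n. prob (?E n)) \<longlonglongrightarrow> prob (\<Union>n. ?E n)"
      by (rule finite_Lim_measure_incseq) (auto simp: incseq_def, meson order_trans)
    also have "(\<Union>n. ?E n) = D l m" by (auto simp: D_def)
    finally have "(\<lambda>n. l\<^sup>2 * prob (?E n)) \<longlonglongrightarrow> l\<^sup>2 * prob (D l m)" by (rule tendsto_mult_left)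
    then show ?thesis by (rule LIMSEQ_le_const2) (use le in auto)
  qed
  have null: "(\<Inter>m. D l m) \<in> null_sets M" if l: "0 < l" for l
  proof -
    have "prob (\<Inter>m. D l m) \<le> (\<Sum>i. v (i + m)) / l\<^sup>2" for m
    proof -
      have "prob (\<Inter>m. D l m) \<le> prob (D l m)" by (rule finite_measure_mono) auto
      also have "\<dots> \<le> (\<Sum>i. v (i + m)) / l\<^sup>2" using Dle[OF l, of m] l by (simp add: field_simps)
      finally show ?thesis .
    qed
    moreover have "(\<lambda>m. (\<Sum>i. v (i + m)) / l\<^sup>2) \<longlonglongrightarrow> 0 / l\<^sup>2"
      by (intro tendsto_divide suminf_exist_split2 v tendsto_const) (use l in auto)
    ultimately have "prob (\<Inter>m. D l m) \<le> 0"
      by (intro LIMSEQ_le_const[where X="\<lambda>m. (\<Sum>i. v (i + m)) / l\<^sup>2"]) auto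
    then have "prob (\<Inter>m. D l m) = 0" using measure_nonneg[of M "\<Inter>m. D l m"] by linarith
    then show ?thesis by (auto simp: null_sets_def emeasure_eq_measure)
  qed
  \<comment> \<open>Off one null set, every precision 1/(p+1) has a starting index after which all
    blocks are smaller. That is the Cauchy criterion, up to a factor 2 because a block from
    \<open>a\<close> to \<open>b\<close> is a difference of two blocks from
    \<open>m\<close>.\<close>
  have "AE \<omega> in M. \<forall>p. \<omega> \<notin> (\<Inter>m. D (1 / real (Suc p)) m)"
    unfolding AE_all_countable by (intro allI AE_not_in null) simp
  then show ?thesis
  proof (rule AE_mp, intro AE_I2 impI)
    fix \<omega> assume \<omega>: "\<omega> \<in> space M" and notin: "\<forall>p. \<omega> \<notin> (\<Inter>m. D (1 / real (Suc p)) m)"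
    show "summable (\<lambda>i. X i \<omega>)"
      unfolding summable_Cauchy
    proof (intro allI impI)
      fix r :: real assume "0 < r"
      then obtain p where p: "1 / real (Suc p) < r / 2" using reals_Archimedean[of "r/2"] by (auto simp: inverse_eq_divide)
      obtain m where "\<omega> \<notin> D (1 / real (Suc p)) m" using notin by auto
      then have less: "\<bar>\<Sum>i<k. X (m + i) \<omega>\<bar> < 1 / real (Suc p)" for k using \<omega> by (force simp: D_def not_le)
      have eq: "(\<Sum>i<k. X (m + i) \<omega>) = (\<Sum>i=m..<m + k. X i \<omega>)" for k
        using sum.shift_bounds_nat_ivl[of "\<lambda>i. X i \<omega>" 0 m k] by (simp add: atLeast0LessThan add.commute)
      have "norm (sum (\<lambda>i. X i \<omega>) {a..<b}) < r" if "a \<ge> m" for a b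
      proof (cases "a \<le> b")
        case True
        have "(\<Sum>i=m..<b. X i \<omega>) = (\<Sum>i=m..<a. X i \<omega>) + (\<Sum>i=a..<b. X i \<omega>)"
          by (rule sum.atLeastLessThan_concat[symmetric]) (use that True in auto)
        moreover have "\<bar>\<Sum>i=m..<b. X i \<omega>\<bar> < r / 2" "\<bar>\<Sum>i=m..<a. X i \<omega>\<bar> < r / 2"
          using less[of "b - m"] less[of "a - m"] p that True by (auto simp: eq)
        ultimately show ?thesis unfolding real_norm_def by linarith
      qed (use \<open>0 < r\<close> in simp)
      then show "\<exists>N. \<forall>a\<ge>N. \<forall>b. norm (sum (\<lambda>i. X i \<omega>) {a..<b}) < r" by blast
    qed
  qed
qed

end

section \<open>Linear processes\<close>

definition tail_sq :: "(nat \<Rightarrow> real) \<Rightarrow> nat \<Rightarrow> real" where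
  "tail_sq b m = (\<Sum>i. (b (i + m))\<^sup>2)"

lemma tail_sq_tendsto_0: "summable (\<lambda>i. (b i)\<^sup>2) \<Longrightarrow> tail_sq b \<longlonglongrightarrow> 0"
  unfolding tail_sq_def[abs_def] by (rule suminf_exist_split2[where f="\<lambda>i. (b i)\<^sup>2"])

lemma tail_sq_nonneg: "summable (\<lambda>i. (b i)\<^sup>2) \<Longrightarrow> 0 \<le> tail_sq b m"
  unfolding tail_sq_def using summable_ignore_initial_segment[of "\<lambda>i. (b i)\<^sup>2" m] by (auto intro: suminf_nonneg)

lemma sum_le_tail_sq:
  assumes "summable (\<lambda>i. (b i)\<^sup>2)"
  shows "(\<Sum>i=m..<n. (b i)\<^sup>2) \<le> tail_sq b m"
proof (cases "m \<le> n")
  case True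
  have "(\<Sum>i=m..<n. (b i)\<^sup>2) = (\<Sum>i<n - m. (b (i + m))\<^sup>2)"
    using sum.shift_bounds_nat_ivl[of "\<lambda>i. (b i)\<^sup>2" 0 m "n - m"] True by (simp add: atLeast0LessThan)
  also have "\<dots> \<le> tail_sq b m" unfolding tail_sq_def
    by (rule sum_le_suminf) (use summable_ignore_initial_segment[of "\<lambda>i. (b i)\<^sup>2" m] assms in auto)
  finally show ?thesis .
qed (use tail_sq_nonneg[OF assms] in simp)

locale innovations = prob_space +
  fixes e :: "int \<Rightarrow> 'a \<Rightarrow> real" and s2 :: real
  assumes indep_e: "indep_vars (\<lambda>_. borel) e UNIV"
    and sq_e: "\<And>t. integrable M (\<lambda>\<omega>. (e t \<omega>)\<^sup>2)"
    and mean_e: "\<And>t. expectation (e t) = 0"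
    and var_e: "\<And>t. expectation (\<lambda>\<omega>. (e t \<omega>)\<^sup>2) = s2"
begin

lemma e_measurable[measurable]: "e t \<in> borel_measurable M"
  using indep_e by (auto simp: indep_vars_def)

lemma s2_nonneg: "0 \<le> s2"
  unfolding var_e[of 0, symmetric] by (rule Bochner_Integration.integral_nonneg) simp

lemma integrable_e: "integrable M (e t)"
  by (rule square_integrable_imp_integrable) (use sq_e in auto)

lemma integrable_e_mult: "integrable M (\<lambda>\<omega>. e t \<omega> * e s \<omega>)"
  by (rule integrable_mult_square_integrable) (use sq_e in auto)

lemma indep_restrict:
  "A \<inter> B = {} \<Longrightarrow> indep_var (PiM A (\<lambda>_. borel)) (\<lambda>\<omega>. restrict (\<lambda>i. e i \<omega>) A)
     (PiM B (\<lambda>_. borel)) (\<lambda>\<omega>. restrict (\<lambda>i. e i \<omega>) B)"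
  by (rule indep_var_restrict[OF indep_e]) auto

lemma expectation_e_mult: "expectation (\<lambda>\<omega>. e t \<omega> * e s \<omega>) = (if t = s then s2 else 0)"
proof (cases "t = s")
  case True
  then show ?thesis using var_e[of t] by (simp add: power2_eq_square)
next
  case False
  have "indep_var borel ((\<lambda>p. p t) \<circ> (\<lambda>\<omega>. restrict (\<lambda>i. e i \<omega>) {t})) borel ((\<lambda>p. p s) \<circ> (\<lambda>\<omega>. restrict (\<lambda>i. e i \<omega>) {s}))"
    by (rule indep_var_compose[OF indep_restrict]) (use False in auto)
  then have "indep_var borel (e t) borel (e s)" by (simp add: comp_def)
  from indep_var_lebesgue_integral[OF this integrable_e integrable_e] show ?thesis
    using False mean_e by simp
qed

definition psum :: "(nat \<Rightarrow> real) \<Rightarrow> nat \<Rightarrow> nat \<Rightarrow> int \<Rightarrow> 'a \<Rightarrow> real" where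
  "psum b k n t \<omega> = (\<Sum>i=k..<n. b i * e (t - int i) \<omega>)"

lemma psum_measurable[measurable]: "psum b k n t \<in> borel_measurable M"
  unfolding psum_def[abs_def] by measurable

lemma expectation_psum: "expectation (psum b k n t) = 0"
  unfolding psum_def[abs_def] using integrable_e mean_e by simp

lemma psum_sq:
  shows integrable_psum_sq: "integrable M (\<lambda>\<omega>. (psum b k n t \<omega>)\<^sup>2)"
    and expectation_psum_sq: "expectation (\<lambda>\<omega>. (psum b k n t \<omega>)\<^sup>2) = s2 * (\<Sum>i=k..<n. (b i)\<^sup>2)"
proof -
  have eq: "(psum b k n t \<omega>)\<^sup>2 = (\<Sum>i=k..<n. \<Sum>j=k..<n. b i * b j * (e (t - int i) \<omega> * e (t - int j) \<omega>))" for \<omega>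
    unfolding psum_def power2_eq_square sum_product by (intro sum.cong) auto
  show "integrable M (\<lambda>\<omega>. (psum b k n t \<omega>)\<^sup>2)" unfolding eq using integrable_e_mult by auto
  have "expectation (\<lambda>\<omega>. (psum b k n t \<omega>)\<^sup>2) = (\<Sum>i=k..<n. \<Sum>j=k..<n. b i * b j * (if i = j then s2 else 0))"
    unfolding eq using integrable_e_mult by (simp add: expectation_e_mult)
  also have "\<dots> = s2 * (\<Sum>i=k..<n. (b i)\<^sup>2)"
    by (simp add: if_distrib[of "\<lambda>x. _ * x"] sum_distrib_left power2_eq_square cong: if_cong) (simp add: mult.commute)
  finally show "expectation (\<lambda>\<omega>. (psum b k n t \<omega>)\<^sup>2) = s2 * (\<Sum>i=k..<n. (b i)\<^sup>2)" .
qed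

lemma linear_process_measurable[measurable]: "linear_process b e t \<in> borel_measurable M"
  unfolding linear_process_def[abs_def] by measurable

lemma AE_summable_linear_process:
  assumes b: "summable (\<lambda>i. (b i)\<^sup>2)"
  shows "AE \<omega> in M. summable (\<lambda>i. b i * e (t - int i) \<omega>)"
proof (rule indep_L2_AE_summable[where v="\<lambda>i. s2 * (b i)\<^sup>2"])
  have "indep_vars (\<lambda>_. borel) (\<lambda>i::nat. e (t - int i)) UNIV"
    by (rule indep_vars_reindex_inj[OF indep_e]) (auto simp: inj_def)
  from indep_vars_compose2[OF this, of "\<lambda>i x. b i * x" "\<lambda>_. borel"]
  show "indep_vars (\<lambda>_. borel) (\<lambda>i \<omega>. b i * e (t - int i) \<omega>) UNIV" by simp
  show "integrable M (\<lambda>\<omega>. (b i * e (t - int i) \<omega>)\<^sup>2)" for i using sq_e by (simp add: power_mult_distrib)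
  show "expectation (\<lambda>\<omega>. b i * e (t - int i) \<omega>) = 0" for i using mean_e by simp
  show "expectation (\<lambda>\<omega>. (\<Sum>i<n. b (k + i) * e (t - int (k + i)) \<omega>)\<^sup>2) \<le> (\<Sum>i<n. s2 * (b (k + i))\<^sup>2)" for k n
  proof -
    have *: "sum g {k..<k + n} = (\<Sum>i<n. g (k + i))" for g :: "nat \<Rightarrow> real"
      using sum.shift_bounds_nat_ivl[of g 0 k n] by (simp add: atLeast0LessThan add.commute)
    have "(\<Sum>i<n. b (k + i) * e (t - int (k + i)) \<omega>) = psum b k (k + n) t \<omega>" for \<omega>
      unfolding psum_def * ..
    then show ?thesis using expectation_psum_sq[of b k "k + n" t] by (simp add: * sum_distrib_left)
  qed
qed (use s2_nonneg b in auto)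

text \<open>Fatou's lemma along the almost surely convergent partial sums: the error after
  \<open>m\<close> terms is a limit of blocks from \<open>m\<close> to \<open>n\<close>, whose
  second moments are bounded by the tail uniformly in \<open>n\<close>.\<close>

lemma linear_process_L2:
  assumes b: "summable (\<lambda>i. (b i)\<^sup>2)"
  shows integrable_linear_process_diff_sq: "integrable M (\<lambda>\<omega>. (linear_process b e t \<omega> - psum b 0 m t \<omega>)\<^sup>2)"
    and linear_process_diff_sq_le:
      "expectation (\<lambda>\<omega>. (linear_process b e t \<omega> - psum b 0 m t \<omega>)\<^sup>2) \<le> s2 * tail_sq b m"
proof -
  let ?L = "linear_process b e t" and ?S = "\<lambda>n. psum b 0 n t"
  let ?f = "\<lambda>n \<omega>. ennreal ((?S n \<omega> - ?S m \<omega>)\<^sup>2)"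
  have lim: "AE \<omega> in M. (\<lambda>n. ?f n \<omega>) \<longlonglongrightarrow> ennreal ((?L \<omega> - ?S m \<omega>)\<^sup>2)"
    using AE_summable_linear_process[OF b, of t]
  proof (rule AE_mp, intro AE_I2 impI)
    fix \<omega> assume "summable (\<lambda>i. b i * e (t - int i) \<omega>)"
    then have "(\<lambda>n. ?S n \<omega>) \<longlonglongrightarrow> ?L \<omega>"
      unfolding linear_process_def psum_def atLeast0LessThan by (rule summable_LIMSEQ)
    then show "(\<lambda>n. ?f n \<omega>) \<longlonglongrightarrow> ennreal ((?L \<omega> - ?S m \<omega>)\<^sup>2)"
      by (intro tendsto_ennrealI tendsto_intros)
  qed
  have bound: "(\<integral>\<^sup>+\<omega>. ?f n \<omega> \<partial>M) \<le> ennreal (s2 * tail_sq b m)" if n: "n \<ge> m" for n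
  proof -
    have "?S n \<omega> - ?S m \<omega> = psum b m n t \<omega>" for \<omega>
      unfolding psum_def using sum.atLeastLessThan_concat[of 0 m n "\<lambda>i. b i * e (t - int i) \<omega>"] n by simp
    then have "(\<integral>\<^sup>+\<omega>. ?f n \<omega> \<partial>M) = ennreal (expectation (\<lambda>\<omega>. (psum b m n t \<omega>)\<^sup>2))"
      by (simp add: nn_integral_eq_integral[OF integrable_psum_sq])
    also have "\<dots> \<le> ennreal (s2 * tail_sq b m)"
      unfolding expectation_psum_sq
      by (intro ennreal_leI mult_left_mono s2_nonneg sum_le_tail_sq b)
    finally show ?thesis .
  qed
  have "(\<integral>\<^sup>+\<omega>. ennreal ((?L \<omega> - ?S m \<omega>)\<^sup>2) \<partial>M) = (\<integral>\<^sup>+\<omega>. liminf (\<lambda>n. ?f n \<omega>) \<partial>M)"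
    by (rule nn_integral_cong_AE, rule AE_mp[OF lim], intro AE_I2 impI, rule lim_imp_Liminf[symmetric]) simp_all
  also have "\<dots> \<le> liminf (\<lambda>n. \<integral>\<^sup>+\<omega>. ?f n \<omega> \<partial>M)" by (rule nn_integral_liminf) measurable
  also have "\<dots> \<le> ennreal (s2 * tail_sq b m)"
  proof -
    have "liminf (\<lambda>n. \<integral>\<^sup>+\<omega>. ?f n \<omega> \<partial>M) \<le> liminf (\<lambda>n. ennreal (s2 * tail_sq b m))"
      by (rule Liminf_mono) (use bound in \<open>auto simp: eventually_sequentially\<close>)
    then show ?thesis by (simp add: Liminf_const)
  qed
  finally have le: "(\<integral>\<^sup>+\<omega>. ennreal ((?L \<omega> - ?S m \<omega>)\<^sup>2) \<partial>M) \<le> ennreal (s2 * tail_sq b m)" .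
  show int: "integrable M (\<lambda>\<omega>. (?L \<omega> - ?S m \<omega>)\<^sup>2)"
    by (rule integrableI_nonneg) (use le in \<open>auto simp: less_top[symmetric] top_unique\<close>)
  show "expectation (\<lambda>\<omega>. (?L \<omega> - ?S m \<omega>)\<^sup>2) \<le> s2 * tail_sq b m"
    using le s2_nonneg tail_sq_nonneg[OF b] by (simp add: nn_integral_eq_integral[OF int])
qed

lemma linear_process_sq:
  assumes b: "summable (\<lambda>i. (b i)\<^sup>2)"
  shows integrable_linear_process_sq: "integrable M (\<lambda>\<omega>. (linear_process b e t \<omega>)\<^sup>2)"
    and linear_process_sq_le: "expectation (\<lambda>\<omega>. (linear_process b e t \<omega>)\<^sup>2) \<le> s2 * tail_sq b 0"
  using linear_process_L2[OF b, of t 0] by (simp_all add: psum_def)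

lemma integrable_linear_process:
  "summable (\<lambda>i. (b i)\<^sup>2) \<Longrightarrow> integrable M (linear_process b e t)"
  by (rule square_integrable_imp_integrable) (auto intro: integrable_linear_process_sq)

text \<open>Moments of the infinite series against a square integrable \<open>Y\<close> thereby
  reduce to finite sums of innovations; by Cauchy-Schwarz the error is the root of a coefficient
  tail.\<close>

lemma tendsto_expectation_psum_mult:
  assumes b: "summable (\<lambda>i. (b i)\<^sup>2)"
    and [measurable]: "Y \<in> borel_measurable M" and Y: "integrable M (\<lambda>\<omega>. (Y \<omega>)\<^sup>2)"
  shows "(\<lambda>m. expectation (\<lambda>\<omega>. psum b 0 m t \<omega> * Y \<omega>)) \<longlonglongrightarrow> expectation (\<lambda>\<omega>. linear_process b e t \<omega> * Y \<omega>)"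
proof (rule LIM_zero_cancel, rule Lim_null_comparison)
  let ?y = "expectation (\<lambda>\<omega>. (Y \<omega>)\<^sup>2)"
  have "norm (expectation (\<lambda>\<omega>. psum b 0 m t \<omega> * Y \<omega>) - expectation (\<lambda>\<omega>. linear_process b e t \<omega> * Y \<omega>))
      \<le> sqrt (s2 * tail_sq b m) * sqrt ?y" for m
  proof -
    have "integrable M (\<lambda>\<omega>. psum b 0 m t \<omega> * Y \<omega>)" "integrable M (\<lambda>\<omega>. linear_process b e t \<omega> * Y \<omega>)"
      by (auto intro!: integrable_mult_square_integrable integrable_psum_sq integrable_linear_process_sq b Y)
    then have "expectation (\<lambda>\<omega>. linear_process b e t \<omega> * Y \<omega>) - expectation (\<lambda>\<omega>. psum b 0 m t \<omega> * Y \<omega>) =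
      expectation (\<lambda>\<omega>. (linear_process b e t \<omega> - psum b 0 m t \<omega>) * Y \<omega>)" by (simp add: left_diff_distrib)
    moreover have "\<bar>expectation (\<lambda>\<omega>. (linear_process b e t \<omega> - psum b 0 m t \<omega>) * Y \<omega>)\<bar> \<le> sqrt (s2 * tail_sq b m) * sqrt ?y"
      by (rule abs_integral_mult_le) (auto intro: linear_process_L2 b Y)
    ultimately show ?thesis by (simp add: abs_minus_commute)
  qed
  then show "eventually (\<lambda>m. norm (expectation (\<lambda>\<omega>. psum b 0 m t \<omega> * Y \<omega>) - expectation (\<lambda>\<omega>. linear_process b e t \<omega> * Y \<omega>))
      \<le> sqrt (s2 * tail_sq b m) * sqrt ?y) sequentially" by simp
  have "(\<lambda>m. sqrt (s2 * tail_sq b m) * sqrt ?y) \<longlonglongrightarrow> sqrt (s2 * 0) * sqrt ?y"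
    by (intro tendsto_intros tail_sq_tendsto_0 b)
  then show "(\<lambda>m. sqrt (s2 * tail_sq b m) * sqrt ?y) \<longlonglongrightarrow> 0" by simp
qed

lemma expectation_linear_process:
  assumes b: "summable (\<lambda>i. (b i)\<^sup>2)"
  shows "expectation (linear_process b e t) = 0"
proof -
  have "(\<lambda>m. 0) \<longlonglongrightarrow> expectation (linear_process b e t)"
    using tendsto_expectation_psum_mult[OF b, of "\<lambda>_. 1" t] expectation_psum[of b 0 _ t] by simp
  then show ?thesis by (simp add: LIMSEQ_const_iff)
qed

lemma expectation_linear_process_e:
  assumes b: "summable (\<lambda>i. (b i)\<^sup>2)"
  shows "expectation (\<lambda>\<omega>. linear_process b e t \<omega> * e (t - int r) \<omega>) = s2 * b r"
proof -
  have "expectation (\<lambda>\<omega>. psum b 0 m t \<omega> * e (t - int r) \<omega>) = s2 * b r" if "m > r" for m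
  proof -
    have "expectation (\<lambda>\<omega>. psum b 0 m t \<omega> * e (t - int r) \<omega>) =
      (\<Sum>i=0..<m. b i * expectation (\<lambda>\<omega>. e (t - int i) \<omega> * e (t - int r) \<omega>))"
      unfolding psum_def sum_distrib_right using integrable_e_mult by (simp add: mult.assoc)
    also have "\<dots> = (\<Sum>i=0..<m. if i = r then b i * s2 else 0)"
      by (rule sum.cong) (auto simp: expectation_e_mult)
    finally show ?thesis using that by simp
  qed
  then have "eventually (\<lambda>m. expectation (\<lambda>\<omega>. psum b 0 m t \<omega> * e (t - int r) \<omega>) = s2 * b r) sequentially"
    by (auto simp: eventually_sequentially intro!: exI[of _ "Suc r"])
  then have "(\<lambda>m. expectation (\<lambda>\<omega>. psum b 0 m t \<omega> * e (t - int r) \<omega>)) \<longlonglongrightarrow> s2 * b r" by (rule tendsto_eventually)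
  with tendsto_expectation_psum_mult[OF b e_measurable sq_e] show ?thesis by (rule LIMSEQ_unique)
qed

lemma linear_process_autocov_sums:
  assumes b: "summable (\<lambda>i. (b i)\<^sup>2)"
  shows "(\<lambda>i. s2 * (b i * b (i + d))) sums expectation (\<lambda>\<omega>. linear_process b e s \<omega> * linear_process b e (s + int d) \<omega>)"
  unfolding sums_def
proof -
  let ?Y = "linear_process b e (s + int d)"
  have "expectation (\<lambda>\<omega>. psum b 0 m s \<omega> * ?Y \<omega>) = (\<Sum>i<m. s2 * (b i * b (i + d)))" for m
  proof -
    have int: "integrable M (\<lambda>\<omega>. e (s - int i) \<omega> * ?Y \<omega>)" for i
      by (rule integrable_mult_square_integrable) (auto intro: sq_e integrable_linear_process_sq b)
    have "expectation (\<lambda>\<omega>. psum b 0 m s \<omega> * ?Y \<omega>) = (\<Sum>i=0..<m. b i * expectation (\<lambda>\<omega>. e (s - int i) \<omega> * ?Y \<omega>))"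
      unfolding psum_def sum_distrib_right using int by (simp add: mult.assoc)
    also have "\<dots> = (\<Sum>i=0..<m. s2 * (b i * b (i + d)))"
    proof (rule sum.cong)
      fix i
      have "s - int i = s + int d - int (i + d)" by simp
      then have "expectation (\<lambda>\<omega>. e (s - int i) \<omega> * ?Y \<omega>) = s2 * b (i + d)"
        using expectation_linear_process_e[OF b, of "s + int d" "i + d"] by (simp add: mult.commute)
      then show "b i * expectation (\<lambda>\<omega>. e (s - int i) \<omega> * ?Y \<omega>) = s2 * (b i * b (i + d))" by simp
    qed simp
    finally show ?thesis by (simp add: atLeast0LessThan)
  qed
  then show "(\<lambda>m. \<Sum>i<m. s2 * (b i * b (i + d))) \<longlonglongrightarrow> expectation (\<lambda>\<omega>. linear_process b e s \<omega> * ?Y \<omega>)"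
    using tendsto_expectation_psum_mult[OF b linear_process_measurable integrable_linear_process_sq[OF b],
        of s "s + int d"] by simp
qed

text \<open>Approximation by the finite moving averages, which are independent at lags \<open>\<ge> m\<close>.\<close>

lemma cov_lipschitz_linear_process_le:
  assumes b: "summable (\<lambda>i. (b i)\<^sup>2)" and g: "\<And>x y. \<bar>g x - g y\<bar> \<le> K * \<bar>x - y\<bar>" and lag: "int m \<le> \<bar>t - s\<bar>"
  shows "\<bar>expectation (\<lambda>\<omega>. (g (linear_process b e t \<omega>) - expectation (\<lambda>\<omega>. g (linear_process b e t \<omega>))) *
      (g (linear_process b e s \<omega>) - expectation (\<lambda>\<omega>. g (linear_process b e s \<omega>))))\<bar>
    \<le> 2 * K\<^sup>2 * s2 * sqrt (tail_sq b 0) * sqrt (tail_sq b m)"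
proof -
  have K: "0 \<le> K" using g[of 0 1] by (simp add: order.trans[OF abs_ge_zero])
  have "continuous_on UNIV g"
  proof (rule continuous_onI)
    fix x r :: real assume r: "0 < r"
    show "\<exists>d>0. \<forall>x'\<in>UNIV. dist x' x < d \<longrightarrow> dist (g x') (g x) \<le> r"
    proof (intro exI[of _ "r / (K + 1)"] conjI ballI impI)
      fix y assume "dist y x < r / (K + 1)"
      then have "K * \<bar>y - x\<bar> \<le> K * (r / (K + 1))" using K by (intro mult_left_mono) (auto simp: dist_real_def)
      also have "\<dots> \<le> r" using K r by (simp add: field_simps)
      finally show "dist (g y) (g x) \<le> r" using g[of y x] by (simp add: dist_real_def)
    qed (use r K in auto)
  qed
  then have gm[measurable]: "g \<in> borel_measurable borel" by (rule borel_measurable_continuous_onI)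
  let ?L = "\<lambda>t. linear_process b e t" and ?S = "\<lambda>t. psum b 0 m t"
  have lip_sq: "integrable M (\<lambda>\<omega>. (g (X \<omega>) - g (Y \<omega>))\<^sup>2) \<and> expectation (\<lambda>\<omega>. (g (X \<omega>) - g (Y \<omega>))\<^sup>2) \<le> K\<^sup>2 * a"
    if [measurable]: "X \<in> borel_measurable M" "Y \<in> borel_measurable M"
      and int: "integrable M (\<lambda>\<omega>. (X \<omega> - Y \<omega>)\<^sup>2)" and le: "expectation (\<lambda>\<omega>. (X \<omega> - Y \<omega>)\<^sup>2) \<le> a" for X Y a
  proof -
    have pt: "(g (X \<omega>) - g (Y \<omega>))\<^sup>2 \<le> K\<^sup>2 * (X \<omega> - Y \<omega>)\<^sup>2" for \<omega>
      using power_mono[OF g[of "X \<omega>" "Y \<omega>"], of 2] by (simp add: power_mult_distrib)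
    have i: "integrable M (\<lambda>\<omega>. (g (X \<omega>) - g (Y \<omega>))\<^sup>2)"
      by (rule Bochner_Integration.integrable_bound[of M "\<lambda>\<omega>. K\<^sup>2 * (X \<omega> - Y \<omega>)\<^sup>2"]) (use int pt in auto)
    have "expectation (\<lambda>\<omega>. (g (X \<omega>) - g (Y \<omega>))\<^sup>2) \<le> expectation (\<lambda>\<omega>. K\<^sup>2 * (X \<omega> - Y \<omega>)\<^sup>2)"
      by (rule integral_mono) (use i int pt in auto)
    also have "\<dots> \<le> K\<^sup>2 * a" using le by (simp add: mult_left_mono)
    finally show ?thesis using i by simp
  qed
  \<comment> \<open>The mean minimises the second moment about a constant, so a bound about any
    \<open>k\<close> also bounds the variance. It is applied with \<open>g 0\<close>, where the
    Lipschitz property gives the bound.\<close>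
  have centre: "integrable M (\<lambda>\<omega>. X \<omega> - expectation X) \<and> integrable M (\<lambda>\<omega>. (X \<omega> - expectation X)\<^sup>2)
      \<and> expectation (\<lambda>\<omega>. (X \<omega> - expectation X)\<^sup>2) \<le> a \<and> expectation (\<lambda>\<omega>. X \<omega> - expectation X) = 0"
    if [measurable]: "X \<in> borel_measurable M"
      and int: "integrable M (\<lambda>\<omega>. (X \<omega> - k)\<^sup>2)" and le: "expectation (\<lambda>\<omega>. (X \<omega> - k)\<^sup>2) \<le> a" for X :: "'a \<Rightarrow> real" and k a
  proof -
    have i1: "integrable M (\<lambda>\<omega>. X \<omega> - k)" by (rule square_integrable_imp_integrable) (use int in auto)
    then have iX: "integrable M X" using Bochner_Integration.integrable_add[OF i1, of "\<lambda>_. k"] by simp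
    let ?c = "expectation X"
    have eq: "(X \<omega> - ?c)\<^sup>2 = (X \<omega> - k)\<^sup>2 - 2 * (?c - k) * (X \<omega> - k) + (?c - k)\<^sup>2" for \<omega>
      by (simp add: power2_eq_square algebra_simps)
    have "expectation (\<lambda>\<omega>. (X \<omega> - ?c)\<^sup>2) = expectation (\<lambda>\<omega>. (X \<omega> - k)\<^sup>2) - (?c - k)\<^sup>2"
      unfolding eq using int i1 iX by (simp add: prob_space power2_eq_square)
    also have "\<dots> \<le> a" using le zero_le_power2[of "?c - k"] by linarith
    finally have "expectation (\<lambda>\<omega>. (X \<omega> - ?c)\<^sup>2) \<le> a" .
    moreover have "integrable M (\<lambda>\<omega>. (X \<omega> - ?c)\<^sup>2)" unfolding eq using int i1 by auto
    ultimately show ?thesis using iX by (simp add: prob_space)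
  qed
  \<comment> \<open>\<open>A\<close> belongs to the full series and \<open>B\<close> to its first
    \<open>m\<close> terms, both centred after applying \<open>g\<close>.\<close>
  define A where "A t \<omega> = g (?L t \<omega>) - expectation (\<lambda>\<omega>. g (?L t \<omega>))" for t \<omega>
  define B where "B t \<omega> = g (?S t \<omega>) - expectation (\<lambda>\<omega>. g (?S t \<omega>))" for t \<omega>
  have [measurable]: "A t \<in> borel_measurable M" "B t \<in> borel_measurable M" for t
    unfolding A_def B_def by measurable
  have L0: "integrable M (\<lambda>\<omega>. (?L t \<omega> - 0)\<^sup>2)" "expectation (\<lambda>\<omega>. (?L t \<omega> - 0)\<^sup>2) \<le> s2 * tail_sq b 0" for t
    using linear_process_sq[OF b] by simp_all
  have S0: "integrable M (\<lambda>\<omega>. (?S t \<omega> - 0)\<^sup>2)" "expectation (\<lambda>\<omega>. (?S t \<omega> - 0)\<^sup>2) \<le> s2 * tail_sq b 0" for t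
    using integrable_psum_sq expectation_psum_sq[of b 0 m t] s2_nonneg sum_le_tail_sq[OF b, of 0 m]
    by (simp_all add: mult_left_mono)
  have A: "integrable M (A t) \<and> integrable M (\<lambda>\<omega>. (A t \<omega>)\<^sup>2) \<and> expectation (\<lambda>\<omega>. (A t \<omega>)\<^sup>2) \<le> K\<^sup>2 * (s2 * tail_sq b 0)" for t
    unfolding A_def using centre[of "\<lambda>\<omega>. g (?L t \<omega>)" "g 0" "K\<^sup>2 * (s2 * tail_sq b 0)"]
      lip_sq[of "?L t" "\<lambda>_. 0", OF _ _ L0] by simp
  have B: "integrable M (B t) \<and> integrable M (\<lambda>\<omega>. (B t \<omega>)\<^sup>2) \<and> expectation (\<lambda>\<omega>. (B t \<omega>)\<^sup>2) \<le> K\<^sup>2 * (s2 * tail_sq b 0)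
      \<and> expectation (B t) = 0" for t
    unfolding B_def using centre[of "\<lambda>\<omega>. g (?S t \<omega>)" "g 0" "K\<^sup>2 * (s2 * tail_sq b 0)"]
      lip_sq[of "?S t" "\<lambda>_. 0", OF _ _ S0] by simp
  have AB: "integrable M (\<lambda>\<omega>. (A t \<omega> - B t \<omega>)\<^sup>2) \<and> expectation (\<lambda>\<omega>. (A t \<omega> - B t \<omega>)\<^sup>2) \<le> K\<^sup>2 * (s2 * tail_sq b m)" for t
  proof -
    have "integrable M (A t)" "integrable M (B t)" using A B by auto
    then have "integrable M (\<lambda>\<omega>. g (?L t \<omega>))" "integrable M (\<lambda>\<omega>. g (?S t \<omega>))"
      using Bochner_Integration.integrable_add[of M "A t" "\<lambda>\<omega>. expectation (\<lambda>\<omega>. g (?L t \<omega>))"]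
        Bochner_Integration.integrable_add[of M "B t" "\<lambda>\<omega>. expectation (\<lambda>\<omega>. g (?S t \<omega>))"]
      by (auto simp: A_def B_def)
    then have "A t \<omega> - B t \<omega> = (g (?L t \<omega>) - g (?S t \<omega>)) - expectation (\<lambda>\<omega>. g (?L t \<omega>) - g (?S t \<omega>))" for \<omega>
      by (simp add: A_def B_def)
    moreover have "integrable M (\<lambda>\<omega>. (g (?L t \<omega>) - g (?S t \<omega>) - 0)\<^sup>2)"
      "expectation (\<lambda>\<omega>. (g (?L t \<omega>) - g (?S t \<omega>) - 0)\<^sup>2) \<le> K\<^sup>2 * (s2 * tail_sq b m)"
      using lip_sq[of "?L t" "?S t", OF _ _ linear_process_L2[OF b, of t m]] by simp_all
    ultimately show ?thesis using centre[of "\<lambda>\<omega>. g (?L t \<omega>) - g (?S t \<omega>)" 0 "K\<^sup>2 * (s2 * tail_sq b m)"] by simp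
  qed
  \<comment> \<open>\<open>B t\<close> uses only the \<open>m\<close> innovations at the times after
    \<open>t - m\<close> up to \<open>t\<close>; at lags of at least \<open>m\<close> these windows
    are disjoint.\<close>
  have BB: "expectation (\<lambda>\<omega>. B t \<omega> * B s \<omega>) = 0"
  proof -
    let ?R = "\<lambda>t. {t - int m<..t}"
    let ?h = "\<lambda>t p. g (\<Sum>i=0..<m. b i * p (t - int i)) - expectation (\<lambda>\<omega>. g (?S t \<omega>))"
    have h: "?h t \<in> borel_measurable (PiM (?R t) (\<lambda>_. borel))" for t by measurable
    have hB: "?h t \<circ> (\<lambda>\<omega>. restrict (\<lambda>i. e i \<omega>) (?R t)) = B t" for t
    proof
      fix \<omega>
      have "(\<Sum>i=0..<m. b i * restrict (\<lambda>i. e i \<omega>) (?R t) (t - int i)) = ?S t \<omega>"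
        unfolding psum_def by (rule sum.cong) auto
      then show "(?h t \<circ> (\<lambda>\<omega>. restrict (\<lambda>i. e i \<omega>) (?R t))) \<omega> = B t \<omega>" by (simp add: B_def)
    qed
    have "?R t \<inter> ?R s = {}" using lag by auto
    from indep_var_compose[OF indep_restrict[OF this] h h]
    have "indep_var borel (B t) borel (B s)" unfolding hB .
    from indep_var_lebesgue_integral[OF this] show ?thesis using B by simp
  qed
  have iAA: "integrable M (\<lambda>\<omega>. (A t \<omega> - B t \<omega>) * A s \<omega>)" "integrable M (\<lambda>\<omega>. B t \<omega> * (A s \<omega> - B s \<omega>))"
    "integrable M (\<lambda>\<omega>. B t \<omega> * B s \<omega>)"
    by (auto intro!: integrable_mult_square_integrable simp: A B AB)
  \<comment> \<open>Replace one factor at a time. Each replacement leaves a difference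
    \<open>A - B\<close>, of size the root of the tail, times a factor of bounded second
    moment.\<close>
  have "expectation (\<lambda>\<omega>. A t \<omega> * A s \<omega>) =
     expectation (\<lambda>\<omega>. (A t \<omega> - B t \<omega>) * A s \<omega> + B t \<omega> * (A s \<omega> - B s \<omega>) + B t \<omega> * B s \<omega>)"
    by (simp add: algebra_simps)
  also have "\<dots> = expectation (\<lambda>\<omega>. (A t \<omega> - B t \<omega>) * A s \<omega>) + expectation (\<lambda>\<omega>. B t \<omega> * (A s \<omega> - B s \<omega>))"
    using iAA BB by simp
  finally have split: "expectation (\<lambda>\<omega>. A t \<omega> * A s \<omega>) =
      expectation (\<lambda>\<omega>. (A t \<omega> - B t \<omega>) * A s \<omega>) + expectation (\<lambda>\<omega>. B t \<omega> * (A s \<omega> - B s \<omega>))" .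
  have "\<bar>expectation (\<lambda>\<omega>. (A t \<omega> - B t \<omega>) * A s \<omega>)\<bar> \<le> sqrt (K\<^sup>2 * (s2 * tail_sq b m)) * sqrt (K\<^sup>2 * (s2 * tail_sq b 0))"
    by (rule abs_integral_mult_le) (auto simp: A AB)
  moreover have "\<bar>expectation (\<lambda>\<omega>. B t \<omega> * (A s \<omega> - B s \<omega>))\<bar> \<le> sqrt (K\<^sup>2 * (s2 * tail_sq b 0)) * sqrt (K\<^sup>2 * (s2 * tail_sq b m))"
    by (rule abs_integral_mult_le) (auto simp: B AB)
  moreover have "sqrt (K\<^sup>2 * (s2 * tail_sq b m)) * sqrt (K\<^sup>2 * (s2 * tail_sq b 0)) +
      sqrt (K\<^sup>2 * (s2 * tail_sq b 0)) * sqrt (K\<^sup>2 * (s2 * tail_sq b m)) = 2 * K\<^sup>2 * s2 * sqrt (tail_sq b 0) * sqrt (tail_sq b m)"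
  proof -
    have eq: "sqrt (K\<^sup>2 * (s2 * x)) = K * (sqrt s2 * sqrt x)" for x using K by (simp add: real_sqrt_mult)
    have "sqrt s2 * sqrt s2 = s2" using s2_nonneg by simp
    moreover have "K * (p * q) * (K * (p * r)) + K * (p * r) * (K * (p * q)) = 2 * K\<^sup>2 * (p * p) * r * q" for p q r :: real
      by (simp add: power2_eq_square algebra_simps)
    ultimately show ?thesis unfolding eq by metis
  qed
  ultimately have "\<bar>expectation (\<lambda>\<omega>. A t \<omega> * A s \<omega>)\<bar> \<le> 2 * K\<^sup>2 * s2 * sqrt (tail_sq b 0) * sqrt (tail_sq b m)"
    using split by linarith
  then show ?thesis unfolding A_def .
qed

end

section \<open>Smoothness of the marginal distribution and an exponential inequality\<close>

lemma exp_le_quadratic: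
  fixes x :: real
  assumes "\<bar>x\<bar> \<le> 1"
  shows "exp x \<le> 1 + x + x\<^sup>2"
proof (cases "0 \<le> x")
  case True
  then show ?thesis using exp_bound assms by auto
next
  case False
  define w where "w = - x"
  have w: "0 < w" using False by (simp add: w_def)
  \<comment> \<open>For negative arguments the reciprocal is bounded instead: the quadratic Taylor
    polynomial of \<open>exp w\<close> times the claimed bound for \<open>exp (- w)\<close> is at
    least 1.\<close>
  have "1 \<le> (1 + w + w\<^sup>2 / 2) * (1 - w + w\<^sup>2)"
  proof -
    have "(1 + w + w\<^sup>2 / 2) * (1 - w + w\<^sup>2) = 1 + (w^2 + w^3 + w^4) / 2"
      by (simp add: power2_eq_square power3_eq_cube power4_eq_xxxx field_simps)
    then show ?thesis using w by simp
  qed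
  also have "\<dots> \<le> exp w * (1 - w + w\<^sup>2)"
  proof (rule mult_right_mono)
    show "1 + w + w\<^sup>2 / 2 \<le> exp w" using exp_lower_Taylor_quadratic[of w] w by simp
    have "0 \<le> (w - 1 / 2)\<^sup>2" by simp
    then show "0 \<le> 1 - w + w\<^sup>2" by (simp add: power2_eq_square algebra_simps)
  qed
  finally have "exp (- w) \<le> exp (- w) * (exp w * (1 - w + w\<^sup>2))" by simp
  also have "\<dots> = 1 - w + w\<^sup>2" by (simp flip: mult.assoc exp_add)
  finally show ?thesis by (simp add: w_def)
qed

lemma derivative_lipschitz:
  fixes g :: "real \<Rightarrow> real"
  assumes d: "\<And>x. (g has_real_derivative g' x) (at x)" and b: "\<And>x. \<bar>g' x\<bar> \<le> C"
  shows "\<bar>g x - g y\<bar> \<le> C * \<bar>x - y\<bar>"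
proof (induct x y rule: linorder_wlog)
  case (le x y)
  show ?case
  proof (cases "x = y")
    case False
    then have "x < y" using le by simp
    then obtain z where "g y - g x = (y - x) * g' z" using MVT2[of x y g g'] d by blast
    then have "\<bar>g y - g x\<bar> = \<bar>y - x\<bar> * \<bar>g' z\<bar>" by (simp add: abs_mult)
    then show ?thesis using mult_left_mono[OF b[of z], of "\<bar>y - x\<bar>"] by (simp add: mult.commute abs_minus_commute)
  qed simp
next
  case (sym x y)
  then show ?case by (simp add: abs_minus_commute)
qed

lemma second_order_remainder:
  fixes g :: "real \<Rightarrow> real"
  assumes d: "\<And>x. (g has_real_derivative g1 x) (at x)"
    and lip: "\<And>x y. \<bar>g1 x - g1 y\<bar> \<le> C * \<bar>x - y\<bar>"
  shows "\<bar>g (v + h) - g v - h * g1 v\<bar> \<le> C * h\<^sup>2"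
proof (cases "h = 0")
  case False
  have C: "0 \<le> C" using lip[of 0 1] by (simp add: order.trans[OF abs_ge_zero])
  obtain z where z: "g (v + h) - g v = h * g1 z" "\<bar>z - v\<bar> \<le> \<bar>h\<bar>"
  proof (cases "0 < h")
    case True
    then obtain z where "v < z" "z < v + h" "g (v + h) - g v = (v + h - v) * g1 z" using MVT2[of v "v + h" g g1] d by auto
    then show ?thesis using that[of z] by simp
  next
    case False
    then have "h < 0" using \<open>h \<noteq> 0\<close> by simp
    then obtain z where "v + h < z" "z < v" "g v - g (v + h) = (v - (v + h)) * g1 z" using MVT2[of "v + h" v g g1] d by auto
    then show ?thesis using that[of z] by simp
  qed
  have "\<bar>g (v + h) - g v - h * g1 v\<bar> = \<bar>h\<bar> * \<bar>g1 z - g1 v\<bar>"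
    unfolding z(1) by (simp add: abs_mult flip: right_diff_distrib)
  also have "\<dots> \<le> \<bar>h\<bar> * (C * \<bar>h\<bar>)"
    using lip[of z v] z(2) C by (intro mult_left_mono) (auto intro: order.trans mult_left_mono)
  also have "\<dots> = C * h\<^sup>2" by (simp add: power2_eq_square)
  finally show ?thesis .
qed simp

text \<open>A density with Lipschitz constant \<open>C\<close> is at most the mass of a nearby interval divided by its
  length, up to \<open>C\<close> times that length.\<close>

lemma cdf_derivative_small:
  assumes "real_distribution D" and d: "\<And>x. (cdf D has_real_derivative g x) (at x)"
    and lip: "\<And>x y. \<bar>g x - g y\<bar> \<le> C * \<bar>x - y\<bar>" and "0 < r"
  shows "\<exists>A. \<forall>x. A \<le> \<bar>x\<bar> \<longrightarrow> \<bar>g x\<bar> \<le> r"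
proof -
  interpret real_distribution D by fact
  have C: "0 \<le> C" using lip[of 0 1] by (simp add: order.trans[OF abs_ge_zero])
  define h where "h = r / (2 * (C + 1))"
  have h: "0 < h" "C * h \<le> r / 2" using C \<open>0 < r\<close> by (auto simp: h_def field_simps)
  have g: "\<bar>g x\<bar> \<le> \<bar>cdf D (x + h) - cdf D x\<bar> / h + r / 2" for x
  proof -
    have "\<bar>h * g x\<bar> \<le> \<bar>cdf D (x + h) - cdf D x\<bar> + C * h\<^sup>2"
      using second_order_remainder[OF d lip, of x h] by linarith
    then have "\<bar>g x\<bar> \<le> (\<bar>cdf D (x + h) - cdf D x\<bar> + C * h\<^sup>2) / h" using h by (simp add: abs_mult field_simps)
    also have "\<dots> = \<bar>cdf D (x + h) - cdf D x\<bar> / h + C * h" using h by (simp add: add_divide_distrib power2_eq_square)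
    finally show ?thesis using h by linarith
  qed
  have "eventually (\<lambda>x. \<bar>cdf D x - 1\<bar> < r * h / 4) at_top"
    using tendstoD[OF cdf_lim_at_top_prob, of "r * h / 4"] h \<open>0 < r\<close> by (simp add: dist_real_def)
  then obtain A1 where A1: "\<And>x. x \<ge> A1 \<Longrightarrow> \<bar>cdf D x - 1\<bar> < r * h / 4" by (auto simp: eventually_at_top_linorder)
  have "eventually (\<lambda>x. \<bar>cdf D x\<bar> < r * h / 4) at_bot"
    using tendstoD[OF cdf_lim_at_bot, of "r * h / 4"] h \<open>0 < r\<close> by (simp add: dist_real_def)
  then obtain A2 where A2: "\<And>x. x \<le> A2 \<Longrightarrow> \<bar>cdf D x\<bar> < r * h / 4" by (auto simp: eventually_at_bot_linorder)
  have "\<bar>g x\<bar> \<le> r" if "\<bar>A1\<bar> + \<bar>A2\<bar> + h \<le> \<bar>x\<bar>" for x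
  proof -
    have "A1 \<le> x \<and> A1 \<le> x + h \<or> x \<le> A2 \<and> x + h \<le> A2" using that h by linarith
    then have "\<bar>cdf D (x + h) - cdf D x\<bar> \<le> r * h / 2"
      using A1[of x] A1[of "x + h"] A2[of x] A2[of "x + h"] by (elim disjE conjE) linarith+
    then have "\<bar>cdf D (x + h) - cdf D x\<bar> / h \<le> r / 2" using h by (simp add: field_simps)
    then show ?thesis using g[of x] by linarith
  qed
  then show ?thesis by blast
qed

text \<open>A Bernstein-type bound. The exponent is \<open>l\<close> times a centred variable
  bounded by 1 whose variance is at most the probability of the interval between the thresholds, so
  the quadratic bound for exp applies.\<close>

lemma cdf_difference_mgf_le:
  assumes "real_distribution D" and l: "\<bar>l\<bar> \<le> 1"
  shows "(\<integral>\<^sup>+x. ennreal (exp (l * (of_bool (x \<le> u) - of_bool (x \<le> v) - (cdf D u - cdf D v)))) \<partial>D)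
    \<le> ennreal (exp (l\<^sup>2 * \<bar>cdf D u - cdf D v\<bar>))"
proof -
  interpret real_distribution D by fact
  let ?m = "cdf D u - cdf D v"
  let ?Y = "\<lambda>x. indicator {..u} x - indicator {..v} x :: real"
  let ?Z = "\<lambda>x. ?Y x - ?m"
  have cdf: "expectation (indicator {..w}) = cdf D w" for w :: real by (simp add: cdf_def2)
  have int: "integrable D (indicator {..w} :: real \<Rightarrow> real)" for w :: real
    by (rule integrable_real_indicator) (auto simp: emeasure_eq_measure)
  have EY: "expectation ?Y = ?m" using int by (simp add: cdf_def2)
  \<comment> \<open>Up to sign \<open>?Y\<close> is the indicator of an interval, so its square is
    again linear in the two indicators.\<close>
  have Y2: "(?Y x)\<^sup>2 = (if v \<le> u then ?Y x else - ?Y x)" for x by (auto simp: indicator_def)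
  have EY2: "expectation (\<lambda>x. (?Y x)\<^sup>2) = \<bar>?m\<bar>" "integrable D (\<lambda>x. (?Y x)\<^sup>2)"
    unfolding Y2 using int cdf_nondecreasing[of u v] cdf_nondecreasing[of v u]
    by (cases "v \<le> u"; simp add: cdf_def2)+
  have EY2': "expectation (\<lambda>x. (?Y x)\<^sup>2) = \<bar>?m\<bar>" by (rule EY2)
  have m1: "\<bar>?m\<bar> \<le> 1" using cdf_bounded_prob[of u] cdf_bounded_prob[of v] cdf_nonneg[of u] cdf_nonneg[of v] by linarith
  have Z1: "\<bar>?Z x\<bar> \<le> 1" for x
    using cdf_bounded_prob[of u] cdf_bounded_prob[of v] cdf_nonneg[of u] cdf_nonneg[of v]
      cdf_nondecreasing[of u v] cdf_nondecreasing[of v u] by (auto simp: indicator_def abs_le_iff)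
  have intq: "integrable D (\<lambda>x. 1 + l * ?Z x + l\<^sup>2 * (?Z x)\<^sup>2)"
    unfolding power2_diff[of "?Y _"] using int EY2(2) by (auto intro!: Bochner_Integration.integrable_add Bochner_Integration.integrable_diff)
  have "(\<integral>\<^sup>+x. ennreal (exp (l * (of_bool (x \<le> u) - of_bool (x \<le> v) - ?m))) \<partial>D)
      \<le> (\<integral>\<^sup>+x. ennreal (1 + l * ?Z x + l\<^sup>2 * (?Z x)\<^sup>2) \<partial>D)"
  proof (rule nn_integral_mono, rule ennreal_leI)
    fix x
    have "\<bar>l * ?Z x\<bar> \<le> 1" using mult_mono[OF l Z1[of x]] by (simp add: abs_mult)
    from exp_le_quadratic[OF this]
    show "exp (l * (of_bool (x \<le> u) - of_bool (x \<le> v) - ?m)) \<le> 1 + l * ?Z x + l\<^sup>2 * (?Z x)\<^sup>2"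
      by (simp add: indicator_def power_mult_distrib)
  qed
  also have "\<dots> = ennreal (expectation (\<lambda>x. 1 + l * ?Z x + l\<^sup>2 * (?Z x)\<^sup>2))"
  proof (rule nn_integral_eq_integral[OF intq], rule AE_I2)
    fix x
    have "\<bar>l * ?Z x\<bar> \<le> 1" using mult_mono[OF l Z1[of x]] by (simp add: abs_mult)
    then have "- 1 \<le> l * ?Z x" by linarith
    moreover have "0 \<le> l\<^sup>2 * (?Z x)\<^sup>2" by simp
    ultimately show "0 \<le> 1 + l * ?Z x + l\<^sup>2 * (?Z x)\<^sup>2" by linarith
  qed
  also have "expectation (\<lambda>x. 1 + l * ?Z x + l\<^sup>2 * (?Z x)\<^sup>2) = 1 + l\<^sup>2 * (\<bar>?m\<bar> - ?m\<^sup>2)"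
  proof -
    have "expectation (\<lambda>x. 1 + l * ?Z x + l\<^sup>2 * (?Z x)\<^sup>2) =
       expectation (\<lambda>x. (1 - l * ?m + l\<^sup>2 * ?m\<^sup>2) + (l - 2 * l\<^sup>2 * ?m) * ?Y x + l\<^sup>2 * (?Y x)\<^sup>2)"
      by (rule Bochner_Integration.integral_cong) (auto simp: power2_eq_square algebra_simps)
    also have "\<dots> = (1 - l * ?m + l\<^sup>2 * ?m\<^sup>2) + (l - 2 * l\<^sup>2 * ?m) * expectation ?Y + l\<^sup>2 * expectation (\<lambda>x. (?Y x)\<^sup>2)"
    proof -
      have iY: "integrable D ?Y" using int by simp
      have "prob UNIV = 1" using prob_space by simp
      then show ?thesis using iY EY2(2) by (simp del: Bochner_Integration.integral_diff)
    qed
    also have "\<dots> = 1 + l\<^sup>2 * (\<bar>?m\<bar> - ?m\<^sup>2)" unfolding EY EY2' by (simp add: power2_eq_square algebra_simps)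
    finally show ?thesis .
  qed
  also have "ennreal (1 + l\<^sup>2 * (\<bar>?m\<bar> - ?m\<^sup>2)) \<le> ennreal (exp (l\<^sup>2 * \<bar>?m\<bar>))"
  proof (rule ennreal_leI)
    have "1 + l\<^sup>2 * (\<bar>?m\<bar> - ?m\<^sup>2) \<le> 1 + l\<^sup>2 * \<bar>?m\<bar>" by (simp add: mult_left_mono)
    also have "\<dots> \<le> exp (l\<^sup>2 * \<bar>?m\<bar>)" by (rule exp_ge_add_one_self)
    finally show "1 + l\<^sup>2 * (\<bar>?m\<bar> - ?m\<^sup>2) \<le> exp (l\<^sup>2 * \<bar>?m\<bar>)" .
  qed
  finally show ?thesis .
qed

section \<open>Conditioning on the past innovations\<close>

context innovations
begin

definition past :: "int \<Rightarrow> 'a \<Rightarrow> int \<Rightarrow> real" where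
  "past t \<omega> = restrict (\<lambda>i. e i \<omega>) {..<t}"

lemma past_measurable[measurable]: "past t \<in> measurable M (PiM {..<t} (\<lambda>_. borel))"
  unfolding past_def by measurable

text \<open>Conditional expectation given the innovations before \<open>t\<close>, in integrated
  form: \<open>e t\<close> is independent of the past, so Fubini's theorem on the product of their
  laws applies.\<close>

lemma nn_integral_past:
  assumes g[measurable]: "g \<in> borel_measurable (borel \<Otimes>\<^sub>M PiM {..<t} (\<lambda>_. borel))"
  shows "(\<integral>\<^sup>+\<omega>. g (e t \<omega>, past t \<omega>) \<partial>M) = (\<integral>\<^sup>+\<omega>. (\<integral>\<^sup>+x. g (x, past t \<omega>) \<partial>distr M borel (e t)) \<partial>M)"
proof -
  \<comment> \<open>Independence is available for restrictions to index sets, so the single variable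
    \<open>e t\<close> is carried as a point of the product space over \<open>{t}\<close> until the
    end.\<close>
  let ?P = "PiM {t} (\<lambda>_. borel :: real measure)" and ?Q = "PiM {..<t} (\<lambda>_. borel :: real measure)"
  let ?E = "\<lambda>\<omega>. restrict (\<lambda>i. e i \<omega>) {t}"
  have [measurable]: "?E \<in> measurable M ?P" by measurable
  have ind: "indep_var ?P ?E ?Q (past t)"
    unfolding past_def[abs_def] by (rule indep_restrict) auto
  then have joint: "distr M ?P ?E \<Otimes>\<^sub>M distr M ?Q (past t) = distr M (?P \<Otimes>\<^sub>M ?Q) (\<lambda>\<omega>. (?E \<omega>, past t \<omega>))"
    unfolding indep_var_distribution_eq by simp
  interpret D1: prob_space "distr M ?P ?E" by (rule prob_space_distr) measurable
  interpret D2: prob_space "distr M ?Q (past t)" by (rule prob_space_distr) measurable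
  interpret pair_sigma_finite "distr M ?P ?E" "distr M ?Q (past t)" ..
  let ?g = "\<lambda>z. g (fst z t, snd z)"
  have gm[measurable]: "?g \<in> borel_measurable (?P \<Otimes>\<^sub>M ?Q)" by measurable
  have "(\<integral>\<^sup>+\<omega>. g (e t \<omega>, past t \<omega>) \<partial>M) = (\<integral>\<^sup>+\<omega>. ?g (?E \<omega>, past t \<omega>) \<partial>M)" by simp
  also have "\<dots> = (\<integral>\<^sup>+z. ?g z \<partial>distr M (?P \<Otimes>\<^sub>M ?Q) (\<lambda>\<omega>. (?E \<omega>, past t \<omega>)))"
    by (subst nn_integral_distr) measurable
  also have "\<dots> = (\<integral>\<^sup>+z. ?g z \<partial>(distr M ?P ?E \<Otimes>\<^sub>M distr M ?Q (past t)))" unfolding joint ..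
  also have "\<dots> = (\<integral>\<^sup>+q. (\<integral>\<^sup>+p. ?g (p, q) \<partial>distr M ?P ?E) \<partial>distr M ?Q (past t))"
    by (rule nn_integral_snd[symmetric]) measurable
  also have "\<dots> = (\<integral>\<^sup>+\<omega>. (\<integral>\<^sup>+p. ?g (p, past t \<omega>) \<partial>distr M ?P ?E) \<partial>M)"
    by (rule nn_integral_distr) measurable
  also have "\<dots> = (\<integral>\<^sup>+\<omega>. (\<integral>\<^sup>+x. g (x, past t \<omega>) \<partial>distr M borel (e t)) \<partial>M)"
  proof (rule nn_integral_cong)
    fix \<omega> assume \<omega>: "\<omega> \<in> space M"
    have [measurable]: "past t \<omega> \<in> space ?Q" using \<omega> by (auto simp: past_def space_PiM)
    have "(\<lambda>x. g (x, past t \<omega>)) \<in> borel_measurable borel" by measurable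
    then show "(\<integral>\<^sup>+p. ?g (p, past t \<omega>) \<partial>distr M ?P ?E) = (\<integral>\<^sup>+x. g (x, past t \<omega>) \<partial>distr M borel (e t))"
      by (subst (1 2) nn_integral_distr) (auto simp: measurable_compose[OF measurable_component_singleton])
  qed
  finally show ?thesis .
qed

text \<open>The predictable part of the process: when \<open>b 0 = 1\<close>, the value at time
  \<open>t\<close> is this plus the fresh innovation \<open>e t\<close>, almost surely.\<close>

definition drift :: "(nat \<Rightarrow> real) \<Rightarrow> int \<Rightarrow> 'a \<Rightarrow> real" where
  "drift b t = linear_process (\<lambda>i. b (Suc i)) e (t - 1)"

text \<open>The drift as a function of a trajectory. This makes it measurable on the product space
  over the past, where \<open>nn_integral_past\<close> operates.\<close>

definition drift_of :: "(nat \<Rightarrow> real) \<Rightarrow> int \<Rightarrow> (int \<Rightarrow> real) \<Rightarrow> real" where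
  "drift_of b t p = (\<Sum>i. b (Suc i) * p (t - 1 - int i))"

lemma drift_eq: "t \<le> k \<Longrightarrow> drift b t \<omega> = drift_of b t (past k \<omega>)"
  unfolding drift_def linear_process_def drift_of_def past_def by simp

lemma drift_of_measurable:
  assumes "t \<le> k" and f: "f \<in> measurable N (PiM {..<k} (\<lambda>_. borel))"
  shows "(\<lambda>x. drift_of b t (f x)) \<in> borel_measurable N"
proof -
  have "(\<lambda>x. f x (t - 1 - int i)) \<in> borel_measurable N" for i
    by (rule measurable_compose[OF f measurable_component_singleton]) (use assms in auto)
  then show ?thesis unfolding drift_of_def by measurable
qed

lemma drift_measurable[measurable]: "drift b t \<in> borel_measurable M"
  unfolding drift_def by measurable

lemma AE_linear_process_split:
  assumes "summable (\<lambda>i. (b i)\<^sup>2)" and "b 0 = 1"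
  shows "AE \<omega> in M. linear_process b e t \<omega> = e t \<omega> + drift b t \<omega>"
  using AE_summable_linear_process[OF assms(1), of t]
proof (rule AE_mp, intro AE_I2 impI)
  fix \<omega> assume s: "summable (\<lambda>i. b i * e (t - int i) \<omega>)"
  show "linear_process b e t \<omega> = e t \<omega> + drift b t \<omega>"
    using suminf_split_head[OF s] assms(2) by (simp add: linear_process_def drift_def algebra_simps)
qed

end

locale noise = innovations +
  fixes a :: "nat \<Rightarrow> real" and G g1 g2 F :: "real \<Rightarrow> real" and C1 C2 :: real
  assumes sq_summable: "summable (\<lambda>i. (a i)\<^sup>2)" and a0: "a 0 = 1"
    and cdf_e: "\<And>t. cdf (distr M borel (e t)) = G"
    and deriv_G: "\<And>x. (G has_real_derivative g1 x) (at x)" and deriv_g1: "\<And>x. (g1 has_real_derivative g2 x) (at x)"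
    and g1_bound: "\<And>x. \<bar>g1 x\<bar> \<le> C1" and g2_bound: "\<And>x. \<bar>g2 x\<bar> \<le> C2"
    and cdf_eps: "\<And>t. cdf (distr M borel (linear_process a e t)) = F"
begin

abbreviation "eps \<equiv> linear_process a e"
abbreviation "eta \<equiv> drift a"

lemma real_distribution_e: "real_distribution (distr M borel (e t))"
  by (rule real_distribution_distr) measurable

lemma real_distribution_eps: "real_distribution (distr M borel (eps t))"
  by (rule real_distribution_distr) measurable

lemma C1_nonneg: "0 \<le> C1" and C2_nonneg: "0 \<le> C2"
  using g1_bound[of 0] g2_bound[of 0] by linarith+

lemma G_lipschitz: "\<bar>G x - G y\<bar> \<le> C1 * \<bar>x - y\<bar>"
  by (rule derivative_lipschitz[OF deriv_G g1_bound])

lemma g1_lipschitz: "\<bar>g1 x - g1 y\<bar> \<le> C2 * \<bar>x - y\<bar>"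
  by (rule derivative_lipschitz[OF deriv_g1 g2_bound])

lemma G_measurable[measurable]: "G \<in> borel_measurable borel"
  by (rule borel_measurable_continuous_onI) (meson DERIV_isCont continuous_at_imp_continuous_on deriv_G)

lemma g1_measurable[measurable]: "g1 \<in> borel_measurable borel"
  by (rule borel_measurable_continuous_onI) (meson DERIV_isCont continuous_at_imp_continuous_on deriv_g1)

lemma summable_drift: "summable (\<lambda>i. (a (Suc i))\<^sup>2)"
  using sq_summable by (subst summable_Suc_iff)

lemma G_bounded: "0 \<le> G x" "G x \<le> 1"
proof -
  interpret D: real_distribution "distr M borel (e 0)" by (rule real_distribution_e)
  show "0 \<le> G x" "G x \<le> 1" using D.cdf_nonneg[of x] D.cdf_bounded_prob[of x] by (simp_all add: cdf_e)
qed

lemma integrable_G: "integrable M (\<lambda>\<omega>. G (u - eta t \<omega>))"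
  by (rule integrable_const_bound[where B=1]) (use G_bounded in auto)

lemma integrable_g1: "integrable M (\<lambda>\<omega>. g1 (u - eta t \<omega>))"
  by (rule integrable_const_bound[where B=C1]) (use g1_bound in auto)

text \<open>Conditioning on the past replaces the indicator by \<open>G\<close>: the marginal law is
  a mixture of translates of the innovation law, through which \<open>F\<close> inherits the
  smoothness of \<open>G\<close>.\<close>

lemma F_eq: "F u = expectation (\<lambda>\<omega>. G (u - eta t \<omega>))"
proof -
  interpret D: real_distribution "distr M borel (e t)" by (rule real_distribution_e)
  have [measurable]: "(\<lambda>z. drift_of a t (snd z)) \<in> borel_measurable (borel \<Otimes>\<^sub>M PiM {..<t} (\<lambda>_. borel))"
    by (rule drift_of_measurable[of _ t]) auto
  have "ennreal (F u) = emeasure M {\<omega> \<in> space M. eps t \<omega> \<le> u}"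
    unfolding cdf_eps[of t, symmetric] cdf_def2
    by (subst measure_distr) (auto simp: emeasure_eq_measure vimage_def Int_def conj_commute)
  also have "\<dots> = emeasure M {\<omega> \<in> space M. e t \<omega> + eta t \<omega> \<le> u}"
    by (rule emeasure_eq_AE) (use AE_linear_process_split[OF sq_summable a0, of t] in auto)
  also have "\<dots> = (\<integral>\<^sup>+\<omega>. indicator {x. fst x + drift_of a t (snd x) \<le> u} (e t \<omega>, past t \<omega>) \<partial>M)"
    by (subst nn_integral_indicator[symmetric], measurable)
      (auto intro!: nn_integral_cong simp: indicator_def drift_eq[of t t])
  also have "\<dots> = (\<integral>\<^sup>+\<omega>. (\<integral>\<^sup>+x. indicator {x. fst x + drift_of a t (snd x) \<le> u} (x, past t \<omega>) \<partial>distr M borel (e t)) \<partial>M)"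
    by (rule nn_integral_past) measurable
  also have "\<dots> = (\<integral>\<^sup>+\<omega>. ennreal (G (u - eta t \<omega>)) \<partial>M)"
  proof (rule nn_integral_cong)
    fix \<omega> assume "\<omega> \<in> space M"
    have "(\<integral>\<^sup>+x. indicator {x. fst x + drift_of a t (snd x) \<le> u} (x, past t \<omega>) \<partial>distr M borel (e t)) =
        (\<integral>\<^sup>+x. indicator {..u - eta t \<omega>} x \<partial>distr M borel (e t))"
      by (rule nn_integral_cong) (auto simp: indicator_def drift_eq[of t t])
    also have "\<dots> = ennreal (G (u - eta t \<omega>))"
      by (simp add: cdf_e[of t, symmetric] cdf_def2 D.emeasure_eq_measure)
    finally show "(\<integral>\<^sup>+x. indicator {x. fst x + drift_of a t (snd x) \<le> u} (x, past t \<omega>) \<partial>distr M borel (e t)) =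
        ennreal (G (u - eta t \<omega>))" .
  qed
  also have "\<dots> = ennreal (expectation (\<lambda>\<omega>. G (u - eta t \<omega>)))"
    by (rule nn_integral_eq_integral[OF integrable_G]) (use G_bounded in auto)
  finally show ?thesis
    using D.cdf_nonneg by (subst (asm) ennreal_inj)
      (auto simp: cdf_eps[of t, symmetric] cdf_def2 G_bounded intro!: Bochner_Integration.integral_nonneg)
qed

definition f where "f u = expectation (\<lambda>\<omega>. g1 (u - eta 0 \<omega>))"

lemma F_remainder: "\<bar>F (u + h) - F u - h * expectation (\<lambda>\<omega>. g1 (u - eta t \<omega>))\<bar> \<le> C2 * h\<^sup>2"
proof -
  have eq: "F (u + h) - F u - h * expectation (\<lambda>\<omega>. g1 (u - eta t \<omega>)) =
      expectation (\<lambda>\<omega>. G (u + h - eta t \<omega>) - G (u - eta t \<omega>) - h * g1 (u - eta t \<omega>))"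
    using integrable_G integrable_g1 by (simp add: F_eq[of _ t])
  have "\<bar>F (u + h) - F u - h * expectation (\<lambda>\<omega>. g1 (u - eta t \<omega>))\<bar> \<le>
      expectation (\<lambda>\<omega>. \<bar>G (u + h - eta t \<omega>) - G (u - eta t \<omega>) - h * g1 (u - eta t \<omega>)\<bar>)"
    unfolding eq by simp
  also have "\<dots> \<le> expectation (\<lambda>\<omega>. C2 * h\<^sup>2)"
  proof (rule integral_mono)
    fix \<omega>
    have "u + h - eta t \<omega> = u - eta t \<omega> + h" by simp
    then show "\<bar>G (u + h - eta t \<omega>) - G (u - eta t \<omega>) - h * g1 (u - eta t \<omega>)\<bar> \<le> C2 * h\<^sup>2"
      using second_order_remainder[OF deriv_G g1_lipschitz, of "u - eta t \<omega>" h] by (simp only:)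
    show "integrable M (\<lambda>\<omega>. \<bar>G (u + h - eta t \<omega>) - G (u - eta t \<omega>) - h * g1 (u - eta t \<omega>)\<bar>)"
      by (intro integrable_abs Bochner_Integration.integrable_diff integrable_mult_right integrable_G integrable_g1)
  qed simp
  finally show ?thesis by (simp add: prob_space)
qed

lemma F_deriv_expectation: "(F has_real_derivative expectation (\<lambda>\<omega>. g1 (u - eta t \<omega>))) (at u)"
  unfolding has_field_derivative_iff
proof (rule LIM_zero_cancel, rule Lim_null_comparison)
  let ?d = "expectation (\<lambda>\<omega>. g1 (u - eta t \<omega>))"
  have "norm ((F y - F u) / (y - u) - ?d) \<le> C2 * \<bar>y - u\<bar>" if "y \<noteq> u" for y
  proof -
    have "(F y - F u) / (y - u) - ?d = (F y - F u - (y - u) * ?d) / (y - u)" using that by (simp add: field_simps)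
    moreover have "\<bar>F y - F u - (y - u) * ?d\<bar> \<le> C2 * (y - u)\<^sup>2" using F_remainder[of u "y - u" t] by simp
    ultimately show ?thesis using that by (simp add: abs_divide divide_le_eq power2_eq_square abs_mult_self_eq mult.assoc)
  qed
  then show "eventually (\<lambda>y. norm ((F y - F u) / (y - u) - ?d) \<le> C2 * \<bar>y - u\<bar>) (at u)"
    by (auto simp: eventually_at_filter)
  show "((\<lambda>y. C2 * \<bar>y - u\<bar>) \<longlongrightarrow> 0) (at u)"
    by (rule tendsto_eq_intros refl | simp)+
qed

text \<open>Both expectations are the derivative of the one function \<open>F\<close>, so they agree
  without comparing the laws of the drifts at different times.\<close>

lemma f_eq: "f u = expectation (\<lambda>\<omega>. g1 (u - eta t \<omega>))"
  unfolding f_def by (rule DERIV_unique[OF F_deriv_expectation F_deriv_expectation])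

lemma deriv_F: "(F has_real_derivative f u) (at u)"
  unfolding f_def by (rule F_deriv_expectation)

lemma f_lipschitz: "\<bar>f x - f y\<bar> \<le> C2 * \<bar>x - y\<bar>"
proof -
  have eq: "f x - f y = expectation (\<lambda>\<omega>. g1 (x - eta 0 \<omega>) - g1 (y - eta 0 \<omega>))"
    using integrable_g1 by (simp add: f_def)
  have "\<bar>f x - f y\<bar> \<le> expectation (\<lambda>\<omega>. \<bar>g1 (x - eta 0 \<omega>) - g1 (y - eta 0 \<omega>)\<bar>)"
    unfolding eq by simp
  also have "\<dots> \<le> expectation (\<lambda>\<omega>. C2 * \<bar>x - y\<bar>)"
  proof (rule integral_mono)
    fix \<omega> show "\<bar>g1 (x - eta 0 \<omega>) - g1 (y - eta 0 \<omega>)\<bar> \<le> C2 * \<bar>x - y\<bar>"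
      using g1_lipschitz[of "x - eta 0 \<omega>" "y - eta 0 \<omega>"] by simp
    show "integrable M (\<lambda>\<omega>. \<bar>g1 (x - eta 0 \<omega>) - g1 (y - eta 0 \<omega>)\<bar>)"
      by (intro integrable_abs Bochner_Integration.integrable_diff integrable_g1)
  qed simp
  finally show ?thesis by (simp add: prob_space)
qed

lemma g1_small: "0 < r \<Longrightarrow> \<exists>A. \<forall>x. A \<le> \<bar>x\<bar> \<longrightarrow> \<bar>g1 x\<bar> \<le> r"
  by (rule cdf_derivative_small[OF real_distribution_e[of 0] _ g1_lipschitz]) (simp_all add: cdf_e deriv_G)

lemma f_small: "0 < r \<Longrightarrow> \<exists>A. \<forall>x. A \<le> \<bar>x\<bar> \<longrightarrow> \<bar>f x\<bar> \<le> r"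
  by (rule cdf_derivative_small[OF real_distribution_eps[of 0] _ f_lipschitz]) (simp_all add: cdf_eps deriv_F)

text \<open>Centred increments of the indicators are martingale differences bounded by \<open>1\<close> whose
  conditional variances are at most \<open>C1\<close> times the increments of the thresholds.\<close>

lemma mgf_indicator_increments:
  assumes l: "\<bar>l\<bar> \<le> 1"
  shows "(\<integral>\<^sup>+\<omega>. ennreal (exp (l * (\<Sum>t=1..int n. of_bool (eps t \<omega> \<le> r t) - of_bool (eps t \<omega> \<le> p t)
      - (G (r t - eta t \<omega>) - G (p t - eta t \<omega>))))) \<partial>M) \<le> ennreal (exp (l\<^sup>2 * C1 * (\<Sum>t=1..int n. \<bar>r t - p t\<bar>)))"
proof -
  \<comment> \<open>One increment as a function of innovation and drift separately, so that the
    innovation can be integrated out with the drift held fixed.\<close>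
  define \<xi> where "\<xi> t x q = of_bool (x + q \<le> r t) - of_bool (x + q \<le> p t) - (G (r t - q) - G (p t - q))" for t x and q :: real
  have [measurable]: "(\<lambda>x. \<xi> t (X x) (Q x)) \<in> borel_measurable N"
    if [measurable]: "X \<in> borel_measurable N" "Q \<in> borel_measurable N" for t X Q and N :: "'z measure"
    unfolding \<xi>_def by measurable
  have main: "(\<integral>\<^sup>+\<omega>. ennreal (exp (l * (\<Sum>t=1..int n. \<xi> t (e t \<omega>) (eta t \<omega>)))) \<partial>M)
      \<le> ennreal (exp (l\<^sup>2 * C1 * (\<Sum>t=1..int n. \<bar>r t - p t\<bar>)))"
  \<comment> \<open>The last time \<open>k\<close> is peeled off: given the innovations before
    \<open>k\<close>, its factor has integral at most a constant, which leaves the outer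
    integral.\<close>
  proof (induction n)
    case 0
    then show ?case by (simp add: emeasure_space_1)
  next
    case (Suc n)
    define k where "k = int (Suc n)"
    have split: "{1..k} = insert k {1..int n}" "k \<notin> {1..int n}" by (auto simp: k_def)
    have le: "t < k" "t \<le> k" if "t \<in> {1..int n}" for t using that by (auto simp: k_def)
    \<comment> \<open>The exponential of all earlier increments as a function of the trajectory
      before \<open>k\<close>; it is constant for the inner integral over
      \<open>e k\<close>.\<close>
    define Y where "Y q = ennreal (exp (l * (\<Sum>t=1..int n. \<xi> t (q t) (drift_of a t q))))" for q
    have Ym[measurable]: "Y \<in> borel_measurable (PiM {..<k} (\<lambda>_. borel))"
    proof -
      have *: "(\<lambda>q. \<xi> t (q t) (drift_of a t q)) \<in> borel_measurable (PiM {..<k} (\<lambda>_. borel))" if "t \<in> {1..int n}" for t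
      proof -
        have "(\<lambda>q. q t) \<in> borel_measurable (PiM {..<k} (\<lambda>_. borel :: real measure))"
          by (rule measurable_component_singleton) (use le[OF that] in auto)
        moreover have "(\<lambda>q. drift_of a t q) \<in> borel_measurable (PiM {..<k} (\<lambda>_. borel))"
          by (rule drift_of_measurable[of _ k]) (use le[OF that] in auto)
        ultimately show ?thesis unfolding \<xi>_def by measurable
      qed
      then have "(\<lambda>q. \<Sum>t=1..int n. \<xi> t (q t) (drift_of a t q)) \<in> borel_measurable (PiM {..<k} (\<lambda>_. borel))"
        by (rule borel_measurable_sum)
      then show ?thesis unfolding Y_def by measurable
    qed
    have Y_past: "Y (past k \<omega>) = ennreal (exp (l * (\<Sum>t=1..int n. \<xi> t (e t \<omega>) (eta t \<omega>))))" for \<omega>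
    proof -
      have "(\<Sum>t=1..int n. \<xi> t (past k \<omega> t) (drift_of a t (past k \<omega>))) = (\<Sum>t=1..int n. \<xi> t (e t \<omega>) (eta t \<omega>))"
        by (rule sum.cong) (auto simp: drift_eq[of _ k] le past_def)
      then show ?thesis by (simp add: Y_def)
    qed
    let ?h = "\<lambda>(x, q). Y q * ennreal (exp (l * \<xi> k x (drift_of a k q)))"
    have hm: "?h \<in> borel_measurable (borel \<Otimes>\<^sub>M PiM {..<k} (\<lambda>_. borel))"
    proof -
      have [measurable]: "(\<lambda>z. drift_of a k (snd z)) \<in> borel_measurable (borel \<Otimes>\<^sub>M PiM {..<k} (\<lambda>_. borel))"
        by (rule drift_of_measurable[of _ k]) auto
      show ?thesis unfolding case_prod_beta \<xi>_def by measurable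
    qed
    let ?K = "ennreal (exp (l\<^sup>2 * (C1 * \<bar>r k - p k\<bar>)))"
    have "(\<integral>\<^sup>+\<omega>. ennreal (exp (l * (\<Sum>t=1..k. \<xi> t (e t \<omega>) (eta t \<omega>)))) \<partial>M) = (\<integral>\<^sup>+\<omega>. ?h (e k \<omega>, past k \<omega>) \<partial>M)"
      unfolding split(1)
      by (rule nn_integral_cong) (use split(2) in \<open>simp add: Y_past distrib_left exp_add ennreal_mult drift_eq[symmetric] mult.commute\<close>)
    also have "\<dots> = (\<integral>\<^sup>+\<omega>. (\<integral>\<^sup>+x. ?h (x, past k \<omega>) \<partial>distr M borel (e k)) \<partial>M)"
      by (rule nn_integral_past[OF hm])
    also have "\<dots> \<le> (\<integral>\<^sup>+\<omega>. Y (past k \<omega>) * ?K \<partial>M)"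
    proof (rule nn_integral_mono)
      fix \<omega>
      let ?q = "drift_of a k (past k \<omega>)"
      have "(\<integral>\<^sup>+x. ?h (x, past k \<omega>) \<partial>distr M borel (e k)) =
          Y (past k \<omega>) * (\<integral>\<^sup>+x. ennreal (exp (l * \<xi> k x ?q)) \<partial>distr M borel (e k))"
        by (simp add: nn_integral_cmult)
      also have "(\<integral>\<^sup>+x. ennreal (exp (l * \<xi> k x ?q)) \<partial>distr M borel (e k)) \<le>
          ennreal (exp (l\<^sup>2 * \<bar>G (r k - ?q) - G (p k - ?q)\<bar>))"
        using cdf_difference_mgf_le[OF real_distribution_e[of k] l, of "r k - ?q" "p k - ?q"]
        by (simp add: cdf_e \<xi>_def le_diff_eq)
      also have "\<dots> \<le> ?K"
        using G_lipschitz[of "r k - ?q" "p k - ?q"] by (intro ennreal_leI) (simp add: mult_left_mono)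
      finally show "(\<integral>\<^sup>+x. ?h (x, past k \<omega>) \<partial>distr M borel (e k)) \<le> Y (past k \<omega>) * ?K"
        by (simp add: mult_left_mono)
    qed
    also have "\<dots> = (\<integral>\<^sup>+\<omega>. Y (past k \<omega>) \<partial>M) * ?K" by (rule nn_integral_multc) measurable
    also have "\<dots> \<le> ennreal (exp (l\<^sup>2 * C1 * (\<Sum>t=1..int n. \<bar>r t - p t\<bar>))) * ?K"
      unfolding Y_past by (rule mult_right_mono[OF Suc.IH]) simp
    also have "\<dots> = ennreal (exp (l\<^sup>2 * C1 * (\<Sum>t=1..k. \<bar>r t - p t\<bar>)))"
      using split(2) unfolding split(1) by (simp add: ennreal_mult[symmetric] mult_exp_exp algebra_simps)
    finally show ?case unfolding k_def .
  qed
  have "AE \<omega> in M. \<forall>t\<in>{1..int n}. eps t \<omega> = e t \<omega> + eta t \<omega>"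
    by (rule AE_finite_allI) (auto intro: AE_linear_process_split sq_summable a0)
  then have ae: "AE \<omega> in M. ennreal (exp (l * (\<Sum>t=1..int n. of_bool (eps t \<omega> \<le> r t) - of_bool (eps t \<omega> \<le> p t)
      - (G (r t - eta t \<omega>) - G (p t - eta t \<omega>))))) = ennreal (exp (l * (\<Sum>t=1..int n. \<xi> t (e t \<omega>) (eta t \<omega>))))"
    by (rule AE_mp) (auto simp: \<xi>_def intro!: AE_I2 sum.cong)
  show ?thesis unfolding nn_integral_cong_AE[OF ae] by (rule main)
qed

text \<open>Chernoff's bound for both signs. The parameter \<open>l\<close> is left open because the
  best choice depends on the size of the summed increments.\<close>

lemma prob_indicator_increments_le:
  assumes l: "0 < l" "l \<le> 1"
  shows "prob {\<omega> \<in> space M. y \<le> \<bar>\<Sum>t=1..int n. of_bool (eps t \<omega> \<le> r t) - of_bool (eps t \<omega> \<le> p t)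
      - (G (r t - eta t \<omega>) - G (p t - eta t \<omega>))\<bar>} \<le> 2 * exp (l\<^sup>2 * C1 * (\<Sum>t=1..int n. \<bar>r t - p t\<bar>) - l * y)"
proof -
  let ?S = "\<lambda>\<omega>. \<Sum>t=1..int n. of_bool (eps t \<omega> \<le> r t) - of_bool (eps t \<omega> \<le> p t) - (G (r t - eta t \<omega>) - G (p t - eta t \<omega>))"
  let ?V = "l\<^sup>2 * C1 * (\<Sum>t=1..int n. \<bar>r t - p t\<bar>)"
  have one: "prob {\<omega> \<in> space M. l * y \<le> k * ?S \<omega>} \<le> exp (?V - l * y)" if k: "k = l \<or> k = - l" for k
  proof -
    have "k\<^sup>2 = l\<^sup>2" "\<bar>k\<bar> \<le> 1" using k l by auto
    have iff: "1 \<le> ennreal (exp (- (l * y))) * ennreal (exp z) \<longleftrightarrow> l * y \<le> z" for z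
    proof -
      have "ennreal (exp (- (l * y))) * ennreal (exp z) = ennreal (exp (z - l * y))"
        by (simp add: ennreal_mult[symmetric] mult_exp_exp)
      then show ?thesis by simp
    qed
    have "emeasure M {\<omega> \<in> space M. l * y \<le> k * ?S \<omega>} = emeasure M {\<omega> \<in> space M. 1 \<le> ennreal (exp (- (l * y))) * ennreal (exp (k * ?S \<omega>))}"
      unfolding iff ..
    also have "\<dots> \<le> ennreal (exp (- (l * y))) * (\<integral>\<^sup>+\<omega>. ennreal (exp (k * ?S \<omega>)) * indicator (space M) \<omega> \<partial>M)"
      by (rule nn_integral_Markov_inequality) measurable
    also have "(\<integral>\<^sup>+\<omega>. ennreal (exp (k * ?S \<omega>)) * indicator (space M) \<omega> \<partial>M) = (\<integral>\<^sup>+\<omega>. ennreal (exp (k * ?S \<omega>)) \<partial>M)"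
      by (rule nn_integral_cong) simp
    also have "\<dots> \<le> ennreal (exp ?V)" using mgf_indicator_increments[OF \<open>\<bar>k\<bar> \<le> 1\<close>, where n=n and r=r and p=p] \<open>k\<^sup>2 = l\<^sup>2\<close> by simp
    finally have "emeasure M {\<omega> \<in> space M. l * y \<le> k * ?S \<omega>} \<le> ennreal (exp (- (l * y))) * ennreal (exp ?V)"
      by (simp add: mult_left_mono)
    also have "\<dots> = ennreal (exp (?V - l * y))" by (simp add: ennreal_mult[symmetric] mult_exp_exp)
    finally show ?thesis by (simp add: emeasure_eq_measure)
  qed
  have "{\<omega> \<in> space M. y \<le> \<bar>?S \<omega>\<bar>} \<subseteq> {\<omega> \<in> space M. l * y \<le> l * ?S \<omega>} \<union> {\<omega> \<in> space M. l * y \<le> - l * ?S \<omega>}"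
  proof (rule subsetI)
    fix \<omega> assume "\<omega> \<in> {\<omega> \<in> space M. y \<le> \<bar>?S \<omega>\<bar>}"
    then have \<omega>: "\<omega> \<in> space M" "y \<le> \<bar>?S \<omega>\<bar>" by simp_all
    have dich: "l * y \<le> l * z \<or> l * y \<le> - l * z" if "y \<le> \<bar>z\<bar>" for z
      using mult_left_mono[OF that, of l] l by (cases "0 \<le> z") simp_all
    from dich[OF \<omega>(2)] \<omega>(1) show "\<omega> \<in> {\<omega> \<in> space M. l * y \<le> l * ?S \<omega>} \<union> {\<omega> \<in> space M. l * y \<le> - l * ?S \<omega>}"
      unfolding Un_iff mem_Collect_eq by blast
  qed
  then have "prob {\<omega> \<in> space M. y \<le> \<bar>?S \<omega>\<bar>} \<le> prob ({\<omega> \<in> space M. l * y \<le> l * ?S \<omega>} \<union> {\<omega> \<in> space M. l * y \<le> - l * ?S \<omega>})"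
    by (rule finite_measure_mono) measurable
  also have "\<dots> \<le> prob {\<omega> \<in> space M. l * y \<le> l * ?S \<omega>} + prob {\<omega> \<in> space M. l * y \<le> - l * ?S \<omega>}"
    by (rule measure_Un_le) measurable
  also have "\<dots> \<le> exp (?V - l * y) + exp (?V - l * y)" by (intro add_mono one) auto
  finally show ?thesis by simp
qed

end

section \<open>Uniform expansion of the shifted empirical process\<close>

lemma sum_abs_le_of_sum_sq:
  fixes z :: "int \<Rightarrow> real"
  assumes "(\<Sum>t=1..int n. (z t)\<^sup>2) \<le> real n * B\<^sup>2" and "0 < B"
  shows "(\<Sum>t=1..int n. \<bar>z t\<bar>) \<le> real n * B"
proof -
  have "(\<Sum>t=1..int n. \<bar>z t\<bar>) \<le> (\<Sum>t=1..int n. ((z t)\<^sup>2 / B + B) / 2)"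
  proof (rule sum_mono)
    fix t
    have "\<bar>B * z t\<bar> \<le> ((z t)\<^sup>2 + B\<^sup>2) / 2"
      using weighted_AM_GM[of 1 B "z t"] by (simp add: add.commute)
    then show "\<bar>z t\<bar> \<le> ((z t)\<^sup>2 / B + B) / 2" using \<open>0 < B\<close> by (simp add: abs_mult field_simps power2_eq_square)
  qed
  also have "\<dots> = ((\<Sum>t=1..int n. (z t)\<^sup>2) / B + real n * B) / 2"
    by (simp add: sum.distrib sum_divide_distrib[symmetric])
  also have "\<dots> \<le> (real n * B\<^sup>2 / B + real n * B) / 2"
    using assms by (intro divide_right_mono add_right_mono) auto
  also have "\<dots> = real n * B" using \<open>0 < B\<close> by (simp add: power2_eq_square)
  finally show ?thesis .
qed

text \<open>The polynomial counts the grid points of \<open>uniform_expansion\<close>, with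
  \<open>N\<close> the number of grid coordinates. The fourth root is the square root of
  \<open>s n\<close>, itself at least of order \<open>sqrt (real n)\<close>.\<close>

lemma poly_times_exp_root_tendsto_0:
  fixes c A :: real and N :: nat
  assumes "0 < c"
  shows "(\<lambda>n. 4 * (2 * (real n)\<^sup>2 + 3) ^ N * exp (A - c * sqrt (sqrt (real n)))) \<longlonglongrightarrow> 0"
proof -
  have "(\<lambda>n. 4 * (2 * (real n)\<^sup>2 + 3) powr (real N) * exp (A - c * sqrt (sqrt (real n)))) \<longlonglongrightarrow> 0"
    using assms by real_asymp
  moreover have "(2 * (real n)\<^sup>2 + 3) powr (real N) = (2 * (real n)\<^sup>2 + 3) ^ N" for n
    by (rule powr_realpow) (simp add: add_nonneg_pos)
  ultimately show ?thesis by simp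
qed

section \<open>Law of large numbers for the conditional density\<close>

context noise
begin

text \<open>The bound that \<open>cov_lipschitz_linear_process_le\<close> gives for the covariance
  at lag \<open>j\<close> of the conditional density along the drift. It is free of the level
  \<open>u\<close>.\<close>

definition rho :: "int \<Rightarrow> real" where
  "rho j = 2 * C2\<^sup>2 * s2 * sqrt (tail_sq (\<lambda>i. a (Suc i)) 0) * sqrt (tail_sq (\<lambda>i. a (Suc i)) (nat \<bar>j\<bar>))"

lemma rho_nonneg: "0 \<le> rho j"
  unfolding rho_def using s2_nonneg tail_sq_nonneg[OF summable_drift] by simp

lemma rho_small:
  assumes "0 < k"
  shows "\<exists>J. \<forall>j. \<bar>j\<bar> \<ge> J \<longrightarrow> \<bar>rho j\<bar> < k"
proof -
  let ?B = "\<lambda>m. 2 * C2\<^sup>2 * s2 * sqrt (tail_sq (\<lambda>i. a (Suc i)) 0) * sqrt (tail_sq (\<lambda>i. a (Suc i)) m)"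
  have "?B \<longlonglongrightarrow> 2 * C2\<^sup>2 * s2 * sqrt (tail_sq (\<lambda>i. a (Suc i)) 0) * sqrt 0"
    by (intro tendsto_intros tail_sq_tendsto_0 summable_drift)
  then have "eventually (\<lambda>m. ?B m < k) sequentially" by (rule order_tendstoD) (use assms in simp)
  then obtain m where m: "\<forall>i\<ge>m. ?B i < k" by (auto simp: eventually_sequentially)
  have "\<bar>rho j\<bar> < k" if "int m \<le> \<bar>j\<bar>" for j
  proof -
    have "nat \<bar>j\<bar> \<ge> m" using that by simp
    with m have "rho j < k" unfolding rho_def by blast
    then show ?thesis using rho_nonneg by simp
  qed
  then show ?thesis by blast
qed

lemma cov_g1_le:
  "\<bar>expectation (\<lambda>\<omega>. (g1 (u - eta t \<omega>) - f u) * (g1 (u - eta s \<omega>) - f u))\<bar> \<le> rho (t - s)"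
proof -
  have "\<bar>g1 (u - x) - g1 (u - y)\<bar> \<le> C2 * \<bar>x - y\<bar>" for x y
    using g1_lipschitz[of "u - x" "u - y"] by (simp add: abs_minus_commute)
  moreover have "int (nat \<bar>t - s\<bar>) \<le> \<bar>(t - 1) - (s - 1)\<bar>" by simp
  ultimately have "\<bar>expectation (\<lambda>\<omega>. (g1 (u - eta t \<omega>) - expectation (\<lambda>\<omega>. g1 (u - eta t \<omega>))) *
      (g1 (u - eta s \<omega>) - expectation (\<lambda>\<omega>. g1 (u - eta s \<omega>))))\<bar> \<le> rho (t - s)"
    unfolding drift_def rho_def by (rule cov_lipschitz_linear_process_le[OF summable_drift])
  then show ?thesis unfolding f_eq[of u t, symmetric] f_eq[of u s, symmetric] .
qed

lemma weighted_g1_sq: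
  fixes z :: "int \<Rightarrow> real"
  shows "integrable M (\<lambda>\<omega>. (\<Sum>t=1..int n. z t * (g1 (u - eta t \<omega>) - f u))\<^sup>2)" (is ?int)
    and "expectation (\<lambda>\<omega>. (\<Sum>t=1..int n. z t * (g1 (u - eta t \<omega>) - f u))\<^sup>2) \<le>
      (\<Sum>j=-int n..int n. \<bar>rho j\<bar>) * (\<Sum>t=1..int n. (z t)\<^sup>2)" (is ?le)
proof -
  let ?w = "\<lambda>t \<omega>. g1 (u - eta t \<omega>) - f u"
  have int: "integrable M (\<lambda>\<omega>. ?w t \<omega> * ?w s \<omega>)" for t s
  proof (rule integrable_const_bound[where B="(C1 + \<bar>f u\<bar>) * (C1 + \<bar>f u\<bar>)"])
    have "\<bar>?w t \<omega>\<bar> \<le> C1 + \<bar>f u\<bar>" for t \<omega> using g1_bound[of "u - eta t \<omega>"] by linarith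
    then show "AE \<omega> in M. norm (?w t \<omega> * ?w s \<omega>) \<le> (C1 + \<bar>f u\<bar>) * (C1 + \<bar>f u\<bar>)"
      using C1_nonneg by (auto simp: abs_mult intro!: mult_mono)
  qed measurable
  have eq: "(\<Sum>t=1..int n. z t * ?w t \<omega>)\<^sup>2 = (\<Sum>t=1..int n. \<Sum>s=1..int n. z t * z s * (?w t \<omega> * ?w s \<omega>))" for \<omega>
    unfolding power2_eq_square sum_product by (intro sum.cong) auto
  show ?int unfolding eq using int by auto
  have "expectation (\<lambda>\<omega>. (\<Sum>t=1..int n. z t * ?w t \<omega>)\<^sup>2) =
      (\<Sum>t=1..int n. \<Sum>s=1..int n. z t * z s * expectation (\<lambda>\<omega>. ?w t \<omega> * ?w s \<omega>))"
    unfolding eq using int by simp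
  also have "\<dots> \<le> (\<Sum>t=1..int n. \<Sum>s=1..int n. rho (t - s) * \<bar>z t\<bar> * \<bar>z s\<bar>)"
  proof (intro sum_mono)
    fix t s
    have "z t * z s * expectation (\<lambda>\<omega>. ?w t \<omega> * ?w s \<omega>) \<le> \<bar>z t * z s\<bar> * \<bar>expectation (\<lambda>\<omega>. ?w t \<omega> * ?w s \<omega>)\<bar>"
      by (simp flip: abs_mult)
    also have "\<dots> \<le> \<bar>z t * z s\<bar> * rho (t - s)" by (rule mult_left_mono[OF cov_g1_le]) simp
    finally show "z t * z s * expectation (\<lambda>\<omega>. ?w t \<omega> * ?w s \<omega>) \<le> rho (t - s) * \<bar>z t\<bar> * \<bar>z s\<bar>"
      by (simp add: abs_mult mult_ac)
  qed
  also have "\<dots> \<le> (\<Sum>j=-int n..int n. \<bar>rho j\<bar>) * (\<Sum>t=1..int n. \<bar>z t\<bar>\<^sup>2)"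
    using toeplitz_quad_le[where f=rho and n=n and u="\<lambda>t. \<bar>z t\<bar>"] by linarith
  finally show ?le by simp
qed

lemma chebyshev_sq:
  assumes [measurable]: "Y \<in> borel_measurable M" and int: "integrable M (\<lambda>\<omega>. (Y \<omega>)\<^sup>2)"
    and le: "expectation (\<lambda>\<omega>. (Y \<omega>)\<^sup>2) \<le> v" and y: "0 < y"
  shows "prob {\<omega> \<in> space M. y < \<bar>Y \<omega> :: real\<bar>} \<le> v / y\<^sup>2"
proof -
  have "prob {\<omega> \<in> space M. y < \<bar>Y \<omega>\<bar>} \<le> prob {\<omega> \<in> space M. y\<^sup>2 \<le> (Y \<omega>)\<^sup>2}"
  proof (rule finite_measure_mono)
    show "{\<omega> \<in> space M. y < \<bar>Y \<omega>\<bar>} \<subseteq> {\<omega> \<in> space M. y\<^sup>2 \<le> (Y \<omega>)\<^sup>2}"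
    proof safe
      fix \<omega> assume "y < \<bar>Y \<omega>\<bar>"
      then have "y\<^sup>2 \<le> \<bar>Y \<omega>\<bar>\<^sup>2" using y by (intro power_mono) auto
      then show "y\<^sup>2 \<le> (Y \<omega>)\<^sup>2" by simp
    qed
  qed measurable
  also have "\<dots> \<le> expectation (\<lambda>\<omega>. (Y \<omega>)\<^sup>2) / y\<^sup>2"
    by (rule integral_Markov_inequality_measure[OF int, where A="{}"]) (use y in auto)
  also have "\<dots> \<le> v / y\<^sup>2" using le by (simp add: divide_right_mono)
  finally show ?thesis .
qed

lemma eta_sq:
  shows "integrable M (\<lambda>\<omega>. (eta t \<omega>)\<^sup>2)" and "expectation (\<lambda>\<omega>. (eta t \<omega>)\<^sup>2) \<le> s2 * tail_sq (\<lambda>i. a (Suc i)) 0"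
  unfolding drift_def by (rule integrable_linear_process_sq[OF summable_drift], rule linear_process_sq_le[OF summable_drift])

text \<open>The threshold for \<open>n\<close> is uniform over the weights \<open>z\<close>, while
  the exceptional event may depend on them. For bounded \<open>u\<close> a finite grid and the
  Lipschitz constants suffice; for large \<open>u\<close> both \<open>g1\<close> and
  \<open>f\<close> are small unless the drift is large, and large drifts are rare.\<close>

lemma lln_g1:
  assumes B: "0 < B" and k: "0 < k" and p: "0 < p"
  shows "eventually (\<lambda>n. \<forall>z. (\<Sum>t=1..int n. (z t)\<^sup>2) \<le> real n * B\<^sup>2 \<longrightarrow>
    (\<exists>E\<in>events. prob E \<le> p \<and> (\<forall>\<omega>\<in>space M - E. \<forall>u. \<bar>\<Sum>t=1..int n. z t * (g1 (u - eta t \<omega>) - f u)\<bar> \<le> k * real n))) sequentially"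
proof -
  \<comment> \<open>Two terms of size \<open>k'\<close>, against absolute weights summing to at most
    \<open>n * B\<close>, cost half of the allowance \<open>k * n\<close>.\<close>
  define k' where "k' = k / (4 * B)"
  have k': "0 < k'" using k B by (simp add: k'_def)
  obtain A1 where A1: "\<And>x. A1 \<le> \<bar>x\<bar> \<Longrightarrow> \<bar>g1 x\<bar> \<le> k'" using g1_small[OF k'] by blast
  obtain A2 where A2: "\<And>x. A2 \<le> \<bar>x\<bar> \<Longrightarrow> \<bar>f x\<bar> \<le> k'" using f_small[OF k'] by blast
  define T where "T = s2 * tail_sq (\<lambda>i. a (Suc i)) 0"
  have T: "0 \<le> T" unfolding T_def using s2_nonneg tail_sq_nonneg[OF summable_drift] by simp
  \<comment> \<open>Chosen so that Markov's inequality for the weighted squares of the drift in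
    \<open>E2\<close> gives at most p/2.\<close>
  define W where "W = 2 * B * T * (C1 + 1) / (k * p) + 1"
  have W: "0 < W" "1 \<le> W" using C1_nonneg B T k p by (simp_all add: W_def add_nonneg_pos)
  \<comment> \<open>If \<open>u\<close> is beyond \<open>A0\<close> while \<open>u - eta t\<close>
    falls back into the region where \<open>g1\<close> may be large, then the drift has square at
    least \<open>2 * W\<close>.\<close>
  define A0 where "A0 = \<bar>A1\<bar> + \<bar>A2\<bar> + sqrt (2 * W)"
  have A0: "\<bar>A1\<bar> \<le> A0" "\<bar>A2\<bar> \<le> A0" "2 * W \<le> (A0 - \<bar>A1\<bar>)\<^sup>2" "0 < A0 - \<bar>A1\<bar>"
  proof -
    have "sqrt (2 * W) \<le> A0 - \<bar>A1\<bar>" by (simp add: A0_def)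
    then have "(sqrt (2 * W))\<^sup>2 \<le> (A0 - \<bar>A1\<bar>)\<^sup>2" using W by (intro power_mono) auto
    then show "2 * W \<le> (A0 - \<bar>A1\<bar>)\<^sup>2" using W by simp
  qed (use W in \<open>auto simp: A0_def add_nonneg_pos\<close>)
  \<comment> \<open>Mesh of the grid for \<open>u\<close>: moving to the nearest grid point below
    changes the weighted sum by at most half of the allowance.\<close>
  define h where "h = k / (4 * B * (C2 + 1))"
  have h: "0 < h" using k B C2_nonneg by (simp add: h_def)
  have hC: "2 * C2 * h * B \<le> k / 2"
  proof -
    have "2 * C2 * h * B \<le> 2 * (C2 + 1) * h * B" using h B by (intro mult_right_mono) auto
    also have "\<dots> = k / 2 * ((B * (C2 + 1)) / (B * (C2 + 1)))" unfolding h_def by (simp add: mult_ac)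
    finally show ?thesis using B C2_nonneg by (simp add: add_nonneg_pos)
  qed
  define N where "N = \<lceil>A0 / h\<rceil> + 1"
  define c where "c = real (card {-N..N})"
  have c: "0 \<le> c" by (simp add: c_def)
  let ?R = "\<lambda>n. \<Sum>j=-int n..int n. \<bar>rho j\<bar>"
  have "(\<lambda>n. c * (B\<^sup>2 * 4 / k\<^sup>2 * (?R n / real n))) \<longlonglongrightarrow> c * (B\<^sup>2 * 4 / k\<^sup>2 * 0)"
    by (intro tendsto_intros cesaro_abs_null rho_small)
  then have "eventually (\<lambda>n. c * (B\<^sup>2 * 4 / k\<^sup>2 * (?R n / real n)) < p / 2) sequentially"
    by (rule order_tendstoD) (use p in simp)
  then show ?thesis using eventually_gt_at_top[of 0]
  proof eventually_elim
    case (elim n)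
    then have n: "0 < real n" by simp
    show ?case
    proof (intro allI impI)
      fix z :: "int \<Rightarrow> real" assume z: "(\<Sum>t=1..int n. (z t)\<^sup>2) \<le> real n * B\<^sup>2"
      have z1: "(\<Sum>t=1..int n. \<bar>z t\<bar>) \<le> real n * B" by (rule sum_abs_le_of_sum_sq[OF z B])
      define S where "S u \<omega> = (\<Sum>t=1..int n. z t * (g1 (u - eta t \<omega>) - f u))" for u \<omega>
      have [measurable]: "S u \<in> borel_measurable M" for u unfolding S_def by measurable
      \<comment> \<open>Controls the total weight of the times at which the drift brings a large
        \<open>u\<close> back to the bulk of \<open>g1\<close>.\<close>
      define Q where "Q \<omega> = (\<Sum>t=1..int n. \<bar>z t\<bar> * (eta t \<omega>)\<^sup>2)" for \<omega>
      have [measurable]: "Q \<in> borel_measurable M" unfolding Q_def by measurable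
      define E1 where "E1 i = {\<omega> \<in> space M. k * real n / 2 < \<bar>S (of_int i * h) \<omega>\<bar>}" for i :: int
      define E2 where "E2 = {\<omega> \<in> space M. k * real n * W / (C1 + 1) \<le> Q \<omega>}"
      have E1[measurable]: "E1 i \<in> events" for i unfolding E1_def by measurable
      have E2[measurable]: "E2 \<in> events" unfolding E2_def by measurable
      have p1: "prob (E1 i) \<le> B\<^sup>2 * 4 / k\<^sup>2 * (?R n / real n)" for i
      proof -
        have "expectation (\<lambda>\<omega>. (S (of_int i * h) \<omega>)\<^sup>2) \<le> ?R n * (\<Sum>t=1..int n. (z t)\<^sup>2)"
          unfolding S_def by (rule weighted_g1_sq)
        also have "\<dots> \<le> ?R n * (real n * B\<^sup>2)" by (rule mult_left_mono[OF z]) (simp add: sum_nonneg)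
        finally have "prob (E1 i) \<le> ?R n * (real n * B\<^sup>2) / (k * real n / 2)\<^sup>2"
          unfolding E1_def using n k weighted_g1_sq(1)[of z "of_int i * h" n]
          by (intro chebyshev_sq) (auto simp: S_def)
        also have "\<dots> = B\<^sup>2 * 4 / k\<^sup>2 * (?R n / real n)" using n k by (simp add: power2_eq_square field_simps)
        finally show ?thesis .
      qed
      have p2: "prob E2 \<le> p / 2"
      proof -
        have iQ: "integrable M Q" unfolding Q_def using eta_sq by auto
        have "expectation Q = (\<Sum>t=1..int n. \<bar>z t\<bar> * expectation (\<lambda>\<omega>. (eta t \<omega>)\<^sup>2))"
          unfolding Q_def using eta_sq by simp
        also have "\<dots> \<le> (\<Sum>t=1..int n. \<bar>z t\<bar> * T)" unfolding T_def using eta_sq by (intro sum_mono mult_left_mono) auto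
        also have "\<dots> \<le> real n * B * T" using z1 T by (simp add: sum_distrib_right[symmetric] mult_right_mono)
        finally have EQ: "expectation Q \<le> real n * B * T" .
        have "prob E2 \<le> expectation Q / (k * real n * W / (C1 + 1))"
          unfolding E2_def
          by (rule integral_Markov_inequality_measure[OF iQ, where A="{}"])
            (use n k W C1_nonneg in \<open>auto simp: Q_def intro!: sum_nonneg\<close>)
        also have "\<dots> \<le> real n * B * T / (k * real n * W / (C1 + 1))"
          using EQ n k W C1_nonneg by (intro divide_right_mono) auto
        also have "\<dots> = (B * T * (C1 + 1) / k) / W" using n k W C1_nonneg by (simp add: field_simps)
        also have "\<dots> \<le> p / 2"
        proof -
          have "B * T * (C1 + 1) / k = p / 2 * (W - 1)" using k p by (simp add: W_def field_simps)
          also have "\<dots> \<le> p / 2 * W" using p by (intro mult_left_mono) auto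
          finally show ?thesis unfolding pos_divide_le_eq[OF W(1)] .
        qed
        finally show ?thesis .
      qed
      define E where "E = (\<Union>i\<in>{-N..N}. E1 i) \<union> E2"
      have E[measurable]: "E \<in> events" unfolding E_def by measurable
      have "prob E \<le> (\<Sum>i\<in>{-N..N}. prob (E1 i)) + prob E2"
        unfolding E_def by (intro order.trans[OF measure_Un_le] add_right_mono measure_UNION_le) auto
      also have "\<dots> \<le> (\<Sum>i\<in>{-N..N}. B\<^sup>2 * 4 / k\<^sup>2 * (?R n / real n)) + p / 2"
        by (intro add_mono sum_mono p1 p2)
      also have "\<dots> \<le> p" using elim by (simp add: c_def)
      finally have "prob E \<le> p" .
      moreover have "\<bar>S u \<omega>\<bar> \<le> k * real n" if \<omega>: "\<omega> \<in> space M - E" for \<omega> u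
      proof (cases "\<bar>u\<bar> \<le> A0")
        case True
        define i where "i = \<lfloor>u / h\<rfloor>"
        have "u / h \<le> A0 / h" using True h by (intro divide_right_mono) auto
        moreover have "- A0 / h \<le> u / h" using True h by (intro divide_right_mono) auto
        ultimately have "i \<le> N" "-N \<le> i" unfolding i_def N_def by linarith+
        then have "i \<in> {-N..N}" by simp
        then have "\<omega> \<notin> E1 i" using \<omega> unfolding E_def by blast
        then have Si: "\<bar>S (of_int i * h) \<omega>\<bar> \<le> k * real n / 2" using \<omega> by (auto simp: E1_def)
        have "of_int i \<le> u / h" "u / h < of_int i + 1" unfolding i_def by linarith+
        then have near: "\<bar>u - of_int i * h\<bar> \<le> h" using h by (simp add: field_simps abs_le_iff)
        have "\<bar>S u \<omega> - S (of_int i * h) \<omega>\<bar> \<le> (\<Sum>t=1..int n. \<bar>z t\<bar> * (2 * C2 * h))"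
          unfolding S_def sum_subtractf[symmetric]
        proof (rule order.trans[OF sum_abs], rule sum_mono)
          fix t
          have "\<bar>(g1 (u - eta t \<omega>) - f u) - (g1 (of_int i * h - eta t \<omega>) - f (of_int i * h))\<bar> \<le> 2 * (C2 * \<bar>u - of_int i * h\<bar>)"
            using g1_lipschitz[of "u - eta t \<omega>" "of_int i * h - eta t \<omega>"] f_lipschitz[of u "of_int i * h"] by simp
          also have "\<dots> \<le> 2 * C2 * h" using near C2_nonneg by (simp add: mult_left_mono)
          finally show "\<bar>z t * (g1 (u - eta t \<omega>) - f u) - z t * (g1 (of_int i * h - eta t \<omega>) - f (of_int i * h))\<bar> \<le> \<bar>z t\<bar> * (2 * C2 * h)"
            unfolding right_diff_distrib[symmetric] abs_mult by (rule mult_left_mono) simp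
        qed
        also have "\<dots> \<le> real n * B * (2 * C2 * h)"
          unfolding sum_distrib_right[symmetric] using z1 C2_nonneg h by (intro mult_right_mono) auto
        also have "\<dots> \<le> k * real n / 2" using mult_left_mono[OF hC, of "real n"] by (simp add: mult_ac)
        finally show ?thesis using Si by linarith
      next
        case False
        then have fu: "\<bar>f u\<bar> \<le> k'" using A2[of u] A0 by linarith
        have Q: "Q \<omega> < k * real n * W / (C1 + 1)" using \<omega> by (auto simp: E_def E2_def)
        \<comment> \<open>Either the argument is in the tail of \<open>g1\<close>, or the drift is
          so large that its scaled square exceeds 1 and dominates the trivial bound
          \<open>C1\<close>.\<close>
        have g: "\<bar>g1 (u - eta t \<omega>)\<bar> \<le> k' + C1 / (2 * W) * (eta t \<omega>)\<^sup>2" for t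
        proof (cases "A1 \<le> \<bar>u - eta t \<omega>\<bar>")
          case True
          have "0 \<le> C1 / (2 * W) * (eta t \<omega>)\<^sup>2" using C1_nonneg W by simp
          then show ?thesis using A1[OF True] by linarith
        next
          case far: False
          then have "A0 - \<bar>A1\<bar> \<le> \<bar>eta t \<omega>\<bar>" using False by linarith
          then have "(A0 - \<bar>A1\<bar>)\<^sup>2 \<le> \<bar>eta t \<omega>\<bar>\<^sup>2" using A0 by (intro power_mono) auto
          then have "2 * W \<le> (eta t \<omega>)\<^sup>2" using A0 by simp
          then have "1 \<le> (eta t \<omega>)\<^sup>2 / (2 * W)" using W by simp
          then have "C1 * 1 \<le> C1 * ((eta t \<omega>)\<^sup>2 / (2 * W))" by (rule mult_left_mono[OF _ C1_nonneg])
          then show ?thesis using g1_bound[of "u - eta t \<omega>"] k' by simp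
        qed
        have "\<bar>S u \<omega>\<bar> \<le> (\<Sum>t=1..int n. \<bar>z t\<bar> * (2 * k') + C1 / (2 * W) * (\<bar>z t\<bar> * (eta t \<omega>)\<^sup>2))"
          unfolding S_def
        proof (rule order.trans[OF sum_abs], rule sum_mono)
          fix t
          have "\<bar>g1 (u - eta t \<omega>) - f u\<bar> \<le> 2 * k' + C1 / (2 * W) * (eta t \<omega>)\<^sup>2" using g[of t] fu by linarith
          then have "\<bar>z t\<bar> * \<bar>g1 (u - eta t \<omega>) - f u\<bar> \<le> \<bar>z t\<bar> * (2 * k' + C1 / (2 * W) * (eta t \<omega>)\<^sup>2)"
            by (rule mult_left_mono) simp
          then show "\<bar>z t * (g1 (u - eta t \<omega>) - f u)\<bar> \<le> \<bar>z t\<bar> * (2 * k') + C1 / (2 * W) * (\<bar>z t\<bar> * (eta t \<omega>)\<^sup>2)"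
            by (simp add: abs_mult distrib_left mult_ac)
        qed
        also have "\<dots> = (\<Sum>t=1..int n. \<bar>z t\<bar>) * (2 * k') + C1 / (2 * W) * Q \<omega>"
          unfolding sum.distrib Q_def by (simp only: sum_distrib_right sum_distrib_left)
        also have "\<dots> \<le> real n * B * (2 * k') + C1 / (2 * W) * (k * real n * W / (C1 + 1))"
          using z1 Q k' C1_nonneg W by (intro add_mono mult_right_mono mult_left_mono) auto
        also have "real n * B * (2 * k') = k * real n / 2" using B by (simp add: k'_def)
        also have "C1 / (2 * W) * (k * real n * W / (C1 + 1)) = C1 / (C1 + 1) * (k * real n / 2)" using W by simp
        also have "\<dots> \<le> 1 * (k * real n / 2)" using C1_nonneg k by (intro mult_right_mono) auto
        finally show ?thesis by simp
      qed
      ultimately show "\<exists>E\<in>events. prob E \<le> p \<and> (\<forall>\<omega>\<in>space M - E. \<forall>u. \<bar>\<Sum>t=1..int n. z t * (g1 (u - eta t \<omega>) - f u)\<bar> \<le> k * real n)"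
        unfolding S_def using E by blast
    qed
  qed
qed

end

section \<open>Uniformity in the level and in the coefficients\<close>

context noise
begin

lemma eps_sq:
  shows "integrable M (\<lambda>\<omega>. (eps t \<omega>)\<^sup>2)" and "expectation (\<lambda>\<omega>. (eps t \<omega>)\<^sup>2) \<le> s2 * tail_sq a 0"
  by (rule integrable_linear_process_sq[OF sq_summable], rule linear_process_sq_le[OF sq_summable])

text \<open>Monotonicity of the indicators reduces the supremum over all \<open>u\<close> and \<open>th\<close> to a grid of mesh
  \<open>1 / n\<close>; the exponential inequality beats the polynomial size of the grid. For \<open>\<bar>u\<bar> > n\<close> both
  indicators agree with high probability.\<close>

lemma uniform_expansion:
  fixes s :: "nat \<Rightarrow> real"
  assumes s_nonneg: "\<And>n. 0 \<le> s n" and s_lower: "0 < k" "eventually (\<lambda>n. k * real n \<le> (s n)\<^sup>2) sequentially"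
    and s_upper: "(\<lambda>n. s n / real n) \<longlonglongrightarrow> 0"
    and B: "0 < B" and \<tau>: "0 < \<tau>" and p: "0 < p"
  shows "eventually (\<lambda>n. \<forall>Z :: int \<Rightarrow> 'i::finite \<Rightarrow> real. (\<forall>i. (\<Sum>t=1..int n. (Z t i)\<^sup>2) \<le> real n * B\<^sup>2) \<longrightarrow>
    (\<exists>E\<in>events. prob E \<le> p \<and> (\<forall>\<omega>\<in>space M - E. \<forall>u th. (\<forall>i. \<bar>th i\<bar> \<le> B * s n / real n) \<longrightarrow>
      \<bar>\<Sum>t=1..int n. of_bool (eps t \<omega> \<le> u + (\<Sum>i\<in>UNIV. th i * Z t i)) - of_bool (eps t \<omega> \<le> u)
         - (\<Sum>i\<in>UNIV. th i * Z t i) * f u\<bar> \<le> \<tau> * s n))) sequentially"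
proof -
  define q where "q = real CARD('i)"
  have q: "1 \<le> q" unfolding q_def using zero_less_card_finite[where 'a='i] by linarith
  \<comment> \<open>Bound for the variance term of the exponential inequality at
    \<open>l = 1 / sqrt S\<close>, since all shifts on the grid sum to at most a multiple of
    \<open>S\<close>.\<close>
  define CV where "CV = C1 * (1 + q * B * (B + 2))"
  \<comment> \<open>Each of the \<open>q\<close> coordinates contributes a coefficient of size
    \<open>B * S / n\<close> times \<open>kq * n\<close>; together this is a quarter of
    \<open>\<tau> * S\<close>.\<close>
  define kq where "kq = \<tau> / (4 * q * B)"
  have kq: "0 < kq" using \<tau> q B by (simp add: kq_def)
  \<comment> \<open>For \<open>u\<close> beyond \<open>n\<close> the linear term stands alone; the
    absolute shifts sum to at most \<open>q * B\<^sup>2 * S\<close>, which fixes this smallness of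
    \<open>f\<close>.\<close>
  obtain Af where Af: "\<And>x. Af \<le> \<bar>x\<bar> \<Longrightarrow> \<bar>f x\<bar> \<le> \<tau> / (q * B\<^sup>2)"
    using f_small[of "\<tau> / (q * B\<^sup>2)"] \<tau> q B by auto
  \<comment> \<open>The deviation term in the exponent is \<open>\<tau> / 4 * sqrt S\<close>, and
    \<open>S\<close> is at least \<open>sqrt (k * n)\<close>.\<close>
  define c where "c = \<tau> / 4 * sqrt (sqrt k)"
  have c: "0 < c" using \<tau> s_lower by (simp add: c_def)
  define T where "T = s2 * tail_sq a 0"
  \<comment> \<open>The allowance \<open>p\<close> is shared in thirds by the grid events, large
    noise values and the law of large numbers. Of the remaining thresholds, \<open>ev2\<close>
    serves the Taylor remainder, \<open>ev4\<close> the discretisation error, and \<open>ev5\<close>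
    levels beyond \<open>n\<close>; \<open>ev2\<close> and \<open>ev5\<close> also keep the shifts
    below n/4 there.\<close>
  have ev1: "eventually (\<lambda>n. 4 * (2 * (real n)\<^sup>2 + 3) ^ (Suc CARD('i)) * exp (CV - c * sqrt (sqrt (real n))) < p / 3) sequentially"
    by (rule order_tendstoD(2)[OF poly_times_exp_root_tendsto_0[OF c]]) (use p in simp)
  have ev2: "eventually (\<lambda>n. s n / real n < min (min 1 (1 / B)) (\<tau> / (8 * (C2 * q\<^sup>2 * B ^ 4 + 1)))) sequentially"
    by (rule order_tendstoD(2)[OF s_upper])
      (use \<tau> C2_nonneg q B in \<open>auto intro!: divide_pos_pos add_nonneg_pos mult_nonneg_nonneg\<close>)
  have lim3: "(\<lambda>n. 4 * T / real n) \<longlonglongrightarrow> 0" by (rule lim_const_over_n)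
  have ev3: "eventually (\<lambda>n. 4 * T / real n < p / 3) sequentially"
    by (rule order_tendstoD(2)[OF lim3]) (use p in simp)
  have ev4: "eventually (\<lambda>n. max 1 (8 * C1 * (2 + 2 * q * B) / \<tau>) < sqrt (k * real n)) sequentially"
    using s_lower(1) by real_asymp
  have ev5: "eventually (\<lambda>n. q * B\<^sup>2 * sqrt (real n) \<le> real n / 4 \<and> Af \<le> real n \<and> B \<le> real n) sequentially"
    by (intro eventually_conj; real_asymp)
  have ev6: "eventually (\<lambda>n. \<forall>z. (\<Sum>t=1..int n. (z t)\<^sup>2) \<le> real n * B\<^sup>2 \<longrightarrow>
    (\<exists>E\<in>events. prob E \<le> p / (3 * q) \<and> (\<forall>\<omega>\<in>space M - E. \<forall>u. \<bar>\<Sum>t=1..int n. z t * (g1 (u - eta t \<omega>) - f u)\<bar> \<le> kq * real n))) sequentially"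
    by (rule lln_g1[OF B kq]) (use p q in simp)
  show ?thesis
    using ev1 ev2 ev3 ev4 ev5 ev6 s_lower(2) eventually_gt_at_top[of 0]
  proof eventually_elim
    case (elim n)
    have n: "1 \<le> real n" using elim(8) by simp
    define S where "S = s n"
    have S_sqrt: "sqrt (k * real n) \<le> S" using elim(7) s_nonneg[of n] by (simp add: S_def real_le_lsqrt)
    have S1: "1 < S" and S_C: "8 * C1 * (2 + 2 * q * B) / \<tau> < S"
      using elim(4) S_sqrt unfolding max_less_iff_conj by linarith+
    have Sn: "S < real n" "B * S < real n" "C2 * q\<^sup>2 * B ^ 4 * S \<le> \<tau> / 8 * real n"
    proof -
      have *: "S / real n < 1" "S / real n < 1 / B" "S / real n < \<tau> / (8 * (C2 * q\<^sup>2 * B ^ 4 + 1))"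
        using elim(2) by (simp_all add: S_def)
      show "S < real n" "B * S < real n" using *(1,2) n B by (simp_all add: field_simps)
      have X: "0 \<le> C2 * q\<^sup>2 * B ^ 4" using C2_nonneg q B by simp
      have "C2 * q\<^sup>2 * B ^ 4 * S \<le> (C2 * q\<^sup>2 * B ^ 4 + 1) * S" using S1 by (intro mult_right_mono) auto
      also have "\<dots> = (C2 * q\<^sup>2 * B ^ 4 + 1) * (S / real n) * real n" using n by simp
      also have "\<dots> \<le> (C2 * q\<^sup>2 * B ^ 4 + 1) * (\<tau> / (8 * (C2 * q\<^sup>2 * B ^ 4 + 1))) * real n"
        using *(3) X n by (intro mult_right_mono mult_left_mono) auto
      also have "\<dots> = \<tau> / 8 * real n"
      proof -
        have "(w + 1) * (\<tau> / (8 * (w + 1))) = \<tau> / 8" if "0 \<le> w" for w :: real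
        proof -
          have "w + 1 \<noteq> 0" using that by linarith
          then show ?thesis by (simp add: divide_simps)
        qed
        from this[OF X] show ?thesis by (simp only:)
      qed
      finally show "C2 * q\<^sup>2 * B ^ 4 * S \<le> \<tau> / 8 * real n" .
    qed
    \<comment> \<open>Bound for the coefficients \<open>th\<close>. The grid has the same mesh
      \<open>h\<close> in \<open>u\<close> and in every coordinate of \<open>th\<close>.\<close>
    define D where "D = B * S / real n"
    have D: "0 \<le> D" using B S1 n by (simp add: D_def)
    define h where "h = 1 / real n"
    have h: "0 < h" "h * real n = 1" using n by (simp_all add: h_def)
    \<comment> \<open>A level \<open>u\<close> of size at most \<open>n\<close> has index at most
      \<open>n\<^sup>2\<close> at mesh 1/n; rounding down costs one more.\<close>
    define K where "K = (int n)\<^sup>2 + 1"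
    show ?case
    proof (intro allI impI)
      fix Z :: "int \<Rightarrow> 'i \<Rightarrow> real"
      assume Z: "\<forall>i. (\<Sum>t=1..int n. (Z t i)\<^sup>2) \<le> real n * B\<^sup>2"
      define y where "y t = (\<Sum>i\<in>UNIV. \<bar>Z t i\<bar>)" for t
      have y0: "0 \<le> y t" for t by (simp add: y_def sum_nonneg)
      have y1: "(\<Sum>t=1..int n. y t) \<le> q * (real n * B)"
      proof -
        have "(\<Sum>t=1..int n. y t) = (\<Sum>i\<in>UNIV. \<Sum>t=1..int n. \<bar>Z t i\<bar>)" unfolding y_def by (rule sum.swap)
        also have "\<dots> \<le> (\<Sum>i\<in>(UNIV::'i set). real n * B)" using Z B by (intro sum_mono sum_abs_le_of_sum_sq) auto
        finally show ?thesis by (simp add: q_def)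
      qed
      have y2: "(\<Sum>t=1..int n. (y t)\<^sup>2) \<le> q\<^sup>2 * (real n * B\<^sup>2)"
      proof -
        have "(\<Sum>t=1..int n. (y t)\<^sup>2) \<le> (\<Sum>t=1..int n. \<Sum>i\<in>UNIV. q * (Z t i)\<^sup>2)"
        proof (rule sum_mono)
          fix t
          have "(y t)\<^sup>2 \<le> (\<Sum>i\<in>(UNIV::'i set). 1\<^sup>2) * (\<Sum>i\<in>UNIV. \<bar>Z t i\<bar>\<^sup>2)"
            using Cauchy_Schwarz_ineq_sum[of "\<lambda>_. 1" "\<lambda>i. \<bar>Z t i\<bar>" "UNIV :: 'i set"] by (simp add: y_def)
          then show "(y t)\<^sup>2 \<le> (\<Sum>i\<in>UNIV. q * (Z t i)\<^sup>2)" by (simp add: q_def sum_distrib_left)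
        qed
        also have "\<dots> = (\<Sum>i\<in>UNIV. q * (\<Sum>t=1..int n. (Z t i)\<^sup>2))" by (subst sum.swap) (simp add: sum_distrib_left)
        also have "\<dots> \<le> (\<Sum>i\<in>(UNIV::'i set). q * (real n * B\<^sup>2))" using Z q by (intro sum_mono mult_left_mono) auto
        also have "\<dots> = q\<^sup>2 * (real n * B\<^sup>2)" by (simp add: q_def power2_eq_square)
        finally show ?thesis .
      qed
      have y_max: "y t \<le> q * B * sqrt (real n)" if "t \<in> {1..int n}" for t
      proof -
        have "(y t)\<^sup>2 \<le> (\<Sum>t=1..int n. (y t)\<^sup>2)" by (rule member_le_sum[OF that]) auto
        also note y2
        also have "q\<^sup>2 * (real n * B\<^sup>2) = (q * B * sqrt (real n))\<^sup>2" by (simp add: power_mult_distrib)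
        finally show ?thesis by (rule power2_le_imp_le) (use q B in simp)
      qed
      define dl where "dl th t = (\<Sum>i\<in>UNIV. th i * Z t i)" for th t
      have dl_diff: "\<bar>dl th t - dl th' t\<bar> \<le> r * y t" if "\<And>i. \<bar>th i - th' i\<bar> \<le> r" for th th' r t
      proof -
        have "\<bar>dl th t - dl th' t\<bar> = \<bar>\<Sum>i\<in>UNIV. (th i - th' i) * Z t i\<bar>"
          by (simp add: dl_def left_diff_distrib sum_subtractf)
        also have "\<dots> \<le> (\<Sum>i\<in>UNIV. r * \<bar>Z t i\<bar>)"
          by (rule order.trans[OF sum_abs], rule sum_mono) (simp add: abs_mult that mult_right_mono)
        finally show ?thesis by (simp add: y_def sum_distrib_left)
      qed
      have dl_le: "\<bar>dl th t\<bar> \<le> r * y t" if "\<And>i. \<bar>th i\<bar> \<le> r" for th r t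
        using dl_diff[of th "\<lambda>_. 0" r t] that by (simp add: dl_def)
      define M' where "M' r q' \<omega> = (\<Sum>t=1..int n. of_bool (eps t \<omega> \<le> r t) - of_bool (eps t \<omega> \<le> q' t)
          - (G (r t - eta t \<omega>) - G (q' t - eta t \<omega>)))" for r q' \<omega>
      define g where "g m t = of_int m * h" for m :: int and t :: int
      define gd where "gd kk = dl (\<lambda>i. of_int (kk i) * h)" for kk :: "'i \<Rightarrow> int"
      \<comment> \<open>The integer range gives the polynomial count, while the second condition
        keeps each grid point within one mesh of the cube, so that its shifts obey the bound
        \<open>(D + h) * y t\<close>.\<close>
      define Q where "Q = {j \<in> {-K..K}. \<bar>of_int j * h\<bar> \<le> D + h}"
      define Gr where "Gr = {-K..K} \<times> PiE (UNIV :: 'i set) (\<lambda>_. Q)"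
      have "finite Q" by (rule finite_subset[of _ "{-K..K}"]) (auto simp: Q_def)
      then have Gr: "finite Gr" unfolding Gr_def by (intro finite_cartesian_product finite_PiE) auto
      have cardGr: "real (card Gr) \<le> (2 * (real n)\<^sup>2 + 3) ^ Suc CARD('i)"
      proof -
        have "card Q \<le> card {-K..K}" unfolding Q_def by (rule card_mono) auto
        then have "card Gr \<le> card {-K..K} * card {-K..K} ^ CARD('i)"
          unfolding Gr_def by (simp add: card_cartesian_product card_PiE power_mono)
        also have "card {-K..K} = 2 * n\<^sup>2 + 3"
          unfolding K_def by (simp add: nat_add_distrib nat_mult_distrib nat_power_eq)
        finally have "real (card Gr) \<le> real ((2 * n\<^sup>2 + 3) * (2 * n\<^sup>2 + 3) ^ CARD('i))" by (rule of_nat_mono)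
        then show ?thesis by simp
      qed
      \<comment> \<open>\<open>lo z\<close> and \<open>up z\<close> bracket \<open>u + dl th\<close> whenever \<open>u\<close> and \<open>th\<close> lie in the cell of the grid point \<open>z\<close>.\<close>
      define up where "up z t = g (fst z + 1) t + gd (snd z) t + h * y t" for z t
      define lo where "lo z t = g (fst z) t + gd (snd z) t - h * y t" for z t
      \<comment> \<open>The upper bracket is compared with the left end of the cell of
        \<open>u\<close> and the lower one with the right end, because the subtracted indicator at
        \<open>u\<close> must be replaced in the opposite direction.\<close>
      define Eu where "Eu z = {\<omega> \<in> space M. \<tau> / 4 * S \<le> \<bar>M' (up z) (g (fst z)) \<omega>\<bar>}" for z
      define El where "El z = {\<omega> \<in> space M. \<tau> / 4 * S \<le> \<bar>M' (lo z) (g (fst z + 1)) \<omega>\<bar>}" for z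
      have [measurable]: "Eu z \<in> events" "El z \<in> events" for z unfolding Eu_def El_def M'_def by measurable
      let ?e = "2 * exp (CV - c * sqrt (sqrt (real n)))"
      have exp_bound: "prob {\<omega> \<in> space M. \<tau> / 4 * S \<le> \<bar>M' r q' \<omega>\<bar>} \<le> ?e"
        if le: "\<And>t. \<bar>r t - q' t\<bar> \<le> h + (D + 2 * h) * y t" for r q'
      proof -
        \<comment> \<open>Balances the exponent: the variance term stays bounded while the deviation
          term grows like \<open>sqrt S\<close>.\<close>
        define l where "l = 1 / sqrt S"
        have l: "0 < l" "l \<le> 1" "l\<^sup>2 * S = 1" "l * S = sqrt S"
          using S1 by (simp_all add: l_def power_divide real_div_sqrt)
        have "(\<Sum>t=1..int n. \<bar>r t - q' t\<bar>) \<le> (\<Sum>t=1..int n. h + (D + 2 * h) * y t)" by (rule sum_mono) (rule le)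
        also have "\<dots> = h * real n + (D + 2 * h) * (\<Sum>t=1..int n. y t)" by (simp only: sum.distrib sum_distrib_left[symmetric]) simp
        also have "\<dots> \<le> 1 + (D + 2 * h) * (q * (real n * B))"
          unfolding h(2) using y1 D h by (intro add_left_mono mult_left_mono) auto
        also have "\<dots> = 1 + q * B * (B * S + 2)" using n by (simp add: D_def h_def field_simps)
        also have "\<dots> \<le> S + q * B * (B * S + 2 * S)" using S1 q B by (intro add_mono mult_left_mono) auto
        also have "\<dots> = (1 + q * B * (B + 2)) * S" by (simp add: algebra_simps)
        finally have sum: "(\<Sum>t=1..int n. \<bar>r t - q' t\<bar>) \<le> (1 + q * B * (B + 2)) * S" .
        have "l\<^sup>2 * C1 * (\<Sum>t=1..int n. \<bar>r t - q' t\<bar>) \<le> l\<^sup>2 * C1 * ((1 + q * B * (B + 2)) * S)"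
          using sum C1_nonneg by (intro mult_left_mono) auto
        also have "\<dots> = (l\<^sup>2 * S) * CV" by (simp add: CV_def mult_ac)
        finally have V: "l\<^sup>2 * C1 * (\<Sum>t=1..int n. \<bar>r t - q' t\<bar>) \<le> CV" using l by simp
        have "l * (\<tau> / 4 * S) = \<tau> / 4 * (l * S)" by (simp add: mult_ac)
        also have "\<dots> = \<tau> / 4 * sqrt S" using l by simp
        also have "\<tau> / 4 * sqrt S \<ge> \<tau> / 4 * sqrt (sqrt (k * real n))"
          using S_sqrt \<tau> by (intro mult_left_mono) auto
        finally have Y: "c * sqrt (sqrt (real n)) \<le> l * (\<tau> / 4 * S)" by (simp add: c_def real_sqrt_mult mult_ac)
        have "prob {\<omega> \<in> space M. \<tau> / 4 * S \<le> \<bar>M' r q' \<omega>\<bar>} \<le> 2 * exp (l\<^sup>2 * C1 * (\<Sum>t=1..int n. \<bar>r t - q' t\<bar>) - l * (\<tau> / 4 * S))"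
          unfolding M'_def by (rule prob_indicator_increments_le[OF l(1,2)])
        also have "\<dots> \<le> ?e" using V Y by simp
        finally show ?thesis .
      qed
      have gd_le: "\<bar>gd kk t\<bar> \<le> (D + h) * y t" if "kk \<in> PiE UNIV (\<lambda>_. Q)" for kk t
        unfolding gd_def by (rule dl_le) (use that in \<open>auto simp: Q_def PiE_iff\<close>)
      have hy: "0 \<le> h * y t" for t using h y0 by simp
      have pu: "prob (Eu z) \<le> ?e" if "z \<in> Gr" for z
        unfolding Eu_def
      proof (rule exp_bound)
        fix t
        have "\<bar>gd (snd z) t\<bar> \<le> (D + h) * y t" by (rule gd_le) (use that in \<open>auto simp: Gr_def\<close>)
        moreover have "up z t - g (fst z) t = h + gd (snd z) t + h * y t" by (simp add: up_def g_def algebra_simps)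
        ultimately show "\<bar>up z t - g (fst z) t\<bar> \<le> h + (D + 2 * h) * y t"
          using h hy[of t] by (simp add: algebra_simps abs_le_iff)
      qed
      have pl: "prob (El z) \<le> ?e" if "z \<in> Gr" for z
        unfolding El_def
      proof (rule exp_bound)
        fix t
        have "\<bar>gd (snd z) t\<bar> \<le> (D + h) * y t" by (rule gd_le) (use that in \<open>auto simp: Gr_def\<close>)
        moreover have "lo z t - g (fst z + 1) t = - h + gd (snd z) t - h * y t" by (simp add: lo_def g_def algebra_simps)
        ultimately show "\<bar>lo z t - g (fst z + 1) t\<bar> \<le> h + (D + 2 * h) * y t"
          using h hy[of t] by (simp add: algebra_simps abs_le_iff)
      qed
      define Et where "Et = (\<Union>t\<in>{1..int n}. {\<omega> \<in> space M. real n / 2 < \<bar>eps t \<omega>\<bar>})"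
      have [measurable]: "Et \<in> events" unfolding Et_def by measurable
      have pt: "prob Et \<le> p / 3"
      proof -
        have "prob Et \<le> (\<Sum>t\<in>{1..int n}. prob {\<omega> \<in> space M. real n / 2 < \<bar>eps t \<omega>\<bar>})"
          unfolding Et_def by (rule measure_UNION_le) auto
        also have "\<dots> \<le> (\<Sum>t\<in>{1..int n}. T / (real n / 2)\<^sup>2)"
          unfolding T_def using n eps_sq by (intro sum_mono chebyshev_sq) auto
        also have "\<dots> = 4 * T / real n" using n by (simp add: power2_eq_square field_simps)
        finally show ?thesis using elim(3) by simp
      qed
      define good where "good i E \<longleftrightarrow> E \<in> events \<and> prob E \<le> p / (3 * q) \<and>
        (\<forall>\<omega>\<in>space M - E. \<forall>u. \<bar>\<Sum>t=1..int n. Z t i * (g1 (u - eta t \<omega>) - f u)\<bar> \<le> kq * real n)" for i E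
      have "\<exists>E. good i E" for i
        unfolding good_def Bex_def[symmetric] by (rule mp[OF spec[OF elim(6)]]) (rule Z[rule_format])
      then obtain Eg where good: "\<And>i. good i (Eg i)" by metis
      have Eg: "Eg i \<in> events" "prob (Eg i) \<le> p / (3 * q)"
        "\<omega> \<in> space M - Eg i \<Longrightarrow> \<bar>\<Sum>t=1..int n. Z t i * (g1 (u - eta t \<omega>) - f u)\<bar> \<le> kq * real n" for i \<omega> u
        using good[of i] unfolding good_def by blast+
      note [measurable] = Eg(1)
      define E where "E = ((\<Union>z\<in>Gr. Eu z) \<union> (\<Union>z\<in>Gr. El z)) \<union> (Et \<union> (\<Union>i\<in>UNIV. Eg i))"
      have mU: "(\<Union>z\<in>Gr. Eu z) \<in> events" "(\<Union>z\<in>Gr. El z) \<in> events" "(\<Union>i\<in>UNIV. Eg i) \<in> events"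
        using Gr Eg(1) by auto
      have E: "E \<in> events" unfolding E_def using mU by auto
      have "prob E \<le> ((\<Sum>z\<in>Gr. prob (Eu z)) + (\<Sum>z\<in>Gr. prob (El z))) + (prob Et + (\<Sum>i\<in>UNIV. prob (Eg i)))"
        unfolding E_def using mU Gr Eg(1)
        by (intro order.trans[OF measure_Un_le] add_mono measure_UNION_le order.refl) auto
      also have "\<dots> \<le> ((\<Sum>z\<in>Gr. ?e) + (\<Sum>z\<in>Gr. ?e)) + (p / 3 + (\<Sum>i\<in>(UNIV::'i set). p / (3 * q)))"
        by (intro add_mono sum_mono pu pl pt Eg(2))
      also have "\<dots> = real (card Gr) * (4 * exp (CV - c * sqrt (sqrt (real n)))) + (p / 3 + p / 3)"
        using q by (simp add: q_def)
      also have "\<dots> \<le> (2 * (real n)\<^sup>2 + 3) ^ Suc CARD('i) * (4 * exp (CV - c * sqrt (sqrt (real n)))) + (p / 3 + p / 3)"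
        by (intro add_right_mono mult_right_mono cardGr) simp
      also have "\<dots> \<le> p" using elim(1) by (simp add: mult_ac)
      finally have pE: "prob E \<le> p" .
      have "\<bar>\<Sum>t=1..int n. of_bool (eps t \<omega> \<le> u + dl th t) - of_bool (eps t \<omega> \<le> u) - dl th t * f u\<bar> \<le> \<tau> * S"
        if \<omega>: "\<omega> \<in> space M - E" and th: "\<forall>i. \<bar>th i\<bar> \<le> D" for \<omega> u th
      \<comment> \<open>Beyond \<open>n\<close> the noise is within n/2 and the shifts are within
        n/4, so no indicator changes. Only the linear term remains, and there \<open>f\<close> is
        small.\<close>
      proof (cases "\<bar>u\<bar> \<le> real n")
        case False
        have eps: "\<bar>eps t \<omega>\<bar> \<le> real n / 2" if "t \<in> {1..int n}" for t
          using \<omega> that by (force simp: E_def Et_def not_less)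
        have dn: "\<bar>dl th t\<bar> \<le> real n / 4" if t: "t \<in> {1..int n}" for t
        proof -
          have "\<bar>dl th t\<bar> \<le> D * y t" using dl_le[of th D t] th by blast
          also have "\<dots> \<le> D * (q * B * sqrt (real n))" by (rule mult_left_mono[OF y_max[OF t] D])
          also have "\<dots> \<le> B * (q * B * sqrt (real n))"
          proof (rule mult_right_mono)
            have "B * S / real n \<le> B * real n / real n" using Sn B n by (intro divide_right_mono mult_left_mono) auto
            then show "D \<le> B" using n by (simp add: D_def)
          qed (use q B in simp)
          also have "\<dots> \<le> real n / 4" using elim(5) by (simp add: power2_eq_square mult_ac)
          finally show ?thesis .
        qed
        have ind: "of_bool (eps t \<omega> \<le> u + dl th t) = (of_bool (eps t \<omega> \<le> u) :: real)" if t: "t \<in> {1..int n}" for t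
        proof (cases "0 \<le> u")
          case True
          then have "eps t \<omega> \<le> u + dl th t" "eps t \<omega> \<le> u" using False eps[OF t] dn[OF t] n by linarith+
          then show ?thesis by simp
        next
          case neg: False
          then have "\<not> eps t \<omega> \<le> u + dl th t" "\<not> eps t \<omega> \<le> u" using False eps[OF t] dn[OF t] n by linarith+
          then show ?thesis by simp
        qed
        have "\<bar>\<Sum>t=1..int n. of_bool (eps t \<omega> \<le> u + dl th t) - of_bool (eps t \<omega> \<le> u) - dl th t * f u\<bar> =
            \<bar>\<Sum>t=1..int n. dl th t * f u\<bar>" by (simp add: ind sum_negf)
        also have "\<dots> \<le> (\<Sum>t=1..int n. D * y t * (\<tau> / (q * B\<^sup>2)))"
        proof (rule order.trans[OF sum_abs], rule sum_mono)
          fix t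
          have "\<bar>dl th t\<bar> \<le> D * y t" using dl_le[of th D t] th by blast
          moreover have "\<bar>f u\<bar> \<le> \<tau> / (q * B\<^sup>2)" using Af[of u] False elim(5) by simp
          ultimately show "\<bar>dl th t * f u\<bar> \<le> D * y t * (\<tau> / (q * B\<^sup>2))"
            unfolding abs_mult using D y0[of t] by (intro mult_mono) auto
        qed
        also have "\<dots> = D * (\<tau> / (q * B\<^sup>2)) * (\<Sum>t=1..int n. y t)"
          unfolding sum_distrib_left by (intro sum.cong) (simp_all add: mult_ac)
        also have "\<dots> \<le> D * (\<tau> / (q * B\<^sup>2)) * (q * (real n * B))"
          using y1 D \<tau> q by (intro mult_left_mono) auto
        also have "\<dots> = \<tau> * S" using B q n by (simp add: D_def power2_eq_square)
        finally show ?thesis .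
      next
        case True
        define m where "m = \<lfloor>u / h\<rfloor>"
        define kk where "kk i = \<lfloor>th i / h\<rfloor>" for i
        have "of_int m \<le> u / h" "u / h < of_int m + 1" unfolding m_def by linarith+
        then have m: "g m t \<le> u" "u < g (m + 1) t" "g (m + 1) t = g m t + h" for t
          using h by (simp_all add: g_def field_simps)
        have kk: "of_int (kk i) * h \<le> th i" "th i < of_int (kk i) * h + h" for i
        proof -
          have "of_int (kk i) \<le> th i / h" "th i / h < of_int (kk i) + 1" unfolding kk_def by linarith+
          then show "of_int (kk i) * h \<le> th i" "th i < of_int (kk i) * h + h" using h by (simp_all add: field_simps)
        qed
        have rK: "of_int K = (real n)\<^sup>2 + 1" by (simp add: K_def)
        have zK: "j \<in> {-K..K}" if "\<bar>of_int j\<bar> \<le> (real n)\<^sup>2 + 1" for j :: int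
        proof -
          have "of_int \<bar>j\<bar> \<le> (of_int K :: real)" using that unfolding rK by simp
          then show ?thesis unfolding of_int_le_iff by auto
        qed
        have mK: "m \<in> {-K..K}"
        proof (rule zK)
          have "\<bar>u / h\<bar> \<le> real n * real n" using True n by (simp add: h_def abs_mult mult_right_mono)
          then show "\<bar>of_int m\<bar> \<le> (real n)\<^sup>2 + 1"
            using \<open>of_int m \<le> u / h\<close> \<open>u / h < of_int m + 1\<close> unfolding power2_eq_square by linarith
        qed
        have kQ: "kk i \<in> Q" for i
        proof -
          have 1: "\<bar>of_int (kk i) * h\<bar> \<le> D + h" using kk[of i] th[rule_format, of i] h by linarith
          have "\<bar>of_int (kk i)\<bar> * h \<le> D + h" using 1 h by (simp add: abs_mult)
          then have "\<bar>of_int (kk i)\<bar> * h * real n \<le> (D + h) * real n" using n by (intro mult_right_mono) auto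
          also have "(D + h) * real n = B * S + 1" using n by (simp add: D_def h_def field_simps)
          also have "\<dots> \<le> real n * real n + 1" using Sn n by (smt (verit) mult_le_cancel_left1)
          finally have "\<bar>of_int (kk i)\<bar> \<le> (real n)\<^sup>2 + 1" using h by (simp add: mult.assoc power2_eq_square)
          from zK[OF this] 1 show ?thesis by (simp add: Q_def)
        qed
        have z: "(m, kk) \<in> Gr" using mK kQ by (simp add: Gr_def PiE_iff)
        have gdl: "\<bar>dl th t - gd kk t\<bar> \<le> h * y t" for t
          unfolding gd_def
        proof (rule dl_diff)
          fix i show "\<bar>th i - of_int (kk i) * h\<bar> \<le> h" using kk[of i] by linarith
        qed
        have Mu: "\<bar>M' (up (m, kk)) (g m) \<omega>\<bar> < \<tau> / 4 * S" and Ml: "\<bar>M' (lo (m, kk)) (g (m + 1)) \<omega>\<bar> < \<tau> / 4 * S"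
          using \<omega> z by (force simp: E_def Eu_def El_def not_le)+
        \<comment> \<open>\<open>I\<close> is compared with its conditional expectation
          \<open>J\<close>, this with the first-order sum in \<open>g1\<close>, and that with
          \<open>L\<close>. The errors are 3/8, 1/8 and 1/4 of \<open>\<tau> * S\<close>, in total
          less than the whole.\<close>
        define I where "I = (\<Sum>t=1..int n. of_bool (eps t \<omega> \<le> u + dl th t) - of_bool (eps t \<omega> \<le> u) :: real)"
        define J where "J = (\<Sum>t=1..int n. G (u + dl th t - eta t \<omega>) - G (u - eta t \<omega>))"
        define L where "L = (\<Sum>t=1..int n. dl th t * f u)"
        \<comment> \<open>Cost of returning from the brackets to \<open>u\<close> and
          \<open>th\<close> inside \<open>G\<close>. The cells have mesh 1/n, so the total over
          \<open>n\<close> times is bounded, and \<open>S\<close> is eventually large.\<close>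
        have slack: "(\<Sum>t=1..int n. C1 * (2 * h + 2 * h * y t)) \<le> \<tau> / 8 * S"
        proof -
          have "(\<Sum>t=1..int n. C1 * (2 * h + 2 * h * y t)) = C1 * (2 * (h * real n) + 2 * h * (\<Sum>t=1..int n. y t))"
            by (simp only: sum_distrib_left[symmetric] sum.distrib) simp
          also have "\<dots> \<le> C1 * (2 * (h * real n) + 2 * h * (q * (real n * B)))"
            using y1 h C1_nonneg by (intro mult_left_mono add_left_mono) auto
          also have "\<dots> = C1 * (2 + 2 * q * B)" using n by (simp add: h_def field_simps)
          also have "\<dots> \<le> \<tau> / 8 * S" using S_C \<tau> by (simp add: field_simps)
          finally show ?thesis .
        qed
        have upper: "I \<le> \<tau> / 4 * S + J + \<tau> / 8 * S"
        proof -
          have "I \<le> (\<Sum>t=1..int n. of_bool (eps t \<omega> \<le> up (m, kk) t) - of_bool (eps t \<omega> \<le> g m t))"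
            unfolding I_def
          proof (rule sum_mono)
            fix t
            have "u + dl th t \<le> up (m, kk) t" using m[of t] gdl[of t] by (simp add: up_def abs_le_iff)
            then show "of_bool (eps t \<omega> \<le> u + dl th t) - of_bool (eps t \<omega> \<le> u) \<le>
                (of_bool (eps t \<omega> \<le> up (m, kk) t) - of_bool (eps t \<omega> \<le> g m t) :: real)"
              using m(1)[of t] by (auto simp: of_bool_def)
          qed
          also have "\<dots> = M' (up (m, kk)) (g m) \<omega> + (\<Sum>t=1..int n. G (up (m, kk) t - eta t \<omega>) - G (g m t - eta t \<omega>))"
            unfolding M'_def by (simp add: sum_subtractf)
          also have "(\<Sum>t=1..int n. G (up (m, kk) t - eta t \<omega>) - G (g m t - eta t \<omega>)) \<le>
              (\<Sum>t=1..int n. (G (u + dl th t - eta t \<omega>) - G (u - eta t \<omega>)) + C1 * (2 * h + 2 * h * y t))"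
          proof (rule sum_mono)
            fix t
            have 1: "\<bar>G (up (m, kk) t - eta t \<omega>) - G (u + dl th t - eta t \<omega>)\<bar> \<le> C1 * \<bar>up (m, kk) t - (u + dl th t)\<bar>"
            proof -
              have e: "up (m, kk) t - eta t \<omega> - (u + dl th t - eta t \<omega>) = up (m, kk) t - (u + dl th t)" by simp
              show ?thesis using G_lipschitz[of "up (m, kk) t - eta t \<omega>" "u + dl th t - eta t \<omega>"] unfolding e .
            qed
            have 2: "\<bar>up (m, kk) t - (u + dl th t)\<bar> \<le> h + 2 * h * y t"
              using m[of t] gdl[of t] hy[of t] by (simp add: up_def abs_le_iff)
            have 3: "\<bar>G (u - eta t \<omega>) - G (g m t - eta t \<omega>)\<bar> \<le> C1 * \<bar>u - g m t\<bar>"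
              using G_lipschitz[of "u - eta t \<omega>" "g m t - eta t \<omega>"] by simp
            have 4: "\<bar>u - g m t\<bar> \<le> h" using m[of t] by simp
            have "C1 * \<bar>up (m, kk) t - (u + dl th t)\<bar> + C1 * \<bar>u - g m t\<bar> \<le> C1 * (2 * h + 2 * h * y t)"
              unfolding distrib_left[symmetric] by (rule mult_left_mono[OF _ C1_nonneg]) (use 2 4 in linarith)
            with 1 3 show "G (up (m, kk) t - eta t \<omega>) - G (g m t - eta t \<omega>) \<le>
               (G (u + dl th t - eta t \<omega>) - G (u - eta t \<omega>)) + C1 * (2 * h + 2 * h * y t)" by linarith
          qed
          also have "\<dots> = J + (\<Sum>t=1..int n. C1 * (2 * h + 2 * h * y t))" unfolding J_def by (rule sum.distrib)
          finally show ?thesis using Mu slack by linarith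
        qed
        have lower: "I \<ge> - (\<tau> / 4 * S) + J - \<tau> / 8 * S"
        proof -
          have "I \<ge> (\<Sum>t=1..int n. of_bool (eps t \<omega> \<le> lo (m, kk) t) - of_bool (eps t \<omega> \<le> g (m + 1) t))"
            unfolding I_def
          proof (rule sum_mono)
            fix t
            have "lo (m, kk) t \<le> u + dl th t" using m[of t] gdl[of t] by (simp add: lo_def abs_le_iff)
            then show "(of_bool (eps t \<omega> \<le> lo (m, kk) t) - of_bool (eps t \<omega> \<le> g (m + 1) t) :: real) \<le>
                of_bool (eps t \<omega> \<le> u + dl th t) - of_bool (eps t \<omega> \<le> u)"
              using m(2)[of t] by (auto simp: of_bool_def)
          qed
          moreover have "(\<Sum>t=1..int n. of_bool (eps t \<omega> \<le> lo (m, kk) t) - of_bool (eps t \<omega> \<le> g (m + 1) t)) =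
              M' (lo (m, kk)) (g (m + 1)) \<omega> + (\<Sum>t=1..int n. G (lo (m, kk) t - eta t \<omega>) - G (g (m + 1) t - eta t \<omega>))"
            unfolding M'_def by (simp add: sum_subtractf)
          moreover have "(\<Sum>t=1..int n. G (lo (m, kk) t - eta t \<omega>) - G (g (m + 1) t - eta t \<omega>)) \<ge>
              (\<Sum>t=1..int n. (G (u + dl th t - eta t \<omega>) - G (u - eta t \<omega>)) - C1 * (2 * h + 2 * h * y t))"
          proof (rule sum_mono)
            fix t
            have 1: "\<bar>G (lo (m, kk) t - eta t \<omega>) - G (u + dl th t - eta t \<omega>)\<bar> \<le> C1 * \<bar>lo (m, kk) t - (u + dl th t)\<bar>"
            proof -
              have e: "lo (m, kk) t - eta t \<omega> - (u + dl th t - eta t \<omega>) = lo (m, kk) t - (u + dl th t)" by simp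
              show ?thesis using G_lipschitz[of "lo (m, kk) t - eta t \<omega>" "u + dl th t - eta t \<omega>"] unfolding e .
            qed
            have 2: "\<bar>lo (m, kk) t - (u + dl th t)\<bar> \<le> h + 2 * h * y t"
              using m[of t] gdl[of t] hy[of t] by (simp add: lo_def abs_le_iff)
            have 3: "\<bar>G (u - eta t \<omega>) - G (g (m + 1) t - eta t \<omega>)\<bar> \<le> C1 * \<bar>u - g (m + 1) t\<bar>"
              using G_lipschitz[of "u - eta t \<omega>" "g (m + 1) t - eta t \<omega>"] by simp
            have 4: "\<bar>u - g (m + 1) t\<bar> \<le> h" using m[of t] by simp
            have "C1 * \<bar>lo (m, kk) t - (u + dl th t)\<bar> + C1 * \<bar>u - g (m + 1) t\<bar> \<le> C1 * (2 * h + 2 * h * y t)"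
              unfolding distrib_left[symmetric] by (rule mult_left_mono[OF _ C1_nonneg]) (use 2 4 in linarith)
            with 1 3 show "(G (u + dl th t - eta t \<omega>) - G (u - eta t \<omega>)) - C1 * (2 * h + 2 * h * y t) \<le>
               G (lo (m, kk) t - eta t \<omega>) - G (g (m + 1) t - eta t \<omega>)" by linarith
          qed
          moreover have "(\<Sum>t=1..int n. (G (u + dl th t - eta t \<omega>) - G (u - eta t \<omega>)) - C1 * (2 * h + 2 * h * y t)) =
              J - (\<Sum>t=1..int n. C1 * (2 * h + 2 * h * y t))" unfolding J_def by (rule sum_subtractf)
          ultimately show ?thesis using Ml slack by linarith
        qed
        \<comment> \<open>The second-order remainders sum to a multiple of
          \<open>S\<^sup>2 / n\<close>, which is small against \<open>S\<close> by the last part of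
          \<open>Sn\<close>.\<close>
        have J: "\<bar>J - (\<Sum>t=1..int n. dl th t * g1 (u - eta t \<omega>))\<bar> \<le> \<tau> / 8 * S"
        proof -
          have "\<bar>J - (\<Sum>t=1..int n. dl th t * g1 (u - eta t \<omega>))\<bar> \<le> (\<Sum>t=1..int n. C2 * D\<^sup>2 * (y t)\<^sup>2)"
            unfolding J_def sum_subtractf[symmetric]
          proof (rule order.trans[OF sum_abs], rule sum_mono)
            fix t
            have e: "u + dl th t - eta t \<omega> = u - eta t \<omega> + dl th t" by simp
            have "\<bar>G (u + dl th t - eta t \<omega>) - G (u - eta t \<omega>) - dl th t * g1 (u - eta t \<omega>)\<bar> \<le> C2 * (dl th t)\<^sup>2"
              unfolding e by (rule second_order_remainder[OF deriv_G g1_lipschitz])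
            also have "(dl th t)\<^sup>2 \<le> (D * y t)\<^sup>2"
              using dl_le[of th D t] th D y0[of t] by (simp add: abs_le_square_iff[symmetric])
            then have "C2 * (dl th t)\<^sup>2 \<le> C2 * D\<^sup>2 * (y t)\<^sup>2"
              using C2_nonneg by (simp add: power_mult_distrib mult_left_mono mult.assoc)
            finally show "\<bar>G (u + dl th t - eta t \<omega>) - G (u - eta t \<omega>) - dl th t * g1 (u - eta t \<omega>)\<bar> \<le> C2 * D\<^sup>2 * (y t)\<^sup>2" .
          qed
          also have "\<dots> = C2 * D\<^sup>2 * (\<Sum>t=1..int n. (y t)\<^sup>2)" by (simp add: sum_distrib_left)
          also have "\<dots> \<le> C2 * D\<^sup>2 * (q\<^sup>2 * (real n * B\<^sup>2))" using y2 C2_nonneg by (intro mult_left_mono) auto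
          also have "\<dots> = C2 * q\<^sup>2 * B ^ 4 * S * S / real n"
            using n by (simp add: D_def power2_eq_square power4_eq_xxxx field_simps)
          also have "\<dots> \<le> \<tau> / 8 * real n * S / real n"
            using Sn(3) S1 n by (intro divide_right_mono mult_right_mono) auto
          finally show ?thesis using n by simp
        qed
        \<comment> \<open>Interchanging sums isolates, for every regressor, one weighted law of
          large numbers that does not involve \<open>th\<close>; this gives uniformity in the
          coefficients.\<close>
        have L: "\<bar>(\<Sum>t=1..int n. dl th t * g1 (u - eta t \<omega>)) - L\<bar> \<le> \<tau> / 4 * S"
        proof -
          have "(\<Sum>t=1..int n. dl th t * g1 (u - eta t \<omega>)) - L = (\<Sum>t=1..int n. \<Sum>i\<in>UNIV. th i * (Z t i * (g1 (u - eta t \<omega>) - f u)))"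
            unfolding L_def dl_def sum_subtractf[symmetric]
            by (intro sum.cong) (simp_all add: sum_distrib_right right_diff_distrib sum_subtractf mult.assoc)
          also have "\<dots> = (\<Sum>i\<in>UNIV. th i * (\<Sum>t=1..int n. Z t i * (g1 (u - eta t \<omega>) - f u)))"
            by (subst sum.swap) (simp add: sum_distrib_left)
          finally have eq: "(\<Sum>t=1..int n. dl th t * g1 (u - eta t \<omega>)) - L = (\<Sum>i\<in>UNIV. th i * (\<Sum>t=1..int n. Z t i * (g1 (u - eta t \<omega>) - f u)))" .
          have "\<bar>(\<Sum>t=1..int n. dl th t * g1 (u - eta t \<omega>)) - L\<bar> \<le> (\<Sum>i\<in>(UNIV::'i set). D * (kq * real n))"
            unfolding eq
          proof (rule order.trans[OF sum_abs], rule sum_mono)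
            fix i
            have "\<omega> \<in> space M - Eg i" using \<omega> by (auto simp: E_def)
            from Eg(3)[OF this] show "\<bar>th i * (\<Sum>t=1..int n. Z t i * (g1 (u - eta t \<omega>) - f u))\<bar> \<le> D * (kq * real n)"
              unfolding abs_mult using th D by (intro mult_mono) auto
          qed
          also have "\<dots> = \<tau> / 4 * S" using n q B by (simp add: D_def kq_def q_def)
          finally show ?thesis .
        qed
        have "0 \<le> \<tau> * S" using \<tau> S1 by simp
        moreover have "(\<Sum>t=1..int n. of_bool (eps t \<omega> \<le> u + dl th t) - of_bool (eps t \<omega> \<le> u) - dl th t * f u) = I - L"
          unfolding I_def L_def by (rule sum_subtractf)
        moreover have "\<tau> / 4 * S = \<tau> * S / 4" "\<tau> / 8 * S = \<tau> * S / 8" by simp_all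
        ultimately show ?thesis using upper lower J L by linarith
      qed
      then show "\<exists>E\<in>events. prob E \<le> p \<and> (\<forall>\<omega>\<in>space M - E. \<forall>u th. (\<forall>i. \<bar>th i\<bar> \<le> B * s n / real n) \<longrightarrow>
        \<bar>\<Sum>t=1..int n. of_bool (eps t \<omega> \<le> u + (\<Sum>i\<in>UNIV. th i * Z t i)) - of_bool (eps t \<omega> \<le> u)
           - (\<Sum>i\<in>UNIV. th i * Z t i) * f u\<bar> \<le> \<tau> * s n)"
        using E pE unfolding dl_def D_def S_def by blast
    qed
  qed
qed

end

section \<open>Growth of the variance of partial sums\<close>

lemma sym_sum_convergent:
  fixes c :: "int \<Rightarrow> real"
  assumes bound: "\<And>n. (\<Sum>j=-int n..int n. \<bar>c j\<bar>) \<le> A"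
  shows "convergent (\<lambda>m. \<Sum>j=-int m..int m. c j)"
proof -
  have "Cauchy (\<lambda>m. \<Sum>j=-int m..int m. c j)"
  proof (rule CauchyI')
    fix k :: real assume "0 < k"
    obtain m where m: "\<forall>n\<ge>m. (\<Sum>j\<in>{-int n..int n} - {-int m..int m}. \<bar>c j\<bar>) < k"
      using sym_sum_tail[OF bound \<open>0 < k\<close>] by blast
    have "dist (\<Sum>j=-int p..int p. c j) (\<Sum>j=-int q..int q. c j) < k" if "p \<ge> m" "q > p" for p q
    proof -
      have "(\<Sum>j=-int q..int q. c j) - (\<Sum>j=-int p..int p. c j) = (\<Sum>j\<in>{-int q..int q} - {-int p..int p}. c j)"
        by (rule sum_diff[symmetric]) (use that in auto)
      moreover have "\<bar>\<Sum>j\<in>{-int q..int q} - {-int p..int p}. c j\<bar> \<le> (\<Sum>j\<in>{-int q..int q} - {-int p..int p}. \<bar>c j\<bar>)"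
        by (rule sum_abs)
      moreover have "\<dots> \<le> (\<Sum>j\<in>{-int q..int q} - {-int m..int m}. \<bar>c j\<bar>)"
        by (rule sum_mono2) (use that in auto)
      moreover have "\<dots> < k" using m that by auto
      ultimately show ?thesis unfolding dist_real_def by linarith
    qed
    then show "\<exists>M. \<forall>p\<ge>M. \<forall>q>p. dist (\<Sum>j=-int p..int p. c j) (\<Sum>j=-int q..int q. c j) < k" by blast
  qed
  then show ?thesis by (simp add: Cauchy_convergent_iff)
qed

lemma toeplitz_sum_eq:
  fixes f :: "int \<Rightarrow> real"
  shows "(\<Sum>t=1..int n. \<Sum>s=1..int n. f (t - s)) = (\<Sum>j=-int n..int n. (real n - real_of_int \<bar>j\<bar>) * f j)"
proof -
  let ?T = "\<lambda>j. {t \<in> {1..int n}. t - j \<in> {1..int n}}"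
  have card: "real (card (?T j)) = real n - real_of_int \<bar>j\<bar>" if "j \<in> {-int n..int n}" for j
  proof -
    have "?T j = {max 1 (1 + j)..min (int n) (int n + j)}" by auto
    then show ?thesis using that by (auto simp: max_def min_def)
  qed
  have "(\<Sum>t=1..int n. \<Sum>s=1..int n. f (t - s)) = (\<Sum>(t, s)\<in>{1..int n} \<times> {1..int n}. f (t - s))"
    by (simp add: sum.cartesian_product)
  also have "\<dots> = (\<Sum>(j, t)\<in>(SIGMA j:{-int n..int n}. ?T j). f j)"
    by (rule sum.reindex_bij_witness[of _ "\<lambda>(j, t). (t, t - j)" "\<lambda>(t, s). (t - s, t)"]) auto
  also have "\<dots> = (\<Sum>j=-int n..int n. \<Sum>t\<in>?T j. f j)"
    by (rule sum.Sigma[symmetric]) (auto intro: finite_subset[of _ "{1..int n}"])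
  also have "\<dots> = (\<Sum>j=-int n..int n. (real n - real_of_int \<bar>j\<bar>) * f j)"
    by (rule sum.cong) (simp_all only: sum_constant card)
  finally show ?thesis .
qed

lemma sum_symmetric_le:
  fixes f :: "int \<Rightarrow> real"
  assumes "\<And>j. f (- j) = f j"
  shows "(\<Sum>j=-int n..int n. \<bar>f j\<bar>) \<le> 2 * (\<Sum>d\<le>n. \<bar>f (int d)\<bar>)"
proof -
  have pos: "(\<Sum>j=0..int n. \<bar>f j\<bar>) = (\<Sum>d\<le>n. \<bar>f (int d)\<bar>)"
    by (rule sum.reindex_bij_witness[of _ int nat]) auto
  have neg: "(\<Sum>j=-int n..0. \<bar>f j\<bar>) = (\<Sum>d\<le>n. \<bar>f (int d)\<bar>)"
    by (rule sum.reindex_bij_witness[of _ "\<lambda>d. - int d" "\<lambda>j. nat (- j)"]) (auto simp: assms)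
  have "(\<Sum>j=-int n..int n. \<bar>f j\<bar>) \<le> (\<Sum>j\<in>{-int n..0} \<union> {0..int n}. \<bar>f j\<bar>)"
    by (rule sum_mono2) auto
  also have "\<dots> \<le> (\<Sum>j=-int n..0. \<bar>f j\<bar>) + (\<Sum>j=0..int n. \<bar>f j\<bar>)"
    by (subst sum_Un) (auto intro!: sum_nonneg)
  finally show ?thesis using pos neg by simp
qed

context innovations
begin

text \<open>Weak stationarity: the series of coefficient products representing the covariance does
  not contain the time, and symmetry covers negative lags.\<close>

lemma expectation_linear_process_mult:
  assumes b: "summable (\<lambda>i. (b i)\<^sup>2)"
  shows "expectation (\<lambda>\<omega>. linear_process b e t \<omega> * linear_process b e s \<omega>) = noise_autocov M (linear_process b e) (t - s)"
proof -
  let ?c = "\<lambda>t s. expectation (\<lambda>\<omega>. linear_process b e t \<omega> * linear_process b e s \<omega>)"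
  have sym: "?c t s = ?c s t" for t s by (simp add: mult.commute)
  have pos: "?c s (s + int d) = ?c 0 (int d)" for s d
    using sums_unique2[OF linear_process_autocov_sums[OF b, of d s] linear_process_autocov_sums[OF b, of d 0]] by simp
  show ?thesis
  proof (cases "s \<le> t")
    case True
    then have "?c t s = ?c 0 (int (nat (t - s)))" using pos[of s "nat (t - s)"] sym by simp
    then show ?thesis using True by (simp add: noise_autocov_def)
  next
    case False
    then have "?c t s = ?c 0 (int (nat (s - t)))" using pos[of t "nat (s - t)"] by simp
    moreover have "?c 0 (t - s) = ?c 0 (int (nat (s - t)))" using pos[of "t - s" "nat (s - t)"] sym[of 0 "t - s"] False by simp
    ultimately show ?thesis by (simp add: noise_autocov_def)
  qed
qed

lemma noise_autocov_minus:
  assumes b: "summable (\<lambda>i. (b i)\<^sup>2)"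
  shows "noise_autocov M (linear_process b e) (- j) = noise_autocov M (linear_process b e) j"
  using expectation_linear_process_mult[OF b, of 0 j] expectation_linear_process_mult[OF b, of j 0]
  by (simp add: mult.commute)

lemma noise_autocov_sums:
  assumes b: "summable (\<lambda>i. (b i)\<^sup>2)"
  shows "(\<lambda>i. s2 * (b i * b (i + d))) sums noise_autocov M (linear_process b e) (int d)"
  using linear_process_autocov_sums[OF b, of d 0] by (simp add: noise_autocov_def)

lemma expectation_weighted_sum_sq:
  fixes w :: "int \<Rightarrow> real"
  assumes b: "summable (\<lambda>i. (b i)\<^sup>2)"
  shows "integrable M (\<lambda>\<omega>. (\<Sum>t=1..int n. w t * linear_process b e t \<omega>)\<^sup>2)"
    and "expectation (\<lambda>\<omega>. (\<Sum>t=1..int n. w t * linear_process b e t \<omega>)\<^sup>2) =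
      (\<Sum>t=1..int n. \<Sum>s=1..int n. noise_autocov M (linear_process b e) (t - s) * w t * w s)"
proof -
  have eq: "(\<Sum>t=1..int n. w t * linear_process b e t \<omega>)\<^sup>2 =
      (\<Sum>t=1..int n. \<Sum>s=1..int n. w t * w s * (linear_process b e t \<omega> * linear_process b e s \<omega>))" for \<omega>
    unfolding power2_eq_square sum_product by (intro sum.cong) auto
  have int: "integrable M (\<lambda>\<omega>. linear_process b e t \<omega> * linear_process b e s \<omega>)" for t s
    by (rule integrable_mult_square_integrable) (auto intro: integrable_linear_process_sq b)
  show "integrable M (\<lambda>\<omega>. (\<Sum>t=1..int n. w t * linear_process b e t \<omega>)\<^sup>2)" unfolding eq using int by auto
  show "expectation (\<lambda>\<omega>. (\<Sum>t=1..int n. w t * linear_process b e t \<omega>)\<^sup>2) =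
      (\<Sum>t=1..int n. \<Sum>s=1..int n. noise_autocov M (linear_process b e) (t - s) * w t * w s)"
    unfolding eq using int by (simp add: expectation_linear_process_mult[OF b] mult_ac)
qed

lemma partial_sum_sd_sq:
  assumes b: "summable (\<lambda>i. (b i)\<^sup>2)"
  shows "(partial_sum_sd M (linear_process b e) n)\<^sup>2 = expectation (\<lambda>\<omega>. (\<Sum>t=1..int n. linear_process b e t \<omega>)\<^sup>2)"
    and "(partial_sum_sd M (linear_process b e) n)\<^sup>2 =
      (\<Sum>t=1..int n. \<Sum>s=1..int n. noise_autocov M (linear_process b e) (t - s))"
proof -
  have "expectation (\<lambda>\<omega>. \<Sum>t=1..int n. linear_process b e t \<omega>) = 0"
    using integrable_linear_process[OF b] by (simp add: expectation_linear_process[OF b])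
  then show *: "(partial_sum_sd M (linear_process b e) n)\<^sup>2 = expectation (\<lambda>\<omega>. (\<Sum>t=1..int n. linear_process b e t \<omega>)\<^sup>2)"
    unfolding partial_sum_sd_def by (simp add: Bochner_Integration.integral_nonneg)
  show "(partial_sum_sd M (linear_process b e) n)\<^sup>2 =
      (\<Sum>t=1..int n. \<Sum>s=1..int n. noise_autocov M (linear_process b e) (t - s))"
    unfolding * using expectation_weighted_sum_sq(2)[OF b, where n=n and w="\<lambda>_. 1"] by simp
qed

lemma noise_autocov_tendsto_0:
  assumes b: "summable (\<lambda>i. (b i)\<^sup>2)" and "0 < k"
  shows "\<exists>J. \<forall>j. \<bar>j\<bar> \<ge> J \<longrightarrow> \<bar>noise_autocov M (linear_process b e) j\<bar> < k"
proof -
  let ?B = "\<lambda>m. 2 * 1\<^sup>2 * s2 * sqrt (tail_sq b 0) * sqrt (tail_sq b m)"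
  have "?B \<longlonglongrightarrow> 2 * 1\<^sup>2 * s2 * sqrt (tail_sq b 0) * sqrt 0"
    by (intro tendsto_intros tail_sq_tendsto_0 b)
  then have "eventually (\<lambda>m. ?B m < k) sequentially" by (rule order_tendstoD) (use \<open>0 < k\<close> in simp)
  then obtain m where m: "?B m < k" by (auto simp: eventually_sequentially)
  have "\<bar>noise_autocov M (linear_process b e) j\<bar> < k" if "int m \<le> \<bar>j\<bar>" for j
    using cov_lipschitz_linear_process_le[OF b, of "\<lambda>x. x" 1 m 0 j] that m
    by (simp add: expectation_linear_process[OF b] noise_autocov_def)
  then show ?thesis by blast
qed

lemma partial_sum_sd_over_n:
  assumes b: "summable (\<lambda>i. (b i)\<^sup>2)"
  shows "(\<lambda>n. partial_sum_sd M (linear_process b e) n / real n) \<longlonglongrightarrow> 0"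
proof (rule tendsto_0_le[where K=1])
  let ?g = "noise_autocov M (linear_process b e)" and ?sd = "partial_sum_sd M (linear_process b e)"
  let ?A = "\<lambda>n. \<Sum>j=-int n..int n. \<bar>?g j\<bar>"
  have "(\<lambda>n. sqrt (?A n / real n)) \<longlonglongrightarrow> sqrt 0"
    by (intro tendsto_real_sqrt cesaro_abs_null noise_autocov_tendsto_0 b)
  then show "(\<lambda>n. sqrt (?A n / real n)) \<longlonglongrightarrow> 0" by simp
  have "norm (?sd n / real n) \<le> norm (sqrt (?A n / real n)) * 1" if "n > 0" for n
  proof -
    have "(?sd n)\<^sup>2 \<le> ?A n * real n"
      using toeplitz_quad_le[where f="?g" and n=n and u="\<lambda>_. 1"] by (simp add: partial_sum_sd_sq(2)[OF b])
    then have "(?sd n / real n)\<^sup>2 \<le> ?A n / real n" using that by (simp add: power_divide power2_eq_square field_simps)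
    then have "\<bar>?sd n / real n\<bar> \<le> sqrt (?A n / real n)" by (rule real_le_rsqrt[of "\<bar>_\<bar>", unfolded power2_abs])
    then show ?thesis by simp
  qed
  then show "eventually (\<lambda>n. norm (?sd n / real n) \<le> norm (sqrt (?A n / real n)) * 1) sequentially"
    by (auto simp: eventually_sequentially intro!: exI[of _ 1])
qed

text \<open>Absolutely summable coefficients have absolutely summable autocovariances. Hence the
  variance divided by \<open>n\<close> converges to their sum, positive by assumption, and
  everything compared here is of order \<open>n\<close>.\<close>

lemma growth_short_memory:
  assumes b: "summable (\<lambda>i. (b i)\<^sup>2)" and abs: "summable (\<lambda>i. \<bar>b i\<bar>)"
    and pos: "0 < long_run_sd M (linear_process b e)"
  shows "\<exists>k>0. \<exists>C. eventually (\<lambda>n. k * real n \<le> (partial_sum_sd M (linear_process b e) n)\<^sup>2 \<and>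
    real n * (\<Sum>j=-int n..int n. \<bar>noise_autocov M (linear_process b e) j\<bar>) \<le> C * (partial_sum_sd M (linear_process b e) n)\<^sup>2) sequentially"
proof -
  let ?g = "noise_autocov M (linear_process b e)" and ?sd = "partial_sum_sd M (linear_process b e)"
  let ?A = "\<lambda>n. \<Sum>j=-int n..int n. \<bar>?g j\<bar>"
  let ?S = "\<Sum>i. \<bar>b i\<bar>"
  have gle: "(\<Sum>d\<le>n. \<bar>?g (int d)\<bar>) \<le> s2 * ?S * ?S" for n
  proof -
    \<comment> \<open>Truncating in \<open>i\<close> makes both sums finite and their interchange
      free; the bound does not depend on \<open>m\<close> and passes to the limit.\<close>
    have partial: "(\<Sum>d\<le>n. \<bar>\<Sum>i<m. s2 * (b i * b (i + d))\<bar>) \<le> s2 * ?S * ?S" for m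
    proof -
      have "(\<Sum>d\<le>n. \<bar>\<Sum>i<m. s2 * (b i * b (i + d))\<bar>) \<le> (\<Sum>d\<le>n. \<Sum>i<m. s2 * (\<bar>b i\<bar> * \<bar>b (i + d)\<bar>))"
        using s2_nonneg by (intro sum_mono order.trans[OF sum_abs]) (simp add: abs_mult)
      also have "\<dots> = (\<Sum>i<m. s2 * \<bar>b i\<bar> * (\<Sum>d\<le>n. \<bar>b (i + d)\<bar>))"
        by (subst sum.swap) (simp add: sum_distrib_left mult.assoc)
      also have "\<dots> \<le> (\<Sum>i<m. s2 * \<bar>b i\<bar> * ?S)"
      proof (intro sum_mono mult_left_mono)
        fix i
        have "(\<Sum>d\<le>n. \<bar>b (i + d)\<bar>) = (\<Sum>d\<in>(+) i ` {..n}. \<bar>b d\<bar>)" by (subst sum.reindex) auto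
        also have "\<dots> \<le> ?S" by (rule sum_le_suminf[OF abs]) auto
        finally show "(\<Sum>d\<le>n. \<bar>b (i + d)\<bar>) \<le> ?S" .
      qed (use s2_nonneg in auto)
      also have "\<dots> = s2 * (\<Sum>i<m. \<bar>b i\<bar>) * ?S" by (simp add: sum_distrib_left sum_distrib_right)
      also have "\<dots> \<le> s2 * ?S * ?S"
        using s2_nonneg suminf_nonneg[OF abs] by (intro mult_right_mono mult_left_mono sum_le_suminf[OF abs]) auto
      finally show ?thesis .
    qed
    have "(\<lambda>m. \<Sum>d\<le>n. \<bar>\<Sum>i<m. s2 * (b i * b (i + d))\<bar>) \<longlonglongrightarrow> (\<Sum>d\<le>n. \<bar>?g (int d)\<bar>)"
      using noise_autocov_sums[OF b] unfolding sums_def by (intro tendsto_intros)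
    then show ?thesis by (rule LIMSEQ_le_const2) (use partial in blast)
  qed
  have A: "?A n \<le> 2 * (s2 * ?S * ?S)" for n
    using sum_symmetric_le[of ?g n, OF noise_autocov_minus[OF b]] gle[of n] by linarith
  have conv: "convergent (\<lambda>m. \<Sum>j=-int m..int m. ?g j)" by (rule sym_sum_convergent[OF A])
  then obtain V where V: "(\<lambda>m. \<Sum>j=-int m..int m. ?g j) \<longlonglongrightarrow> V" by (auto simp: convergent_def)
  \<comment> \<open>The stochastic averaging lemma is applied to deterministic summands, all equal
    to 1.\<close>
  have "(\<lambda>n. expectation (\<lambda>\<omega>. \<bar>(\<Sum>t=1..int n. \<Sum>s=1..int n. ?g (t - s) * 1) / real n - V\<bar>)) \<longlonglongrightarrow> 0"
  proof (rule toeplitz_L1[OF A, where C=1 and G="\<lambda>_. 1"])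
    fix j :: int
    have "eventually (\<lambda>n. expectation (\<lambda>\<omega>. \<bar>(\<Sum>t=1..int n. 1) / real n - 1\<bar>) = 0) sequentially"
      by (auto simp: eventually_sequentially intro!: exI[of _ 1])
    then show "(\<lambda>n. expectation (\<lambda>\<omega>. \<bar>(\<Sum>t=1..int n. 1) / real n - 1\<bar>)) \<longlonglongrightarrow> 0" by (rule tendsto_eventually)
  qed (use V in \<open>simp_all add: prob_space\<close>)
  then have "(\<lambda>n. \<bar>(?sd n)\<^sup>2 / real n - V\<bar>) \<longlonglongrightarrow> 0" by (simp add: partial_sum_sd_sq(2)[OF b] prob_space)
  then have lim: "(\<lambda>n. (?sd n)\<^sup>2 / real n) \<longlonglongrightarrow> V" by (simp add: tendsto_rabs_zero_iff LIM_zero_iff)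
  then have "V > 0" using pos by (simp add: long_run_sd_def limI)
  have "eventually (\<lambda>n. V / 2 < (?sd n)\<^sup>2 / real n) sequentially"
    by (rule order_tendstoD(1)[OF lim]) (use \<open>V > 0\<close> in simp)
  then have "eventually (\<lambda>n. V / 2 * real n \<le> (?sd n)\<^sup>2 \<and>
    real n * ?A n \<le> 2 * (s2 * ?S * ?S) * (2 / V) * (?sd n)\<^sup>2) sequentially"
    using eventually_gt_at_top[of 0]
  proof eventually_elim
    case (elim n)
    then have le: "V / 2 * real n \<le> (?sd n)\<^sup>2" by (simp add: field_simps)
    have "real n * ?A n \<le> real n * (2 * (s2 * ?S * ?S))" using A by (intro mult_left_mono) auto
    also have "\<dots> = 2 * (s2 * ?S * ?S) * (2 / V) * (V / 2 * real n)" using \<open>V > 0\<close> by simp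
    also have "\<dots> \<le> 2 * (s2 * ?S * ?S) * (2 / V) * (?sd n)\<^sup>2"
      using le \<open>V > 0\<close> s2_nonneg suminf_nonneg[OF abs] by (intro mult_left_mono) auto
    finally show ?case using le by simp
  qed
  then show ?thesis using \<open>V > 0\<close> by (intro exI[of _ "V / 2"] conjI exI[of _ "2 * (s2 * ?S * ?S) * (2 / V)"]) simp_all
qed

text \<open>For a fixed number of terms, \<open>b (i + d)\<close> is comparable with
  \<open>b d\<close>, so these terms give about \<open>b d\<close> times a partial sum of
  \<open>b\<close>. As that sum diverges, it outweighs the initial coefficients of unknown sign; all
  later terms are positive.\<close>

lemma noise_autocov_lower_bound:
  assumes b: "summable (\<lambda>i. (b i)\<^sup>2)" and pos: "\<And>i. k0 \<le> i \<Longrightarrow> 0 < b i"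
    and ratio: "(\<lambda>i. b (Suc i) / b i) \<longlonglongrightarrow> 1" and div: "\<not> summable b"
  shows "eventually (\<lambda>d. s2 * (b d / 2) \<le> noise_autocov M (linear_process b e) (int d)) sequentially"
proof -
  define B where "B = (\<Sum>i<k0. \<bar>b i\<bar>)"
  have B: "0 \<le> B" by (simp add: B_def sum_nonneg)
  \<comment> \<open>The initial terms lose at most \<open>2 * B * b d\<close>; a partial sum of
    \<open>4 * B + 1\<close>, times \<open>b d / 2\<close>, covers this loss and leaves
    \<open>b d / 2\<close>.\<close>
  have "\<exists>K\<ge>k0. 4 * B + 1 \<le> (\<Sum>i=k0..<K. b i)"
  proof (rule ccontr)
    assume no: "\<not> ?thesis"
    have lt: "(\<Sum>i=k0..<K. b i) < 4 * B + 1" if "k0 \<le> K" for K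
    proof (rule ccontr)
      assume "\<not> ?thesis"
      then have "4 * B + 1 \<le> (\<Sum>i=k0..<K. b i)" by simp
      with no that show False by blast
    qed
    have "summable (\<lambda>i. b (i + k0))"
    proof (rule summableI_nonneg_bounded)
      show "0 \<le> b (i + k0)" for i using pos[of "i + k0"] by simp
      show "(\<Sum>i<n. b (i + k0)) \<le> 4 * B + 1" for n
        using less_imp_le[OF lt[of "n + k0"]] sum.shift_bounds_nat_ivl[of b 0 k0 n] by (simp add: atLeast0LessThan)
    qed
    then show False using div by (simp add: summable_iff_shift)
  qed
  then obtain K where K: "k0 \<le> K" "4 * B + 1 \<le> (\<Sum>i=k0..<K. b i)" by blast
  have shift: "(\<lambda>d. b (i + d) / b d) \<longlonglongrightarrow> 1" for i
  proof (induction i)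
    case 0
    have "eventually (\<lambda>d. b (0 + d) / b d = 1) sequentially"
      using pos by (auto simp: eventually_sequentially intro!: exI[of _ k0]) force
    then show ?case by (rule tendsto_eventually)
  next
    case (Suc i)
    have "(\<lambda>d. b (Suc (d + i)) / b (d + i)) \<longlonglongrightarrow> 1" by (rule LIMSEQ_ignore_initial_segment[OF ratio])
    from tendsto_mult[OF this Suc]
    have "(\<lambda>d. b (Suc (d + i)) / b (d + i) * (b (i + d) / b d)) \<longlonglongrightarrow> 1" by simp
    moreover have "eventually (\<lambda>d. b (Suc (d + i)) / b (d + i) * (b (i + d) / b d) = b (Suc i + d) / b d) sequentially"
      unfolding eventually_sequentially
    proof (intro exI allI impI)
      fix d assume "k0 \<le> d"
      then have "b (d + i) > 0" using pos by simp
      then show "b (Suc (d + i)) / b (d + i) * (b (i + d) / b d) = b (Suc i + d) / b d" by (simp add: add.commute)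
    qed
    ultimately show ?case by (rule Lim_transform_eventually)
  qed
  have "eventually (\<lambda>d. 1 / 2 < b (i + d) / b d \<and> b (i + d) / b d < 2) sequentially" for i
    by (intro eventually_conj order_tendstoD(1)[OF shift] order_tendstoD(2)[OF shift]) simp_all
  then have "eventually (\<lambda>d. \<forall>i<K. 1 / 2 < b (i + d) / b d \<and> b (i + d) / b d < 2) sequentially"
    by (subst eventually_ball_finite_distrib[of "{..<K}", simplified lessThan_iff[symmetric] Ball_def, simplified]) auto
  then show ?thesis using eventually_ge_at_top[of k0]
  proof eventually_elim
    case (elim d)
    then have bd: "0 < b d" using pos by simp
    have near: "b d / 2 \<le> b (i + d)" "b (i + d) \<le> 2 * b d" "0 \<le> b (i + d)" if "i < K" for i
      using elim(1)[rule_format, OF that] bd by (auto simp: field_simps)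
    have main: "b d / 2 \<le> (\<Sum>i<K. b i * b (i + d))"
    proof -
      have "(\<Sum>i<K. b i * b (i + d)) = (\<Sum>i<k0. b i * b (i + d)) + (\<Sum>i=k0..<K. b i * b (i + d))"
        using sum.atLeastLessThan_concat[of 0 k0 K "\<lambda>i. b i * b (i + d)"] K by (simp add: atLeast0LessThan)
      moreover have "(\<Sum>i<k0. b i * b (i + d)) \<ge> (\<Sum>i<k0. - (\<bar>b i\<bar> * (2 * b d)))"
      proof (rule sum_mono)
        fix i assume "i \<in> {..<k0}"
        then have "i < K" using K by simp
        have "\<bar>b i * b (i + d)\<bar> \<le> \<bar>b i\<bar> * (2 * b d)" using near[OF \<open>i < K\<close>] by (simp add: abs_mult mult_left_mono)
        then show "- (\<bar>b i\<bar> * (2 * b d)) \<le> b i * b (i + d)" by linarith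
      qed
      then have "(\<Sum>i<k0. b i * b (i + d)) \<ge> - (B * (2 * b d))" by (simp add: sum_negf B_def sum_distrib_right)
      moreover have "(\<Sum>i=k0..<K. b i * b (i + d)) \<ge> (\<Sum>i=k0..<K. b i * (b d / 2))"
        using near pos by (intro sum_mono mult_left_mono) (auto intro: less_imp_le)
      then have "(\<Sum>i=k0..<K. b i * b (i + d)) \<ge> (\<Sum>i=k0..<K. b i) * (b d / 2)" unfolding sum_distrib_right .
      moreover have "(\<Sum>i=k0..<K. b i) * (b d / 2) \<ge> (4 * B + 1) * (b d / 2)" using K bd by (intro mult_right_mono) auto
      moreover have "(4 * B + 1) * (b d / 2) = B * (2 * b d) + b d / 2" by (simp add: algebra_simps)
      ultimately show ?thesis by linarith
    qed
    have "s2 * (b d / 2) \<le> (\<Sum>i<m. s2 * (b i * b (i + d)))" if m: "m \<ge> K" for m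
    proof -
      have "(\<Sum>i<m. b i * b (i + d)) = (\<Sum>i<K. b i * b (i + d)) + (\<Sum>i=K..<m. b i * b (i + d))"
        using sum.atLeastLessThan_concat[of 0 K m "\<lambda>i. b i * b (i + d)"] m by (simp add: atLeast0LessThan)
      moreover have "0 \<le> (\<Sum>i=K..<m. b i * b (i + d))"
        using pos K by (intro sum_nonneg mult_nonneg_nonneg) (auto intro!: less_imp_le)
      ultimately have "b d / 2 \<le> (\<Sum>i<m. b i * b (i + d))" using main by linarith
      then show ?thesis unfolding sum_distrib_left[symmetric] by (rule mult_left_mono[OF _ s2_nonneg])
    qed
    then show ?case
      using noise_autocov_sums[OF b, of d] unfolding sums_def by (intro LIMSEQ_le_const) blast+
  qed
qed

text \<open>Beyond a finite lag no cancellation occurs, so absolute and signed autocovariance sums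
  are comparable. The triangular weights of the variance are at least \<open>n\<close> on lags up to
  \<open>n\<close> if the sample has length \<open>2 * n\<close>; doubling the sample then costs
  only a factor 4.\<close>

lemma growth_long_memory:
  assumes b: "summable (\<lambda>i. (b i)\<^sup>2)" and pos: "\<And>i. k0 \<le> i \<Longrightarrow> 0 < b i"
    and ratio: "(\<lambda>i. b (Suc i) / b i) \<longlonglongrightarrow> 1" and div: "\<not> summable b" and s2: "0 < s2"
  shows "\<exists>k>0. \<exists>C. eventually (\<lambda>n. k * real n \<le> (partial_sum_sd M (linear_process b e) n)\<^sup>2 \<and>
    real n * (\<Sum>j=-int n..int n. \<bar>noise_autocov M (linear_process b e) j\<bar>) \<le> C * (partial_sum_sd M (linear_process b e) n)\<^sup>2) sequentially"
proof -
  let ?g = "noise_autocov M (linear_process b e)" and ?sd = "partial_sum_sd M (linear_process b e)"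
  let ?A = "\<lambda>n. \<Sum>j=-int n..int n. \<bar>?g j\<bar>"
  obtain d0 where d0: "\<And>d. d \<ge> d0 \<Longrightarrow> s2 * (b d / 2) \<le> ?g (int d)"
    using noise_autocov_lower_bound[OF assms(1-4)] by (auto simp: eventually_sequentially)
  define D where "D = max d0 k0"
  have gpos: "0 \<le> ?g j" if "\<bar>j\<bar> \<ge> int D" for j
  proof -
    have "0 < b (nat \<bar>j\<bar>)" using that by (intro pos) (auto simp: D_def)
    then have "0 \<le> s2 * (b (nat \<bar>j\<bar>) / 2)" using s2 by simp
    also have "\<dots> \<le> ?g \<bar>j\<bar>" using d0[of "nat \<bar>j\<bar>"] that by (simp add: D_def)
    also have "?g \<bar>j\<bar> = ?g j" using noise_autocov_minus[OF b, of j] by (simp add: abs_if)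
    finally show ?thesis .
  qed
  define K where "K = ?A D"
  have K: "0 \<le> K" by (simp add: K_def sum_nonneg)
  \<comment> \<open>At the finitely many lags up to \<open>D\<close> the sign is unknown: the target
    has \<open>n\<close> and the weighted term may be as low as minus \<open>2 * n\<close> times the
    absolute value, hence the factor 3.\<close>
  have lower: "real n * (?A n - 3 * K) \<le> (?sd (2 * n))\<^sup>2" for n
  proof -
    have "real n * ?A n \<le> (\<Sum>j=-int (2 * n)..int (2 * n). if j \<in> {-int n..int n} then real n * \<bar>?g j\<bar> else 0)"
      by (subst sum.inter_restrict[symmetric]) (auto simp: sum_distrib_left intro!: sum_mono2)
    also have "\<dots> \<le> (\<Sum>j=-int (2 * n)..int (2 * n). (real (2 * n) - real_of_int \<bar>j\<bar>) * ?g j +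
        (if j \<in> {-int D..int D} then 3 * real n * \<bar>?g j\<bar> else 0))"
    proof (rule sum_mono)
      fix j assume j: "j \<in> {-int (2 * n)..int (2 * n)}"
      show "(if j \<in> {-int n..int n} then real n * \<bar>?g j\<bar> else 0) \<le> (real (2 * n) - real_of_int \<bar>j\<bar>) * ?g j +
        (if j \<in> {-int D..int D} then 3 * real n * \<bar>?g j\<bar> else 0)"
      proof (cases "j \<in> {-int D..int D}")
        case True
        have "- (2 * real n * \<bar>?g j\<bar>) \<le> (real (2 * n) - real_of_int \<bar>j\<bar>) * ?g j"
        proof -
          have "\<bar>(real (2 * n) - real_of_int \<bar>j\<bar>) * ?g j\<bar> = (real (2 * n) - real_of_int \<bar>j\<bar>) * \<bar>?g j\<bar>"
          proof -
            have "\<bar>j\<bar> \<le> int (2 * n)" using j by auto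
            then have "real_of_int \<bar>j\<bar> \<le> real_of_int (int (2 * n))" by (rule of_int_le_iff[THEN iffD2])
            then show ?thesis by (simp add: abs_mult)
          qed
          also have "\<dots> \<le> 2 * real n * \<bar>?g j\<bar>" by (rule mult_right_mono) auto
          finally show ?thesis by linarith
        qed
        moreover have "(if j \<in> {-int n..int n} then real n * \<bar>?g j\<bar> else 0) \<le> real n * \<bar>?g j\<bar>" by simp
        ultimately show ?thesis using True by simp
      next
        case False
        then have g0: "0 \<le> ?g j" by (intro gpos) auto
        have "(if j \<in> {-int n..int n} then real n * \<bar>?g j\<bar> else 0) \<le> (real (2 * n) - real_of_int \<bar>j\<bar>) * ?g j"
          using g0 j by (auto intro!: mult_right_mono)
        then show ?thesis unfolding if_not_P[OF False] by simp
      qed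
    qed
    also have "\<dots> = (?sd (2 * n))\<^sup>2 + (\<Sum>j=-int (2 * n)..int (2 * n). if j \<in> {-int D..int D} then 3 * real n * \<bar>?g j\<bar> else 0)"
      unfolding partial_sum_sd_sq(2)[OF b] toeplitz_sum_eq by (rule sum.distrib)
    also have "(\<Sum>j=-int (2 * n)..int (2 * n). if j \<in> {-int D..int D} then 3 * real n * \<bar>?g j\<bar> else 0) \<le> 3 * real n * K"
      unfolding K_def sum_distrib_left by (subst sum.inter_restrict[symmetric]) (auto intro!: sum_mono2)
    finally show ?thesis by (simp add: algebra_simps)
  qed
  \<comment> \<open>The two halves of the longer sample have the same second moment by
    stationarity.\<close>
  have upper: "(?sd (2 * n))\<^sup>2 \<le> 4 * (?sd n)\<^sup>2" for n
  proof -
    let ?P = "\<lambda>\<omega>. \<Sum>t=1..int n. linear_process b e t \<omega>" and ?Q = "\<lambda>\<omega>. \<Sum>t=1..int n. linear_process b e (t + int n) \<omega>"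
    have split: "(\<Sum>t=1..int (2 * n). linear_process b e t \<omega>) = ?P \<omega> + ?Q \<omega>" for \<omega>
    proof -
      have "{1..int (2 * n)} = {1..int n} \<union> {int n + 1..2 * int n}" by auto
      then have "(\<Sum>t=1..int (2 * n). linear_process b e t \<omega>) = ?P \<omega> + (\<Sum>t=int n + 1..2 * int n. linear_process b e t \<omega>)"
        by (simp only:) (rule sum.union_disjoint, auto)
      also have "(\<Sum>t=int n + 1..2 * int n. linear_process b e t \<omega>) = ?Q \<omega>"
        by (rule sum.reindex_bij_witness[of _ "\<lambda>t. t + int n" "\<lambda>t. t - int n"]) auto
      finally show ?thesis .
    qed
    have int: "integrable M (\<lambda>\<omega>. linear_process b e t \<omega> * linear_process b e s \<omega>)" for t s
      by (rule integrable_mult_square_integrable) (auto intro: integrable_linear_process_sq b)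
    have P: "integrable M (\<lambda>\<omega>. (?P \<omega>)\<^sup>2)" "expectation (\<lambda>\<omega>. (?P \<omega>)\<^sup>2) = (?sd n)\<^sup>2"
      using expectation_weighted_sum_sq(1)[OF b, where n=n and w="\<lambda>_. 1"] partial_sum_sd_sq(1)[OF b, of n] by simp_all
    have Q: "integrable M (\<lambda>\<omega>. (?Q \<omega>)\<^sup>2)" "expectation (\<lambda>\<omega>. (?Q \<omega>)\<^sup>2) = (?sd n)\<^sup>2"
    proof -
      have eq: "(?Q \<omega>)\<^sup>2 = (\<Sum>t=1..int n. \<Sum>s=1..int n. linear_process b e (t + int n) \<omega> * linear_process b e (s + int n) \<omega>)" for \<omega>
        unfolding power2_eq_square sum_product ..
      show "integrable M (\<lambda>\<omega>. (?Q \<omega>)\<^sup>2)" unfolding eq using int by auto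
      show "expectation (\<lambda>\<omega>. (?Q \<omega>)\<^sup>2) = (?sd n)\<^sup>2"
        unfolding eq partial_sum_sd_sq(2)[OF b] using int by (simp add: expectation_linear_process_mult[OF b])
    qed
    have "(?sd (2 * n))\<^sup>2 = expectation (\<lambda>\<omega>. (?P \<omega> + ?Q \<omega>)\<^sup>2)"
      unfolding partial_sum_sd_sq(1)[OF b] split ..
    also have "\<dots> \<le> expectation (\<lambda>\<omega>. 2 * (?P \<omega>)\<^sup>2 + 2 * (?Q \<omega>)\<^sup>2)"
    proof (rule integral_mono)
      show "integrable M (\<lambda>\<omega>. (?P \<omega> + ?Q \<omega>)\<^sup>2)"
        using expectation_weighted_sum_sq(1)[OF b, where n="2 * n" and w="\<lambda>_. 1"] split by simp
      show "integrable M (\<lambda>\<omega>. 2 * (?P \<omega>)\<^sup>2 + 2 * (?Q \<omega>)\<^sup>2)" using P Q by simp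
      fix \<omega>
      have "0 \<le> (?P \<omega> - ?Q \<omega>)\<^sup>2" by simp
      then show "(?P \<omega> + ?Q \<omega>)\<^sup>2 \<le> 2 * (?P \<omega>)\<^sup>2 + 2 * (?Q \<omega>)\<^sup>2"
        by (simp add: power2_diff power2_sum)
    qed
    also have "\<dots> = 4 * (?sd n)\<^sup>2" using P Q by simp
    finally show ?thesis .
  qed
  \<comment> \<open>The autocovariances dominate \<open>b\<close>, whose sum diverges. Hence the
    correction \<open>3 * K\<close> is eventually at most half of \<open>?A n\<close>, and
    \<open>?A n\<close> is at least 1, which also yields linear growth of the variance.\<close>
  have large: "eventually (\<lambda>n. 6 * K + 1 \<le> ?A n) sequentially"
  proof (rule ccontr)
    assume "\<not> ?thesis"
    then have "\<forall>N. \<exists>n\<ge>N. ?A n < 6 * K + 1" by (auto simp: eventually_sequentially not_le)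
    moreover have mono: "?A m \<le> ?A n" if "m \<le> n" for m n using that by (intro sum_mono2) auto
    ultimately have bd: "?A n \<le> 6 * K + 1" for n by (meson less_imp_le order_trans)
    have "summable (\<lambda>i. b (i + D))"
    proof (rule summableI_nonneg_bounded)
      show "0 \<le> b (i + D)" for i by (rule less_imp_le, rule pos) (simp add: D_def)
      fix n
      have "s2 / 2 * (\<Sum>i<n. b (i + D)) = (\<Sum>i<n. s2 * (b (i + D) / 2))" by (simp add: sum_distrib_left sum_divide_distrib)
      also have "\<dots> \<le> (\<Sum>i<n. \<bar>?g (int (i + D))\<bar>)"
        by (intro sum_mono order.trans[OF d0]) (auto simp: D_def)
      also have "\<dots> = (\<Sum>j\<in>(\<lambda>i. int (i + D)) ` {..<n}. \<bar>?g j\<bar>)" by (subst sum.reindex) (auto simp: inj_on_def)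
      also have "\<dots> \<le> ?A (n + D)" by (rule sum_mono2) auto
      also note bd
      finally show "(\<Sum>i<n. b (i + D)) \<le> (6 * K + 1) / (s2 / 2)" using s2 by (simp add: field_simps)
    qed
    then show False using div by (simp add: summable_iff_shift)
  qed
  have "eventually (\<lambda>n. 1 / 8 * real n \<le> (?sd n)\<^sup>2 \<and> real n * ?A n \<le> 8 * (?sd n)\<^sup>2) sequentially"
    using large
  proof eventually_elim
    case (elim n)
    have "?A n / 2 \<le> ?A n - 3 * K" using elim by linarith
    then have "real n * (?A n / 2) \<le> real n * (?A n - 3 * K)" by (intro mult_left_mono) auto
    then have *: "real n * ?A n \<le> 8 * (?sd n)\<^sup>2" using lower[of n] upper[of n] by linarith
    have "1 \<le> ?A n" using elim K by linarith
    then have "real n * 1 \<le> real n * ?A n" by (intro mult_left_mono) auto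
    then show ?case using * by linarith
  qed
  then show ?thesis by (intro exI[of _ "1/8"] conjI exI[of _ 8]) simp_all
qed

end

section \<open>Cosine series and matrix integrals\<close>

lemma has_integral_cos_multiple:
  "((\<lambda>l. cos (real k * l)) has_integral (if k = 0 then 2 * pi else 0)) {-pi..pi}"
proof (cases "k = 0")
  case True
  then show ?thesis using has_integral_const_real[of "1::real" "-pi" pi] by simp
next
  case False
  have "((\<lambda>l. cos (real k * l)) has_integral (sin (real k * pi) / real k - sin (real k * (- pi)) / real k)) {-pi..pi}"
  proof (rule fundamental_theorem_of_calculus)
    fix x
    have "((\<lambda>l. sin (real k * l) / real k) has_real_derivative cos (real k * x)) (at x within {-pi..pi})"
      using False by (auto intro!: derivative_eq_intros)
    then show "((\<lambda>l. sin (real k * l) / real k) has_vector_derivative cos (real k * x)) (at x within {-pi..pi})"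
      by (rule has_real_derivative_iff_has_vector_derivative[THEN iffD1])
  qed simp
  then show ?thesis using False by (simp add: sin_npi)
qed

lemma cos_times_cos_nat:
  "cos (real j * l) * cos (real k * l) = (cos (real (j + k) * l) + cos (real (if j \<le> k then k - j else j - k) * l)) / 2"
proof -
  have "cos (real j * l - real k * l) = cos (real (if j \<le> k then k - j else j - k) * l)"
  proof (cases "j \<le> k")
    case True
    then have "cos (real j * l - real k * l) = cos (- (real (k - j) * l))" by (simp add: of_nat_diff algebra_simps)
    then show ?thesis using True by (simp only: cos_minus if_True)
  next
    case False
    then show ?thesis by (simp add: of_nat_diff algebra_simps)
  qed
  then show ?thesis by (simp add: cos_times_cos algebra_simps)
qed

lemma has_integral_cos_cos:
  "((\<lambda>l. cos (real j * l) * cos (real k * l)) has_integral (if j = k then if j = 0 then 2 * pi else pi else 0)) {-pi..pi}"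
proof -
  let ?d = "if j \<le> k then k - j else j - k"
  have "((\<lambda>l. (cos (real (j + k) * l) + cos (real ?d * l)) / 2) has_integral
      ((if j + k = 0 then 2 * pi else 0) + (if ?d = 0 then 2 * pi else 0)) / 2) {-pi..pi}"
    by (intro has_integral_divide has_integral_add has_integral_cos_multiple)
  then show ?thesis unfolding cos_times_cos_nat by (rule has_integral_eq_rhs) auto
qed

text \<open>An even continuous function on \<open>[-\<pi>, \<pi>]\<close> is a continuous function of the cosine, which the
  Weierstrass theorem approximates by trigonometric polynomials.\<close>

lemma even_zero_cosine_coefficients:
  fixes h :: "real \<Rightarrow> real"
  assumes cont: "continuous_on {-pi..pi} h" and even: "\<And>l. l \<in> {-pi..pi} \<Longrightarrow> h (- l) = h l"
    and zero: "\<And>k::nat. integral {-pi..pi} (\<lambda>l. h l * cos (real k * l)) = 0" and l: "l \<in> {-pi..pi}"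
  shows "h l = 0"
proof -
  have ci: "continuous_on {-pi..pi} (\<lambda>l. h l * cos l ^ m * cos (real k * l))" for m k
    using cont by (intro continuous_intros)
  then have ii: "(\<lambda>l. h l * cos l ^ m * cos (real k * l)) integrable_on {-pi..pi}" for m k
    by (rule integrable_continuous_real)
  \<comment> \<open>A power of cosine is moved into the frequency one factor at a time by the
    product formula.\<close>
  have pow0: "integral {-pi..pi} (\<lambda>l. h l * cos l ^ m * cos (real k * l)) = 0" for m k
  proof (induction m arbitrary: k)
    case 0
    then show ?case using zero by simp
  next
    case (Suc m)
    have "h l * cos l ^ Suc m * cos (real k * l) =
        (h l * cos l ^ m * cos (real (1 + k) * l) + h l * cos l ^ m * cos (real (if 1 \<le> k then k - 1 else 1 - k) * l)) / 2" for l
    proof -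
      have "h l * cos l ^ Suc m * cos (real k * l) = h l * cos l ^ m * (cos (real 1 * l) * cos (real k * l))" by simp
      then show ?thesis unfolding cos_times_cos_nat by (simp only: times_divide_eq_right distrib_left)
    qed
    moreover have "((\<lambda>l. h l * cos l ^ m * cos (real k' * l)) has_integral 0) {-pi..pi}" for k'
      using integrable_integral[OF ii[of m k']] unfolding Suc.IH .
    then have "((\<lambda>l. (h l * cos l ^ m * cos (real (1 + k) * l) + h l * cos l ^ m * cos (real (if 1 \<le> k then k - 1 else 1 - k) * l)) / 2)
        has_integral (0 + 0) / 2) {-pi..pi}"
      by (intro has_integral_divide has_integral_add)
    ultimately have "((\<lambda>l. h l * cos l ^ Suc m * cos (real k * l)) has_integral (0 + 0) / 2) {-pi..pi}" by (simp only:)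
    then show ?case by (simp add: integral_unique)
  qed
  have pow: "integral {-pi..pi} (\<lambda>l. h l * cos l ^ m) = 0" for m using pow0[of m 0] by simp
  have ip: "(\<lambda>l. h l * cos l ^ m) integrable_on {-pi..pi}" for m using ii[of m 0] by simp
  define g where "g = h \<circ> arccos"
  have g: "h x = g (cos x)" if "x \<in> {-pi..pi}" for x
  proof (cases "0 \<le> x")
    case True
    then show ?thesis using that by (simp add: g_def arccos_cos)
  next
    case False
    then have "arccos (cos x) = - x" using that arccos_cos[of "- x"] by simp
    then show ?thesis using even[OF that] by (simp add: g_def)
  qed
  have cg: "continuous_on {-1..1} g" unfolding g_def
  proof (rule continuous_on_compose)
    show "continuous_on {-1..1} arccos" by (rule continuous_on_arccos')
    have "arccos ` {-1..1} \<subseteq> {-pi..pi}"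
      using arccos_lbound arccos_ubound pi_gt_zero by (force intro: order.trans[of _ 0])
    then show "continuous_on (arccos ` {-1..1}) h" by (rule continuous_on_subset[OF cont])
  qed
  have ih2: "(\<lambda>l. h l * h l) integrable_on {-pi..pi}" "(\<lambda>l. \<bar>h l\<bar>) integrable_on {-pi..pi}"
    using cont by (auto intro!: integrable_continuous_real continuous_intros)
  \<comment> \<open>\<open>h\<close> is orthogonal to every polynomial in the cosine, so subtracting
    one that approximates \<open>h\<close> within \<open>r\<close> does not change the integral of
    the square.\<close>
  have le: "integral {-pi..pi} (\<lambda>l. h l * h l) \<le> r * integral {-pi..pi} (\<lambda>l. \<bar>h l\<bar>)" if r: "0 < r" for r
  proof -
    obtain p where p: "real_polynomial_function p" "\<And>x. x \<in> {-1..1} \<Longrightarrow> \<bar>g x - p x\<bar> < r"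
      using Stone_Weierstrass_real_polynomial_function[of "{-1..1::real}" g r] cg r by auto
    obtain a n where a: "p = (\<lambda>x. \<Sum>i\<le>n. a i * x ^ i)" using p(1) unfolding real_polynomial_function_iff_sum by blast
    have hp: "integral {-pi..pi} (\<lambda>l. h l * p (cos l)) = 0" "(\<lambda>l. h l * p (cos l)) integrable_on {-pi..pi}"
    proof -
      have eq: "h l * p (cos l) = (\<Sum>i\<le>n. a i * (h l * cos l ^ i))" for l
        unfolding a sum_distrib_left by (simp add: mult_ac)
      have "((\<lambda>l. \<Sum>i\<le>n. a i * (h l * cos l ^ i)) has_integral (\<Sum>i\<le>n. a i * 0)) {-pi..pi}"
        using ip pow by (intro has_integral_sum has_integral_mult_right) (auto simp: has_integral_integral)
      then show "integral {-pi..pi} (\<lambda>l. h l * p (cos l)) = 0" "(\<lambda>l. h l * p (cos l)) integrable_on {-pi..pi}"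
        unfolding eq by (auto simp: integral_unique intro: has_integral_integrable)
    qed
    have "integral {-pi..pi} (\<lambda>l. h l * h l) = integral {-pi..pi} (\<lambda>l. h l * h l - h l * p (cos l))"
      using hp ih2 by (simp add: integral_diff)
    also have "\<dots> \<le> integral {-pi..pi} (\<lambda>l. r * \<bar>h l\<bar>)"
    proof (rule integral_le)
      fix x assume x: "x \<in> {-pi..pi}"
      have "h x * h x - h x * p (cos x) = h x * (g (cos x) - p (cos x))" using g[OF x] by (simp add: algebra_simps)
      also have "\<dots> \<le> \<bar>h x\<bar> * \<bar>g (cos x) - p (cos x)\<bar>" by (simp flip: abs_mult)
      also have "\<dots> \<le> \<bar>h x\<bar> * r" using p(2)[of "cos x"] by (intro mult_left_mono) (auto intro: less_imp_le)
      finally show "h x * h x - h x * p (cos x) \<le> r * \<bar>h x\<bar>" by (simp add: mult.commute)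
    qed (use hp ih2 in \<open>auto intro!: integrable_diff integrable_on_mult_right\<close>)
    finally show ?thesis by simp
  qed
  let ?J = "integral {-pi..pi} (\<lambda>l. \<bar>h l\<bar>)"
  have J: "0 \<le> ?J" by (rule integral_nonneg) (use ih2 in auto)
  have "integral {-pi..pi} (\<lambda>l. h l * h l) \<le> 0"
  proof (rule field_le_epsilon)
    fix r :: real assume r: "0 < r"
    have "integral {-pi..pi} (\<lambda>l. h l * h l) \<le> r / (?J + 1) * ?J" by (rule le) (use r J in simp)
    also have "\<dots> \<le> r" using r J by (simp add: field_simps)
    finally show "integral {-pi..pi} (\<lambda>l. h l * h l) \<le> 0 + r" by simp
  qed
  moreover have "0 \<le> integral {-pi..pi} (\<lambda>l. h l * h l)" by (rule integral_nonneg) (use ih2 in auto)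
  ultimately have "integral {-pi..pi} (\<lambda>l. h l * h l) = 0" by simp
  moreover have "(integral {-pi..pi} (\<lambda>l. h l * h l) = 0) = (\<forall>l\<in>{-pi..pi}. h l * h l = 0)"
  proof (rule integral_eq_0_iff)
    show "continuous_on {-pi..pi} (\<lambda>l. h l * h l)" by (intro continuous_on_mult cont)
    show "- pi < pi" using pi_gt_zero by linarith
  qed simp
  ultimately have "h l * h l = 0" using l by blast
  then show ?thesis by simp
qed

lemma continuous_AE_eq_imp_eq:
  fixes f g :: "real \<Rightarrow> real"
  assumes "continuous_on UNIV f" "continuous_on UNIV g" "AE x in lborel. f x = g x"
  shows "f x = g x"
proof (rule ccontr)
  assume ne: "f x \<noteq> g x"
  define U where "U = {x. f x \<noteq> g x}"
  have "open U" unfolding U_def using assms(1,2) by (rule open_Collect_neq)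
  moreover have "x \<in> U" using ne by (simp add: U_def)
  ultimately obtain r where r: "0 < r" "ball x r \<subseteq> U" by (rule openE)
  have "U \<in> null_sets lborel"
    using assms(3) \<open>open U\<close> by (subst AE_iff_null_sets) (auto simp: U_def)
  then have "ball x r \<in> null_sets lborel" by (rule null_sets_subset) (use r in auto)
  then have "emeasure lborel (ball x r) = 0" by (simp add: null_sets_def)
  moreover have "ball x r = {x - r<..<x + r}" by (auto simp: ball_def dist_real_def abs_less_iff)
  ultimately show False using r by simp
qed

text \<open>The series converges uniformly to a continuous even function with the same cosine
  coefficients as \<open>\<phi>c\<close>; their difference vanishes by
  \<open>even_zero_cosine_coefficients\<close>.\<close>

lemma absolutely_convergent_cosine_series:
  fixes \<phi> \<phi>c :: "real \<Rightarrow> real"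
  assumes even: "\<And>l. \<phi> (- l) = \<phi> l" and int: "set_integrable lborel {-pi..pi} \<phi>"
    and ver: "continuous_version \<phi>c \<phi>"
    and sum: "summable (\<lambda>k. \<bar>weight_coeff \<phi> (int k)\<bar>)" and l: "l \<in> {-pi..pi}"
  shows "(\<lambda>k. (if k = 0 then 2 * pi else 4 * pi) * weight_coeff \<phi> (int k) * cos (real k * l)) sums \<phi>c l"
proof -
  \<comment> \<open>The coefficients are normalised by \<open>1 / (2 * pi)\<^sup>2\<close>, whereas
    cosine expansions divide by 2 pi at frequency 0 and by pi elsewhere; the ratios are 2 pi and 4
    pi.\<close>
  define d where "d k = (if k = 0 then 2 * pi else 4 * pi) * weight_coeff \<phi> (int k)" for k
  have sd: "summable (\<lambda>k. \<bar>d k\<bar>)"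
  proof (rule summable_comparison_test'[where g="\<lambda>k. 4 * pi * \<bar>weight_coeff \<phi> (int k)\<bar>" and N=0])
    show "summable (\<lambda>k. 4 * pi * \<bar>weight_coeff \<phi> (int k)\<bar>)" using sum by (rule summable_mult)
  qed (auto simp: d_def abs_mult mult_right_mono)
  define P where "P l = (\<Sum>k. d k * cos (real k * l))" for l
  have bd: "norm (d k * cos (real k * l)) \<le> \<bar>d k\<bar>" for k l
    by (simp add: abs_mult mult_left_le)
  have P_sums: "(\<lambda>k. d k * cos (real k * l)) sums P l" for l
    unfolding P_def by (rule summable_sums, rule summable_comparison_test'[OF sd, of 0]) (rule bd)
  have unif: "uniform_limit UNIV (\<lambda>n l. \<Sum>k<n. d k * cos (real k * l)) P sequentially"
    unfolding P_def[abs_def] by (rule Weierstrass_m_test[OF _ sd]) (rule bd)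
  have cP: "continuous_on UNIV P"
    by (rule uniform_limit_theorem[OF _ unif]) (auto intro!: always_eventually continuous_intros)
  have c\<phi>: "continuous_on UNIV \<phi>c" and ae: "AE l in lborel. \<phi>c l = \<phi> l"
    using ver by (auto simp: continuous_version_def)
  \<comment> \<open>Evenness passes to the continuous version only almost everywhere; continuity
    upgrades it to every point.\<close>
  have even_c: "\<phi>c (- l) = \<phi>c l" for l
  proof (rule continuous_AE_eq_imp_eq[of "\<lambda>l. \<phi>c (- l)" \<phi>c])
    show "continuous_on UNIV (\<lambda>l. \<phi>c (- l))"
      by (rule continuous_on_compose2[OF c\<phi>]) (auto intro!: continuous_intros)
    have "AE l in distr lborel borel uminus. \<phi>c l = \<phi> l" using ae by (subst lborel_distr_uminus)
    then have "AE l in lborel. \<phi>c (- l) = \<phi> (- l)" by (rule AE_distrD[rotated]) simp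
    with ae show "AE l in lborel. \<phi>c (- l) = \<phi>c l" by eventually_elim (simp add: even)
  qed (rule c\<phi>)
  have coeff: "integral {-pi..pi} (\<lambda>l. \<phi>c l * cos (real k * l)) = (2 * pi)\<^sup>2 * weight_coeff \<phi> (int k)" for k
  proof -
    have ic: "set_integrable lborel {-pi..pi} (\<lambda>l. \<phi>c l * cos (real k * l))"
      unfolding set_integrable_def by (rule borel_integrable_compact) (auto intro!: continuous_intros continuous_on_subset[OF c\<phi>])
    have "integral {-pi..pi} (\<lambda>l. \<phi>c l * cos (real k * l)) = (LINT l:{-pi..pi}|lborel. \<phi>c l * cos (real k * l))"
      by (rule set_borel_integral_eq_integral(2)[OF ic, symmetric])
    also have "\<dots> = (LINT l:{-pi..pi}|lborel. \<phi> l * cos (real k * l))"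
      unfolding set_lebesgue_integral_def
    proof (rule integral_cong_AE)
      show "(\<lambda>l. indicat_real {-pi..pi} l *\<^sub>R (\<phi>c l * cos (real k * l))) \<in> borel_measurable lborel"
        using ic unfolding set_integrable_def by (rule borel_measurable_integrable)
      have m: "(\<lambda>l. indicat_real {-pi..pi} l *\<^sub>R \<phi> l) \<in> borel_measurable lborel"
        using int unfolding set_integrable_def by (rule borel_measurable_integrable)
      have "(\<lambda>l. (indicat_real {-pi..pi} l *\<^sub>R \<phi> l) * cos (real k * l)) \<in> borel_measurable lborel"
        using m by measurable
      then show "(\<lambda>l. indicat_real {-pi..pi} l *\<^sub>R (\<phi> l * cos (real k * l))) \<in> borel_measurable lborel"
        by (simp add: mult.assoc)
      show "AE l in lborel. indicat_real {-pi..pi} l *\<^sub>R (\<phi>c l * cos (real k * l)) = indicat_real {-pi..pi} l *\<^sub>R (\<phi> l * cos (real k * l))"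
        using ae by eventually_elim simp
    qed
    finally show ?thesis by (simp add: weight_coeff_def)
  qed
  \<comment> \<open>Uniform convergence permits termwise integration, and orthogonality keeps a
    single term.\<close>
  have coeff_P: "integral {-pi..pi} (\<lambda>l. P l * cos (real j * l)) = (if j = 0 then 2 * pi else pi) * d j" for j
  proof -
    let ?f = "\<lambda>n l. (\<Sum>k<n. d k * cos (real k * l)) * cos (real j * l)"
    have "uniform_limit {-pi..pi} ?f (\<lambda>l. P l * cos (real j * l)) sequentially"
      unfolding uniform_limit_iff
    proof (intro allI impI)
      fix r :: real assume "0 < r"
      then have "eventually (\<lambda>n. \<forall>l\<in>UNIV. dist (\<Sum>k<n. d k * cos (real k * l)) (P l) < r) sequentially"
        using unif unfolding uniform_limit_iff by blast
      then show "eventually (\<lambda>n. \<forall>l\<in>{-pi..pi}. dist (?f n l) (P l * cos (real j * l)) < r) sequentially"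
      proof eventually_elim
        case (elim n)
        show ?case
        proof
          fix l
          have "dist (?f n l) (P l * cos (real j * l)) = dist (\<Sum>k<n. d k * cos (real k * l)) (P l) * \<bar>cos (real j * l)\<bar>"
            by (simp add: dist_real_def abs_mult flip: left_diff_distrib)
          also have "\<dots> \<le> dist (\<Sum>k<n. d k * cos (real k * l)) (P l) * 1" by (rule mult_left_mono) auto
          also have "\<dots> < r" using elim by simp
          finally show "dist (?f n l) (P l * cos (real j * l)) < r" .
        qed
      qed
    qed
    moreover have "continuous_on {-pi..pi} (?f n)" for n by (intro continuous_intros)
    ultimately obtain I J where IJ: "\<And>n. (?f n has_integral I n) {-pi..pi}"
      "((\<lambda>l. P l * cos (real j * l)) has_integral J) {-pi..pi}" "I \<longlonglongrightarrow> J"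
      by (rule uniform_limit_integral) auto
    have "((\<lambda>l. \<Sum>k<n. d k * (cos (real k * l) * cos (real j * l))) has_integral
        (\<Sum>k<n. d k * (if k = j then if k = 0 then 2 * pi else pi else 0))) {-pi..pi}" for n
      by (intro has_integral_sum has_integral_mult_right has_integral_cos_cos) simp
    then have "(?f n has_integral (\<Sum>k<n. d k * (if k = j then if k = 0 then 2 * pi else pi else 0))) {-pi..pi}" for n
      by (simp add: sum_distrib_right mult.assoc)
    then have I: "I n = (\<Sum>k<n. d k * (if k = j then if k = 0 then 2 * pi else pi else 0))" for n
      using IJ(1) has_integral_unique by blast
    have "eventually (\<lambda>n. I n = (if j = 0 then 2 * pi else pi) * d j) sequentially"
      unfolding eventually_sequentially
    proof (intro exI allI impI)
      fix n assume "Suc j \<le> n"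
      have "I n = (\<Sum>k<n. if k = j then (if j = 0 then 2 * pi else pi) * d j else 0)"
        unfolding I by (rule sum.cong) auto
      then show "I n = (if j = 0 then 2 * pi else pi) * d j" using \<open>Suc j \<le> n\<close> by simp
    qed
    then have "I \<longlonglongrightarrow> (if j = 0 then 2 * pi else pi) * d j" by (rule tendsto_eventually)
    then have "J = (if j = 0 then 2 * pi else pi) * d j" by (rule LIMSEQ_unique[OF IJ(3)])
    then show ?thesis using integral_unique[OF IJ(2)] by simp
  qed
  have "\<phi>c l - P l = 0"
  proof (rule even_zero_cosine_coefficients[OF _ _ _ l])
    show "continuous_on {-pi..pi} (\<lambda>l. \<phi>c l - P l)"
      by (intro continuous_intros continuous_on_subset[OF c\<phi>] continuous_on_subset[OF cP]) auto
    show "\<phi>c (- l) - P (- l) = \<phi>c l - P l" for l by (simp add: even_c P_def)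
    fix k
    have "integral {-pi..pi} (\<lambda>l. (\<phi>c l - P l) * cos (real k * l)) =
        integral {-pi..pi} (\<lambda>l. \<phi>c l * cos (real k * l)) - integral {-pi..pi} (\<lambda>l. P l * cos (real k * l))"
      unfolding left_diff_distrib
      by (rule integral_diff) (auto intro!: integrable_continuous_real continuous_intros continuous_on_subset[OF c\<phi>] continuous_on_subset[OF cP])
    also have "\<dots> = 0" unfolding coeff coeff_P by (simp add: d_def power2_eq_square)
    finally show "integral {-pi..pi} (\<lambda>l. (\<phi>c l - P l) * cos (real k * l)) = 0" .
  qed
  then show ?thesis using P_sums[of l] by (simp add: d_def)
qed

lemma weight_coeff_minus: "weight_coeff \<phi> (- j) = weight_coeff \<phi> j"
  by (simp add: weight_coeff_def)

lemma abs_weight_coeff_le: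
  assumes "set_integrable lborel {-pi..pi} \<phi>"
  shows "\<bar>weight_coeff \<phi> j\<bar> \<le> 1 / (2 * pi)\<^sup>2 * (LINT l:{-pi..pi}|lborel. \<bar>\<phi> l\<bar>)"
proof -
  have i: "integrable lborel (\<lambda>l. indicat_real {-pi..pi} l *\<^sub>R \<phi> l)" using assms unfolding set_integrable_def .
  have "\<bar>LINT l:{-pi..pi}|lborel. \<phi> l * cos (of_int j * l)\<bar> \<le> (LINT l:{-pi..pi}|lborel. \<bar>\<phi> l\<bar>)"
    unfolding set_lebesgue_integral_def
  proof (rule order.trans[OF integral_abs_bound], rule integral_mono')
    show "integrable lborel (\<lambda>l. indicat_real {-pi..pi} l *\<^sub>R \<bar>\<phi> l\<bar>)"
      using integrable_abs[OF i] by (simp add: abs_mult)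
    show "\<bar>indicat_real {-pi..pi} l *\<^sub>R (\<phi> l * cos (of_int j * l))\<bar> \<le> indicat_real {-pi..pi} l *\<^sub>R \<bar>\<phi> l\<bar>" for l
      by (auto simp: abs_mult indicator_def intro!: mult_left_le)
  qed (auto simp: indicator_def)
  then show ?thesis unfolding weight_coeff_def abs_mult by (simp add: divide_right_mono)
qed

lemma quad_form_diagonal: "quad_form A (axis j 1) = A $ j $ j"
proof -
  have "quad_form A (axis j 1) = (\<Sum>a\<in>UNIV. if a = j then (\<Sum>b\<in>UNIV. if b = j then A $ a $ b else 0) else 0)"
    unfolding quad_form_def
    by (intro sum.cong refl) (simp add: axis_def if_distrib[where f="\<lambda>x. _ * x"] cong: if_cong)
  then show ?thesis by simp
qed

text \<open>At \<open>w = 1\<close> and \<open>w = \<i>\<close> the transposed entry enters with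
  coefficients 1 and \<open>- \<i>\<close>, so multiplying the second value by \<open>- \<i>\<close>
  and adding cancels it. The diagonal part is then removed.\<close>

lemma quad_form_polarisation:
  fixes A :: "complex ^ 'q ^ 'q"
  assumes "i \<noteq> k"
  shows "A $ i $ k = (quad_form A (axis i 1 + axis k 1) - \<i> * quad_form A (axis i 1 + axis k \<i>)
      - (1 - \<i>) * (quad_form A (axis i 1) + quad_form A (axis k 1))) / 2"
proof -
  have q: "quad_form A (axis i 1 + axis k w) = A $ i $ i + cnj w * w * A $ k $ k + w * A $ i $ k + cnj w * A $ k $ i" for w
  proof -
    let ?z = "axis i 1 + axis k w :: complex ^ 'q"
    have z: "?z $ a = (if a = i then 1 else if a = k then w else 0)" for a using assms by (auto simp: axis_def)
    have s: "(\<Sum>a\<in>UNIV. (if a = i then X a else if a = k then Y a else 0)) = X i + Y k" for X Y :: "'q \<Rightarrow> complex"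
    proof -
      have "(\<Sum>a\<in>UNIV. (if a = i then X a else if a = k then Y a else 0)) =
          (\<Sum>a\<in>UNIV. (if a = i then X a else 0) + (if a = k then Y a else 0))"
        by (rule sum.cong) (use assms in auto)
      then show ?thesis by (simp add: sum.distrib)
    qed
    have inner: "(\<Sum>b\<in>UNIV. cnj (?z $ a) * A $ a $ b * ?z $ b) = cnj (?z $ a) * (A $ a $ i + w * A $ a $ k)" for a
    proof -
      have "(\<Sum>b\<in>UNIV. cnj (?z $ a) * A $ a $ b * ?z $ b) =
          (\<Sum>b\<in>UNIV. if b = i then cnj (?z $ a) * A $ a $ b else if b = k then cnj (?z $ a) * A $ a $ b * w else 0)"
        by (rule sum.cong) (use z in \<open>auto split: if_splits\<close>)
      then show ?thesis by (simp only: s) (simp add: algebra_simps)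
    qed
    have "quad_form A ?z = (\<Sum>a\<in>UNIV. if a = i then A $ a $ i + w * A $ a $ k else if a = k then cnj w * (A $ a $ i + w * A $ a $ k) else 0)"
      unfolding quad_form_def inner by (rule sum.cong) (use z in \<open>auto split: if_splits\<close>)
    then show ?thesis by (simp only: s) (simp add: algebra_simps)
  qed
  show ?thesis unfolding q quad_form_diagonal by (simp add: algebra_simps)
qed

lemma tendsto_of_quad_form_tendsto:
  fixes A :: "nat \<Rightarrow> complex ^ 'q ^ 'q"
  assumes "\<And>z. (\<lambda>m. quad_form (A m) z) \<longlonglongrightarrow> quad_form S z"
  shows "(\<lambda>m. A m $ i $ k) \<longlonglongrightarrow> S $ i $ k"
proof (cases "i = k")
  case True
  then show ?thesis using assms[of "axis i 1"] by (simp add: quad_form_diagonal)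
next
  case False
  show ?thesis unfolding quad_form_polarisation[OF False] by (intro tendsto_intros assms) simp
qed

text \<open>This links the time-domain limit of the moment matrix with its spectral form. For each
  vector \<open>z\<close> the claim concerns one scalar measure, where the cosine series may be
  integrated termwise by dominated convergence.\<close>

lemma matrix_integral_of_cosine_series:
  fixes \<H> :: "real \<Rightarrow> complex ^ 'q ^ 'q" and \<phi> \<phi>c :: "real \<Rightarrow> real"
  assumes even: "\<And>l. \<phi> (- l) = \<phi> l" and int: "set_integrable lborel {-pi..pi} \<phi>"
    and ver: "continuous_version \<phi>c \<phi>"
    and sum: "summable (\<lambda>k. \<bar>weight_coeff \<phi> (int k)\<bar>)"
    and \<Gamma>: "\<And>j. has_matrix_integral (\<lambda>l. cis (of_int j * l)) \<H> (\<Gamma> j)"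
    and S: "has_matrix_integral (\<lambda>l. complex_of_real (1 / (2 * pi) * \<phi>c l)) \<H> S"
  shows "(\<lambda>m. \<Sum>j=-int m..int m. complex_of_real (weight_coeff \<phi> j) * \<Gamma> j $ i $ k) \<longlonglongrightarrow> S $ i $ k"
proof -
  let ?c = "weight_coeff \<phi>"
  define A where "A m = (\<chi> i k. \<Sum>j=-int m..int m. complex_of_real (?c j) * \<Gamma> j $ i $ k)" for m
  \<comment> \<open>Coefficients at \<open>j\<close> and \<open>-j\<close> agree, so the two
    exponentials combine to a cosine.\<close>
  have trig: "(\<Sum>j=-int m..int m. complex_of_real (?c j) * cis (of_int j * l)) =
      complex_of_real (\<Sum>k\<le>m. (if k = 0 then 1 else 2) * ?c (int k) * cos (real k * l))" for m l
  proof (induction m)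
    case (Suc m)
    have "{-int (Suc m)..int (Suc m)} = insert (int (Suc m)) (insert (- int (Suc m)) {-int m..int m})" by auto
    then have "(\<Sum>j=-int (Suc m)..int (Suc m). complex_of_real (?c j) * cis (of_int j * l)) =
      complex_of_real (?c (int (Suc m))) * cis (of_int (int (Suc m)) * l) + (complex_of_real (?c (- int (Suc m))) * cis (of_int (- int (Suc m)) * l) +
      (\<Sum>j=-int m..int m. complex_of_real (?c j) * cis (of_int j * l)))"
      by (simp only:) (subst sum.insert; simp)+
    also have "complex_of_real (?c (int (Suc m))) * cis (of_int (int (Suc m)) * l) + (complex_of_real (?c (- int (Suc m))) * cis (of_int (- int (Suc m)) * l) + X) =
      complex_of_real (2 * ?c (int (Suc m)) * cos (real (Suc m) * l)) + X" for X
    proof -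
      have "cis (of_int (- int (Suc m)) * l) = cnj (cis (of_int (int (Suc m)) * l))"
      proof -
        have "of_int (- int (Suc m)) * l = - (of_int (int (Suc m)) * l)" by (simp del: of_nat_Suc)
        then show ?thesis by (simp only: cis_cnj)
      qed
      then show ?thesis unfolding weight_coeff_minus
        by (simp add: complex_eq_iff del: of_nat_Suc)
    qed
    finally show ?case unfolding Suc.IH by (simp del: of_nat_Suc)
  qed simp
  have lim: "(\<lambda>m. \<Sum>j=-int m..int m. complex_of_real (?c j) * cis (of_int j * l)) \<longlonglongrightarrow> complex_of_real (1 / (2 * pi) * \<phi>c l)"
    if "l \<in> {-pi..pi}" for l
  proof -
    have "(\<lambda>k. 1 / (2 * pi) * ((if k = 0 then 2 * pi else 4 * pi) * ?c (int k) * cos (real k * l))) sums (1 / (2 * pi) * \<phi>c l)"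
      by (rule sums_mult, rule absolutely_convergent_cosine_series[OF even int ver sum that])
    moreover have "1 / (2 * pi) * ((if k = 0 then 2 * pi else 4 * pi) * ?c (int k) * cos (real k * l)) =
        (if k = 0 then 1 else 2) * ?c (int k) * cos (real k * l)" for k by simp
    ultimately have "(\<lambda>k. (if k = 0 then 1 else 2) * ?c (int k) * cos (real k * l)) sums (1 / (2 * pi) * \<phi>c l)" by (simp only:)
    then have "(\<lambda>m. \<Sum>k\<le>m. (if k = 0 then 1 else 2) * ?c (int k) * cos (real k * l)) \<longlonglongrightarrow> 1 / (2 * pi) * \<phi>c l"
      by (simp add: sums_def_le)
    then show ?thesis unfolding trig by (rule tendsto_of_real)
  qed
  have "(\<lambda>m. quad_form (A m) z) \<longlonglongrightarrow> quad_form S z" for z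
  proof -
    define \<mu> where "\<mu> = interval_measure (\<lambda>l. Re (quad_form (\<H> l) z))"
    let ?I = "{-pi<..pi}"
    have \<Gamma>i: "set_integrable \<mu> ?I (\<lambda>l. cis (of_int j * l))" and \<Gamma>q: "quad_form (\<Gamma> j) z = (LINT l:?I|\<mu>. cis (of_int j * l))" for j
      using \<Gamma>[of j] unfolding has_matrix_integral_def Let_def \<mu>_def by blast+
    have Si: "set_integrable \<mu> ?I (\<lambda>l. complex_of_real (1 / (2 * pi) * \<phi>c l))"
      and Sq: "quad_form S z = (LINT l:?I|\<mu>. complex_of_real (1 / (2 * pi) * \<phi>c l))"
      using S unfolding has_matrix_integral_def Let_def \<mu>_def by blast+
    let ?Q = "\<lambda>m l. \<Sum>j=-int m..int m. complex_of_real (?c j) * (indicat_real ?I l *\<^sub>R cis (of_int j * l))"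
    have qA: "quad_form (A m) z = (\<integral>l. ?Q m l \<partial>\<mu>)" for m
    proof -
      have "quad_form (A m) z = (\<Sum>j=-int m..int m. complex_of_real (?c j) * quad_form (\<Gamma> j) z)"
      proof -
        have "quad_form (A m) z = (\<Sum>a\<in>UNIV. \<Sum>b\<in>UNIV. \<Sum>j=-int m..int m. complex_of_real (?c j) * (cnj (z $ a) * \<Gamma> j $ a $ b * z $ b))"
          unfolding quad_form_def A_def by (intro sum.cong refl) (simp add: sum_distrib_left sum_distrib_right mult_ac)
        also have "\<dots> = (\<Sum>a\<in>UNIV. \<Sum>j=-int m..int m. \<Sum>b\<in>UNIV. complex_of_real (?c j) * (cnj (z $ a) * \<Gamma> j $ a $ b * z $ b))"
          by (intro sum.cong refl sum.swap)
        also have "\<dots> = (\<Sum>j=-int m..int m. \<Sum>a\<in>UNIV. \<Sum>b\<in>UNIV. complex_of_real (?c j) * (cnj (z $ a) * \<Gamma> j $ a $ b * z $ b))"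
          by (rule sum.swap)
        finally show ?thesis by (simp add: quad_form_def sum_distrib_left)
      qed
      also have "\<dots> = (\<Sum>j=-int m..int m. \<integral>l. complex_of_real (?c j) * (indicat_real ?I l *\<^sub>R cis (of_int j * l)) \<partial>\<mu>)"
        unfolding \<Gamma>q set_lebesgue_integral_def by (intro sum.cong refl integral_mult_right_zero[symmetric])
      also have "\<dots> = (\<integral>l. ?Q m l \<partial>\<mu>)"
        by (rule Bochner_Integration.integral_sum[symmetric]) (rule integrable_mult_right, rule \<Gamma>i[unfolded set_integrable_def])
      finally show ?thesis .
    qed
    have "(\<lambda>m. \<integral>l. ?Q m l \<partial>\<mu>) \<longlonglongrightarrow> (\<integral>l. indicat_real ?I l *\<^sub>R complex_of_real (1 / (2 * pi) * \<phi>c l) \<partial>\<mu>)"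
    \<comment> \<open>The dominating function is constant on the interval; the hypothesis at
      frequency 0 makes it integrable.\<close>
    proof (rule integral_dominated_convergence[where w="\<lambda>l. (2 * (\<Sum>k. \<bar>?c (int k)\<bar>)) * norm (indicat_real ?I l *\<^sub>R cis (of_int 0 * l))"])
      show "(\<lambda>l. indicat_real ?I l *\<^sub>R complex_of_real (1 / (2 * pi) * \<phi>c l)) \<in> borel_measurable \<mu>"
        using Si unfolding set_integrable_def by (rule borel_measurable_integrable)
      show "?Q m \<in> borel_measurable \<mu>" for m
        using \<Gamma>i unfolding set_integrable_def by (intro borel_measurable_sum borel_measurable_times) (auto dest: borel_measurable_integrable)
      show "integrable \<mu> (\<lambda>l. (2 * (\<Sum>k. \<bar>?c (int k)\<bar>)) * norm (indicat_real ?I l *\<^sub>R cis (of_int 0 * l)))"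
        using \<Gamma>i[of 0] unfolding set_integrable_def by (intro integrable_mult_right integrable_norm)
      show "AE l in \<mu>. (\<lambda>m. ?Q m l) \<longlonglongrightarrow> indicat_real ?I l *\<^sub>R complex_of_real (1 / (2 * pi) * \<phi>c l)"
      proof (rule AE_I2)
        fix l
        show "(\<lambda>m. ?Q m l) \<longlonglongrightarrow> indicat_real ?I l *\<^sub>R complex_of_real (1 / (2 * pi) * \<phi>c l)"
        proof (cases "l \<in> ?I")
          case True
          then show ?thesis using lim[of l] by simp
        qed simp
      qed
      show "AE l in \<mu>. norm (?Q m l) \<le> (2 * (\<Sum>k. \<bar>?c (int k)\<bar>)) * norm (indicat_real ?I l *\<^sub>R cis (of_int 0 * l))" for m
      proof (rule AE_I2)
        fix l
        show "norm (?Q m l) \<le> (2 * (\<Sum>k. \<bar>?c (int k)\<bar>)) * norm (indicat_real ?I l *\<^sub>R cis (of_int 0 * l))"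
        proof (cases "l \<in> ?I")
          case True
          have "norm (?Q m l) = \<bar>\<Sum>k\<le>m. (if k = 0 then 1 else 2) * ?c (int k) * cos (real k * l)\<bar>"
          proof -
            have "?Q m l = (\<Sum>j=-int m..int m. complex_of_real (?c j) * cis (of_int j * l))" using True by simp
            then show ?thesis unfolding trig by (simp only: norm_of_real)
          qed
          also have "\<dots> \<le> (\<Sum>k\<le>m. 2 * \<bar>?c (int k)\<bar>)"
          proof (rule order.trans[OF sum_abs], rule sum_mono)
            fix k
            have "\<bar>(if k = 0 then 1 else 2) * ?c (int k)\<bar> * \<bar>cos (real k * l)\<bar> \<le> (2 * \<bar>?c (int k)\<bar>) * 1"
              by (rule mult_mono) (auto simp: abs_mult)
            then show "\<bar>(if k = 0 then 1 else 2) * ?c (int k) * cos (real k * l)\<bar> \<le> 2 * \<bar>?c (int k)\<bar>" by (simp add: abs_mult)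
          qed
          also have "\<dots> \<le> 2 * (\<Sum>k. \<bar>?c (int k)\<bar>)"
            unfolding sum_distrib_left[symmetric] using sum_le_suminf[OF sum, of "{..m}"] by simp
          finally have "norm (?Q m l) \<le> 2 * (\<Sum>k. \<bar>?c (int k)\<bar>)" .
          moreover have "norm (indicat_real ?I l *\<^sub>R cis (of_int 0 * l)) = 1" using True by simp
          ultimately show ?thesis by (simp only: mult_1_right)
        qed simp
      qed
    qed
    then show ?thesis unfolding qA Sq set_lebesgue_integral_def .
  qed
  from tendsto_of_quad_form_tendsto[OF this, of i k] show ?thesis by (simp add: A_def)
qed

section \<open>Fourth-order stationary regressors\<close>

lemma partitions_insert:
  assumes "a \<notin> A"
  shows "{P. partition_on (insert a A) P} =
    (\<Union>P\<in>{P. partition_on A P}. insert (insert {a} P) ((\<lambda>B. insert (insert a B) (P - {B})) ` P))"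
    (is "?L = ?R")
proof (intro equalityI subsetI)
  fix Q assume "Q \<in> ?L"
  then have Q: "partition_on (insert a A) Q" by simp
  then obtain C where C: "C \<in> Q" "a \<in> C" unfolding partition_on_def by blast
  define B where "B = C - {a}"
  have CB: "C = insert a B" "a \<notin> B" using C by (auto simp: B_def)
  have disj: "D \<inter> C = {}" if "D \<in> Q" "D \<noteq> C" for D
    using Q that C unfolding partition_on_def disjoint_def by blast
  define P0 where "P0 = Q - {C}"
  have QP: "Q = insert C P0" using C by (auto simp: P0_def)
  have a0: "a \<notin> D" if "D \<in> P0" for D using disj[of D] that C by (auto simp: P0_def)
  have un: "insert a A = \<Union>Q" using partition_onD1[OF Q] .
  have unP0: "\<Union>P0 \<union> B = A"
  proof -
    have "insert a A = insert a (\<Union>P0 \<union> B)" using un QP CB by auto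
    moreover have "a \<notin> \<Union>P0 \<union> B" using CB a0 by auto
    ultimately show ?thesis using assms insert_ident[of a A "\<Union>P0 \<union> B"] by blast
  qed
  have disj0: "disjoint P0" using partition_onD2[OF Q] by (auto simp: P0_def disjoint_def)
  have ne: "{} \<notin> P0" using partition_onD3[OF Q] by (auto simp: P0_def)
  have dB: "D \<inter> B = {}" if "D \<in> P0" for D using disj[of D] that CB by (auto simp: P0_def)
  show "Q \<in> ?R"
  proof (cases "B = {}")
    case True
    then have "partition_on A P0" using unP0 disj0 ne by (auto simp: partition_on_def)
    moreover have "Q = insert {a} P0" using QP CB True by simp
    ultimately show ?thesis by blast
  next
    case False
    have nB: "B \<notin> P0" using dB False by blast
    have "partition_on A (insert B P0)"
      using unP0 disj0 ne False dB by (auto simp: partition_on_def disjoint_def)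
    moreover have "Q = insert (insert a B) (insert B P0 - {B})" using QP CB nB by simp
    ultimately show ?thesis by blast
  qed
next
  fix Q assume "Q \<in> ?R"
  then obtain P where P: "partition_on A P"
    and Q: "Q = insert {a} P \<or> (\<exists>B\<in>P. Q = insert (insert a B) (P - {B}))" by auto
  have aP: "a \<notin> D" if "D \<in> P" for D using partition_onD1[OF P] assms that by auto
  from Q show "Q \<in> ?L"
  proof
    assume "Q = insert {a} P"
    then show ?thesis using P aP by (auto simp: partition_on_def disjoint_def)
  next
    assume "\<exists>B\<in>P. Q = insert (insert a B) (P - {B})"
    then obtain B where B: "B \<in> P" "Q = insert (insert a B) (P - {B})" by blast
    have "D \<inter> B = {}" if "D \<in> P" "D \<noteq> B" for D using P B that unfolding partition_on_def disjoint_def by blast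
    then show ?thesis using P aP B unfolding partition_on_def disjoint_def by auto
  qed
qed

text \<open>A recursion that lets sums over all partitions of a concrete set be expanded: the new
  element is a block of its own or joins an existing block.\<close>

lemma sum_partitions_insert:
  fixes f :: "'b set set \<Rightarrow> real"
  assumes "finite A" and a: "a \<notin> A"
  shows "(\<Sum>P | partition_on (insert a A) P. f P) =
    (\<Sum>P | partition_on A P. f (insert {a} P) + (\<Sum>B\<in>P. f (insert (insert a B) (P - {B}))))"
proof -
  let ?U = "\<lambda>P. insert (insert {a} P) ((\<lambda>B. insert (insert a B) (P - {B})) ` P)"
  \<comment> \<open>Removing \<open>a\<close> from every block, and dropping the block if it becomes
    empty, recovers the smaller partition; hence different partitions have disjoint sets of
    extensions.\<close>
  let ?r = "\<lambda>Q. (\<lambda>D. D - {a}) ` Q - {{}}"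
  have fin: "finite {P. partition_on A P}" by (rule finitely_many_partition_on[OF \<open>finite A\<close>])
  have fP: "finite P" if "partition_on A P" for P by (rule finite_elements[OF \<open>finite A\<close> that])
  have aP: "a \<notin> D" if "partition_on A P" "D \<in> P" for D P using partition_onD1[OF that(1)] a that(2) by auto
  have ne: "{} \<notin> P" if "partition_on A P" for P using partition_onD3[OF that] .
  have minus: "(\<lambda>D. D - {a}) ` P = P" if "partition_on A P" for P
  proof -
    have "(\<lambda>D. D - {a}) ` P = (\<lambda>D. D) ` P" by (rule image_cong) (use aP[OF that] in auto)
    then show ?thesis by simp
  qed
  have r: "?r Q = P" if P: "partition_on A P" and Q: "Q \<in> ?U P" for P Q
  proof -
    from Q consider "Q = insert {a} P" | B where "B \<in> P" "Q = insert (insert a B) (P - {B})" by blast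
    then show ?thesis
    proof cases
      case 1
      then show ?thesis using ne[OF P] by (simp add: minus[OF P])
    next
      case 2
      have "(\<lambda>D. D - {a}) ` Q = insert (B - {a}) ((\<lambda>D. D - {a}) ` (P - {B}))" using 2 by auto
      also have "\<dots> = (\<lambda>D. D - {a}) ` P" using 2(1) by auto
      finally show ?thesis using ne[OF P] by (simp add: minus[OF P])
    qed
  qed
  have "(\<Sum>P | partition_on (insert a A) P. f P) = (\<Sum>P | partition_on A P. sum f (?U P))"
    unfolding partitions_insert[OF a]
  proof (rule sum.UNION_disjoint[OF fin])
    show "\<forall>P\<in>{P. partition_on A P}. finite (?U P)" using fP by simp
    show "\<forall>P\<in>{P. partition_on A P}. \<forall>P'\<in>{P. partition_on A P}. P \<noteq> P' \<longrightarrow> ?U P \<inter> ?U P' = {}"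
    proof (intro ballI impI)
      fix P P' assume P: "P \<in> {P. partition_on A P}" "P' \<in> {P. partition_on A P}" "P \<noteq> P'"
      show "?U P \<inter> ?U P' = {}"
      proof (rule equals0I)
        fix Q assume Q: "Q \<in> ?U P \<inter> ?U P'"
        have "?r Q = P" by (rule r[OF _ IntD1[OF Q]]) (use P in simp)
        moreover have "?r Q = P'" by (rule r[OF _ IntD2[OF Q]]) (use P in simp)
        ultimately show False using P(3) by simp
      qed
    qed
  qed
  also have "\<dots> = (\<Sum>P | partition_on A P. f (insert {a} P) + (\<Sum>B\<in>P. f (insert (insert a B) (P - {B}))))"
  proof (rule sum.cong)
    fix P assume "P \<in> {P. partition_on A P}"
    then have P: "partition_on A P" by simp
    have key: "insert a B = C" if "B \<in> P" "insert a B \<in> insert C (P - X)" for B C X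
      using that aP[OF P, of "insert a B"] by auto
    have "insert {a} P \<notin> (\<lambda>B. insert (insert a B) (P - {B})) ` P"
    proof
      assume "insert {a} P \<in> (\<lambda>B. insert (insert a B) (P - {B})) ` P"
      then obtain B where B: "B \<in> P" "insert {a} P = insert (insert a B) (P - {B})" by blast
      then have "insert a B \<in> insert {a} (P - {})" by auto
      from key[OF B(1) this] have "B = {}" using aP[OF P B(1)] by auto
      then show False using ne[OF P] B(1) by simp
    qed
    moreover have "inj_on (\<lambda>B. insert (insert a B) (P - {B})) P"
    proof (rule inj_onI)
      fix B B' assume B: "B \<in> P" "B' \<in> P" "insert (insert a B) (P - {B}) = insert (insert a B') (P - {B'})"
      then have "insert a B \<in> insert (insert a B') (P - {B'})" by blast
      from key[OF B(1) this] show "B = B'" using aP[OF P B(1)] aP[OF P B(2)] insert_ident by metis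
    qed
    ultimately show "sum f (?U P) = f (insert {a} P) + (\<Sum>B\<in>P. f (insert (insert a B) (P - {B})))"
      using fP[OF P] by (simp add: sum.reindex)
  qed simp
  finally show ?thesis .
qed

text \<open>The recursion yields the fifteen partitions of a four-element set, with coefficients 1,
  -1, 2 and -6 according to the number of blocks.\<close>

lemma joint_cumulant_four:
  fixes X :: "nat \<Rightarrow> 'w \<Rightarrow> real" and M :: "'w measure"
  defines "m \<equiv> \<lambda>B. \<integral>\<omega>. (\<Prod>i\<in>B. X i \<omega>) \<partial>M"
  shows "joint_cumulant M {0..<4} X =
    m {0,1,2,3} - m {0} * m {1,2,3} - m {1} * m {0,2,3} - m {2} * m {0,1,3} - m {3} * m {0,1,2}
    - m {0,1} * m {2,3} - m {0,2} * m {1,3} - m {0,3} * m {1,2}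
    + 2 * (m {0,1} * m {2} * m {3} + m {0,2} * m {1} * m {3} + m {0,3} * m {1} * m {2}
      + m {1,2} * m {0} * m {3} + m {1,3} * m {0} * m {2} + m {2,3} * m {0} * m {1})
    - 6 * m {0} * m {1} * m {2} * m {3}"
proof -
  define F where "F P = (-1) ^ (card P - 1) * fact (card P - 1) * (\<Prod>B\<in>P. m B)" for P :: "nat set set"
  have F1: "F {A} = m A" for A by (simp add: F_def)
  have F2: "F {A, B} = - (m A * m B)" if "A \<noteq> B" for A B using that by (simp add: F_def)
  have F3: "F {A, B, C} = 2 * (m A * m B * m C)" if "A \<noteq> B" "A \<noteq> C" "B \<noteq> C" for A B C
    using that by (simp add: F_def fact_numeral)
  have F4: "F {A, B, C, D} = - 6 * (m A * m B * m C * m D)" if "A \<noteq> B" "A \<noteq> C" "A \<noteq> D" "B \<noteq> C" "B \<noteq> D" "C \<noteq> D" for A B C D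
    using that by (simp add: F_def fact_numeral numeral_eq_Suc)
  have 4: "{0..<4::nat} = insert 0 (insert 1 (insert 2 (insert 3 {})))" by auto
  have "joint_cumulant M {0..<4} X = (\<Sum>P | partition_on {0..<4} P. F P)"
    unfolding joint_cumulant_def F_def m_def ..
  also have "\<dots> = F {{0},{1},{2},{3}} + F {{0,1},{2},{3}} + F {{0,2},{1},{3}} + F {{0,3},{1},{2}} + F {{1,2},{0},{3}}
      + F {{1,3},{0},{2}} + F {{2,3},{0},{1}} + F {{0,1},{2,3}} + F {{0,2},{1,3}} + F {{0,3},{1,2}}
      + F {{0,1,2},{3}} + F {{0,1,3},{2}} + F {{0,2,3},{1}} + F {{1,2,3},{0}} + F {{0,1,2,3}}"
    unfolding 4 by (simp add: sum_partitions_insert partition_on_empty insert_Diff_if doubleton_eq_iff del: One_nat_def)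
      (simp add: insert_commute)
  finally show ?thesis by (simp add: F1 F2 F3 F4 doubleton_eq_iff)
qed

text \<open>The three covariance products are the Gaussian part of the fourth moment. After
  expansion of the centred factors it is a polynomial identity in the fifteen mixed moments.\<close>

lemma (in prob_space) expectation_centred_product_four:
  fixes X :: "nat \<Rightarrow> 'a \<Rightarrow> real"
  assumes int: "\<And>B. B \<subseteq> {0..<4} \<Longrightarrow> integrable M (\<lambda>\<omega>. \<Prod>i\<in>B. X i \<omega>)"
  defines "Z \<equiv> \<lambda>i \<omega>. X i \<omega> - expectation (X i)"
  shows "expectation (\<lambda>\<omega>. Z 0 \<omega> * Z 1 \<omega> * Z 2 \<omega> * Z 3 \<omega>) = joint_cumulant M {0..<4} X
      + expectation (\<lambda>\<omega>. Z 0 \<omega> * Z 1 \<omega>) * expectation (\<lambda>\<omega>. Z 2 \<omega> * Z 3 \<omega>)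
      + expectation (\<lambda>\<omega>. Z 0 \<omega> * Z 2 \<omega>) * expectation (\<lambda>\<omega>. Z 1 \<omega> * Z 3 \<omega>)
      + expectation (\<lambda>\<omega>. Z 0 \<omega> * Z 3 \<omega>) * expectation (\<lambda>\<omega>. Z 1 \<omega> * Z 2 \<omega>)"
    and "integrable M (\<lambda>\<omega>. Z 0 \<omega> * Z 1 \<omega> * Z 2 \<omega> * Z 3 \<omega>)"
    and "integrable M (\<lambda>\<omega>. Z 0 \<omega> * Z 1 \<omega>)"
proof -
  define m where "m B = expectation (\<lambda>\<omega>. \<Prod>i\<in>B. X i \<omega>)" for B
  define P where "P B \<omega> = (\<Prod>i\<in>B. X i \<omega>)" for B \<omega>
  have iP: "integrable M (P B)" if "B \<subseteq> {0..<4}" for B using int[OF that] by (simp add: P_def[abs_def])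
  have mP: "expectation (P B) = m B" for B by (simp add: m_def P_def[abs_def])
  have m1: "expectation (X i) = m {i}" for i by (simp add: m_def)
  have cov_eq: "Z i \<omega> * Z j \<omega> = P {i, j} \<omega> - m {i} * P {j} \<omega> - m {j} * P {i} \<omega> + m {i} * m {j}" if "i \<noteq> j" for i j \<omega>
    using that by (simp add: Z_def m1 P_def algebra_simps)
  have cov: "integrable M (\<lambda>\<omega>. Z i \<omega> * Z j \<omega>) \<and> expectation (\<lambda>\<omega>. Z i \<omega> * Z j \<omega>) = m {i, j} - m {i} * m {j}"
    if "i \<noteq> j" "i < 4" "j < 4" for i j
    unfolding cov_eq[OF that(1)] using that iP[of "{i, j}"] iP[of "{i}"] iP[of "{j}"] by (simp add: mP prob_space)
  have eq4: "Z 0 \<omega> * Z 1 \<omega> * Z 2 \<omega> * Z 3 \<omega> = P {0,1,2,3} \<omega>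
     - m {3} * P {0,1,2} \<omega> - m {2} * P {0,1,3} \<omega> - m {1} * P {0,2,3} \<omega> - m {0} * P {1,2,3} \<omega>
     + m {2} * m {3} * P {0,1} \<omega> + m {1} * m {3} * P {0,2} \<omega> + m {1} * m {2} * P {0,3} \<omega>
     + m {0} * m {3} * P {1,2} \<omega> + m {0} * m {2} * P {1,3} \<omega> + m {0} * m {1} * P {2,3} \<omega>
     - m {1} * m {2} * m {3} * P {0} \<omega> - m {0} * m {2} * m {3} * P {1} \<omega>
     - m {0} * m {1} * m {3} * P {2} \<omega> - m {0} * m {1} * m {2} * P {3} \<omega> + m {0} * m {1} * m {2} * m {3}" for \<omega>
    by (simp add: Z_def m1 P_def algebra_simps)
  note ints = iP[of "{0,1,2,3}"] iP[of "{0,1,2}"] iP[of "{0,1,3}"] iP[of "{0,2,3}"] iP[of "{1,2,3}"]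
    iP[of "{0,1}"] iP[of "{0,2}"] iP[of "{0,3}"] iP[of "{1,2}"] iP[of "{1,3}"] iP[of "{2,3}"]
    iP[of "{0}"] iP[of "{1}"] iP[of "{2}"] iP[of "{3}"]
  show "integrable M (\<lambda>\<omega>. Z 0 \<omega> * Z 1 \<omega> * Z 2 \<omega> * Z 3 \<omega>)" unfolding eq4 using ints by simp
  have E4: "expectation (\<lambda>\<omega>. Z 0 \<omega> * Z 1 \<omega> * Z 2 \<omega> * Z 3 \<omega>) = m {0,1,2,3}
     - m {3} * m {0,1,2} - m {2} * m {0,1,3} - m {1} * m {0,2,3} - m {0} * m {1,2,3}
     + m {2} * m {3} * m {0,1} + m {1} * m {3} * m {0,2} + m {1} * m {2} * m {0,3}
     + m {0} * m {3} * m {1,2} + m {0} * m {2} * m {1,3} + m {0} * m {1} * m {2,3}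
     - m {1} * m {2} * m {3} * m {0} - m {0} * m {2} * m {3} * m {1}
     - m {0} * m {1} * m {3} * m {2} - m {0} * m {1} * m {2} * m {3} + m {0} * m {1} * m {2} * m {3}"
    unfolding eq4 using ints by (simp add: mP prob_space)
  show "integrable M (\<lambda>\<omega>. Z 0 \<omega> * Z 1 \<omega>)" using cov[of 0 1] by simp
  have c: "expectation (\<lambda>\<omega>. Z 0 \<omega> * Z 1 \<omega>) = m {0,1} - m {0} * m {1}" "expectation (\<lambda>\<omega>. Z 2 \<omega> * Z 3 \<omega>) = m {2,3} - m {2} * m {3}"
    "expectation (\<lambda>\<omega>. Z 0 \<omega> * Z 2 \<omega>) = m {0,2} - m {0} * m {2}" "expectation (\<lambda>\<omega>. Z 1 \<omega> * Z 3 \<omega>) = m {1,3} - m {1} * m {3}"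
    "expectation (\<lambda>\<omega>. Z 0 \<omega> * Z 3 \<omega>) = m {0,3} - m {0} * m {3}" "expectation (\<lambda>\<omega>. Z 1 \<omega> * Z 2 \<omega>) = m {1,2} - m {1} * m {2}"
    using cov[of 0 1] cov[of 2 3] cov[of 0 2] cov[of 1 3] cov[of 0 3] cov[of 1 2] by simp_all
  show "expectation (\<lambda>\<omega>. Z 0 \<omega> * Z 1 \<omega> * Z 2 \<omega> * Z 3 \<omega>) = joint_cumulant M {0..<4} X
      + expectation (\<lambda>\<omega>. Z 0 \<omega> * Z 1 \<omega>) * expectation (\<lambda>\<omega>. Z 2 \<omega> * Z 3 \<omega>)
      + expectation (\<lambda>\<omega>. Z 0 \<omega> * Z 2 \<omega>) * expectation (\<lambda>\<omega>. Z 1 \<omega> * Z 3 \<omega>)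
      + expectation (\<lambda>\<omega>. Z 0 \<omega> * Z 3 \<omega>) * expectation (\<lambda>\<omega>. Z 1 \<omega> * Z 2 \<omega>)"
    unfolding E4 c joint_cumulant_four m_def[symmetric] by algebra
qed

text \<open>Invariance of the moments does not make the process strictly stationary; only the moments up to
  order four are ever used.\<close>

locale fourth_order = prob_space +
  fixes x :: "int \<Rightarrow> 'a \<Rightarrow> real ^ 'q"
  assumes fos: "fourth_order_stationary M x"
begin

lemma x_measurable[measurable]: "x t \<in> borel_measurable M"
  using fos by (simp add: fourth_order_stationary_def)

lemma integrable_moment: "length ps \<le> 4 \<Longrightarrow> integrable M (\<lambda>\<omega>. \<Prod>(a, t)\<leftarrow>ps. x t \<omega> $ a)"
  using fos by (simp add: fourth_order_stationary_def)

lemma moment_shift: "length ps \<le> 4 \<Longrightarrow>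
    expectation (\<lambda>\<omega>. \<Prod>(a, t)\<leftarrow>ps. x (t + h) \<omega> $ a) = expectation (\<lambda>\<omega>. \<Prod>(a, t)\<leftarrow>ps. x t \<omega> $ a)"
  using fos by (simp add: fourth_order_stationary_def)

definition mu :: "'q \<Rightarrow> real" where "mu a = expectation (\<lambda>\<omega>. x 1 \<omega> $ a)"

definition Z :: "int \<Rightarrow> 'q \<Rightarrow> 'a \<Rightarrow> real" where "Z t a \<omega> = x t \<omega> $ a - mu a"

lemma mean_x: "expectation (\<lambda>\<omega>. x t \<omega> $ a) = mu a"
  using moment_shift[of "[(a, 1)]" "t - 1"] by (simp add: mu_def)

lemma integrable_x: "integrable M (\<lambda>\<omega>. x t \<omega> $ a)"
  using integrable_moment[of "[(a, t)]"] by simp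

lemma Z_measurable[measurable]: "Z t a \<in> borel_measurable M"
  unfolding Z_def[abs_def] by (rule borel_measurable_integrable) (use integrable_x in simp)

lemma integrable_ZZ: "integrable M (\<lambda>\<omega>. Z t a \<omega> * Z s b \<omega>)"
proof -
  have "integrable M (\<lambda>\<omega>. x t \<omega> $ a * x s \<omega> $ b)" using integrable_moment[of "[(a, t), (b, s)]"] by simp
  moreover have "Z t a \<omega> * Z s b \<omega> = x t \<omega> $ a * x s \<omega> $ b - mu b * x t \<omega> $ a - mu a * x s \<omega> $ b + mu a * mu b" for \<omega>
    by (simp add: Z_def algebra_simps)
  ultimately show ?thesis using integrable_x by simp
qed

definition ac :: "int \<Rightarrow> 'q \<Rightarrow> 'q \<Rightarrow> real" where "ac u a b = autocov_matrix M x u $ a $ b"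

lemma expectation_ZZ: "expectation (\<lambda>\<omega>. Z t a \<omega> * Z s b \<omega>) = ac (s - t) a b"
proof -
  have *: "expectation (\<lambda>\<omega>. Z t a \<omega> * Z s b \<omega>) = expectation (\<lambda>\<omega>. x t \<omega> $ a * x s \<omega> $ b) - mu a * mu b" for t s
  proof -
    have "integrable M (\<lambda>\<omega>. x t \<omega> $ a * x s \<omega> $ b)" using integrable_moment[of "[(a, t), (b, s)]"] by simp
    moreover have "Z t a \<omega> * Z s b \<omega> = x t \<omega> $ a * x s \<omega> $ b - mu b * x t \<omega> $ a - mu a * x s \<omega> $ b + mu a * mu b" for \<omega>
      by (simp add: Z_def algebra_simps)
    ultimately show ?thesis using integrable_x by (simp add: mean_x prob_space)
  qed
  have "expectation (\<lambda>\<omega>. Z t a \<omega> * Z s b \<omega>) = expectation (\<lambda>\<omega>. Z 1 a \<omega> * Z (1 + (s - t)) b \<omega>)"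
    unfolding * using moment_shift[of "[(a, 1), (b, 1 + (s - t))]" "t - 1"] by (simp add: algebra_simps)
  then show ?thesis by (simp add: ac_def autocov_matrix_def Z_def mean_x)
qed

lemma ac_minus: "ac (- u) a b = ac u b a"
  using expectation_ZZ[of 0 a "-u" b] expectation_ZZ[of "-u" b 0 a] by (simp add: mult.commute)

text \<open>The explicit formula involves only moments of order at most four, each of which is
  invariant.\<close>

lemma cumulant_shift: "fourth_cumulant M x a b c d (s + h) (u + h) (v + h) (w + h) = fourth_cumulant M x a b c d s u v w"
proof -
  have "expectation (\<lambda>\<omega>. x (s + h) \<omega> $ a) = expectation (\<lambda>\<omega>. x s \<omega> $ a)" for a s by (simp add: mean_x)
  moreover have "expectation (\<lambda>\<omega>. x (s + h) \<omega> $ a * x (u + h) \<omega> $ b) = expectation (\<lambda>\<omega>. x s \<omega> $ a * x u \<omega> $ b)" for a b s u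
    using moment_shift[of "[(a, s), (b, u)]" h] by simp
  moreover have "expectation (\<lambda>\<omega>. x (s + h) \<omega> $ a * (x (u + h) \<omega> $ b * x (v + h) \<omega> $ c)) = expectation (\<lambda>\<omega>. x s \<omega> $ a * (x u \<omega> $ b * x v \<omega> $ c))" for a b c s u v
    using moment_shift[of "[(a, s), (b, u), (c, v)]" h] by simp
  moreover have "expectation (\<lambda>\<omega>. x (s + h) \<omega> $ a * (x (u + h) \<omega> $ b * (x (v + h) \<omega> $ c * x (w + h) \<omega> $ d))) = expectation (\<lambda>\<omega>. x s \<omega> $ a * (x u \<omega> $ b * (x v \<omega> $ c * x w \<omega> $ d)))"
    using moment_shift[of "[(a, s), (b, u), (c, v), (d, w)]" h] by simp
  ultimately show ?thesis
    unfolding fourth_cumulant_def joint_cumulant_four by (simp add: numeral_eq_Suc)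
qed

text \<open>Bridges two encodings: stationarity speaks of lists of pairs, the cumulant of subsets of
  the index set.\<close>

lemma integrable_sublists:
  assumes "B \<subseteq> {0..<4::nat}"
  shows "integrable M (\<lambda>\<omega>. \<Prod>i\<in>B. [x s \<omega> $ a, x u \<omega> $ b, x v \<omega> $ c, x w \<omega> $ d] ! i)"
proof -
  let ?p = "[(a, s), (b, u), (c, v), (d, w)]"
  have fin: "finite B" using assms finite_subset by blast
  define l where "l = map (\<lambda>i. ?p ! i) (sorted_list_of_set B)"
  have "length l \<le> 4" using card_mono[OF _ assms] by (simp add: l_def)
  then have "integrable M (\<lambda>\<omega>. \<Prod>(a, t)\<leftarrow>l. x t \<omega> $ a)" by (rule integrable_moment)
  moreover have "(\<Prod>(a, t)\<leftarrow>l. x t \<omega> $ a) = (\<Prod>i\<in>B. [x s \<omega> $ a, x u \<omega> $ b, x v \<omega> $ c, x w \<omega> $ d] ! i)" for \<omega>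
  proof -
    have "(\<Prod>(a, t)\<leftarrow>l. x t \<omega> $ a) = (\<Prod>i\<leftarrow>sorted_list_of_set B. case ?p ! i of (a, t) \<Rightarrow> x t \<omega> $ a)"
      by (simp add: l_def comp_def)
    also have "\<dots> = (\<Prod>i\<in>B. case ?p ! i of (a, t) \<Rightarrow> x t \<omega> $ a)"
      using prod.distinct_set_conv_list[of "sorted_list_of_set B" "\<lambda>i. case ?p ! i of (a, t) \<Rightarrow> x t \<omega> $ a"] fin by simp
    also have "\<dots> = (\<Prod>i\<in>B. [x s \<omega> $ a, x u \<omega> $ b, x v \<omega> $ c, x w \<omega> $ d] ! i)"
    proof (rule prod.cong)
      fix i assume "i \<in> B"
      then have "i = 0 \<or> i = 1 \<or> i = 2 \<or> i = 3" using assms by auto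
      then show "(case ?p ! i of (a, t) \<Rightarrow> x t \<omega> $ a) = [x s \<omega> $ a, x u \<omega> $ b, x v \<omega> $ c, x w \<omega> $ d] ! i"
        by (elim disjE) simp_all
    qed simp
    finally show ?thesis .
  qed
  ultimately show ?thesis by simp
qed

lemma expectation_ZZZZ:
  shows "expectation (\<lambda>\<omega>. Z s a \<omega> * Z u b \<omega> * Z v c \<omega> * Z w d \<omega>) = fourth_cumulant M x a b c d s u v w
      + ac (u - s) a b * ac (w - v) c d + ac (v - s) a c * ac (w - u) b d + ac (w - s) a d * ac (v - u) b c"
    and "integrable M (\<lambda>\<omega>. Z s a \<omega> * Z u b \<omega> * Z v c \<omega> * Z w d \<omega>)"
proof -
  let ?X = "\<lambda>i \<omega>. [x s \<omega> $ a, x u \<omega> $ b, x v \<omega> $ c, x w \<omega> $ d] ! i"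
  note E = expectation_centred_product_four[of ?X, OF integrable_sublists]
  have Z: "?X 0 \<omega> - expectation (?X 0) = Z s a \<omega>" "?X 1 \<omega> - expectation (?X 1) = Z u b \<omega>"
    "?X 2 \<omega> - expectation (?X 2) = Z v c \<omega>" "?X 3 \<omega> - expectation (?X 3) = Z w d \<omega>" for \<omega>
    by (simp_all add: Z_def mean_x)
  show "expectation (\<lambda>\<omega>. Z s a \<omega> * Z u b \<omega> * Z v c \<omega> * Z w d \<omega>) = fourth_cumulant M x a b c d s u v w
      + ac (u - s) a b * ac (w - v) c d + ac (v - s) a c * ac (w - u) b d + ac (w - s) a d * ac (v - u) b c"
    using E(1) unfolding Z expectation_ZZ fourth_cumulant_def by simp
  show "integrable M (\<lambda>\<omega>. Z s a \<omega> * Z u b \<omega> * Z v c \<omega> * Z w d \<omega>)" using E(2) unfolding Z .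
qed

lemma integrable_ZZ_sq: "integrable M (\<lambda>\<omega>. (Z t a \<omega> * Z s b \<omega>)\<^sup>2)"
  using expectation_ZZZZ(2)[of t a t a s b s b] by (simp add: power2_eq_square mult_ac)

lemma abs_ac_le: "\<bar>ac u a b\<bar> \<le> sqrt (ac 0 a a) * sqrt (ac 0 b b)"
proof -
  have "\<bar>expectation (\<lambda>\<omega>. Z 0 a \<omega> * Z u b \<omega>)\<bar> \<le> sqrt (ac 0 a a) * sqrt (ac 0 b b)"
    by (rule abs_integral_mult_le)
      (use integrable_ZZ[of 0 a 0 a] integrable_ZZ[of u b u b] expectation_ZZ[of 0 a 0 a] expectation_ZZ[of u b u b] in
        \<open>simp_all add: power2_eq_square\<close>)
  then show ?thesis by (simp add: expectation_ZZ)
qed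

lemma ac_diag_nonneg: "0 \<le> ac 0 a a"
  unfolding expectation_ZZ[of 0 a 0 a, simplified, symmetric] by (rule Bochner_Integration.integral_nonneg) simp

text \<open>The cumulants are bounded, so that the suprema in the hypothesis are genuine.\<close>

lemma cumulant_bounded: "\<exists>K. \<forall>s u v w. \<bar>fourth_cumulant M x a b c d s u v w\<bar> \<le> K"
proof -
  define V where "V a = expectation (\<lambda>\<omega>. (Z 0 a \<omega>) ^ 4)" for a
  \<comment> \<open>Stationarity is stated for raw moments; the centred fourth moment is free of
    time because cumulant and covariances express it.\<close>
  have Z4: "integrable M (\<lambda>\<omega>. (Z t a \<omega>) ^ 4) \<and> expectation (\<lambda>\<omega>. (Z t a \<omega>) ^ 4) = V a" for t a
  proof -
    have eq: "Z t a \<omega> * Z t a \<omega> * Z t a \<omega> * Z t a \<omega> = (Z t a \<omega>) ^ 4" for t \<omega> by (simp add: power4_eq_xxxx)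
    show ?thesis using expectation_ZZZZ[of t a t a t a t a] expectation_ZZZZ[of 0 a 0 a 0 a 0 a]
        cumulant_shift[of a a a a 0 t 0 0 0] unfolding eq V_def by simp
  qed
  define W where "W = V a + V b + V c + V d"
  define A where "A = sqrt (ac 0 a a) * sqrt (ac 0 b b) * (sqrt (ac 0 c c) * sqrt (ac 0 d d))
     + sqrt (ac 0 a a) * sqrt (ac 0 c c) * (sqrt (ac 0 b b) * sqrt (ac 0 d d))
     + sqrt (ac 0 a a) * sqrt (ac 0 d d) * (sqrt (ac 0 b b) * sqrt (ac 0 c c))"
  have "\<bar>fourth_cumulant M x a b c d s u v w\<bar> \<le> W + A" for s u v w
  proof -
    have amgm: "\<bar>p * q * r * t\<bar> \<le> p ^ 4 + q ^ 4 + r ^ 4 + t ^ 4" for p q r t :: real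
    proof -
      have 1: "2 * \<bar>y * z\<bar> \<le> y\<^sup>2 + z\<^sup>2" for y z :: real
        using sum_squares_bound[of "\<bar>y\<bar>" "\<bar>z\<bar>"] by (simp add: abs_mult mult.assoc)
      have A: "2 * \<bar>(p * q) * (r * t)\<bar> \<le> (p * q)\<^sup>2 + (r * t)\<^sup>2" by (rule 1)
      have B: "2 * (p * q)\<^sup>2 \<le> p ^ 4 + q ^ 4" using 1[of "p\<^sup>2" "q\<^sup>2"] by (simp add: power_mult_distrib)
      have C: "2 * (r * t)\<^sup>2 \<le> r ^ 4 + t ^ 4" using 1[of "r\<^sup>2" "t\<^sup>2"] by (simp add: power_mult_distrib)
      have D: "0 \<le> (p * q)\<^sup>2" "0 \<le> (r * t)\<^sup>2" by simp_all
      have E: "p * q * r * t = (p * q) * (r * t)" by (simp add: mult.assoc)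
      show ?thesis unfolding E using A B C D by linarith
    qed
    have "\<bar>expectation (\<lambda>\<omega>. Z s a \<omega> * Z u b \<omega> * Z v c \<omega> * Z w d \<omega>)\<bar> \<le> expectation (\<lambda>\<omega>. \<bar>Z s a \<omega> * Z u b \<omega> * Z v c \<omega> * Z w d \<omega>\<bar>)" by simp
    also have "\<dots> \<le> expectation (\<lambda>\<omega>. Z s a \<omega> ^ 4 + Z u b \<omega> ^ 4 + Z v c \<omega> ^ 4 + Z w d \<omega> ^ 4)"
    proof (rule integral_mono)
      show "integrable M (\<lambda>\<omega>. \<bar>Z s a \<omega> * Z u b \<omega> * Z v c \<omega> * Z w d \<omega>\<bar>)"
        by (intro integrable_abs expectation_ZZZZ(2))
      show "integrable M (\<lambda>\<omega>. Z s a \<omega> ^ 4 + Z u b \<omega> ^ 4 + Z v c \<omega> ^ 4 + Z w d \<omega> ^ 4)"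
        by (intro Bochner_Integration.integrable_add) (simp_all add: Z4)
      show "\<bar>Z s a \<omega> * Z u b \<omega> * Z v c \<omega> * Z w d \<omega>\<bar> \<le> Z s a \<omega> ^ 4 + Z u b \<omega> ^ 4 + Z v c \<omega> ^ 4 + Z w d \<omega> ^ 4" for \<omega>
        by (rule amgm)
    qed
    also have "\<dots> = W" using Z4 by (simp add: W_def)
    finally have E: "\<bar>expectation (\<lambda>\<omega>. Z s a \<omega> * Z u b \<omega> * Z v c \<omega> * Z w d \<omega>)\<bar> \<le> W" .
    have "\<bar>ac i p q * ac j r t\<bar> \<le> sqrt (ac 0 p p) * sqrt (ac 0 q q) * (sqrt (ac 0 r r) * sqrt (ac 0 t t))" for i j p q r t
      unfolding abs_mult by (intro mult_mono abs_ac_le) (auto simp: ac_diag_nonneg)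
    from this[of "u - s" a b "w - v" c d] this[of "v - s" a c "w - u" b d] this[of "w - s" a d "v - u" b c] E
    show ?thesis unfolding A_def using expectation_ZZZZ(1)[of s a u b v c w d] by linarith
  qed
  then show ?thesis by blast
qed

end

lemma filtercomap_abs_eventually:
  fixes P :: "int \<Rightarrow> bool"
  assumes "eventually P (filtercomap abs at_top)"
  shows "\<exists>J. \<forall>j. J \<le> \<bar>j\<bar> \<longrightarrow> P j"
  using assms unfolding eventually_filtercomap eventually_at_top_linorder by blast

locale fourth_order_mixing = fourth_order M x
  for M :: "'a measure" and x :: "int \<Rightarrow> 'a \<Rightarrow> real ^ 'q" +
  assumes ac_lim: "((\<lambda>u::int. autocov_matrix M x \<bar>u\<bar>) \<longlongrightarrow> 0) (filtercomap abs at_top)"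
    and cum_lim: "\<And>i j k l. ((\<lambda>u::int. SUP (v, w)\<in>UNIV. \<bar>fourth_cumulant M x i j k l 0 u v w\<bar>) \<longlongrightarrow> 0)
                      (filtercomap abs at_top)"
begin

text \<open>The hypothesis concerns nonnegative lags. A negative lag gives the transposed entry, so
  both entries have to be small.\<close>

lemma ac_small:
  assumes "0 < r"
  shows "\<exists>J. \<forall>j. J \<le> \<bar>j\<bar> \<longrightarrow> \<bar>ac j a b\<bar> < r"
proof -
  have "\<exists>J. \<forall>j. J \<le> \<bar>j\<bar> \<longrightarrow> \<bar>ac \<bar>j\<bar> a b\<bar> < r" for a b
  proof (rule filtercomap_abs_eventually)
    have "((\<lambda>u::int. autocov_matrix M x \<bar>u\<bar> $ a $ b) \<longlongrightarrow> 0 $ a $ b) (filtercomap abs at_top)"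
      by (intro tendsto_vec_nth ac_lim)
    from tendstoD[OF this \<open>0 < r\<close>] show "eventually (\<lambda>j. \<bar>ac \<bar>j\<bar> a b\<bar> < r) (filtercomap abs at_top)"
      by (simp add: ac_def dist_real_def)
  qed
  from this[of a b] this[of b a] obtain J1 J2 where J: "\<forall>j. J1 \<le> \<bar>j\<bar> \<longrightarrow> \<bar>ac \<bar>j\<bar> a b\<bar> < r" "\<forall>j. J2 \<le> \<bar>j\<bar> \<longrightarrow> \<bar>ac \<bar>j\<bar> b a\<bar> < r" by blast
  have "\<bar>ac j a b\<bar> < r" if "max J1 J2 \<le> \<bar>j\<bar>" for j
  proof (cases "0 \<le> j")
    case True
    then show ?thesis using J(1)[rule_format, of j] that by simp
  next
    case False
    then show ?thesis using J(2)[rule_format, of j] that ac_minus[of "-j" a b] by simp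
  qed
  then show ?thesis by blast
qed

lemma cumulant_small:
  assumes "0 < r"
  shows "\<exists>J. \<forall>u. J \<le> \<bar>u\<bar> \<longrightarrow> (\<forall>v w. \<bar>fourth_cumulant M x a b c d 0 u v w\<bar> < r)"
proof -
  obtain K where K: "\<And>s u v w. \<bar>fourth_cumulant M x a b c d s u v w\<bar> \<le> K" using cumulant_bounded[of a b c d] by blast
  let ?S = "\<lambda>u. SUP (v, w)\<in>UNIV. \<bar>fourth_cumulant M x a b c d 0 u v w\<bar>"
  have "eventually (\<lambda>u. \<bar>?S u\<bar> < r) (filtercomap abs at_top)"
    using tendstoD[OF cum_lim \<open>0 < r\<close>, of a b c d] by (simp add: dist_real_def)
  then obtain J where J: "\<forall>u. J \<le> \<bar>u\<bar> \<longrightarrow> \<bar>?S u\<bar> < r" using filtercomap_abs_eventually by blast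
  have "\<bar>fourth_cumulant M x a b c d 0 u v w\<bar> < r" if "J \<le> \<bar>u\<bar>" for u v w
  proof -
    have "(\<lambda>(v, w). \<bar>fourth_cumulant M x a b c d 0 u v w\<bar>) (v, w) \<le> ?S u"
      by (rule cSUP_upper) (use K in \<open>auto intro!: bdd_aboveI[of _ K]\<close>)
    moreover have "\<bar>?S u\<bar> < r" using J that by blast
    ultimately show ?thesis by simp
  qed
  then show ?thesis by blast
qed

end

section \<open>Laws of large numbers for the regressors\<close>

context fourth_order_mixing
begin

text \<open>The covariance, at time distance \<open>d\<close>, of the products of component
  \<open>i\<close> with component \<open>k\<close> taken \<open>j\<close> steps earlier: the
  cumulant and the two remaining Gaussian pairings.\<close>

definition lagcov :: "'q \<Rightarrow> 'q \<Rightarrow> int \<Rightarrow> int \<Rightarrow> real" where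
  "lagcov i k j d = fourth_cumulant M x i i k k 0 (- d) (- j) (- d - j)
     + ac (- d) i i * ac (- d) k k + ac (- d - j) i k * ac (d - j) i k"

lemma expectation_lag_products:
  "expectation (\<lambda>\<omega>. (Z t i \<omega> * Z (t - j) k \<omega> - ac (- j) i k) * (Z s i \<omega> * Z (s - j) k \<omega> - ac (- j) i k)) = lagcov i k j (t - s)"
proof -
  have int: "integrable M (\<lambda>\<omega>. Z t i \<omega> * Z s i \<omega> * Z (t - j) k \<omega> * Z (s - j) k \<omega>)" by (rule expectation_ZZZZ(2))
  have eq: "(Z t i \<omega> * Z (t - j) k \<omega> - ac (- j) i k) * (Z s i \<omega> * Z (s - j) k \<omega> - ac (- j) i k) =
      Z t i \<omega> * Z s i \<omega> * Z (t - j) k \<omega> * Z (s - j) k \<omega> - ac (- j) i k * (Z t i \<omega> * Z (t - j) k \<omega>)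
      - ac (- j) i k * (Z s i \<omega> * Z (s - j) k \<omega>) + ac (- j) i k * ac (- j) i k" for \<omega>
    by (simp add: algebra_simps)
  have "expectation (\<lambda>\<omega>. (Z t i \<omega> * Z (t - j) k \<omega> - ac (- j) i k) * (Z s i \<omega> * Z (s - j) k \<omega> - ac (- j) i k)) =
      expectation (\<lambda>\<omega>. Z t i \<omega> * Z s i \<omega> * Z (t - j) k \<omega> * Z (s - j) k \<omega>) - ac (- j) i k * ac (- j) i k"
    unfolding eq using int integrable_ZZ by (simp add: prob_space expectation_ZZ)
  also have "\<dots> = fourth_cumulant M x i i k k t s (t - j) (s - j) + ac (s - t) i i * ac (s - t) k k
      + ac (s - j - t) i k * ac (t - j - s) i k"
    unfolding expectation_ZZZZ(1) by (simp add: algebra_simps)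
  also have "fourth_cumulant M x i i k k t s (t - j) (s - j) = fourth_cumulant M x i i k k 0 (s - t) (- j) (s - t - j)"
    using cumulant_shift[of i i k k 0 t "s - t" "- j" "s - t - j"] by (simp add: algebra_simps)
  finally show ?thesis by (simp add: lagcov_def algebra_simps)
qed

text \<open>In each summand at least one factor tends to 0 as \<open>d\<close> grows while the other
  stays bounded.\<close>

lemma lagcov_small:
  assumes "0 < r"
  shows "\<exists>J. \<forall>d. J \<le> \<bar>d\<bar> \<longrightarrow> \<bar>lagcov i k j d\<bar> < r"
proof -
  define V where "V = sqrt (ac 0 i i) * sqrt (ac 0 k k) + ac 0 k k + 1"
  have V: "0 < V" using ac_diag_nonneg[of i] ac_diag_nonneg[of k] by (simp add: V_def add_nonneg_pos)
  have r: "0 < r / (3 * V)" "0 < r / 3" using assms V by simp_all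
  obtain J1 where J1: "\<forall>u. J1 \<le> \<bar>u\<bar> \<longrightarrow> (\<forall>v w. \<bar>fourth_cumulant M x i i k k 0 u v w\<bar> < r / 3)"
    using cumulant_small[OF r(2)] by blast
  obtain J2 where J2: "\<forall>u. J2 \<le> \<bar>u\<bar> \<longrightarrow> \<bar>ac u i i\<bar> < r / (3 * V)" using ac_small[OF r(1)] by blast
  obtain J3 where J3: "\<forall>u. J3 \<le> \<bar>u\<bar> \<longrightarrow> \<bar>ac u i k\<bar> < r / (3 * V)" using ac_small[OF r(1)] by blast
  \<comment> \<open>One covariance sits at lag \<open>- d - j\<close>, so its threshold is raised by
    the fixed \<open>j\<close>.\<close>
  have "\<bar>lagcov i k j d\<bar> < r" if d: "max J1 (max J2 (J3 + \<bar>j\<bar>)) \<le> \<bar>d\<bar>" for d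
  proof -
    have d': "J1 \<le> \<bar>- d\<bar>" "J2 \<le> \<bar>- d\<bar>" "J3 \<le> \<bar>- d - j\<bar>" using d by auto
    have 1: "\<bar>fourth_cumulant M x i i k k 0 (- d) (- j) (- d - j)\<bar> < r / 3" using J1 d'(1) by blast
    have kk: "\<bar>ac (- d) k k\<bar> \<le> V" 
    proof -
      have "\<bar>ac (- d) k k\<bar> \<le> ac 0 k k" using abs_ac_le[of "-d" k k] ac_diag_nonneg[of k] by simp
      moreover have "0 \<le> sqrt (ac 0 i i) * sqrt (ac 0 k k)" by (simp add: ac_diag_nonneg)
      ultimately show ?thesis unfolding V_def by linarith
    qed
    have ik: "\<bar>ac (d - j) i k\<bar> \<le> V" 
      using abs_ac_le[of "d - j" i k] ac_diag_nonneg[of k] unfolding V_def by linarith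
    have 2: "\<bar>ac (- d) i i * ac (- d) k k\<bar> \<le> r / (3 * V) * V"
      unfolding abs_mult using J2[rule_format, OF d'(2)] kk r by (intro mult_mono) auto
    have 3: "\<bar>ac (- d - j) i k * ac (d - j) i k\<bar> \<le> r / (3 * V) * V"
      unfolding abs_mult using J3[rule_format, OF d'(3)] ik r by (intro mult_mono) auto
    have "r / (3 * V) * V = r / 3" using V by simp
    then show ?thesis unfolding lagcov_def using 1 2 3 by linarith
  qed
  then show ?thesis by blast
qed

text \<open>The variance of the average is at most a Cesaro mean of covariances that vanish at large
  distance, so convergence holds in mean square and hence in mean.\<close>

lemma lag_average_L1:
  "(\<lambda>n. expectation (\<lambda>\<omega>. \<bar>(\<Sum>t=1..int n. Z t i \<omega> * Z (t - j) k \<omega>) / real n - ac (- j) i k\<bar>)) \<longlonglongrightarrow> 0"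
proof (rule tendsto_0_le[where K=1])
  let ?A = "\<lambda>n. \<Sum>d=-int n..int n. \<bar>lagcov i k j d\<bar>"
  have "(\<lambda>n. sqrt (?A n / real n)) \<longlonglongrightarrow> sqrt 0" by (intro tendsto_real_sqrt cesaro_abs_null lagcov_small)
  then show "(\<lambda>n. sqrt (?A n / real n)) \<longlonglongrightarrow> 0" by simp
  let ?E = "\<lambda>n. expectation (\<lambda>\<omega>. \<bar>(\<Sum>t=1..int n. Z t i \<omega> * Z (t - j) k \<omega>) / real n - ac (- j) i k\<bar>)"
  have "norm (?E n) \<le> norm (sqrt (?A n / real n)) * 1" if n: "0 < n" for n
  proof -
    let ?W = "\<lambda>t \<omega>. Z t i \<omega> * Z (t - j) k \<omega> - ac (- j) i k"
    let ?Y = "\<lambda>\<omega>. (\<Sum>t=1..int n. Z t i \<omega> * Z (t - j) k \<omega>) / real n - ac (- j) i k"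
    have YW: "?Y \<omega> = (\<Sum>t=1..int n. ?W t \<omega>) / real n" for \<omega>
      using n by (simp add: sum_subtractf diff_divide_distrib)
    have Y2: "(?Y \<omega>)\<^sup>2 = (\<Sum>t=1..int n. \<Sum>s=1..int n. ?W t \<omega> * ?W s \<omega>) / (real n)\<^sup>2" for \<omega>
      unfolding YW power_divide power2_eq_square[of "sum _ _"] sum_product ..
    have iW: "integrable M (\<lambda>\<omega>. ?W t \<omega> * ?W s \<omega>)" for t s
    proof (rule integrable_mult_square_integrable)
      have eq: "(?W t \<omega>)\<^sup>2 = (Z t i \<omega> * Z (t - j) k \<omega>)\<^sup>2 - 2 * ac (- j) i k * (Z t i \<omega> * Z (t - j) k \<omega>) + (ac (- j) i k)\<^sup>2" for t \<omega>
        by (simp add: power2_eq_square algebra_simps)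
      show "integrable M (\<lambda>\<omega>. (?W t \<omega>)\<^sup>2)" for t unfolding eq using integrable_ZZ_sq integrable_ZZ by simp
      then show "integrable M (\<lambda>\<omega>. (?W s \<omega>)\<^sup>2)" .
    qed measurable
    have E2: "expectation (\<lambda>\<omega>. (?Y \<omega>)\<^sup>2) \<le> ?A n / real n"
    proof -
      have "expectation (\<lambda>\<omega>. (?Y \<omega>)\<^sup>2) = (\<Sum>t=1..int n. \<Sum>s=1..int n. lagcov i k j (t - s)) / (real n)\<^sup>2"
        unfolding Y2 using iW by (simp add: expectation_lag_products)
      also have "\<dots> \<le> (?A n * real n) / (real n)\<^sup>2"
        using toeplitz_quad_le[where f="lagcov i k j" and n=n and u="\<lambda>_. 1"] by (intro divide_right_mono) auto
      finally show ?thesis using n by (simp add: power2_eq_square)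
    qed
    have "integrable M (\<lambda>\<omega>. (?Y \<omega>)\<^sup>2)" unfolding Y2 using iW by auto
    then have "?E n \<le> sqrt (?A n / real n)" by (intro abs_expectation_le_sqrt E2) measurable
    moreover have "0 \<le> ?E n" by (rule Bochner_Integration.integral_nonneg) simp
    ultimately show ?thesis by simp
  qed
  then show "eventually (\<lambda>n. norm (?E n) \<le> norm (sqrt (?A n / real n)) * 1) sequentially"
    by (auto simp: eventually_sequentially intro!: exI[of _ 1])
qed

definition Zbar :: "nat \<Rightarrow> 'q \<Rightarrow> 'a \<Rightarrow> real" where "Zbar n a \<omega> = (\<Sum>t=1..int n. Z t a \<omega>) / real n"

lemma Zbar_measurable[measurable]: "Zbar n a \<in> borel_measurable M"
  unfolding Zbar_def[abs_def] by measurable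

lemma Zbar_sq:
  shows "integrable M (\<lambda>\<omega>. (Zbar n a \<omega>)\<^sup>2)"
    and "expectation (\<lambda>\<omega>. (Zbar n a \<omega>)\<^sup>2) \<le> (\<Sum>d=-int n..int n. \<bar>ac d a a\<bar>) / real n"
proof -
  have eq: "(Zbar n a \<omega>)\<^sup>2 = (\<Sum>t=1..int n. \<Sum>s=1..int n. Z t a \<omega> * Z s a \<omega>) / (real n)\<^sup>2" for \<omega>
    unfolding Zbar_def power_divide power2_eq_square[of "sum _ _"] sum_product ..
  show "integrable M (\<lambda>\<omega>. (Zbar n a \<omega>)\<^sup>2)" unfolding eq using integrable_ZZ by auto
  have exp: "expectation (\<lambda>\<omega>. Z t a \<omega> * Z s a \<omega>) = ac (t - s) a a" for t s
    using ac_minus[of "t - s" a a] by (simp add: expectation_ZZ)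
  have "expectation (\<lambda>\<omega>. (Zbar n a \<omega>)\<^sup>2) = (\<Sum>t=1..int n. \<Sum>s=1..int n. ac (t - s) a a) / (real n)\<^sup>2"
    unfolding eq using integrable_ZZ by (simp add: exp)
  also have "\<dots> \<le> ((\<Sum>d=-int n..int n. \<bar>ac d a a\<bar>) * real n) / (real n)\<^sup>2"
    using toeplitz_quad_le[where f="\<lambda>d. ac d a a" and n=n and u="\<lambda>_. 1"] by (intro divide_right_mono) auto
  also have "\<dots> = (\<Sum>d=-int n..int n. \<bar>ac d a a\<bar>) / real n" by (simp add: power2_eq_square)
  finally show "expectation (\<lambda>\<omega>. (Zbar n a \<omega>)\<^sup>2) \<le> (\<Sum>d=-int n..int n. \<bar>ac d a a\<bar>) / real n" .
qed

lemma Zbar_sq_tendsto_0: "(\<lambda>n. expectation (\<lambda>\<omega>. (Zbar n a \<omega>)\<^sup>2)) \<longlonglongrightarrow> 0"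
proof (rule tendsto_sandwich[where f="\<lambda>_. 0"])
  show "(\<lambda>n. (\<Sum>d=-int n..int n. \<bar>ac d a a\<bar>) / real n) \<longlonglongrightarrow> 0" by (rule cesaro_abs_null) (rule ac_small)
qed (use Zbar_sq(2) in \<open>auto intro!: always_eventually Bochner_Integration.integral_nonneg\<close>)

lemma centred_sample: "n > 0 \<Longrightarrow> (x t \<omega> - sample_mean n (\<lambda>t. x t \<omega>)) $ a = Z t a \<omega> - Zbar n a \<omega>"
  by (simp add: Z_def Zbar_def sample_mean_def sum_subtractf diff_divide_distrib)

lemma expectation_centred_sq_le:
  assumes n: "0 < n"
  shows "integrable M (\<lambda>\<omega>. \<Sum>t=1..int n. ((x t \<omega> - sample_mean n (\<lambda>t. x t \<omega>)) $ a)\<^sup>2)"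
    and "expectation (\<lambda>\<omega>. \<Sum>t=1..int n. ((x t \<omega> - sample_mean n (\<lambda>t. x t \<omega>)) $ a)\<^sup>2) \<le> real n * ac 0 a a"
proof -
  have eq: "(\<Sum>t=1..int n. ((x t \<omega> - sample_mean n (\<lambda>t. x t \<omega>)) $ a)\<^sup>2) = (\<Sum>t=1..int n. Z t a \<omega> * Z t a \<omega>) - real n * (Zbar n a \<omega>)\<^sup>2" for \<omega>
  proof -
    have "(\<Sum>t=1..int n. ((x t \<omega> - sample_mean n (\<lambda>t. x t \<omega>)) $ a)\<^sup>2) =
      (\<Sum>t=1..int n. Z t a \<omega> * Z t a \<omega> - 2 * Zbar n a \<omega> * Z t a \<omega> + (Zbar n a \<omega>)\<^sup>2)"
      unfolding centred_sample[OF n] by (intro sum.cong) (simp_all add: power2_eq_square algebra_simps)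
    also have "\<dots> = (\<Sum>t=1..int n. Z t a \<omega> * Z t a \<omega>) - 2 * Zbar n a \<omega> * (\<Sum>t=1..int n. Z t a \<omega>) + real n * (Zbar n a \<omega>)\<^sup>2"
      by (simp add: sum.distrib sum_subtractf sum_distrib_left)
    also have "(\<Sum>t=1..int n. Z t a \<omega>) = real n * Zbar n a \<omega>" using n by (simp add: Zbar_def)
    finally show ?thesis by (simp add: power2_eq_square)
  qed
  show "integrable M (\<lambda>\<omega>. \<Sum>t=1..int n. ((x t \<omega> - sample_mean n (\<lambda>t. x t \<omega>)) $ a)\<^sup>2)"
    unfolding eq using integrable_ZZ Zbar_sq(1) by auto
  have "expectation (\<lambda>\<omega>. \<Sum>t=1..int n. ((x t \<omega> - sample_mean n (\<lambda>t. x t \<omega>)) $ a)\<^sup>2) =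
      real n * ac 0 a a - real n * expectation (\<lambda>\<omega>. (Zbar n a \<omega>)\<^sup>2)"
    unfolding eq using integrable_ZZ Zbar_sq(1) by (simp add: expectation_ZZ)
  also have "\<dots> \<le> real n * ac 0 a a" by (simp add: Bochner_Integration.integral_nonneg)
  finally show "expectation (\<lambda>\<omega>. \<Sum>t=1..int n. ((x t \<omega> - sample_mean n (\<lambda>t. x t \<omega>)) $ a)\<^sup>2) \<le> real n * ac 0 a a" .
qed

lemma integrable_Zbar_Z: "integrable M (\<lambda>\<omega>. Zbar n p \<omega> * Z t q \<omega>)"
  by (rule integrable_mult_square_integrable) (use integrable_ZZ[of t q t q] Zbar_sq in \<open>simp_all add: power2_eq_square\<close>)

lemma integrable_Zbar_Zbar: "integrable M (\<lambda>\<omega>. Zbar n p \<omega> * Zbar n q \<omega>)"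
  by (rule integrable_mult_square_integrable) (use Zbar_sq in simp_all)

lemma integrable_centred_product: "integrable M (\<lambda>\<omega>. (Z t i \<omega> - Zbar n i \<omega>) * (Z s k \<omega> - Zbar n k \<omega>))"
proof -
  have "(Z t i \<omega> - Zbar n i \<omega>) * (Z s k \<omega> - Zbar n k \<omega>) =
      Z t i \<omega> * Z s k \<omega> - Zbar n i \<omega> * Z s k \<omega> - Zbar n k \<omega> * Z t i \<omega> + Zbar n i \<omega> * Zbar n k \<omega>" for \<omega>
    by (simp add: algebra_simps)
  then show ?thesis using integrable_ZZ integrable_Zbar_Z integrable_Zbar_Zbar by simp
qed

text \<open>With the true means in place of sample means this is \<open>toeplitz_L1\<close>. Each
  correction contains a factor \<open>Zbar\<close>, which tends to 0 in mean square, against row or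
  column sums at most \<open>A\<close>. Lag \<open>-j\<close> appears because the second time is
  \<open>t - j\<close>.\<close>

lemma weighted_moment_matrix_L1:
  fixes c :: "int \<Rightarrow> real"
  assumes A: "\<And>n. (\<Sum>j=-int n..int n. \<bar>c j\<bar>) \<le> A"
    and S: "(\<lambda>m. \<Sum>j=-int m..int m. c j * ac (- j) i k) \<longlonglongrightarrow> S"
  shows "(\<lambda>n. expectation (\<lambda>\<omega>. \<bar>(\<Sum>t=1..int n. \<Sum>s=1..int n. c (t - s) * (x t \<omega> - sample_mean n (\<lambda>t. x t \<omega>)) $ i *
      (x s \<omega> - sample_mean n (\<lambda>t. x t \<omega>)) $ k) / real n - S\<bar>)) \<longlonglongrightarrow> 0"
    (is "?E \<longlonglongrightarrow> 0")
proof -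
  have A0: "0 \<le> A" using A[of 0] by (rule order.trans[rotated]) simp
  let ?V = "\<lambda>a. ac 0 a a" and ?z = "\<lambda>n a. expectation (\<lambda>\<omega>. (Zbar n a \<omega>)\<^sup>2)"
  let ?main = "\<lambda>n. expectation (\<lambda>\<omega>. \<bar>(\<Sum>t=1..int n. \<Sum>s=1..int n. c (t - s) * (Z t i \<omega> * Z s k \<omega>)) / real n - S\<bar>)"
  let ?rest = "\<lambda>n. A * (sqrt (?z n i) * sqrt (?V k)) + A * (sqrt (?z n k) * sqrt (?V i)) + A * (sqrt (?z n i) * sqrt (?z n k))"
  have main: "?main \<longlonglongrightarrow> 0"
  proof (rule toeplitz_L1[OF A])
    show "integrable M (\<lambda>\<omega>. Z t i \<omega> * Z s k \<omega>)" for t s by (rule integrable_ZZ)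
    show "expectation (\<lambda>\<omega>. \<bar>Z t i \<omega> * Z s k \<omega>\<bar>) \<le> sqrt (?V i) * sqrt (?V k)" for t s
    proof -
      have "expectation (\<lambda>\<omega>. \<bar>Z t i \<omega> * Z s k \<omega>\<bar>) \<le> sqrt (expectation (\<lambda>\<omega>. (Z t i \<omega>)\<^sup>2)) * sqrt (expectation (\<lambda>\<omega>. (Z s k \<omega>)\<^sup>2))"
        by (rule integral_Cauchy_Schwarz) (use integrable_ZZ in \<open>simp_all add: power2_eq_square\<close>)
      then show ?thesis by (simp add: power2_eq_square expectation_ZZ)
    qed
    show "(\<lambda>n. expectation (\<lambda>\<omega>. \<bar>(\<Sum>t=1..int n. Z t i \<omega> * Z (t - j) k \<omega>) / real n - ac (- j) i k\<bar>)) \<longlonglongrightarrow> 0" for j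
      by (rule lag_average_L1)
  qed (rule S)
  have CS: "expectation (\<lambda>\<omega>. \<bar>Zbar n p \<omega> * Z t q \<omega>\<bar>) \<le> sqrt (?z n p) * sqrt (?V q)" for n p q t
  proof -
    have "expectation (\<lambda>\<omega>. \<bar>Zbar n p \<omega> * Z t q \<omega>\<bar>) \<le> sqrt (?z n p) * sqrt (expectation (\<lambda>\<omega>. (Z t q \<omega>)\<^sup>2))"
      by (rule integral_Cauchy_Schwarz) (use integrable_ZZ[of t q t q] Zbar_sq in \<open>simp_all add: power2_eq_square\<close>)
    then show ?thesis by (simp add: power2_eq_square expectation_ZZ)
  qed
  have bound: "?E n \<le> ?main n + ?rest n" if n: "0 < n" for n
  proof -
    let ?X = "\<lambda>t a \<omega>. Z t a \<omega> - Zbar n a \<omega>"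
    let ?b = "\<lambda>\<omega>. \<bar>(\<Sum>t=1..int n. \<Sum>s=1..int n. c (t - s) * (Z t i \<omega> * Z s k \<omega>)) / real n - S\<bar>
       + (\<Sum>s=1..int n. A * \<bar>Zbar n i \<omega> * Z s k \<omega>\<bar>) / real n + (\<Sum>t=1..int n. A * \<bar>Zbar n k \<omega> * Z t i \<omega>\<bar>) / real n
       + A * \<bar>Zbar n i \<omega> * Zbar n k \<omega>\<bar>"
    have "?E n = expectation (\<lambda>\<omega>. \<bar>(\<Sum>t=1..int n. \<Sum>s=1..int n. c (t - s) * (?X t i \<omega> * ?X s k \<omega>)) / real n - S\<bar>)"
      unfolding centred_sample[OF n] by (simp add: mult.assoc)
    also have "\<dots> \<le> expectation ?b"
    proof (rule integral_mono)
      show "integrable M (\<lambda>\<omega>. \<bar>(\<Sum>t=1..int n. \<Sum>s=1..int n. c (t - s) * (?X t i \<omega> * ?X s k \<omega>)) / real n - S\<bar>)"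
        using integrable_centred_product by auto
      show "integrable M ?b" using integrable_ZZ integrable_Zbar_Z integrable_Zbar_Zbar
        by (intro Bochner_Integration.integrable_add integrable_abs Bochner_Integration.integrable_diff integrable_divide_zero
            Bochner_Integration.integrable_sum integrable_mult_right) auto
      fix \<omega>
      have split: "(\<Sum>t=1..int n. \<Sum>s=1..int n. c (t - s) * (?X t i \<omega> * ?X s k \<omega>)) =
          (\<Sum>t=1..int n. \<Sum>s=1..int n. c (t - s) * (Z t i \<omega> * Z s k \<omega>))
          - (\<Sum>t=1..int n. \<Sum>s=1..int n. c (t - s) * (Zbar n i \<omega> * Z s k \<omega>))
          - (\<Sum>t=1..int n. \<Sum>s=1..int n. c (t - s) * (Zbar n k \<omega> * Z t i \<omega>))
          + (\<Sum>t=1..int n. \<Sum>s=1..int n. c (t - s) * (Zbar n i \<omega> * Zbar n k \<omega>))"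
        unfolding sum_subtractf[symmetric] sum.distrib[symmetric] by (intro sum.cong) (simp_all add: algebra_simps)
      have T1: "\<bar>\<Sum>t=1..int n. \<Sum>s=1..int n. c (t - s) * (Zbar n i \<omega> * Z s k \<omega>)\<bar> \<le> (\<Sum>s=1..int n. A * \<bar>Zbar n i \<omega> * Z s k \<omega>\<bar>)"
      proof -
        have "(\<Sum>t=1..int n. \<Sum>s=1..int n. c (t - s) * (Zbar n i \<omega> * Z s k \<omega>)) = (\<Sum>s=1..int n. \<Sum>t=1..int n. c (t - s) * (Zbar n i \<omega> * Z s k \<omega>))"
          by (rule sum.swap)
        also have "\<dots> = (\<Sum>s=1..int n. (\<Sum>t=1..int n. c (t - s)) * (Zbar n i \<omega> * Z s k \<omega>))" by (simp add: sum_distrib_right)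
        finally have eq: "(\<Sum>t=1..int n. \<Sum>s=1..int n. c (t - s) * (Zbar n i \<omega> * Z s k \<omega>)) = (\<Sum>s=1..int n. (\<Sum>t=1..int n. c (t - s)) * (Zbar n i \<omega> * Z s k \<omega>))" .
        show ?thesis unfolding eq
        proof (rule order.trans[OF sum_abs], rule sum_mono)
          fix s assume s: "s \<in> {1..int n}"
          have "\<bar>\<Sum>t=1..int n. c (t - s)\<bar> \<le> A"
            using toeplitz_col_le[OF s, of c] A[of n] sum_abs[of "\<lambda>t. c (t - s)" "{1..int n}"] by linarith
          then show "\<bar>(\<Sum>t=1..int n. c (t - s)) * (Zbar n i \<omega> * Z s k \<omega>)\<bar> \<le> A * \<bar>Zbar n i \<omega> * Z s k \<omega>\<bar>"
            unfolding abs_mult[of "sum _ _"] by (rule mult_right_mono) simp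
        qed
      qed
      have T23: "\<bar>\<Sum>t=1..int n. \<Sum>s=1..int n. c (t - s) * w t\<bar> \<le> (\<Sum>t=1..int n. A * \<bar>w t\<bar>)" for w
        unfolding sum_distrib_right[symmetric]
      proof (rule order.trans[OF sum_abs], rule sum_mono)
        fix t assume t: "t \<in> {1..int n}"
        have "\<bar>\<Sum>s=1..int n. c (t - s)\<bar> \<le> A"
          using toeplitz_row_le[OF t, of c] A[of n] sum_abs[of "\<lambda>s. c (t - s)" "{1..int n}"] by linarith
        then show "\<bar>(\<Sum>s=1..int n. c (t - s)) * w t\<bar> \<le> A * \<bar>w t\<bar>"
          unfolding abs_mult by (rule mult_right_mono) simp
      qed
      have T2: "\<bar>\<Sum>t=1..int n. \<Sum>s=1..int n. c (t - s) * (Zbar n k \<omega> * Z t i \<omega>)\<bar> \<le> (\<Sum>t=1..int n. A * \<bar>Zbar n k \<omega> * Z t i \<omega>\<bar>)"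
        by (rule T23)
      have T3: "\<bar>\<Sum>t=1..int n. \<Sum>s=1..int n. c (t - s) * (Zbar n i \<omega> * Zbar n k \<omega>)\<bar> \<le> real n * (A * \<bar>Zbar n i \<omega> * Zbar n k \<omega>\<bar>)"
        using T23[of "\<lambda>_. Zbar n i \<omega> * Zbar n k \<omega>"] by simp
      have tri: "\<bar>(m1 - m2 - m3 + m4) / N - S\<bar> \<le> \<bar>m1 / N - S\<bar> + b2 / N + b3 / N + b4"
        if "\<bar>m2\<bar> \<le> b2" "\<bar>m3\<bar> \<le> b3" "\<bar>m4\<bar> \<le> N * b4" "0 < N" for m1 m2 m3 m4 b2 b3 b4 N :: real
      proof -
        have "\<bar>m2 / N\<bar> \<le> b2 / N" "\<bar>m3 / N\<bar> \<le> b3 / N" "\<bar>m4 / N\<bar> \<le> b4"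
          using that by (simp_all add: divide_right_mono divide_le_eq mult.commute)
        moreover have "(m1 - m2 - m3 + m4) / N - S = (m1 / N - S) - m2 / N - m3 / N + m4 / N"
          by (simp add: add_divide_distrib diff_divide_distrib)
        ultimately show ?thesis by linarith
      qed
      show "\<bar>(\<Sum>t=1..int n. \<Sum>s=1..int n. c (t - s) * (?X t i \<omega> * ?X s k \<omega>)) / real n - S\<bar> \<le> ?b \<omega>"
        unfolding split by (rule tri[OF T1 T2 T3]) (use n in simp)
    qed
    also have "\<dots> = ?main n + (\<Sum>s=1..int n. A * expectation (\<lambda>\<omega>. \<bar>Zbar n i \<omega> * Z s k \<omega>\<bar>)) / real n
       + (\<Sum>t=1..int n. A * expectation (\<lambda>\<omega>. \<bar>Zbar n k \<omega> * Z t i \<omega>\<bar>)) / real n + A * expectation (\<lambda>\<omega>. \<bar>Zbar n i \<omega> * Zbar n k \<omega>\<bar>)"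
    proof -
      have "integrable M (\<lambda>\<omega>. \<bar>(\<Sum>t=1..int n. \<Sum>s=1..int n. c (t - s) * (Z t i \<omega> * Z s k \<omega>)) / real n - S\<bar>)"
        using integrable_ZZ by auto
      then show ?thesis using integrable_Zbar_Z integrable_Zbar_Zbar by simp
    qed
    also have "\<dots> \<le> ?main n + (\<Sum>s=1..int n. A * (sqrt (?z n i) * sqrt (?V k))) / real n
       + (\<Sum>t=1..int n. A * (sqrt (?z n k) * sqrt (?V i))) / real n + A * (sqrt (?z n i) * sqrt (?z n k))"
      using A0 Zbar_sq by (intro add_mono order.refl divide_right_mono sum_mono mult_left_mono CS integral_Cauchy_Schwarz) auto
    also have "\<dots> = ?main n + ?rest n" using n by simp
    finally show ?thesis .
  qed
  have "(\<lambda>n. ?main n + ?rest n) \<longlonglongrightarrow> 0 + (A * (sqrt 0 * sqrt (?V k)) + A * (sqrt 0 * sqrt (?V i)) + A * (sqrt 0 * sqrt 0))"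
    by (intro tendsto_intros main Zbar_sq_tendsto_0)
  then have lim: "(\<lambda>n. ?main n + ?rest n) \<longlonglongrightarrow> 0" by simp
  show ?thesis
  proof (rule tendsto_sandwich[OF _ _ tendsto_const lim])
    show "eventually (\<lambda>n. 0 \<le> ?E n) sequentially" by (simp add: Bochner_Integration.integral_nonneg)
    show "eventually (\<lambda>n. ?E n \<le> ?main n + ?rest n) sequentially"
      using eventually_gt_at_top[of 0] by eventually_elim (rule bound)
  qed
qed

end

section \<open>Weighted least squares for a fixed design\<close>

lemma sum_matrix_vector_mult:
  fixes A :: "'i \<Rightarrow> real ^ 'n ^ 'm"
  shows "(\<Sum>i\<in>I. A i) *v w = (\<Sum>i\<in>I. A i *v w)"
  by (induction I rule: infinite_finite_induct) (auto simp: matrix_vector_mult_add_rdistrib)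

lemma outer_prod_mult: "outer_prod u v *v w = (v \<bullet> w) *\<^sub>R u"
  by (simp add: vec_eq_iff outer_prod_def matrix_vector_mult_def inner_vec_def sum_distrib_left mult_ac)

definition wls_matrix :: "(int \<Rightarrow> real) \<Rightarrow> nat \<Rightarrow> (int \<Rightarrow> real ^ 'q) \<Rightarrow> real ^ 'q ^ 'q" where
  "wls_matrix c n x = (\<Sum>t=1..int n. \<Sum>s=1..int n.
     c (t - s) *\<^sub>R outer_prod (x t - sample_mean n x) (x s - sample_mean n x))"

definition wls_vector :: "(int \<Rightarrow> real) \<Rightarrow> nat \<Rightarrow> (int \<Rightarrow> real ^ 'q) \<Rightarrow> (int \<Rightarrow> real) \<Rightarrow> real ^ 'q" where
  "wls_vector c n x y = (\<Sum>t=1..int n. \<Sum>s=1..int n.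
     (c (t - s) * (y s - sample_mean n y)) *\<^sub>R (x t - sample_mean n x))"

lemma wls_slope_eq: "wls_slope c n x y = matrix_inv (wls_matrix c n x) *v wls_vector c n x y"
  by (simp add: wls_slope_def wls_matrix_def wls_vector_def)

lemma wls_matrix_component:
  "wls_matrix c n x $ i $ k = (\<Sum>t=1..int n. \<Sum>s=1..int n. c (t - s) * (x t - sample_mean n x) $ i * (x s - sample_mean n x) $ k)"
  by (simp add: wls_matrix_def outer_prod_def mult.assoc)

context
  fixes c :: "int \<Rightarrow> real" and n :: nat and x :: "int \<Rightarrow> real ^ 'q" and y z :: "int \<Rightarrow> real"
    and \<alpha>\<^sub>0 :: real and \<alpha> :: "real ^ 'q"
  assumes model: "\<And>t. y t = \<alpha>\<^sub>0 + \<alpha> \<bullet> x t + z t"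
begin

lemma sample_mean_regression: "0 < n \<Longrightarrow> sample_mean n y = \<alpha>\<^sub>0 + \<alpha> \<bullet> sample_mean n x + sample_mean n z"
  by (simp add: sample_mean_def model sum.distrib inner_sum_right add_divide_distrib)

lemma wls_vector_regression:
  assumes n: "0 < n"
  shows "wls_vector c n x y = wls_matrix c n x *v \<alpha> + wls_vector c n x z"
proof -
  have "y s - sample_mean n y = (x s - sample_mean n x) \<bullet> \<alpha> + (z s - sample_mean n z)" for s
    unfolding sample_mean_regression[OF n] by (simp add: model inner_diff_left inner_commute algebra_simps)
  then have "wls_vector c n x y = (\<Sum>t=1..int n. \<Sum>s=1..int n. c (t - s) *\<^sub>R (((x s - sample_mean n x) \<bullet> \<alpha>) *\<^sub>R (x t - sample_mean n x)) +
      (c (t - s) * (z s - sample_mean n z)) *\<^sub>R (x t - sample_mean n x))"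
    unfolding wls_vector_def by (simp add: distrib_left scaleR_add_left)
  also have "\<dots> = (\<Sum>t=1..int n. \<Sum>s=1..int n. c (t - s) *\<^sub>R (((x s - sample_mean n x) \<bullet> \<alpha>) *\<^sub>R (x t - sample_mean n x))) + wls_vector c n x z"
    unfolding wls_vector_def by (simp add: sum.distrib)
  also have "(\<Sum>t=1..int n. \<Sum>s=1..int n. c (t - s) *\<^sub>R (((x s - sample_mean n x) \<bullet> \<alpha>) *\<^sub>R (x t - sample_mean n x))) = wls_matrix c n x *v \<alpha>"
    unfolding wls_matrix_def sum_matrix_vector_mult
    by (intro sum.cong refl) (simp add: outer_prod_mult flip: scaleR_matrix_vector_assoc)
  finally show ?thesis .
qed

lemma wls_residual_regression:
  assumes n: "0 < n"
  shows "wls_residual c n x y t = z t - (sample_mean n z + (wls_slope c n x y - \<alpha>) \<bullet> (x t - sample_mean n x))"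
  unfolding wls_residual_def wls_intercept_def sample_mean_regression[OF n]
  by (simp add: model inner_diff_left inner_diff_right algebra_simps)

text \<open>The intercept absorbs the slope error, so that the estimation error enters the linear term only
  through the sum of the noise.\<close>

lemma wls_linear_term:
  "((wls_intercept c n x y, wls_slope c n x y) - (\<alpha>\<^sub>0, \<alpha>)) \<bullet> (\<Sum>t=1..int n. (1::real, x t)) = (\<Sum>t=1..int n. z t)"
proof (cases "n = 0")
  case False
  then have n: "0 < n" by simp
  have sx: "(\<Sum>t=1..int n. x t) = real n *\<^sub>R sample_mean n x" and sz: "(\<Sum>t=1..int n. z t) = real n * sample_mean n z"
    using n by (simp_all add: sample_mean_def)
  have "(\<Sum>t=1..int n. (1::real, x t)) = (real n, real n *\<^sub>R sample_mean n x)"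
    by (simp add: sum_prod sx)
  then show ?thesis
    unfolding sz wls_intercept_def sample_mean_regression[OF n]
    by (simp add: inner_diff_left algebra_simps)
qed simp

end

lemma wls_vector_component:
  fixes x :: "int \<Rightarrow> real ^ 'q"
  shows "wls_vector c n x z $ i = (\<Sum>s=1..int n. (\<Sum>t=1..int n. c (t - s) * (x t - sample_mean n x) $ i) * (z s - sample_mean n z))"
proof -
  have "wls_vector c n x z $ i = (\<Sum>t=1..int n. \<Sum>s=1..int n. c (t - s) * (x t - sample_mean n x) $ i * (z s - sample_mean n z))"
    unfolding wls_vector_def by (simp add: mult_ac)
  also have "\<dots> = (\<Sum>s=1..int n. \<Sum>t=1..int n. c (t - s) * (x t - sample_mean n x) $ i * (z s - sample_mean n z))"
    by (rule sum.swap)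
  finally show ?thesis by (simp add: sum_distrib_right)
qed

lemma sum_centred_sample:
  fixes x :: "int \<Rightarrow> 'v::real_vector"
  assumes "0 < n"
  shows "(\<Sum>t=1..int n. x t - sample_mean n x) = 0"
proof -
  have "(\<Sum>t=1..int n. sample_mean n x) = real n *\<^sub>R sample_mean n x"
    by (simp add: sum_constant_scaleR)
  then show ?thesis using assms by (simp add: sample_mean_def sum_subtractf)
qed

lemma invertible_matrix_inv:
  fixes D :: "real ^ 'q ^ 'q"
  assumes "invertible D"
  shows "D ** matrix_inv D = mat 1"
  using assms unfolding invertible_def matrix_inv_def by (rule someI2_ex) simp

text \<open>Errors of \<open>c0 / (2 * q\<^sup>2)\<close> in each of the q^2 entries change a vector
  of norm 1 by at most \<open>c0 / 2\<close>, so half of the lower bound survives and the kernel is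
  trivial.\<close>

lemma perturbed_matrix_bounded_below:
  fixes S D :: "real ^ 'q ^ 'q"
  assumes S: "\<And>w. c0 * norm w \<le> norm (S *v w)" and c0: "0 < c0" and n: "0 < n"
    and close: "\<And>i k. \<bar>D $ i $ k / real n - S $ i $ k\<bar> \<le> c0 / (2 * (real CARD('q))\<^sup>2)"
  shows "invertible D" and "norm w \<le> 2 / (c0 * real n) * norm (D *v w)"
proof -
  let ?q = "real CARD('q)"
  have q: "0 < ?q" by simp
  have low: "c0 / 2 * real n * norm w \<le> norm (D *v w)" for w
  proof -
    define E where "E = (1 / real n) *\<^sub>R D - S"
    have E: "\<bar>E $ i $ k\<bar> \<le> c0 / (2 * ?q\<^sup>2)" for i k using close[of i k] by (simp add: E_def)
    have "norm (E *v w) \<le> (\<Sum>i\<in>UNIV. \<bar>(E *v w) $ i\<bar>)" by (rule norm_le_l1_cart)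
    also have "\<dots> \<le> (\<Sum>i\<in>(UNIV::'q set). \<Sum>k\<in>(UNIV::'q set). c0 / (2 * ?q\<^sup>2) * norm w)"
    proof (rule sum_mono)
      fix i
      have "\<bar>(E *v w) $ i\<bar> \<le> (\<Sum>k\<in>UNIV. \<bar>E $ i $ k * w $ k\<bar>)" unfolding matrix_vector_mult_def by (simp add: sum_abs)
      also have "\<dots> \<le> (\<Sum>k\<in>(UNIV::'q set). c0 / (2 * ?q\<^sup>2) * norm w)"
        unfolding abs_mult using E c0 by (intro sum_mono mult_mono component_le_norm_cart) auto
      finally show "\<bar>(E *v w) $ i\<bar> \<le> (\<Sum>k\<in>(UNIV::'q set). c0 / (2 * ?q\<^sup>2) * norm w)" .
    qed
    also have "\<dots> = c0 / 2 * norm w" using q by (simp add: power2_eq_square)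
    finally have "norm (E *v w) \<le> c0 / 2 * norm w" .
    moreover have "(1 / real n) *\<^sub>R (D *v w) = S *v w + E *v w"
      by (simp add: E_def matrix_vector_mult_diff_rdistrib scaleR_matrix_vector_assoc)
    then have "norm (S *v w) \<le> norm ((1 / real n) *\<^sub>R (D *v w)) + norm (E *v w)"
      using norm_triangle_ineq4[of "(1 / real n) *\<^sub>R (D *v w)" "E *v w"] by simp
    moreover have "norm ((1 / real n) *\<^sub>R (D *v w)) = norm (D *v w) / real n" by simp
    moreover have "c0 * norm w = c0 / 2 * norm w + c0 / 2 * norm w" by simp
    ultimately have "c0 / 2 * norm w \<le> norm (D *v w) / real n" using S[of w] by linarith
    then show ?thesis using n by (simp add: field_simps)
  qed
  have "D *v w = 0 \<Longrightarrow> w = 0" for w using low[of w] c0 n by (simp add: mult_le_0_iff)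
  then show "invertible D"
    unfolding invertible_left_inverse matrix_left_invertible_ker by blast
  show "norm w \<le> 2 / (c0 * real n) * norm (D *v w)" using low[of w] c0 n by (simp add: field_simps)
qed

text \<open>The expression inside the supremum as a function of two paths, so that \<open>x\<close>
  can be frozen while \<open>z\<close> remains random. The normalised sum of \<open>z\<close> stands
  for R_n, by \<open>wls_linear_term\<close>.\<close>

definition expansion_gap :: "(int \<Rightarrow> real) \<Rightarrow> real \<Rightarrow> (real \<Rightarrow> real) \<Rightarrow> (real \<Rightarrow> real) \<Rightarrow> nat \<Rightarrow> real \<Rightarrow> real ^ 'q \<Rightarrow>
    (int \<Rightarrow> real ^ 'q) \<Rightarrow> (int \<Rightarrow> real) \<Rightarrow> real \<Rightarrow> real" where
  "expansion_gap c s F f n \<alpha>\<^sub>0 \<alpha> x z u =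
     empirical_process s F n (\<lambda>t. wls_residual c n x (\<lambda>t. \<alpha>\<^sub>0 + \<alpha> \<bullet> x t + z t) t) u
     - empirical_process s F n z u - (1 / s * (\<Sum>t=1..int n. z t)) * f u"

text \<open>\<open>F\<close> cancels between the two empirical processes. The centred regressors sum
  to 0, so the noise has the same sum as the shifts, and the linear term can be distributed over the
  times.\<close>

lemma expansion_gap_eq:
  fixes x :: "int \<Rightarrow> real ^ 'q" and \<alpha> :: "real ^ 'q" and c z :: "int \<Rightarrow> _" and \<alpha>\<^sub>0 :: real
  assumes n: "0 < n"
  defines "b \<equiv> wls_slope c n x (\<lambda>t. \<alpha>\<^sub>0 + \<alpha> \<bullet> x t + z t) - \<alpha>"
  defines "d \<equiv> \<lambda>t. sample_mean n z + b \<bullet> (x t - sample_mean n x)"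
  shows "expansion_gap c s F f n \<alpha>\<^sub>0 \<alpha> x z u =
    1 / s * (\<Sum>t=1..int n. of_bool (z t \<le> u + d t) - of_bool (z t \<le> u) - d t * f u)"
proof -
  have res: "wls_residual c n x (\<lambda>t. \<alpha>\<^sub>0 + \<alpha> \<bullet> x t + z t) t = z t - d t" for t
    unfolding d_def b_def by (rule wls_residual_regression[OF refl n])
  have "(\<Sum>t=1..int n. d t) = real n * sample_mean n z + b \<bullet> (\<Sum>t=1..int n. x t - sample_mean n x)"
    by (simp add: d_def sum.distrib inner_sum_right)
  also have "\<dots> = (\<Sum>t=1..int n. z t)"
    unfolding sum_centred_sample[OF n] using n by (simp add: sample_mean_def)
  finally have sd: "(\<Sum>t=1..int n. z t) = (\<Sum>t=1..int n. d t)" ..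
  have "z t - d t \<le> u \<longleftrightarrow> z t \<le> u + d t" for t by linarith
  then show ?thesis
    unfolding expansion_gap_def empirical_process_def res sd
    by (simp only: sum_subtractf sum_distrib_right[symmetric]) (simp add: right_diff_distrib)
qed

context noise
begin

text \<open>For a regular design, Chebyshev's inequality confines both random coefficients to the
  cube of \<open>uniform_expansion\<close>, whose estimate is then evaluated at the coefficients
  that actually occur. The threshold for \<open>n\<close> is common to all regular designs, as
  needed for mixing over them.\<close>

lemma fixed_design_expansion:
  fixes c :: "int \<Rightarrow> real" and \<alpha> :: "real ^ 'q" and S :: "real ^ 'q ^ 'q"
  defines "s \<equiv> partial_sum_sd M eps"
  assumes growth: "0 < k" "eventually (\<lambda>n. k * real n \<le> (s n)\<^sup>2 \<and>
      real n * (\<Sum>j=-int n..int n. \<bar>noise_autocov M eps j\<bar>) \<le> C * (s n)\<^sup>2) sequentially"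
    and A: "\<And>n. (\<Sum>j=-int n..int n. \<bar>c j\<bar>) \<le> A" "0 < A"
    and S: "\<And>w. c0 * norm w \<le> norm (S *v w)" "0 < c0"
    and B: "1 \<le> B" and \<tau>: "0 < \<tau>" and p: "0 < p"
  shows "eventually (\<lambda>n. \<forall>x :: int \<Rightarrow> real ^ 'q.
      (\<forall>i. (\<Sum>t=1..int n. ((x t - sample_mean n x) $ i)\<^sup>2) \<le> real n * B\<^sup>2) \<longrightarrow>
      (\<forall>i k. \<bar>wls_matrix c n x $ i $ k / real n - S $ i $ k\<bar> \<le> c0 / (2 * (real CARD('q))\<^sup>2)) \<longrightarrow>
      prob {\<omega> \<in> space M. \<tau> < (SUP u. \<bar>expansion_gap c (s n) F f n \<alpha>\<^sub>0 \<alpha> x (\<lambda>t. eps t \<omega>) u\<bar>)} \<le> p) sequentially"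
proof -
  define q where "q = real CARD('q)"
  have q: "1 \<le> q" unfolding q_def using zero_less_card_finite[where 'a='q] by linarith
  \<comment> \<open>Chebyshev's inequality for the normalised noise sum, of second moment 1, gives
    p/3. In the same way \<open>B2\<close> allots p/(3q) to each component of the slope
    equation.\<close>
  define B1 where "B1 = sqrt (3 / p)"
  define B2 where "B2 = sqrt (3 * q * (\<bar>C\<bar> + 1) * A\<^sup>2 * B\<^sup>2 / p)"
  have B1: "0 < B1" "1 / B1\<^sup>2 = p / 3" using p by (simp_all add: B1_def)
  have B2sq: "B2\<^sup>2 = 3 * q * (\<bar>C\<bar> + 1) * A\<^sup>2 * B\<^sup>2 / p" using p q by (simp add: B2_def)
  have B2: "0 < B2" using p q A B unfolding B2_def by (auto intro!: divide_pos_pos mult_pos_pos)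
  \<comment> \<open>One radius for everything: \<open>B\<close> for the regressors,
    \<open>B1\<close> for the mean of the noise, and the last term for the slope error obtained by
    inverting the moment matrix.\<close>
  define Bf where "Bf = max B (max B1 (2 / c0 * (q * (B2 + B1 * A * B))))"
  have Bf: "0 < Bf" "B \<le> Bf" "B1 \<le> Bf" "2 / c0 * (q * (B2 + B1 * A * B)) \<le> Bf" "1 \<le> Bf" using B by (auto simp: Bf_def)
  have s0: "0 \<le> s n" for n unfolding s_def partial_sum_sd_def by (simp add: Bochner_Integration.integral_nonneg)
  have lower: "eventually (\<lambda>n. k * real n \<le> (s n)\<^sup>2) sequentially" using growth(2) by eventually_elim simp
  have upper: "(\<lambda>n. s n / real n) \<longlonglongrightarrow> 0" unfolding s_def by (rule partial_sum_sd_over_n[OF sq_summable])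
  have "0 < p / 3" using p by simp
  note unif = uniform_expansion[OF s0 growth(1) lower upper Bf(1) \<tau> this, where 'i="'q option"]
  show ?thesis
    using unif growth(2) eventually_gt_at_top[of 0]
  proof eventually_elim
    case (elim n)
    have n: "0 < n" "0 < real n" using elim(3) by simp_all
    have sk: "k * real n \<le> (s n)\<^sup>2" and sC: "real n * (\<Sum>j=-int n..int n. \<bar>noise_autocov M eps j\<bar>) \<le> C * (s n)\<^sup>2" using elim(2) by auto
    have s2pos: "0 < (s n)\<^sup>2" using sk growth(1) n by (meson less_le_trans mult_pos_pos)
    then have s: "0 < s n" using s0[of n] by (simp add: order_less_le)
    show ?case
    proof (intro allI impI)
      fix x :: "int \<Rightarrow> real ^ 'q"
      assume x2: "\<forall>i. (\<Sum>t=1..int n. ((x t - sample_mean n x) $ i)\<^sup>2) \<le> real n * B\<^sup>2"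
        and close: "\<forall>i k. \<bar>wls_matrix c n x $ i $ k / real n - S $ i $ k\<bar> \<le> c0 / (2 * (real CARD('q))\<^sup>2)"
      define z where "z t i = (x t - sample_mean n x) $ i" for t i
      \<comment> \<open>Coefficients of the noise in component \<open>i\<close> of the weighted
        normal equations.\<close>
      define V where "V i r = (\<Sum>t=1..int n. c (t - r) * z t i)" for i r
      have V2: "(\<Sum>r=1..int n. (V i r)\<^sup>2) \<le> A\<^sup>2 * (real n * B\<^sup>2)" for i
      proof -
        have "(\<Sum>r=1..int n. (V i r)\<^sup>2) \<le> A\<^sup>2 * (\<Sum>t=1..int n. (z t i)\<^sup>2)"
          unfolding V_def by (rule toeplitz_conv_sq_le[OF A])
        also have "\<dots> \<le> A\<^sup>2 * (real n * B\<^sup>2)" using x2 by (intro mult_left_mono) (auto simp: z_def)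
        finally show ?thesis .
      qed
      have V1: "(\<Sum>r=1..int n. \<bar>V i r\<bar>) \<le> real n * (A * B)" for i
        by (rule sum_abs_le_of_sum_sq) (use V2[of i] A B in \<open>auto simp: power_mult_distrib mult_ac\<close>)
      \<comment> \<open>The index \<open>None\<close> is the constant regressor, whose coefficient
        is the mean of the noise.\<close>
      define Z :: "int \<Rightarrow> 'q option \<Rightarrow> real" where "Z t j = (case j of None \<Rightarrow> 1 | Some i \<Rightarrow> z t i)" for t j
      have "\<forall>j. (\<Sum>t=1..int n. (Z t j)\<^sup>2) \<le> real n * Bf\<^sup>2"
      proof
        fix j show "(\<Sum>t=1..int n. (Z t j)\<^sup>2) \<le> real n * Bf\<^sup>2"
        proof (cases j)
          case None
          have "1 * 1 \<le> Bf * Bf" using Bf by (intro mult_mono) auto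
          then show ?thesis using None n by (simp add: Z_def power2_eq_square)
        next
          case (Some i)
          have "(\<Sum>t=1..int n. (Z t j)\<^sup>2) \<le> real n * B\<^sup>2" using x2 Some by (simp add: Z_def z_def)
          also have "\<dots> \<le> real n * Bf\<^sup>2" using Bf B by (intro mult_left_mono power_mono) auto
          finally show ?thesis .
        qed
      qed
      with elim(1) obtain E where E: "E \<in> events" "prob E \<le> p / 3"
        and gap: "\<forall>\<omega>\<in>space M - E. \<forall>u th. (\<forall>i. \<bar>th i\<bar> \<le> Bf * s n / real n) \<longrightarrow>
          \<bar>\<Sum>t=1..int n. of_bool (eps t \<omega> \<le> u + (\<Sum>i\<in>UNIV. th i * Z t i)) - of_bool (eps t \<omega> \<le> u)
           - (\<Sum>i\<in>UNIV. th i * Z t i) * f u\<bar> \<le> \<tau> * s n" by blast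
      define E1 where "E1 = {\<omega> \<in> space M. B1 * s n < \<bar>\<Sum>t=1..int n. eps t \<omega>\<bar>}"
      define E2 where "E2 i = {\<omega> \<in> space M. B2 * s n < \<bar>\<Sum>t=1..int n. V i t * eps t \<omega>\<bar>}" for i
      have [measurable]: "E1 \<in> events" "E2 i \<in> events" for i unfolding E1_def E2_def by measurable
      have p1: "prob E1 \<le> p / 3"
      proof -
        have "prob E1 \<le> (s n)\<^sup>2 / (B1 * s n)\<^sup>2"
          unfolding E1_def
          using expectation_weighted_sum_sq(1)[OF sq_summable, where n=n and w="\<lambda>_. 1"] partial_sum_sd_sq(1)[OF sq_summable, of n] B1 s
          by (intro chebyshev_sq) (auto simp: s_def)
        also have "\<dots> = 1 / B1\<^sup>2" using s by (simp add: power_mult_distrib)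
        finally show ?thesis using B1 by simp
      qed
      have p2: "prob (E2 i) \<le> p / (3 * q)" for i
      proof -
        let ?G = "\<Sum>j=-int n..int n. \<bar>noise_autocov M eps j\<bar>"
        have "expectation (\<lambda>\<omega>. (\<Sum>t=1..int n. V i t * eps t \<omega>)\<^sup>2) \<le> ?G * (\<Sum>t=1..int n. (V i t)\<^sup>2)"
          unfolding expectation_weighted_sum_sq(2)[OF sq_summable]
          using toeplitz_quad_le[where f="noise_autocov M eps" and n=n and u="V i"] by linarith
        also have "\<dots> \<le> ?G * (A\<^sup>2 * (real n * B\<^sup>2))" by (rule mult_left_mono[OF V2]) (simp add: sum_nonneg)
        also have "\<dots> = A\<^sup>2 * B\<^sup>2 * (real n * ?G)" by (simp add: mult_ac)
        also have "\<dots> \<le> A\<^sup>2 * B\<^sup>2 * ((\<bar>C\<bar> + 1) * (s n)\<^sup>2)"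
        proof (rule mult_left_mono)
          have "C * (s n)\<^sup>2 \<le> (\<bar>C\<bar> + 1) * (s n)\<^sup>2" by (rule mult_right_mono) auto
          then show "real n * ?G \<le> (\<bar>C\<bar> + 1) * (s n)\<^sup>2" using sC by linarith
        qed simp
        finally have "prob (E2 i) \<le> A\<^sup>2 * B\<^sup>2 * ((\<bar>C\<bar> + 1) * (s n)\<^sup>2) / (B2 * s n)\<^sup>2"
          unfolding E2_def using expectation_weighted_sum_sq(1)[OF sq_summable, where n=n and w="V i"] B2 s
          by (intro chebyshev_sq) auto
        also have "\<dots> = A\<^sup>2 * B\<^sup>2 * (\<bar>C\<bar> + 1) / B2\<^sup>2" using s by (simp add: power_mult_distrib)
        also have "\<dots> = p / (3 * q)"
        proof -
          define w where "w = A\<^sup>2 * B\<^sup>2 * (\<bar>C\<bar> + 1)"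
          have w: "0 < w" unfolding w_def using A B by (intro mult_pos_pos) auto
          have B2w: "B2\<^sup>2 = 3 * q * w / p" unfolding B2sq w_def by (simp add: mult_ac)
          show ?thesis unfolding w_def[symmetric] B2w using w p q by simp
        qed
        finally show ?thesis .
      qed
      define Bad where "Bad = E \<union> (E1 \<union> (\<Union>i\<in>UNIV. E2 i))"
      have mU: "(\<Union>i\<in>UNIV. E2 i) \<in> events" by auto
      have Bad: "Bad \<in> events" unfolding Bad_def using E(1) mU by auto
      have "prob Bad \<le> prob E + (prob E1 + (\<Sum>i\<in>UNIV. prob (E2 i)))"
        unfolding Bad_def using E(1) mU
        by (intro order.trans[OF measure_Un_le] add_mono order.refl measure_UNION_le) auto
      also have "\<dots> \<le> p / 3 + (p / 3 + (\<Sum>i\<in>(UNIV::'q set). p / (3 * q)))"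
        by (intro add_mono sum_mono p1 p2 E(2))
      also have "\<dots> = p" using q by (simp add: q_def)
      finally have pBad: "prob Bad \<le> p" .
      have "(SUP u. \<bar>expansion_gap c (s n) F f n \<alpha>\<^sub>0 \<alpha> x (\<lambda>t. eps t \<omega>) u\<bar>) \<le> \<tau>" if \<omega>: "\<omega> \<in> space M - Bad" for \<omega>
      proof (rule cSUP_least)
        fix u
        let ?e = "\<lambda>t. eps t \<omega>"
        define b where "b = wls_slope c n x (\<lambda>t. \<alpha>\<^sub>0 + \<alpha> \<bullet> x t + ?e t) - \<alpha>"
        have close': "\<And>i k. \<bar>wls_matrix c n x $ i $ k / real n - S $ i $ k\<bar> \<le> c0 / (2 * (real CARD('q))\<^sup>2)" using close by blast
        note low = perturbed_matrix_bounded_below[OF S n(1) close']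
        have Db: "wls_matrix c n x *v b = wls_vector c n x ?e"
        proof -
          have inv: "wls_matrix c n x ** matrix_inv (wls_matrix c n x) = mat 1" by (rule invertible_matrix_inv[OF low(1)])
          show ?thesis
            unfolding b_def wls_slope_eq wls_vector_regression[OF refl n(1)]
            by (simp add: matrix_vector_mult_diff_distrib matrix_vector_mul_assoc inv)
        qed
        have \<omega>E: "\<omega> \<in> space M - E" "\<omega> \<notin> E1" "\<And>i. \<omega> \<notin> E2 i" using \<omega> by (auto simp: Bad_def)
        have e1: "\<bar>\<Sum>t=1..int n. ?e t\<bar> \<le> B1 * s n" using \<omega>E(2) \<omega> by (auto simp: E1_def)
        have e2: "\<bar>\<Sum>t=1..int n. V i t * ?e t\<bar> \<le> B2 * s n" for i using \<omega>E(3)[of i] \<omega> by (auto simp: E2_def)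
        have mean: "\<bar>sample_mean n ?e\<bar> \<le> B1 * s n / real n"
          using e1 n by (simp add: sample_mean_def divide_right_mono)
        \<comment> \<open>The first part is the Toeplitz term controlled by \<open>E2\<close>; the
          second corrects for centring the noise at its sample mean.\<close>
        have Ni: "\<bar>wls_vector c n x ?e $ i\<bar> \<le> (B2 + B1 * A * B) * s n" for i
        proof -
          have "wls_vector c n x ?e $ i = (\<Sum>t=1..int n. V i t * ?e t) - sample_mean n ?e * (\<Sum>t=1..int n. V i t)"
            unfolding wls_vector_component V_def z_def by (simp add: right_diff_distrib sum_subtractf sum_distrib_left mult_ac)
          moreover have "\<bar>sample_mean n ?e * (\<Sum>t=1..int n. V i t)\<bar> \<le> B1 * s n / real n * (real n * (A * B))"
            unfolding abs_mult using mean order.trans[OF sum_abs V1[of i]] B1 s n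
            by (intro mult_mono) auto
          moreover have "B1 * s n / real n * (real n * (A * B)) = B1 * A * B * s n" using n by simp
          ultimately show ?thesis using e2[of i] by (simp add: distrib_right)
        qed
        have nN: "norm (wls_vector c n x ?e) \<le> q * ((B2 + B1 * A * B) * s n)"
        proof -
          have "norm (wls_vector c n x ?e) \<le> (\<Sum>i\<in>UNIV. \<bar>wls_vector c n x ?e $ i\<bar>)" by (rule norm_le_l1_cart)
          also have "\<dots> \<le> (\<Sum>i\<in>(UNIV::'q set). (B2 + B1 * A * B) * s n)" by (intro sum_mono Ni)
          finally show ?thesis by (simp add: q_def)
        qed
        have nb: "norm b \<le> Bf * s n / real n"
        proof -
          have "norm b \<le> 2 / (c0 * real n) * norm (wls_vector c n x ?e)" using low(2)[of b] unfolding Db .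
          also have "\<dots> \<le> 2 / (c0 * real n) * (q * ((B2 + B1 * A * B) * s n))"
            using nN S(2) n by (intro mult_left_mono) auto
          also have "\<dots> = 2 / c0 * (q * (B2 + B1 * A * B)) * s n / real n" by simp
          also have "\<dots> \<le> Bf * s n / real n" using Bf(4) s n by (intro divide_right_mono mult_right_mono) auto
          finally show ?thesis .
        qed
        define th :: "'q option \<Rightarrow> real" where "th j = (case j of None \<Rightarrow> sample_mean n ?e | Some i \<Rightarrow> b $ i)" for j
        have th: "\<forall>j. \<bar>th j\<bar> \<le> Bf * s n / real n"
        proof
          fix j show "\<bar>th j\<bar> \<le> Bf * s n / real n"
          proof (cases j)
            case None
            have "B1 * s n / real n \<le> Bf * s n / real n" using Bf(3) s n by (intro divide_right_mono mult_right_mono) auto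
            then show ?thesis using None mean by (simp add: th_def)
          next
            case (Some i)
            then show ?thesis using nb component_le_norm_cart[of b i] by (simp add: th_def)
          qed
        qed
        have dl: "(\<Sum>j\<in>UNIV. th j * Z t j) = sample_mean n ?e + b \<bullet> (x t - sample_mean n x)" for t
          by (simp add: UNIV_option_conv sum.reindex th_def Z_def z_def inner_vec_def)
        have "\<bar>\<Sum>t=1..int n. of_bool (?e t \<le> u + (\<Sum>j\<in>UNIV. th j * Z t j)) - of_bool (?e t \<le> u)
           - (\<Sum>j\<in>UNIV. th j * Z t j) * f u\<bar> \<le> \<tau> * s n"
          using gap[rule_format, OF \<omega>E(1), of th u] th by blast
        then show "\<bar>expansion_gap c (s n) F f n \<alpha>\<^sub>0 \<alpha> x ?e u\<bar> \<le> \<tau>"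
          unfolding dl expansion_gap_eq[OF n(1)] b_def[symmetric] abs_mult using s by (simp add: pos_divide_le_eq)
      qed simp
      then have "{\<omega> \<in> space M. \<tau> < (SUP u. \<bar>expansion_gap c (s n) F f n \<alpha>\<^sub>0 \<alpha> x (\<lambda>t. eps t \<omega>) u\<bar>)} \<subseteq> Bad"
        by (auto simp: not_less[symmetric])
      from finite_measure_mono[OF this Bad] pBad
      show "prob {\<omega> \<in> space M. \<tau> < (SUP u. \<bar>expansion_gap c (s n) F f n \<alpha>\<^sub>0 \<alpha> x (\<lambda>t. eps t \<omega>) u\<bar>)} \<le> p" by linarith
    qed
  qed
qed

end

section \<open>Measurability and independence\<close>

lemma borel_measurable_vec_components:
  fixes f :: "'w \<Rightarrow> real ^ 'q"
  assumes "\<And>i. (\<lambda>\<omega>. f \<omega> $ i) \<in> borel_measurable N"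
  shows "f \<in> borel_measurable N"
proof (subst borel_measurable_euclidean_space, intro ballI)
  fix b :: "real ^ 'q" assume "b \<in> Basis"
  then obtain i where "b = axis i 1" by (auto simp: Basis_vec_def)
  then show "(\<lambda>\<omega>. f \<omega> \<bullet> b) \<in> borel_measurable N" using assms[of i] by (simp add: inner_axis)
qed

lemma borel_measurable_vec_component:
  fixes f :: "'w \<Rightarrow> real ^ 'q"
  assumes "f \<in> borel_measurable N"
  shows "(\<lambda>\<omega>. f \<omega> $ i) \<in> borel_measurable N"
proof -
  have "(\<lambda>\<omega>. f \<omega> \<bullet> axis i 1) \<in> borel_measurable N" using assms by measurable
  then show ?thesis by (simp add: inner_axis)
qed

lemma borel_measurable_det:
  fixes A :: "'w \<Rightarrow> real ^ 'q ^ 'q"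
  assumes [measurable]: "\<And>i k. (\<lambda>\<omega>. A \<omega> $ i $ k) \<in> borel_measurable N"
  shows "(\<lambda>\<omega>. det (A \<omega>)) \<in> borel_measurable N"
  unfolding det_def by measurable

text \<open>Cramer's rule where the determinant does not vanish; elsewhere \<open>matrix_inv\<close> is one fixed matrix.\<close>

lemma borel_measurable_matrix_inv_vector:
  fixes A :: "'w \<Rightarrow> real ^ 'q ^ 'q" and v :: "'w \<Rightarrow> real ^ 'q"
  assumes A[measurable]: "\<And>i k. (\<lambda>\<omega>. A \<omega> $ i $ k) \<in> borel_measurable N"
    and v[measurable]: "\<And>i. (\<lambda>\<omega>. v \<omega> $ i) \<in> borel_measurable N"
  shows "(\<lambda>\<omega>. matrix_inv (A \<omega>) *v v \<omega>) \<in> borel_measurable N"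
proof (rule borel_measurable_vec_components)
  fix k
  \<comment> \<open>For a singular matrix the defining predicate of \<open>matrix_inv\<close> is
    identically false, so the choice operator returns this same matrix every time.\<close>
  define J :: "real ^ 'q ^ 'q" where "J = (SOME B. False)"
  have [measurable]: "(\<lambda>\<omega>. det (A \<omega>)) \<in> borel_measurable N" by (rule borel_measurable_det) (rule A)
  have [measurable]: "(\<lambda>\<omega>. det (\<chi> i j. if j = k then v \<omega> $ i else A \<omega> $ i $ j)) \<in> borel_measurable N"
    by (rule borel_measurable_det) simp
  have "(matrix_inv (A \<omega>) *v v \<omega>) $ k =
    (if det (A \<omega>) \<noteq> 0 then det (\<chi> i j. if j = k then v \<omega> $ i else A \<omega> $ i $ j) / det (A \<omega>)
      else (\<Sum>j\<in>UNIV. J $ k $ j * v \<omega> $ j))" for \<omega>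
  proof (cases "det (A \<omega>) \<noteq> 0")
    case True
    then have "A \<omega> ** matrix_inv (A \<omega>) = mat 1" by (intro invertible_matrix_inv) (simp add: invertible_det_nz)
    then have "A \<omega> *v (matrix_inv (A \<omega>) *v v \<omega>) = v \<omega>" by (simp add: matrix_vector_mul_assoc)
    then have "matrix_inv (A \<omega>) *v v \<omega> = (\<chi> k. det (\<chi> i j. if j = k then v \<omega> $ i else A \<omega> $ i $ j) / det (A \<omega>))"
      using cramer[OF True] by simp
    then show ?thesis using True by simp
  next
    case False
    then have "\<not> invertible (A \<omega>)" by (simp add: invertible_det_nz)
    then have "matrix_inv (A \<omega>) = J" unfolding invertible_def matrix_inv_def J_def by (intro arg_cong[where f=Eps]) blast
    then show ?thesis using False by (simp add: matrix_vector_mult_def)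
  qed
  then show "(\<lambda>\<omega>. (matrix_inv (A \<omega>) *v v \<omega>) $ k) \<in> borel_measurable N" by simp
qed

context
  fixes N :: "'w measure" and X :: "int \<Rightarrow> 'w \<Rightarrow> real ^ 'q" and E :: "int \<Rightarrow> 'w \<Rightarrow> real"
  assumes X[measurable]: "\<And>t. X t \<in> borel_measurable N" and E[measurable]: "\<And>t. E t \<in> borel_measurable N"
begin

lemma borel_measurable_centred: "(\<lambda>\<omega>. (X t \<omega> - sample_mean n (\<lambda>t. X t \<omega>)) $ i) \<in> borel_measurable N"
  by (rule borel_measurable_vec_component) (unfold sample_mean_def, measurable)

lemma borel_measurable_wls_matrix: "(\<lambda>\<omega>. wls_matrix c n (\<lambda>t. X t \<omega>) $ i $ k) \<in> borel_measurable N"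
  unfolding wls_matrix_component
  by (intro borel_measurable_sum borel_measurable_times borel_measurable_centred borel_measurable_const)

lemma borel_measurable_wls_vector: "(\<lambda>\<omega>. wls_vector c n (\<lambda>t. X t \<omega>) (\<lambda>t. E t \<omega>) $ i) \<in> borel_measurable N"
proof (rule borel_measurable_vec_component)
  show "(\<lambda>\<omega>. wls_vector c n (\<lambda>t. X t \<omega>) (\<lambda>t. E t \<omega>)) \<in> borel_measurable N"
    unfolding wls_vector_def sample_mean_def by measurable
qed

lemma borel_measurable_wls_slope: "(\<lambda>\<omega>. wls_slope c n (\<lambda>t. X t \<omega>) (\<lambda>t. E t \<omega>)) \<in> borel_measurable N"
  unfolding wls_slope_eq
  by (intro borel_measurable_matrix_inv_vector borel_measurable_wls_matrix borel_measurable_wls_vector)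

lemma borel_measurable_wls_residual: "(\<lambda>\<omega>. wls_residual c n (\<lambda>t. X t \<omega>) (\<lambda>t. E t \<omega>) t) \<in> borel_measurable N"
proof -
  note [measurable] = borel_measurable_wls_slope
  show ?thesis unfolding wls_residual_def wls_intercept_def sample_mean_def by measurable
qed

end

lemma borel_measurable_expansion_gap:
  fixes X :: "int \<Rightarrow> 'w \<Rightarrow> real ^ 'q" and E :: "int \<Rightarrow> 'w \<Rightarrow> real"
  assumes [measurable]: "\<And>t. X t \<in> borel_measurable N" "\<And>t. E t \<in> borel_measurable N"
  shows "(\<lambda>\<omega>. expansion_gap c s F f n \<alpha>\<^sub>0 \<alpha> (\<lambda>t. X t \<omega>) (\<lambda>t. E t \<omega>) u) \<in> borel_measurable N"
proof -
  have [measurable]: "(\<lambda>\<omega>. wls_residual c n (\<lambda>t. X t \<omega>) (\<lambda>t. \<alpha>\<^sub>0 + \<alpha> \<bullet> X t \<omega> + E t \<omega>) t) \<in> borel_measurable N" for t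
    using borel_measurable_wls_residual[of X N "\<lambda>t \<omega>. \<alpha>\<^sub>0 + \<alpha> \<bullet> X t \<omega> + E t \<omega>" c n t] by simp
  show ?thesis unfolding expansion_gap_def empirical_process_def by measurable
qed

text \<open>By right continuity, a value above the rational supremum would persist on an interval to
  the right, which contains a rational. The countable supremum is what measurability
  requires.\<close>

lemma Sup_abs_eq_Sup_rationals:
  fixes g :: "real \<Rightarrow> real"
  assumes bound: "\<And>u. \<bar>g u\<bar> \<le> B" and cont: "\<And>u. continuous (at_right u) g"
  shows "(SUP u. \<bar>g u\<bar>) = (SUP u\<in>\<rat>. \<bar>g u\<bar>)"
proof (rule antisym)
  have bdd: "bdd_above ((\<lambda>u. \<bar>g u\<bar>) ` T)" for T using bound by (intro bdd_aboveI2)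
  show "(SUP u\<in>\<rat>. \<bar>g u\<bar>) \<le> (SUP u. \<bar>g u\<bar>)" by (rule cSUP_subset_mono) (use bdd in \<open>auto intro: Rats_0\<close>)
  show "(SUP u. \<bar>g u\<bar>) \<le> (SUP u\<in>\<rat>. \<bar>g u\<bar>)"
  proof (rule cSUP_least)
    fix u
    show "\<bar>g u\<bar> \<le> (SUP u\<in>\<rat>. \<bar>g u\<bar>)"
    proof (rule ccontr)
      assume "\<not> ?thesis"
      then have less: "(SUP u\<in>\<rat>. \<bar>g u\<bar>) < \<bar>g u\<bar>" by simp
      have "((\<lambda>v. \<bar>g v\<bar>) \<longlongrightarrow> \<bar>g u\<bar>) (at_right u)" using cont[of u] unfolding continuous_within by (intro tendsto_rabs)
      from order_tendstoD(1)[OF this less] obtain b where b: "u < b" "\<And>v. u < v \<Longrightarrow> v < b \<Longrightarrow> (SUP u\<in>\<rat>. \<bar>g u\<bar>) < \<bar>g v\<bar>"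
        unfolding eventually_at_right_field by blast
      obtain r where r: "r \<in> \<rat>" "u < r" "r < b" using Rats_dense_in_real[OF b(1)] by blast
      have "\<bar>g r\<bar> \<le> (SUP u\<in>\<rat>. \<bar>g u\<bar>)" by (rule cSUP_upper[OF r(1) bdd])
      with b(2)[OF r(2,3)] show False by simp
    qed
  qed simp
qed

lemma continuous_at_right_indicator:
  fixes a u :: real
  shows "continuous (at_right u) (\<lambda>u. of_bool (a \<le> u) :: real)"
proof -
  have "eventually (\<lambda>v. of_bool (a \<le> v) = (of_bool (a \<le> u) :: real)) (at_right u)"
    unfolding eventually_at_right_field
  proof (cases "a \<le> u")
    case True
    then show "\<exists>b>u. \<forall>v>u. v < b \<longrightarrow> of_bool (a \<le> v) = (of_bool (a \<le> u) :: real)"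
      by (intro exI[of _ "u + 1"]) auto
  next
    case False
    then show "\<exists>b>u. \<forall>v>u. v < b \<longrightarrow> of_bool (a \<le> v) = (of_bool (a \<le> u) :: real)"
      by (intro exI[of _ a]) auto
  qed
  then show ?thesis unfolding continuous_within by (rule tendsto_eventually)
qed

lemma
  fixes x :: "int \<Rightarrow> real ^ 'q"
  assumes cont: "continuous_on UNIV f" and bound: "\<And>u. \<bar>f u\<bar> \<le> C"
  shows expansion_gap_bounded: "\<exists>B. \<forall>u. \<bar>expansion_gap c s F f n \<alpha>\<^sub>0 \<alpha> x z u\<bar> \<le> B"
    and expansion_gap_right_continuous: "continuous (at_right u) (expansion_gap c s F f n \<alpha>\<^sub>0 \<alpha> x z)"
proof -
  define r where "r t = wls_residual c n x (\<lambda>t. \<alpha>\<^sub>0 + \<alpha> \<bullet> x t + z t) t" for t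
  define m where "m = 1 / s * (\<Sum>t=1..int n. z t)"
  \<comment> \<open>\<open>F\<close> cancels, which leaves right-continuous indicators and the
    continuous \<open>f\<close>.\<close>
  have eq: "expansion_gap c s F f n \<alpha>\<^sub>0 \<alpha> x z u = 1 / s * (\<Sum>t=1..int n. of_bool (r t \<le> u) - of_bool (z t \<le> u)) - m * f u" for u
    unfolding expansion_gap_def empirical_process_def r_def m_def
    by (simp only: sum_subtractf) (simp add: right_diff_distrib)
  have "\<bar>expansion_gap c s F f n \<alpha>\<^sub>0 \<alpha> x z u\<bar> \<le> \<bar>1 / s\<bar> * real n + \<bar>m\<bar> * C" for u
  proof -
    have "\<bar>\<Sum>t=1..int n. of_bool (r t \<le> u) - (of_bool (z t \<le> u) :: real)\<bar> \<le> (\<Sum>t=1..int n. 1)"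
      by (intro order.trans[OF sum_abs] sum_mono) simp
    then have "\<bar>1 / s * (\<Sum>t=1..int n. of_bool (r t \<le> u) - of_bool (z t \<le> u))\<bar> \<le> \<bar>1 / s\<bar> * real n"
      unfolding abs_mult by (intro mult_left_mono) auto
    moreover have "\<bar>m * f u\<bar> \<le> \<bar>m\<bar> * C" unfolding abs_mult by (intro mult_left_mono bound) simp
    ultimately show ?thesis unfolding eq by linarith
  qed
  then show "\<exists>B. \<forall>u. \<bar>expansion_gap c s F f n \<alpha>\<^sub>0 \<alpha> x z u\<bar> \<le> B" by blast
  have "continuous (at_right u) f" using cont by (simp add: continuous_on_eq_continuous_at continuous_at_imp_continuous_at_within)
  then show "continuous (at_right u) (expansion_gap c s F f n \<alpha>\<^sub>0 \<alpha> x z)"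
    unfolding eq[abs_def] by (intro continuous_intros continuous_at_right_indicator)
qed

lemma borel_measurable_Sup_expansion_gap:
  fixes X :: "int \<Rightarrow> 'w \<Rightarrow> real ^ 'q" and E :: "int \<Rightarrow> 'w \<Rightarrow> real"
  assumes cont: "continuous_on UNIV f" and bound: "\<And>u. \<bar>f u\<bar> \<le> C"
    and X: "\<And>t. X t \<in> borel_measurable N" and E: "\<And>t. E t \<in> borel_measurable N"
  shows "(\<lambda>\<omega>. SUP u. \<bar>expansion_gap c s F f n \<alpha>\<^sub>0 \<alpha> (\<lambda>t. X t \<omega>) (\<lambda>t. E t \<omega>) u\<bar>) \<in> borel_measurable N"
proof -
  let ?g = "\<lambda>\<omega>. expansion_gap c s F f n \<alpha>\<^sub>0 \<alpha> (\<lambda>t. X t \<omega>) (\<lambda>t. E t \<omega>)"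
  have bdd: "\<exists>B. \<forall>u. \<bar>?g \<omega> u\<bar> \<le> B" for \<omega> by (rule expansion_gap_bounded[OF cont bound])
  have eq: "(SUP u. \<bar>?g \<omega> u\<bar>) = (SUP u\<in>\<rat>. \<bar>?g \<omega> u\<bar>)" for \<omega>
  proof -
    obtain B where "\<forall>u. \<bar>?g \<omega> u\<bar> \<le> B" using bdd by blast
    then show ?thesis by (intro Sup_abs_eq_Sup_rationals expansion_gap_right_continuous[OF cont bound]) blast
  qed
  show ?thesis unfolding eq
  proof (rule borel_measurable_cSUP)
    show "countable (\<rat> :: real set)" by (rule countable_rat)
    show "(\<lambda>\<omega>. \<bar>?g \<omega> u\<bar>) \<in> borel_measurable N" for u by (intro borel_measurable_abs borel_measurable_expansion_gap X E)
    fix \<omega>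
    obtain B where "\<forall>u. \<bar>?g \<omega> u\<bar> \<le> B" using bdd by blast
    then show "bdd_above ((\<lambda>u. \<bar>?g \<omega> u\<bar>) ` \<rat>)" by (intro bdd_aboveI2) blast
  qed
qed

text \<open>The freezing argument: the joint law is a product, so Fubini's theorem applies. Sections
  over \<open>G\<close> have probability at most \<open>p\<close>, and the others are bounded by
  1.\<close>

lemma (in prob_space) prob_independent_processes_le:
  fixes x :: "int \<Rightarrow> 'a \<Rightarrow> 'b::topological_space" and z :: "int \<Rightarrow> 'a \<Rightarrow> 'c::topological_space"
  assumes ind: "indep_processes M x z"
    and Q: "Q \<in> sets (PiM UNIV (\<lambda>_. borel) \<Otimes>\<^sub>M PiM UNIV (\<lambda>_. borel))" and G: "G \<in> sets (PiM UNIV (\<lambda>_. borel))"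
    and p: "0 \<le> p" "\<And>w. w \<in> G \<Longrightarrow> prob {\<omega> \<in> space M. (w, \<lambda>t. z t \<omega>) \<in> Q} \<le> p"
  shows "prob {\<omega> \<in> space M. (\<lambda>t. x t \<omega>, \<lambda>t. z t \<omega>) \<in> Q} \<le> p + prob {\<omega> \<in> space M. (\<lambda>t. x t \<omega>) \<notin> G}"
proof -
  define PX :: "(int \<Rightarrow> 'b) measure" where "PX = PiM UNIV (\<lambda>_. borel)"
  define PZ :: "(int \<Rightarrow> 'c) measure" where "PZ = PiM UNIV (\<lambda>_. borel)"
  define xp where "xp \<omega> = (\<lambda>t. x t \<omega>)" for \<omega>
  define zp where "zp \<omega> = (\<lambda>t. z t \<omega>)" for \<omega>
  have [measurable]: "xp \<in> measurable M PX" "zp \<in> measurable M PZ" "Q \<in> sets (PX \<Otimes>\<^sub>M PZ)" "G \<in> sets PX"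
    using ind Q G unfolding indep_processes_def xp_def[abs_def] zp_def[abs_def] PX_def PZ_def by auto
  have "indep_set {xp -` A \<inter> space M |A. A \<in> sets PX} {zp -` B \<inter> space M |B. B \<in> sets PZ}"
    using ind unfolding indep_processes_def xp_def[abs_def] zp_def[abs_def] PX_def PZ_def by blast
  then have indep: "prob ((xp -` A \<inter> space M) \<inter> (zp -` B \<inter> space M)) = prob (xp -` A \<inter> space M) * prob (zp -` B \<inter> space M)"
    if "A \<in> sets PX" "B \<in> sets PZ" for A B using that by (intro indep_setD) auto
  interpret X: prob_space "distr M PX xp" by (rule prob_space_distr) measurable
  interpret Z: prob_space "distr M PZ zp" by (rule prob_space_distr) measurable
  have law: "distr M PX xp \<Otimes>\<^sub>M distr M PZ zp = distr M (PX \<Otimes>\<^sub>M PZ) (\<lambda>\<omega>. (xp \<omega>, zp \<omega>))"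
  proof (rule pair_measure_eqI)
    show "sigma_finite_measure (distr M PX xp)" "sigma_finite_measure (distr M PZ zp)" by unfold_locales
    show "sets (distr M PX xp \<Otimes>\<^sub>M distr M PZ zp) = sets (distr M (PX \<Otimes>\<^sub>M PZ) (\<lambda>\<omega>. (xp \<omega>, zp \<omega>)))" by simp
    fix A B assume AB: "A \<in> sets (distr M PX xp)" "B \<in> sets (distr M PZ zp)"
    then have [measurable]: "A \<in> sets PX" "B \<in> sets PZ" by auto
    have "(\<lambda>\<omega>. (xp \<omega>, zp \<omega>)) -` (A \<times> B) \<inter> space M = (xp -` A \<inter> space M) \<inter> (zp -` B \<inter> space M)" by auto
    then show "emeasure (distr M PX xp) A * emeasure (distr M PZ zp) B = emeasure (distr M (PX \<Otimes>\<^sub>M PZ) (\<lambda>\<omega>. (xp \<omega>, zp \<omega>))) (A \<times> B)"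
      using indep[of A B] by (simp add: emeasure_distr emeasure_eq_measure flip: ennreal_mult)
  qed
  have "ennreal (prob {\<omega> \<in> space M. (xp \<omega>, zp \<omega>) \<in> Q}) = emeasure (distr M (PX \<Otimes>\<^sub>M PZ) (\<lambda>\<omega>. (xp \<omega>, zp \<omega>))) Q"
    by (subst emeasure_distr) (auto simp: emeasure_eq_measure vimage_def Int_def conj_commute)
  also have "\<dots> = (\<integral>\<^sup>+w. emeasure (distr M PZ zp) (Pair w -` Q) \<partial>distr M PX xp)"
    unfolding law[symmetric] by (rule Z.emeasure_pair_measure_alt) simp
  also have "\<dots> \<le> (\<integral>\<^sup>+w. ennreal p + indicator (space PX - G) w \<partial>distr M PX xp)"
  proof (rule nn_integral_mono)
    fix w assume w: "w \<in> space (distr M PX xp)"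
    have sec: "Pair w -` Q \<in> sets PZ" by (rule sets_Pair1[of Q PX PZ]) measurable
    then have sec': "{v. (w, v) \<in> Q} \<in> sets PZ" by (simp add: vimage_def)
    show "emeasure (distr M PZ zp) (Pair w -` Q) \<le> ennreal p + indicator (space PX - G) w"
    proof (cases "w \<in> G")
      case True
      have "emeasure (distr M PZ zp) (Pair w -` Q) = ennreal (prob {\<omega> \<in> space M. (w, zp \<omega>) \<in> Q})"
        using sec sec' by (subst emeasure_distr) (auto simp: emeasure_eq_measure vimage_def Int_def conj_commute)
      also have "\<dots> \<le> ennreal p" using p(2)[OF True] unfolding zp_def by (rule ennreal_leI)
      finally show ?thesis using True by simp
    next
      case False
      have "emeasure (distr M PZ zp) (Pair w -` Q) \<le> 1" by (rule Z.emeasure_le_1)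
      also have "\<dots> \<le> ennreal p + indicator (space PX - G) w" using False w by simp
      finally show ?thesis .
    qed
  qed
  also have "\<dots> = ennreal p + emeasure (distr M PX xp) (space PX - G)"
    by (subst nn_integral_add) (auto simp: X.emeasure_space_1[simplified])
  also have "emeasure (distr M PX xp) (space PX - G) = ennreal (prob {\<omega> \<in> space M. xp \<omega> \<notin> G})"
  proof -
    have "xp -` (space PX - G) \<inter> space M = {\<omega> \<in> space M. xp \<omega> \<notin> G}"
      using measurable_space[of xp M PX] by auto
    then show ?thesis by (subst emeasure_distr) (auto simp: emeasure_eq_measure)
  qed
  also have "ennreal p + ennreal (prob {\<omega> \<in> space M. xp \<omega> \<notin> G}) = ennreal (p + prob {\<omega> \<in> space M. xp \<omega> \<notin> G})"
    using p(1) by simp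
  finally show ?thesis unfolding xp_def zp_def using p(1) by (simp del: ennreal_plus add: ennreal_le_iff flip: ennreal_plus)
qed

section \<open>Convergence in probability for random regressors\<close>

context fourth_order_mixing
begin

lemma prob_design_irregular_le:
  assumes n: "0 < n" and B: "0 < B" and K: "0 < K"
  shows "prob {\<omega> \<in> space M. \<not> ((\<forall>i. (\<Sum>t=1..int n. ((x t \<omega> - sample_mean n (\<lambda>t. x t \<omega>)) $ i)\<^sup>2) \<le> real n * B\<^sup>2) \<and>
      (\<forall>i k. \<bar>wls_matrix c n (\<lambda>t. x t \<omega>) $ i $ k / real n - S $ i $ k\<bar> \<le> K))}
    \<le> (\<Sum>i\<in>UNIV. ac 0 i i / B\<^sup>2) +
      (\<Sum>i\<in>UNIV. \<Sum>k\<in>UNIV. expectation (\<lambda>\<omega>. \<bar>wls_matrix c n (\<lambda>t. x t \<omega>) $ i $ k / real n - S $ i $ k\<bar>) / K)"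
proof -
  note [measurable] = borel_measurable_centred[of x M, OF x_measurable] borel_measurable_wls_matrix[of x M, OF x_measurable]
  let ?U = "\<lambda>i \<omega>. \<Sum>t=1..int n. ((x t \<omega> - sample_mean n (\<lambda>t. x t \<omega>)) $ i)\<^sup>2"
  let ?W = "\<lambda>i k \<omega>. \<bar>wls_matrix c n (\<lambda>t. x t \<omega>) $ i $ k / real n - S $ i $ k\<bar>"
  define P where "P i = {\<omega> \<in> space M. real n * B\<^sup>2 \<le> ?U i \<omega>}" for i
  define Q where "Q i k = {\<omega> \<in> space M. K \<le> ?W i k \<omega>}" for i k
  have mQ[measurable]: "P i \<in> events" "Q i k \<in> events" for i k unfolding P_def Q_def by measurable
  have nB: "0 < real n * B\<^sup>2" using n B by simp
  have P: "prob (P i) \<le> ac 0 i i / B\<^sup>2" for i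
  proof -
    have "prob (P i) \<le> expectation (?U i) / (real n * B\<^sup>2)"
      unfolding P_def by (rule integral_Markov_inequality_measure[OF expectation_centred_sq_le(1)[OF n], where A="{}"])
        (use nB in \<open>auto intro!: sum_nonneg\<close>)
    also have "\<dots> \<le> real n * ac 0 i i / (real n * B\<^sup>2)"
      using nB by (intro divide_right_mono expectation_centred_sq_le(2)[OF n]) simp
    finally show ?thesis using n by simp
  qed
  have Q: "prob (Q i k) \<le> expectation (?W i k) / K" for i k
  proof -
    have "integrable M (?W i k)"
      unfolding wls_matrix_component centred_sample[OF n] mult.assoc using integrable_centred_product by auto
    then show ?thesis
      unfolding Q_def by (rule integral_Markov_inequality_measure[where A="{}"]) (use K in auto)
  qed
  have "prob {\<omega> \<in> space M. \<not> ((\<forall>i. ?U i \<omega> \<le> real n * B\<^sup>2) \<and> (\<forall>i k. ?W i k \<omega> \<le> K))}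
      \<le> prob ((\<Union>i. P i) \<union> (\<Union>i. \<Union>k. Q i k))"
  proof (rule finite_measure_mono)
    show "{\<omega> \<in> space M. \<not> ((\<forall>i. ?U i \<omega> \<le> real n * B\<^sup>2) \<and> (\<forall>i k. ?W i k \<omega> \<le> K))} \<subseteq> (\<Union>i. P i) \<union> (\<Union>i. \<Union>k. Q i k)"
      by (auto simp: P_def Q_def not_le intro: less_imp_le)
  qed (use mQ in auto)
  also have "\<dots> \<le> prob (\<Union>i. P i) + prob (\<Union>i. \<Union>k. Q i k)" by (rule measure_Un_le) auto
  also have "\<dots> \<le> (\<Sum>i\<in>UNIV. prob (P i)) + (\<Sum>i\<in>UNIV. prob (\<Union>k. Q i k))"
    by (intro add_mono measure_UNION_le) auto
  also have "\<dots> \<le> (\<Sum>i\<in>UNIV. prob (P i)) + (\<Sum>i\<in>UNIV. \<Sum>k\<in>UNIV. prob (Q i k))"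
    by (intro add_mono sum_mono measure_UNION_le order.refl) auto
  also have "\<dots> \<le> (\<Sum>i\<in>UNIV. ac 0 i i / B\<^sup>2) + (\<Sum>i\<in>UNIV. \<Sum>k\<in>UNIV. expectation (?W i k) / K)"
    by (intro add_mono sum_mono P Q)
  finally show ?thesis .
qed

end

lemma (in noise) abs_f_le: "\<bar>f u\<bar> \<le> C1"
proof -
  have "\<bar>f u\<bar> \<le> expectation (\<lambda>\<omega>. \<bar>g1 (u - eta 0 \<omega>)\<bar>)" unfolding f_def by (rule integral_abs_bound)
  also have "\<dots> \<le> expectation (\<lambda>\<omega>. C1)"
    by (rule integral_mono) (use integrable_g1 g1_bound in auto)
  finally show ?thesis by (simp add: prob_space)
qed

lemma (in noise) f_continuous: "continuous_on UNIV f"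
proof (rule lipschitz_on_continuous_on)
  show "C2-lipschitz_on UNIV f"
    by (rule lipschitz_onI) (use f_lipschitz C2_nonneg in \<open>simp_all add: dist_real_def\<close>)
qed

text \<open>Regular designs have high probability by the \<open>L\<^sup>1\<close> convergence of the
  moment matrix, and \<open>fixed_design_expansion\<close> handles each of them; independence joins
  the two.\<close>

lemma (in noise) expansion_gap_in_probability:
  fixes c :: "int \<Rightarrow> real" and x :: "int \<Rightarrow> 'a \<Rightarrow> real ^ 'q" and S :: "real ^ 'q ^ 'q"
  defines "s \<equiv> partial_sum_sd M eps"
  assumes mix: "fourth_order_mixing M x" and ind: "indep_processes M x eps"
    and growth: "0 < k" "eventually (\<lambda>n. k * real n \<le> (s n)\<^sup>2 \<and>
      real n * (\<Sum>j=-int n..int n. \<bar>noise_autocov M eps j\<bar>) \<le> C * (s n)\<^sup>2) sequentially"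
    and A: "\<And>n. (\<Sum>j=-int n..int n. \<bar>c j\<bar>) \<le> A" "0 < A"
    and S: "\<And>i k. (\<lambda>m. \<Sum>j=-int m..int m. c j * autocov_matrix M x (- j) $ i $ k) \<longlonglongrightarrow> S $ i $ k" "invertible S"
    and \<tau>: "0 < \<tau>"
  shows "(\<lambda>n. prob {\<omega> \<in> space M. \<tau> < (SUP u. \<bar>expansion_gap c (s n) F f n \<alpha>\<^sub>0 \<alpha> (\<lambda>t. x t \<omega>) (\<lambda>t. eps t \<omega>) u\<bar>)}) \<longlonglongrightarrow> 0"
proof -
  interpret X: fourth_order_mixing M x by (rule mix)
  obtain c0 where c0: "0 < c0" "\<And>w. c0 * norm w \<le> norm (S *v w)"
    using linear_inj_bounded_below_pos[OF matrix_vector_mul_linear inj_matrix_vector_mult[OF S(2)]] by blast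
  define K where "K = c0 / (2 * (real CARD('q))\<^sup>2)"
  have K: "0 < K" using c0(1) by (simp add: K_def)
  define D where "D n = (\<Sum>i\<in>UNIV. \<Sum>k\<in>UNIV. expectation (\<lambda>\<omega>. \<bar>wls_matrix c n (\<lambda>t. x t \<omega>) $ i $ k / real n - S $ i $ k\<bar>) / K)" for n
  have "D \<longlonglongrightarrow> (\<Sum>i\<in>(UNIV::'q set). \<Sum>k\<in>(UNIV::'q set). 0 / K)"
    unfolding D_def[abs_def] wls_matrix_component
    by (intro tendsto_sum tendsto_divide tendsto_const X.weighted_moment_matrix_L1[OF A(1)] S(1)[folded X.ac_def])
      (use K in simp)
  then have D: "D \<longlonglongrightarrow> 0" by simp
  show ?thesis
  proof (rule tendstoI)
    fix r :: real assume r: "0 < r"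
    define V where "V = (\<Sum>i\<in>UNIV. X.ac 0 i i)"
    have V: "0 \<le> V" unfolding V_def by (intro sum_nonneg X.ac_diag_nonneg)
    define B where "B = sqrt (1 + 4 * V / r)"
    have B: "1 \<le> B" using V r by (simp add: B_def)
    have B2: "B\<^sup>2 = 1 + 4 * V / r" using V r by (simp add: B_def)
    have VB: "(\<Sum>i\<in>UNIV. X.ac 0 i i / B\<^sup>2) \<le> r / 4"
    proof -
      have "4 * V \<le> r * B\<^sup>2" unfolding B2 using r by (simp add: distrib_left)
      moreover have "0 < B\<^sup>2" using B by simp
      ultimately have "V / B\<^sup>2 \<le> r / 4" by (simp add: pos_divide_le_eq)
      then show ?thesis by (simp add: V_def sum_divide_distrib)
    qed
    have r4: "0 < r / 4" using r by simp
    have D': "eventually (\<lambda>n. D n < r / 4) sequentially" by (rule order_tendstoD(2)[OF D r4])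
    note fixed = fixed_design_expansion[OF growth[unfolded s_def] A c0(2,1) B \<tau> r4, folded s_def K_def]
    show "eventually (\<lambda>n. dist (prob {\<omega> \<in> space M. \<tau> < (SUP u. \<bar>expansion_gap c (s n) F f n \<alpha>\<^sub>0 \<alpha> (\<lambda>t. x t \<omega>) (\<lambda>t. eps t \<omega>) u\<bar>)}) 0 < r) sequentially"
      using fixed[of \<alpha>\<^sub>0 \<alpha>] D' eventually_gt_at_top[of 0]
    proof eventually_elim
      case (elim n)
      note n = elim(3)
      define PX :: "(int \<Rightarrow> real ^ 'q) measure" where "PX = PiM UNIV (\<lambda>_. borel)"
      define PZ :: "(int \<Rightarrow> real) measure" where "PZ = PiM UNIV (\<lambda>_. borel)"
      \<comment> \<open>The regular paths. This set and the bad set \<open>Q\<close> live on path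
        spaces, where the independence of the processes is expressed.\<close>
      define G where "G = {w \<in> space PX. (\<forall>i. (\<Sum>t=1..int n. ((w t - sample_mean n (\<lambda>t. w t)) $ i)\<^sup>2) \<le> real n * B\<^sup>2) \<and>
        (\<forall>i k. \<bar>wls_matrix c n (\<lambda>t. w t) $ i $ k / real n - S $ i $ k\<bar> \<le> K)}"
      define Q where "Q = {v \<in> space (PX \<Otimes>\<^sub>M PZ). \<tau> < (SUP u. \<bar>expansion_gap c (s n) F f n \<alpha>\<^sub>0 \<alpha> (\<lambda>t. fst v t) (\<lambda>t. snd v t) u\<bar>)}"
      have cX: "(\<lambda>w. w t) \<in> borel_measurable PX" for t unfolding PX_def by measurable
      have cX': "(\<lambda>v. fst v t) \<in> borel_measurable (PX \<Otimes>\<^sub>M PZ)" for t unfolding PX_def by measurable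
      have cZ': "(\<lambda>v. snd v t) \<in> borel_measurable (PX \<Otimes>\<^sub>M PZ)" for t unfolding PZ_def by measurable
      note [measurable] = borel_measurable_centred[of "\<lambda>t w. w t" PX, OF cX] borel_measurable_wls_matrix[of "\<lambda>t w. w t" PX, OF cX]
        borel_measurable_Sup_expansion_gap[OF f_continuous abs_f_le cX' cZ']
      have G: "G \<in> sets PX" unfolding G_def by measurable
      have Q: "Q \<in> sets (PX \<Otimes>\<^sub>M PZ)" unfolding Q_def by measurable
      have spX: "space PX = UNIV" and sp: "space (PX \<Otimes>\<^sub>M PZ) = UNIV"
        by (simp_all add: PX_def PZ_def space_PiM space_pair_measure)
      have "prob {\<omega> \<in> space M. (\<lambda>t. x t \<omega>, \<lambda>t. eps t \<omega>) \<in> Q} \<le> r / 4 + prob {\<omega> \<in> space M. (\<lambda>t. x t \<omega>) \<notin> G}"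
      proof (rule prob_independent_processes_le[OF ind Q[unfolded PX_def PZ_def] G[unfolded PX_def]])
        fix w assume w: "w \<in> G"
        have "prob {\<omega> \<in> space M. \<tau> < (SUP u. \<bar>expansion_gap c (s n) F f n \<alpha>\<^sub>0 \<alpha> w (\<lambda>t. eps t \<omega>) u\<bar>)} \<le> r / 4"
          using elim(1)[rule_format, of w] w unfolding G_def by blast
        then show "prob {\<omega> \<in> space M. (w, \<lambda>t. eps t \<omega>) \<in> Q} \<le> r / 4" unfolding Q_def sp by simp
      qed (use r in simp)
      moreover have "prob {\<omega> \<in> space M. (\<lambda>t. x t \<omega>) \<notin> G} \<le> (\<Sum>i\<in>UNIV. X.ac 0 i i / B\<^sup>2) + D n"
        using X.prob_design_irregular_le[OF n _ K, of B c S] B unfolding G_def D_def spX by simp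
      ultimately have "prob {\<omega> \<in> space M. (\<lambda>t. x t \<omega>, \<lambda>t. eps t \<omega>) \<in> Q} \<le> r / 4 + (r / 4 + r / 4)"
        using VB elim(2) by linarith
      then have "prob {\<omega> \<in> space M. (\<lambda>t. x t \<omega>, \<lambda>t. eps t \<omega>) \<in> Q} < r" using r by linarith
      then show ?case unfolding Q_def sp by (simp add: dist_real_def)
    qed
  qed
qed

section \<open>Regularly varying coefficients\<close>

lemma summable_even_symmetric_sums_bounded:
  fixes c :: "int \<Rightarrow> real"
  assumes even: "\<And>j. c (- j) = c j" and sum: "summable (\<lambda>k. \<bar>c (int k)\<bar>)"
  shows "(\<Sum>j=-int n..int n. \<bar>c j\<bar>) \<le> 2 * (\<Sum>k. \<bar>c (int k)\<bar>)"
proof -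
  have "(\<Sum>j=-int n..int n. \<bar>c j\<bar>) \<le> 2 * (\<Sum>k\<le>n. \<bar>c (int k)\<bar>)"
  proof (induction n)
    case (Suc n)
    define k where "k = int (Suc n)"
    have "{-k..k} = insert k (insert (- k) {-int n..int n})" by (auto simp: k_def)
    moreover have "k \<notin> insert (- k) {-int n..int n}" "- k \<notin> {-int n..int n}" by (auto simp: k_def)
    ultimately have "(\<Sum>j=-k..k. \<bar>c j\<bar>) = 2 * \<bar>c k\<bar> + (\<Sum>j=-int n..int n. \<bar>c j\<bar>)" by (simp add: even)
    also have "\<dots> \<le> 2 * \<bar>c k\<bar> + 2 * (\<Sum>k\<le>n. \<bar>c (int k)\<bar>)" by (rule add_left_mono[OF Suc])
    also have "\<dots> = 2 * (\<Sum>k\<le>Suc n. \<bar>c (int k)\<bar>)" by (simp add: k_def del: of_nat_Suc)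
    finally show ?case unfolding k_def .
  qed simp
  also have "(\<Sum>k\<le>n. \<bar>c (int k)\<bar>) \<le> (\<Sum>k. \<bar>c (int k)\<bar>)" by (rule sum_le_suminf[OF sum]) auto
  finally show ?thesis by simp
qed

lemma summable_weight_coeff:
  assumes "set_integrable lborel {-pi..pi} \<phi>" and sum: "summable (tail_max (weight_coeff \<phi>))"
  shows "summable (\<lambda>k. \<bar>weight_coeff \<phi> (int k)\<bar>)"
proof (rule summable_comparison_test'[OF sum])
  fix k :: nat
  have "\<bar>weight_coeff \<phi> (int k)\<bar> \<le> tail_max (weight_coeff \<phi>) k"
    unfolding tail_max_def using abs_weight_coeff_le[OF assms(1)] by (intro cSUP_upper bdd_aboveI2) auto
  then show "norm \<bar>weight_coeff \<phi> (int k)\<bar> \<le> tail_max (weight_coeff \<phi>) k" by simp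
qed

text \<open>A limit of real numbers is real, and the determinant commutes with the embedding into
  the complex numbers, so invertibility descends.\<close>

lemma real_matrix_of_limits:
  fixes S :: "complex ^ 'q ^ 'q"
  assumes lim: "\<And>i k. (\<lambda>m. complex_of_real (r m i k)) \<longlonglongrightarrow> S $ i $ k" and inv: "invertible S"
  obtains T :: "real ^ 'q ^ 'q" where "\<And>i k. (\<lambda>m. r m i k) \<longlonglongrightarrow> T $ i $ k" "invertible T"
proof
  define T :: "real ^ 'q ^ 'q" where "T = (\<chi> i k. Re (S $ i $ k))"
  show *: "(\<lambda>m. r m i k) \<longlonglongrightarrow> T $ i $ k" for i k using tendsto_Re[OF lim[of i k]] by (simp add: T_def)
  have "S $ i $ k = complex_of_real (T $ i $ k)" for i k
    by (rule LIMSEQ_unique[OF lim tendsto_of_real[OF *]])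
  then have "det S = complex_of_real (det T)" by (simp add: det_def)
  then show "invertible T" using inv by (simp add: invertible_det_nz)
qed

lemma regularly_varying_summable:
  assumes L: "slowly_varying L" and p: "p < -1" and a: "\<And>k. 1 \<le> k \<Longrightarrow> a k = real k powr p * L (real k)"
  shows "summable (\<lambda>k. \<bar>a k\<bar>)"
proof -
  \<comment> \<open>Half of the distance from \<open>p\<close> to -1, so that \<open>p + d\<close>
    is still below -1.\<close>
  define d where "d = (- 1 - p) / 2"
  have d: "0 < d" "p + d < -1" using p by (simp_all add: d_def field_simps)
  obtain C where C: "0 < C" "eventually (\<lambda>x. C * x powr (- d) \<le> L x \<and> L x \<le> x powr d / C) at_top"
    using slowly_varying_potter[OF L d(1)] by blast
  have ev: "eventually (\<lambda>n. C * real n powr (- d) \<le> L (real n) \<and> L (real n) \<le> real n powr d / C) sequentially"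
    using C(2) filterlim_real_sequentially by (rule eventually_compose_filterlim)
  show ?thesis
  proof (rule summable_comparison_test_ev)
    show "summable (\<lambda>n. real n powr (p + d) / C)" using d(2) by (intro summable_divide) (simp add: summable_real_powr_iff)
    show "eventually (\<lambda>n. norm \<bar>a n\<bar> \<le> real n powr (p + d) / C) sequentially"
      using ev eventually_ge_at_top[of 1]
    proof eventually_elim
      case (elim n)
      have "0 \<le> C * real n powr (- d)" using C(1) by simp
      then have L: "0 \<le> L (real n)" "L (real n) \<le> real n powr d / C" using elim(1) by auto
      have "real n powr p * L (real n) \<le> real n powr p * (real n powr d / C)" by (rule mult_left_mono[OF L(2)]) simp
      then show ?case using L(1) a[OF elim(2)] by (simp add: powr_add abs_mult)
    qed
  qed
qed

lemma regularly_varying_not_summable: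
  assumes L: "slowly_varying L" and p: "-1 < p" and a: "\<And>k. 1 \<le> k \<Longrightarrow> a k = real k powr p * L (real k)"
  shows "\<not> summable a"
proof
  assume sum: "summable a"
  \<comment> \<open>With this \<open>d\<close> the lower Potter bound makes \<open>a\<close>
    dominate a multiple of the harmonic series.\<close>
  define d where "d = p + 1"
  have d: "0 < d" using p by (simp add: d_def)
  obtain C where C: "0 < C" "eventually (\<lambda>x. C * x powr (- d) \<le> L x \<and> L x \<le> x powr d / C) at_top"
    using slowly_varying_potter[OF L d] by blast
  have ev: "eventually (\<lambda>n. C * real n powr (- d) \<le> L (real n) \<and> L (real n) \<le> real n powr d / C) sequentially"
    using C(2) filterlim_real_sequentially by (rule eventually_compose_filterlim)
  have "summable (\<lambda>n. C * real n powr (-1))"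
  proof (rule summable_comparison_test_ev[OF _ sum])
    show "eventually (\<lambda>n. norm (C * real n powr (-1)) \<le> a n) sequentially"
      using ev eventually_ge_at_top[of 1]
    proof eventually_elim
      case (elim n)
      have "real n powr p * (C * real n powr (- d)) \<le> real n powr p * L (real n)" using elim(1) by (intro mult_left_mono) auto
      moreover have "real n powr p * real n powr (- d) = real n powr (-1)" by (simp add: d_def flip: powr_add)
      ultimately show ?case using C(1) a[OF elim(2)] by (simp add: mult.left_commute)
    qed
  qed
  then have "C = 0 \<or> summable (\<lambda>n. real n powr (-1))" by (simp only: summable_cmult_iff)
  then have "C = 0 \<or> (-1::real) < -1" by (simp only: summable_real_powr_iff)
  then show False using C(1) by simp
qed

lemma regularly_varying_ratio:
  assumes L: "slowly_varying L" and a: "\<And>k. 1 \<le> k \<Longrightarrow> a k = real k powr p * L (real k)"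
  shows "(\<lambda>k. a (Suc k) / a k) \<longlonglongrightarrow> 1"
proof -
  have "(\<lambda>k. (real (Suc k) powr p / real k powr p) * (L (real (Suc k)) / L (real k))) \<longlonglongrightarrow> 1 * 1"
  proof (intro tendsto_mult slowly_varying_Suc_ratio[OF L])
    show "(\<lambda>k. real (Suc k) powr p / real k powr p) \<longlonglongrightarrow> 1" by real_asymp
  qed
  then have "(\<lambda>k. (real (Suc k) powr p / real k powr p) * (L (real (Suc k)) / L (real k))) \<longlonglongrightarrow> 1" by simp
  then show ?thesis
  proof (rule Lim_transform_eventually)
    show "eventually (\<lambda>k. (real (Suc k) powr p / real k powr p) * (L (real (Suc k)) / L (real k)) = a (Suc k) / a k) sequentially"
      using eventually_ge_at_top[of 1] by eventually_elim (simp add: a del: of_nat_Suc)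
  qed
qed

lemma regularly_varying_eventually_pos:
  assumes L: "slowly_varying L" and a: "\<And>k. 1 \<le> k \<Longrightarrow> a k = real k powr p * L (real k)"
  shows "\<exists>k0. \<forall>k\<ge>k0. 0 < a k"
proof -
  obtain X where X: "\<And>x. X \<le> x \<Longrightarrow> 0 < L x" using L unfolding slowly_varying_def by blast
  have "0 < a k" if "nat \<lceil>X\<rceil> + 1 \<le> k" for k
  proof -
    have "X \<le> real k" "1 \<le> k" using that by linarith+
    then show ?thesis using X[of "real k"] by (simp add: a)
  qed
  then show ?thesis by blast
qed

text \<open>If the variance were 0, the innovation would vanish almost surely and \<open>G\<close>
  would jump at 0, although it is differentiable.\<close>

lemma (in noise) variance_pos: "0 < s2"
proof (rule ccontr)
  assume "\<not> 0 < s2"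
  then have "expectation (\<lambda>\<omega>. (e 0 \<omega>)\<^sup>2) = 0" using s2_nonneg by (simp add: var_e)
  then have "AE \<omega> in M. (e 0 \<omega>)\<^sup>2 = 0" using integral_nonneg_eq_0_iff_AE[OF sq_e] by simp
  then have zero: "AE \<omega> in M. e 0 \<omega> = 0" by simp
  have G: "G u = prob {\<omega> \<in> space M. e 0 \<omega> \<le> u}" for u
  proof -
    have "G u = measure (distr M borel (e 0)) {..u}" by (simp add: cdf_e[of 0, symmetric] cdf_def)
    also have "\<dots> = prob (e 0 -` {..u} \<inter> space M)" by (rule measure_distr) measurable
    also have "e 0 -` {..u} \<inter> space M = {\<omega> \<in> space M. e 0 \<omega> \<le> u}" by auto
    finally show ?thesis .
  qed
  have "G 0 = 1" unfolding G by (subst prob_Collect_eq_1) (use zero in auto)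
  have neg: "G u = 0" if "u < 0" for u
    unfolding G by (subst prob_Collect_eq_0) (use zero that in auto)
  have "isCont G 0" using deriv_G by (rule DERIV_isCont)
  then have "(G \<longlongrightarrow> 1) (at_left 0)" unfolding isCont_def \<open>G 0 = 1\<close> by (rule filterlim_mono[OF _ order.refl at_le]) simp
  moreover have "(G \<longlongrightarrow> 0) (at_left 0)"
    by (rule tendsto_eventually) (use neg in \<open>auto simp: eventually_at_filter\<close>)
  ultimately show False using tendsto_unique[of "at_left (0::real)" G 1 0] by simp
qed

text \<open>The exponent \<open>H - 3/2\<close> crosses -1 exactly at 1/2: above it the coefficients
  have a divergent sum, below it they are absolutely summable, and the boundary case is assumed
  summable.\<close>

lemma (in noise) partial_sum_growth:
  assumes L: "slowly_varying L" and a: "\<And>k. 1 \<le> k \<Longrightarrow> a k = real k powr (H - 3/2) * L (real k)"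
    and H: "H < 1/2 \<and> 0 < long_run_sd M eps \<or>
         H = 1/2 \<and> 0 < long_run_sd M eps \<and> summable (\<lambda>j. \<bar>a j\<bar>) \<or> 1/2 < H"
  shows "\<exists>k>0. \<exists>C. eventually (\<lambda>n. k * real n \<le> (partial_sum_sd M eps n)\<^sup>2 \<and>
    real n * (\<Sum>j=-int n..int n. \<bar>noise_autocov M eps j\<bar>) \<le> C * (partial_sum_sd M eps n)\<^sup>2) sequentially"
proof (cases "1/2 < H")
  case True
  obtain k0 where pos: "\<And>k. k0 \<le> k \<Longrightarrow> 0 < a k" using regularly_varying_eventually_pos[OF L a] by blast
  have "-1 < H - 3/2" using True by simp
  then have div: "\<not> summable a" using regularly_varying_not_summable[OF L _ a] by blast
  show ?thesis
    by (rule growth_long_memory[OF sq_summable pos regularly_varying_ratio[OF L a] div variance_pos])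
next
  case False
  have "summable (\<lambda>j. \<bar>a j\<bar>)"
  proof (cases "H < 1/2")
    case True
    then have "H - 3/2 < -1" by simp
    then show ?thesis by (rule regularly_varying_summable[OF L _ a])
  qed (use H False in auto)
  moreover have "0 < long_run_sd M eps" using H False by auto
  ultimately show ?thesis by (rule growth_short_memory[OF sq_summable])
qed

text \<open>By \<open>wls_linear_term\<close>, this is the sequence \<open>R\<^sub>n\<close> of the theorem.\<close>

lemma (in noise) Op_one_partial_sums:
  "Op_one M (\<lambda>n \<omega>. 1 / partial_sum_sd M eps n * (\<Sum>t=1..int n. eps t \<omega>))"
  unfolding Op_one_def
proof (intro conjI allI impI)
  let ?s = "partial_sum_sd M eps"
  let ?R = "\<lambda>n \<omega>. 1 / ?s n * (\<Sum>t=1..int n. eps t \<omega>)"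
  show R[measurable]: "?R n \<in> borel_measurable M" for n by measurable
  fix d :: real assume d: "0 < d"
  have "prob {\<omega> \<in> space M. sqrt (1 / d) < \<bar>?R n \<omega>\<bar>} \<le> 1 / (sqrt (1 / d))\<^sup>2" for n
  proof (rule chebyshev_sq)
    have eq: "(?R n \<omega>)\<^sup>2 = (1 / ?s n)\<^sup>2 * (\<Sum>t=1..int n. eps t \<omega>)\<^sup>2" for \<omega> by (rule power_mult_distrib)
    have int: "integrable M (\<lambda>\<omega>. (\<Sum>t=1..int n. eps t \<omega>)\<^sup>2)"
      using expectation_weighted_sum_sq(1)[OF sq_summable, where n=n and w="\<lambda>_. 1"] by simp
    show "integrable M (\<lambda>\<omega>. (?R n \<omega>)\<^sup>2)" unfolding eq using int by (rule integrable_mult_right)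
    have "expectation (\<lambda>\<omega>. (?R n \<omega>)\<^sup>2) = (1 / ?s n)\<^sup>2 * (?s n)\<^sup>2"
      unfolding eq partial_sum_sd_sq(1)[OF sq_summable] by (rule integral_mult_right_zero)
    \<comment> \<open>Equality unless the standard deviation is 0, where division by 0 gives
      0.\<close>
    also have "\<dots> \<le> 1" by (cases "?s n = 0") (simp_all add: power_divide)
    finally show "expectation (\<lambda>\<omega>. (?R n \<omega>)\<^sup>2) \<le> 1" .
  qed (use d in simp_all)
  then show "\<exists>C. \<forall>n. measure M {\<omega> \<in> space M. C < \<bar>?R n \<omega>\<bar>} \<le> d"
    using d by (intro exI[of _ "sqrt (1 / d)"]) simp
qed

theorem theorem3p1:
  fixes M :: "'w measure"
    and e \<epsilon> y :: "int \<Rightarrow> 'w \<Rightarrow> real"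
    and x :: "int \<Rightarrow> 'w \<Rightarrow> real ^ 'q"
    and a :: "nat \<Rightarrow> real" and L\<^sub>0 :: "real \<Rightarrow> real" and H :: real
    and F G\<^sub>0 :: "real \<Rightarrow> real"
    and \<alpha>\<^sub>0 :: real and \<alpha> :: "real ^ 'q"
    and f \<phi> \<phi>c \<psi> :: "real \<Rightarrow> real"
    and c \<gamma> :: "int \<Rightarrow> real"
    and \<sigma> :: "nat \<Rightarrow> real"
    and \<H> :: "real \<Rightarrow> complex ^ 'q ^ 'q"
    and S\<phi> S\<psi> :: "complex ^ 'q ^ 'q"
    and \<beta> :: "real \<times> (real ^ 'q)"
    and \<beta>hat :: "nat \<Rightarrow> 'w \<Rightarrow> real \<times> (real ^ 'q)"
    and X :: "int \<Rightarrow> 'w \<Rightarrow> real \<times> (real ^ 'q)"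
    and \<epsilon>hat :: "nat \<Rightarrow> int \<Rightarrow> 'w \<Rightarrow> real"
    and K Khat :: "nat \<Rightarrow> real \<Rightarrow> 'w \<Rightarrow> real"
    and R :: "nat \<Rightarrow> 'w \<Rightarrow> real"
  \<comment> \<open>noise\<close>
  assumes "prob_space M"
    and "prob_space.indep_vars M (\<lambda>_. borel) e UNIV"
    and "\<And>t. cdf (distr M borel (e t)) = G\<^sub>0"
    and "\<And>t. integrable M (\<lambda>\<omega>. (e t \<omega>)\<^sup>2)"
    and "\<And>t. (\<integral>\<omega>. e t \<omega> \<partial>M) = 0"
    and "a 0 = 1"
    and "\<And>k. k \<ge> 1 \<Longrightarrow> a k = real k powr (H - 3/2) * L\<^sub>0 (real k)"
    and "slowly_varying L\<^sub>0" and "H < 1"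
    and "summable (\<lambda>i. (a i)\<^sup>2)"
    and "\<epsilon> = linear_process a e"
    and "\<And>t. cdf (distr M borel (\<epsilon> t)) = F"
    and "\<sigma> = partial_sum_sd M \<epsilon>"
    and "\<gamma> = noise_autocov M \<epsilon>"
  \<comment> \<open>regression model\<close>
    and "indep_processes M x \<epsilon>"
    and "\<And>t \<omega>. y t \<omega> = \<alpha>\<^sub>0 + \<alpha> \<bullet> x t \<omega> + \<epsilon> t \<omega>"
  \<comment> \<open>weights; \<open>\<phi>\<close> and \<open>f\<close> matter only up to null sets\<close>
    and "spectral_density \<gamma> f"
    and "\<And>l. \<phi> (- l) = \<phi> l" and "\<And>l. \<phi> (l + 2 * pi) = \<phi> l"
    and "set_integrable lborel {-pi..pi} \<phi>"
    and "continuous_version \<psi> (\<lambda>l. (\<phi> l)\<^sup>2 * f l)"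
    and "c = weight_coeff \<phi>"
  \<comment> \<open>estimators, residuals and empirical processes\<close>
    and "\<beta> = (\<alpha>\<^sub>0, \<alpha>)"
    and "\<And>n \<omega>. \<beta>hat n \<omega> = (wls_intercept c n (\<lambda>t. x t \<omega>) (\<lambda>t. y t \<omega>),
                            wls_slope c n (\<lambda>t. x t \<omega>) (\<lambda>t. y t \<omega>))"
    and "\<And>t \<omega>. X t \<omega> = (1, x t \<omega>)"
    and "\<And>n t \<omega>. \<epsilon>hat n t \<omega> = wls_residual c n (\<lambda>t. x t \<omega>) (\<lambda>t. y t \<omega>) t"
    and "\<And>n u \<omega>. K n u \<omega> = empirical_process (\<sigma> n) F n (\<lambda>t. \<epsilon> t \<omega>) u"
    and "\<And>n u \<omega>. Khat n u \<omega> = empirical_process (\<sigma> n) F n (\<lambda>t. \<epsilon>hat n t \<omega>) u"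
    and "\<And>n \<omega>. R n \<omega> = 1 / \<sigma> n * ((\<beta>hat n \<omega> - \<beta>) \<bullet> (\<Sum>t=1..int n. X t \<omega>))"
  \<comment> \<open>condition (1)\<close>
    and "H < 1/2 \<and> 0 < long_run_sd M \<epsilon> \<or>
         H = 1/2 \<and> 0 < long_run_sd M \<epsilon> \<and> summable (\<lambda>j. \<bar>a j\<bar>) \<or>
         1/2 < H \<and> H < 1"
  \<comment> \<open>condition (2)\<close>
    and "\<And>k u. k < 3 \<Longrightarrow> ((deriv ^^ k) G\<^sub>0 has_real_derivative (deriv ^^ Suc k) G\<^sub>0 u) (at u)"
    and "\<And>k. k \<in> {1, 2, 3} \<Longrightarrow>
           bounded (range ((deriv ^^ k) G\<^sub>0)) \<and> continuous_on UNIV ((deriv ^^ k) G\<^sub>0) \<and>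
           integrable lborel ((deriv ^^ k) G\<^sub>0)"
    and "integrable (interval_measure G\<^sub>0) (\<lambda>u. u ^ 4)"
  \<comment> \<open>condition (3)\<close>
    and "summable (tail_max c)"
    and "(\<lambda>n. ((\<Sum>j=0..n. \<bar>\<gamma> (int j)\<bar>) + real n * tail_max \<gamma> n) *
               ((\<Sum>j=0..n. sqrt (tail_max c j))\<^sup>2 + real n * tail_sum c n)) \<in> O(\<lambda>n. real n)"
  \<comment> \<open>condition (4)\<close>
    and "fourth_order_stationary M x"
    and "((\<lambda>u::int. autocov_matrix M x \<bar>u\<bar>) \<longlongrightarrow> 0) (filtercomap abs at_top)"
    and "\<And>i j k l. ((\<lambda>u::int. SUP (v, w)\<in>UNIV. \<bar>fourth_cumulant M x i j k l 0 u v w\<bar>) \<longlongrightarrow> 0)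
                      (filtercomap abs at_top)"
  \<comment> \<open>condition (5); by (3), \<open>\<phi>\<close> has a continuous version, the sum of its Fourier series\<close>
    and "spectral_distribution \<H>"
    and "\<And>j. has_matrix_integral (\<lambda>l. cis (of_int j * l)) \<H>
               (\<chi> i k. complex_of_real (autocov_matrix M x j $ i $ k))"
    and "continuous_version \<phi>c \<phi>"
    and "has_matrix_integral (\<lambda>l. complex_of_real (1 / (2 * pi) * \<phi>c l)) \<H> S\<phi>"
    and "has_matrix_integral (\<lambda>l. complex_of_real (1 / (2 * pi) * \<psi> l)) \<H> S\<psi>"
    and "invertible S\<phi>" and "invertible S\<psi>"
  shows "op_one M (\<lambda>n \<omega>. SUP u. \<bar>Khat n u \<omega> - K n u \<omega> - R n \<omega> * deriv F u\<bar>) \<and> Op_one M R"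
proof -
  define s2 where "s2 = (\<integral>\<omega>. (e 0 \<omega>)\<^sup>2 \<partial>M)"
  interpret P: prob_space M by (rule assms(1))
  have e_meas[measurable]: "e t \<in> borel_measurable M" for t using assms(2) by (auto simp: P.indep_vars_def)
  \<comment> \<open>Only the distribution functions are known to agree; they determine the laws, and
    hence the common variance.\<close>
  have law_e: "distr M borel (e t) = distr M borel (e 0)" for t
    by (rule cdf_unique) (simp_all add: assms(3) P.real_distribution_distr)
  have var: "(\<integral>\<omega>. (e t \<omega>)\<^sup>2 \<partial>M) = s2" for t
  proof -
    have "(\<integral>\<omega>. (e t \<omega>)\<^sup>2 \<partial>M) = (\<integral>v. v\<^sup>2 \<partial>distr M borel (e t))" for t
      by (subst integral_distr) auto
    from this[of t] this[of 0] show ?thesis unfolding s2_def law_e[of t] by (rule trans[OF _ sym])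
  qed
  have d1: "(G\<^sub>0 has_real_derivative deriv G\<^sub>0 u) (at u)" for u using assms(31)[of 0 u] by simp
  have d2: "(deriv G\<^sub>0 has_real_derivative (deriv ^^ 2) G\<^sub>0 u) (at u)" for u
    using assms(31)[of 1 u] by (simp add: numeral_2_eq_2)
  have "bounded (range (deriv G\<^sub>0))" "bounded (range ((deriv ^^ 2) G\<^sub>0))" using assms(32)[of 1] assms(32)[of 2] by simp_all
  then obtain C1 C2 where C: "\<And>u. \<bar>deriv G\<^sub>0 u\<bar> \<le> C1" "\<And>u. \<bar>(deriv ^^ 2) G\<^sub>0 u\<bar> \<le> C2"
    unfolding bounded_iff by (auto simp del: funpow.simps)
  interpret N: noise M e s2 a G\<^sub>0 "deriv G\<^sub>0" "(deriv ^^ 2) G\<^sub>0" F C1 C2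
    by unfold_locales (use assms(2-6,10) assms(12)[unfolded assms(11)] var d1 d2 C in auto)
  interpret X: fourth_order_mixing M x
    by unfold_locales (rule assms(36), rule assms(37), rule assms(38))
  have \<epsilon>: "\<epsilon> = N.eps" by (rule assms(11))
  have F': "deriv F u = N.f u" for u by (rule DERIV_imp_deriv[OF N.deriv_F])
  have R: "R n \<omega> = 1 / \<sigma> n * (\<Sum>t=1..int n. \<epsilon> t \<omega>)" for n \<omega>
    unfolding assms(29) assms(24) assms(23) assms(25)
    by (subst wls_linear_term[OF assms(16)]) (rule refl)
  have gap: "Khat n u \<omega> - K n u \<omega> - R n \<omega> * deriv F u =
      expansion_gap c (partial_sum_sd M N.eps n) F N.f n \<alpha>\<^sub>0 \<alpha> (\<lambda>t. x t \<omega>) (\<lambda>t. N.eps t \<omega>) u" for n u \<omega>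
    unfolding expansion_gap_def assms(27) assms(28) assms(26) R F' assms(16) assms(13) \<epsilon> ..
  have "Op_one M R"
    using N.Op_one_partial_sums unfolding R[abs_def] assms(13) \<epsilon> .
  moreover have "op_one M (\<lambda>n \<omega>. SUP u. \<bar>Khat n u \<omega> - K n u \<omega> - R n \<omega> * deriv F u\<bar>)"
    unfolding op_one_def gap
  proof (intro conjI allI impI)
    show "(\<lambda>\<omega>. SUP u. \<bar>expansion_gap c (partial_sum_sd M N.eps n) F N.f n \<alpha>\<^sub>0 \<alpha> (\<lambda>t. x t \<omega>) (\<lambda>t. N.eps t \<omega>) u\<bar>) \<in> borel_measurable M" for n
      by (rule borel_measurable_Sup_expansion_gap[OF N.f_continuous N.abs_f_le]) measurable
    fix \<delta> :: real assume \<delta>: "0 < \<delta>"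
    have even: "c (- j) = c j" for j unfolding assms(22) by (rule weight_coeff_minus)
    have abs: "summable (\<lambda>k. \<bar>c (int k)\<bar>)"
      using summable_weight_coeff[OF assms(20)] assms(34) unfolding assms(22) by blast
    have A: "(\<Sum>j=-int n..int n. \<bar>c j\<bar>) \<le> 2 * (\<Sum>k. \<bar>c (int k)\<bar>) + 1" for n
      using summable_even_symmetric_sums_bounded[OF even abs, of n] by simp
    have A0: "0 < 2 * (\<Sum>k. \<bar>c (int k)\<bar>) + 1" using suminf_nonneg[OF abs] by simp
    have "(\<lambda>m. complex_of_real (\<Sum>j=-int m..int m. c j * autocov_matrix M x (- j) $ i $ k)) \<longlonglongrightarrow> S\<phi> $ i $ k" for i k
    proof -
      \<comment> \<open>The moment matrix carries lag \<open>-j\<close> and the spectral series lag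
        \<open>j\<close>; the weights are even, so the symmetric sums agree.\<close>
      have flip: "(\<Sum>j=-int m..int m. c j * autocov_matrix M x (- j) $ i $ k) = (\<Sum>j=-int m..int m. c j * autocov_matrix M x j $ i $ k)" for m
        by (rule sum.reindex_bij_witness[of _ uminus uminus]) (auto simp: even)
      show ?thesis
        using matrix_integral_of_cosine_series[OF assms(18,20,41) abs[unfolded assms(22)] assms(40,42), of i k]
        unfolding flip unfolding assms(22) by simp
    qed
    then obtain T where T: "\<And>i k. (\<lambda>m. \<Sum>j=-int m..int m. c j * autocov_matrix M x (- j) $ i $ k) \<longlonglongrightarrow> T $ i $ k" "invertible T"
      using real_matrix_of_limits[OF _ assms(44), where r="\<lambda>m i k. \<Sum>j=-int m..int m. c j * autocov_matrix M x (- j) $ i $ k"] by blast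
    have H: "H < 1/2 \<and> 0 < long_run_sd M N.eps \<or> H = 1/2 \<and> 0 < long_run_sd M N.eps \<and> summable (\<lambda>j. \<bar>a j\<bar>) \<or> 1/2 < H"
      using assms(30) unfolding \<epsilon> by blast
    obtain k C where growth: "0 < k" "eventually (\<lambda>n. k * real n \<le> (partial_sum_sd M N.eps n)\<^sup>2 \<and>
      real n * (\<Sum>j=-int n..int n. \<bar>noise_autocov M N.eps j\<bar>) \<le> C * (partial_sum_sd M N.eps n)\<^sup>2) sequentially"
      using N.partial_sum_growth[OF assms(8,7) H] by blast
    show "(\<lambda>n. measure M {\<omega> \<in> space M. \<delta> < \<bar>SUP u. \<bar>expansion_gap c (partial_sum_sd M N.eps n) F N.f n \<alpha>\<^sub>0 \<alpha> (\<lambda>t. x t \<omega>) (\<lambda>t. N.eps t \<omega>) u\<bar>\<bar>}) \<longlonglongrightarrow> 0"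
    proof -
      have "0 \<le> (SUP u. \<bar>expansion_gap c s F N.f n \<alpha>\<^sub>0 \<alpha> (\<lambda>t. x t \<omega>) (\<lambda>t. N.eps t \<omega>) u\<bar>)" for s n \<omega>
      proof -
        obtain B where B: "\<forall>u. \<bar>expansion_gap c s F N.f n \<alpha>\<^sub>0 \<alpha> (\<lambda>t. x t \<omega>) (\<lambda>t. N.eps t \<omega>) u\<bar> \<le> B"
          using expansion_gap_bounded[OF N.f_continuous N.abs_f_le] by blast
        have "\<bar>expansion_gap c s F N.f n \<alpha>\<^sub>0 \<alpha> (\<lambda>t. x t \<omega>) (\<lambda>t. N.eps t \<omega>) 0\<bar> \<le> (SUP u. \<bar>expansion_gap c s F N.f n \<alpha>\<^sub>0 \<alpha> (\<lambda>t. x t \<omega>) (\<lambda>t. N.eps t \<omega>) u\<bar>)"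
          by (rule cSUP_upper) (use B in \<open>auto intro: bdd_aboveI2\<close>)
        then show ?thesis by (rule order.trans[OF abs_ge_zero])
      qed
      then show ?thesis
        using N.expansion_gap_in_probability[OF X.fourth_order_mixing_axioms assms(15)[unfolded \<epsilon>] growth A A0 T \<delta>, of \<alpha>\<^sub>0 \<alpha>]
        by (simp add: abs_of_nonneg)
    qed
  qed
  ultimately show ?thesis by simp
qed

end
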